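(* Let $m\in\mathbb{N}$ and let $\Omega\subset\mathbb{R}^N$ be a bounded domain with a sufficiently smooth boundary $\partial\Omega$. Let $H^m(\Omega)$ be equipped with the norm $$\|u\|_{H^m(\Omega)}=\Big(\sum_{0\le|\alpha|\le m}\|D^\alpha u\|_{L_2(\Omega)}^2\Big)^{1/2}$$ and corresponding inner product $\langle u,v\rangle_{H^m(\Omega)}=\sum_{0\le|\alpha|\le m}\langle D^\alpha u,D^\alpha v\rangle_{L_2(\Omega)}$. Then there exist $m$ linear differential operators $N_k$ of order $k$, with $m\le k\le 2m-1$, which are non-characteristic on $\partial\Omega$, such that for each $u\in L_2(\Omega)$ the element $E_m^*u$ is the unique solution $z$ of the variational problem associated to the boundary value problem $$\sum_{0\le|\alpha|\le m}(-1)^{|\alpha|}D^{2\alpha}z(x)=u(x),\quad\forall\,x\in\Omega,\qquad\qquad N_{2m-1-j}z(x)=0,\quad\forall\,x\in\partial\Omega,\ 0\le j\le m-1.$$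
   Context: $L_2(\Omega)$ carries $\langle u,v\rangle_{L_2(\Omega)}=\int_\Omega u\overline v\,dx$; $H^m(\Omega)$ is the space of $u\in L_2(\Omega)$ with weak derivatives $D^\alpha u\in L_2(\Omega)$ for $0\le|\alpha|\le m$. $E_m:H^m(\Omega)\to L_2(\Omega)$, $E_mu:=u$, is the embedding operator and $E_m^*:L_2(\Omega)\to H^m(\Omega)$ its adjoint, defined by $\langle E_m^*u,v\rangle_{H^m(\Omega)}=\langle u,v\rangle_{L_2(\Omega)}$ for all $u\in L_2(\Omega)$, $v\in H^m(\Omega)$. A linear differential operator $N_k$ of order $k$ on $\partial\Omega$ has the form $N_kz=\sum_{0\le|\alpha|\le k}d_{k,\alpha}D^\alpha z$ with functions $d_{k,\alpha}$ defined on $\partial\Omega$; it is non-characteristic on $\partial\Omega$ if $\sum_{|\alpha|=k}d_{k,\alpha}(x)\mathbf{n}(x)^\alpha\neq0$ for all $x\in\partial\Omega$, where $\mathbf{n}$ is the exterior unit normal. Variational problem associated to the boundary value problem: put $Bz:=\sum_{0\le|\alpha|\le m}(-1)^{|\alpha|}D^{2\alpha}z$. The boundary operators $N_k$ are linked to $B$ by the Green-type identity $$\sum_{0\le|\alpha|\le m}\langle D^\alpha z,D^\alpha v\rangle_{L_2(\Omega)}=\langle Bz,v\rangle_{L_2(\Omega)}+\sum_{j=0}^{m-1}\int_{\partial\Omega}\overline{\frac{\partial^jv}{\partial\mathbf{n}^j}}\,N_{2m-1-j}z\,dS\qquad\forall\,v,z\in C^{2m}(\overline\Omega),$$ where $\partial^j/\partial\mathbf{n}^j$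 is the $j$-th derivative in the direction $\mathbf{n}$. The associated variational problem is obtained by multiplying $Bz=u$ with a test function $v$, integrating over $\Omega$, applying this identity and using the boundary conditions $N_{2m-1-j}z=0$, i.e.: find $z\in H^m(\Omega)$ with $$\sum_{0\le|\alpha|\le m}\langle D^\alpha z,D^\alpha v\rangle_{L_2(\Omega)}=\langle u,v\rangle_{L_2(\Omega)}\qquad\forall\,v\in H^m(\Omega).$$ *)

theory Defs
  imports "HOL-Analysis.Analysis"
begin

section \<open>Classical derivatives\<close>

text \<open>Multi-indices for \<open>real ^ 'n\<close> are functions \<open>'n \<Rightarrow> nat\<close>.\<close>

definition mi_order :: "('n::finite \<Rightarrow> nat) \<Rightarrow> nat" where
  "mi_order \<alpha> = (\<Sum>i\<in>UNIV. \<alpha> i)"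

definition mi_power :: "real ^ 'n \<Rightarrow> ('n::finite \<Rightarrow> nat) \<Rightarrow> real" where
  "mi_power x \<alpha> = (\<Prod>i\<in>UNIV. (x $ i) ^ \<alpha> i)"

definition dir_deriv ::
  "real ^ 'n \<Rightarrow> (real ^ 'n \<Rightarrow> 'b::real_normed_vector) \<Rightarrow> real ^ 'n \<Rightarrow> 'b" where
  "dir_deriv w f x = vector_derivative (\<lambda>t. f (x + t *\<^sub>R w)) (at 0)"

abbreviation partial ::
  "'n \<Rightarrow> (real ^ 'n \<Rightarrow> 'b::real_normed_vector) \<Rightarrow> real ^ 'n \<Rightarrow> 'b" where
  "partial i \<equiv> dir_deriv (axis i 1)"

text \<open>The index type carries no order, so an enumeration of it is fixed to say in which order
  the partial derivatives are taken. On functions of class \<open>C\<^sup>k\<close> with \<open>k \<ge> mi_order \<alpha>\<close> the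
  result does not depend on the enumeration.\<close>

definition mi_enum :: "'n::finite list" where
  "mi_enum = (SOME xs. distinct xs \<and> set xs = UNIV)"

definition mi_deriv ::
  "('n::finite \<Rightarrow> nat) \<Rightarrow> (real ^ 'n \<Rightarrow> 'b::real_normed_vector) \<Rightarrow> real ^ 'n \<Rightarrow> 'b" where
  "mi_deriv \<alpha> f = foldr (\<lambda>i g. (partial i ^^ \<alpha> i) g) mi_enum f"

text \<open>\<open>C_on k U f\<close>, for \<open>U\<close> open: all iterated partial derivatives of \<open>f\<close> up to order \<open>k\<close> exist
  and are continuous on \<open>U\<close>.\<close>

primrec C_on ::
  "nat \<Rightarrow> (real ^ 'n) set \<Rightarrow> (real ^ 'n::finite \<Rightarrow> 'b::real_normed_vector) \<Rightarrow> bool" where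
  "C_on 0 U f \<longleftrightarrow> continuous_on U f"
| "C_on (Suc k) U f \<longleftrightarrow> continuous_on U f \<and>
     (\<forall>i. (\<forall>x\<in>U. (\<lambda>t. f (x + t *\<^sub>R axis i 1)) differentiable (at 0)) \<and> C_on k U (partial i f))"

text \<open>\<open>C\<^sup>k\<close> up to the boundary: on the open set \<open>\<Omega>\<close>, and every derivative of order at most \<open>k\<close>
  has a continuous extension to the closure. Values outside \<open>\<Omega>\<close> play no role.\<close>

definition C_closure :: "nat \<Rightarrow> (real ^ 'n::finite) set \<Rightarrow> (real ^ 'n \<Rightarrow> complex) set" where
  "C_closure k \<Omega> = {f. C_on k \<Omega> f \<and>
     (\<forall>\<alpha>. mi_order \<alpha> \<le> k \<longrightarrow>
        (\<exists>g. continuous_on (closure \<Omega>) g \<and> (\<forall>x\<in>\<Omega>. g x = mi_deriv \<alpha> f x)))}"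

definition boundary_value ::
  "(real ^ 'n) set \<Rightarrow> (real ^ 'n::finite \<Rightarrow> complex) \<Rightarrow> real ^ 'n \<Rightarrow> complex" where
  "boundary_value \<Omega> f x = Lim (at x within \<Omega>) f"

definition test_functions ::
  "(real ^ 'n) set \<Rightarrow> (real ^ 'n::finite \<Rightarrow> 'b::real_normed_vector) set" where
  "test_functions U = {\<phi>. (\<forall>k. C_on k UNIV \<phi>) \<and>
     compact (closure {x. \<phi> x \<noteq> 0}) \<and> closure {x. \<phi> x \<noteq> 0} \<subseteq> U}"


section \<open>The spaces \<open>L\<^sub>2\<close> and \<open>H\<^sup>m\<close>\<close>

text \<open>Elements of \<open>L\<^sub>2\<close> and \<open>H\<^sup>m\<close> are represented by functions; equality in these spaces is
  equality almost everywhere on \<open>\<Omega>\<close>.\<close>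

definition L2 :: "(real ^ 'n::finite) set \<Rightarrow> (real ^ 'n \<Rightarrow> complex) set" where
  "L2 \<Omega> = {u. u \<in> borel_measurable (lebesgue_on \<Omega>) \<and>
              integrable (lebesgue_on \<Omega>) (\<lambda>x. (cmod (u x))\<^sup>2)}"

definition L2_inner ::
  "(real ^ 'n::finite) set \<Rightarrow> (real ^ 'n \<Rightarrow> complex) \<Rightarrow> (real ^ 'n \<Rightarrow> complex) \<Rightarrow> complex" where
  "L2_inner \<Omega> u v = (\<integral>x. u x * cnj (v x) \<partial>lebesgue_on \<Omega>)"

definition L2_norm :: "(real ^ 'n::finite) set \<Rightarrow> (real ^ 'n \<Rightarrow> complex) \<Rightarrow> real" where
  "L2_norm \<Omega> u = sqrt (\<integral>x. (cmod (u x))\<^sup>2 \<partial>lebesgue_on \<Omega>)"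

definition ae_eq ::
  "(real ^ 'n::finite) set \<Rightarrow> (real ^ 'n \<Rightarrow> complex) \<Rightarrow> (real ^ 'n \<Rightarrow> complex) \<Rightarrow> bool" where
  "ae_eq \<Omega> u v \<longleftrightarrow> (AE x in lebesgue_on \<Omega>. u x = v x)"

definition is_weak_deriv ::
  "(real ^ 'n) set \<Rightarrow> ('n::finite \<Rightarrow> nat) \<Rightarrow> (real ^ 'n \<Rightarrow> complex) \<Rightarrow> (real ^ 'n \<Rightarrow> complex) \<Rightarrow> bool"
where
  "is_weak_deriv \<Omega> \<alpha> u w \<longleftrightarrow>
     (\<forall>\<phi>\<in>test_functions \<Omega>.
        (\<integral>x. u x * mi_deriv \<alpha> \<phi> x \<partial>lebesgue_on \<Omega>)
        = (-1) ^ mi_order \<alpha> * (\<integral>x. w x * \<phi> x \<partial>lebesgue_on \<Omega>))"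

definition weak_deriv ::
  "(real ^ 'n) set \<Rightarrow> ('n::finite \<Rightarrow> nat) \<Rightarrow> (real ^ 'n \<Rightarrow> complex) \<Rightarrow> real ^ 'n \<Rightarrow> complex" where
  "weak_deriv \<Omega> \<alpha> u = (SOME w. w \<in> L2 \<Omega> \<and> is_weak_deriv \<Omega> \<alpha> u w)"

definition Hm :: "(real ^ 'n::finite) set \<Rightarrow> nat \<Rightarrow> (real ^ 'n \<Rightarrow> complex) set" where
  "Hm \<Omega> m = {u \<in> L2 \<Omega>. \<forall>\<alpha>. mi_order \<alpha> \<le> m \<longrightarrow> (\<exists>w\<in>L2 \<Omega>. is_weak_deriv \<Omega> \<alpha> u w)}"

definition Hm_norm :: "(real ^ 'n::finite) set \<Rightarrow> nat \<Rightarrow> (real ^ 'n \<Rightarrow> complex) \<Rightarrow> real" where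
  "Hm_norm \<Omega> m u = sqrt (\<Sum>\<alpha> | mi_order \<alpha> \<le> m. (L2_norm \<Omega> (weak_deriv \<Omega> \<alpha> u))\<^sup>2)"

definition Hm_inner ::
  "(real ^ 'n::finite) set \<Rightarrow> nat \<Rightarrow> (real ^ 'n \<Rightarrow> complex) \<Rightarrow> (real ^ 'n \<Rightarrow> complex) \<Rightarrow> complex"
where
  "Hm_inner \<Omega> m u v =
     (\<Sum>\<alpha> | mi_order \<alpha> \<le> m. L2_inner \<Omega> (weak_deriv \<Omega> \<alpha> u) (weak_deriv \<Omega> \<alpha> v))"

lemma finite_mi_order_le: "finite {\<alpha>::'n::finite \<Rightarrow> nat. mi_order \<alpha> \<le> m}"
proof (rule finite_subset)
  have "\<alpha> i \<le> m" if "mi_order \<alpha> \<le> m" for \<alpha> :: "'n \<Rightarrow> nat" and i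
    using that member_le_sum[of i UNIV \<alpha>] by (simp add: mi_order_def)
  then show "{\<alpha>::'n \<Rightarrow> nat. mi_order \<alpha> \<le> m} \<subseteq> (UNIV \<rightarrow>\<^sub>E {..m})"
    by (simp add: subset_iff PiE_iff)
next
  show "finite (UNIV \<rightarrow>\<^sub>E {..m} :: ('n \<Rightarrow> nat) set)"
    by (rule finite_PiE) simp_all
qed

lemma L2_inner_self: "L2_inner \<Omega> u u = of_real ((L2_norm \<Omega> u)\<^sup>2)"
proof -
  have "L2_inner \<Omega> u u = (\<integral>x. of_real ((cmod (u x))\<^sup>2) \<partial>lebesgue_on \<Omega>)"
    unfolding L2_inner_def by (simp only: complex_norm_square)
  also have "\<dots> = of_real (\<integral>x. (cmod (u x))\<^sup>2 \<partial>lebesgue_on \<Omega>)"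
    by (rule integral_complex_of_real)
  also have "(\<integral>x. (cmod (u x))\<^sup>2 \<partial>lebesgue_on \<Omega>) = (L2_norm \<Omega> u)\<^sup>2"
    unfolding L2_norm_def by (subst real_sqrt_pow2) (auto intro: integral_nonneg_AE)
  finally show ?thesis .
qed

lemma Hm_inner_self: "Hm_inner \<Omega> m u u = of_real ((Hm_norm \<Omega> m u)\<^sup>2)"
  by (simp add: Hm_inner_def Hm_norm_def L2_inner_self sum_nonneg)

definition Hm_embed :: "(real ^ 'n::finite \<Rightarrow> complex) \<Rightarrow> real ^ 'n \<Rightarrow> complex" where
  "Hm_embed u = u"

definition Hm_embed_adjoint ::
  "(real ^ 'n::finite) set \<Rightarrow> nat \<Rightarrow> (real ^ 'n \<Rightarrow> complex) \<Rightarrow> real ^ 'n \<Rightarrow> complex" where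
  "Hm_embed_adjoint \<Omega> m u =
     (SOME z. z \<in> Hm \<Omega> m \<and> (\<forall>v\<in>Hm \<Omega> m. Hm_inner \<Omega> m z v = L2_inner \<Omega> u (Hm_embed v)))"


section \<open>The boundary\<close>

text \<open>Inside the open set \<open>U\<close>, the set \<open>\<Omega>\<close> is the part on one side of the graph of a \<open>C\<^sup>k\<close>
  function \<open>\<gamma>\<close> of the coordinates other than the \<open>i\<close>-th; \<open>s = \<plusminus>1\<close> is the orientation of the
  \<open>i\<close>-th axis.\<close>

definition graph_patch ::
  "nat \<Rightarrow> (real ^ 'n::finite) set \<Rightarrow> 'n \<Rightarrow> real \<Rightarrow> (real ^ 'n \<Rightarrow> real) \<Rightarrow> (real ^ 'n) set \<Rightarrow> bool" where
  "graph_patch k \<Omega> i s \<gamma> U \<longleftrightarrow>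
     open U \<and> s \<in> {1, -1} \<and> C_on k UNIV \<gamma> \<and>
     (\<forall>x y. (\<forall>j. j \<noteq> i \<longrightarrow> x $ j = y $ j) \<longrightarrow> \<gamma> x = \<gamma> y) \<and>
     \<Omega> \<inter> U = {x \<in> U. \<gamma> x < s * x $ i}"

definition C_boundary :: "nat \<Rightarrow> (real ^ 'n::finite) set \<Rightarrow> bool" where
  "C_boundary k \<Omega> \<longleftrightarrow> (\<forall>x\<in>frontier \<Omega>. \<exists>i s \<gamma> U. x \<in> U \<and> graph_patch k \<Omega> i s \<gamma> U)"

text \<open>The exterior unit normal: a unit vector orthogonal to the tangent space of the boundary
  at \<open>x\<close>, pointing out of \<open>\<Omega>\<close>.\<close>

definition outer_normal :: "(real ^ 'n::finite) set \<Rightarrow> real ^ 'n \<Rightarrow> real ^ 'n" where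
  "outer_normal \<Omega> x = (THE n. norm n = 1 \<and>
     ((\<lambda>y. (n \<bullet> (y - x)) / norm (y - x)) \<longlongrightarrow> 0) (at x within frontier \<Omega>) \<and>
     (\<forall>\<^sub>F t in at_right 0. x - t *\<^sub>R n \<in> \<Omega> \<and> x + t *\<^sub>R n \<notin> \<Omega>))"

text \<open>Surface integrals are defined by graph parametrisations and a partition of unity:
  \[ \int_{\partial\Omega} f\,dS = \sum_l \int_{{\bf R}^{N-1}} (\varphi_l f)(y,\gamma_l(y))
     \sqrt{1+|\nabla\gamma_l(y)|^2}\,dy. \]
  Here \<open>\<real>\<^sup>N\<^sup>-\<^sup>1\<close> is the product of copies of \<open>\<real>\<close> indexed by the coordinates other than the
  graph direction \<open>i\<close>. For a \<open>C\<^sup>1\<close> boundary the value does not depend on the choice of the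
  patches and of the partition of unity. When \<open>N = 1\<close> the product is a one-point space of
  measure 1, and the integral is the sum over the boundary points.\<close>

type_synonym 'n patch = "'n \<times> real \<times> (real ^ 'n \<Rightarrow> real) \<times> (real ^ 'n \<Rightarrow> real)"

definition boundary_atlas :: "(real ^ 'n::finite) set \<Rightarrow> 'n patch list \<Rightarrow> bool" where
  "boundary_atlas \<Omega> P \<longleftrightarrow>
     (\<forall>(i, s, \<gamma>, \<phi>)\<in>set P. \<exists>U. graph_patch 1 \<Omega> i s \<gamma> U \<and> \<phi> \<in> test_functions U \<and> (\<forall>x. 0 \<le> \<phi> x)) \<and>
     (\<forall>x\<in>frontier \<Omega>. (\<Sum>(i, s, \<gamma>, \<phi>)\<leftarrow>P. \<phi> x) = 1)"

definition the_atlas :: "(real ^ 'n::finite) set \<Rightarrow> 'n patch list" where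
  "the_atlas \<Omega> = (SOME P. boundary_atlas \<Omega> P)"

text \<open>The factor \<open>s\<close> occurs because the graph is \<open>s * x $ i = \<gamma> x\<close>, i.e. \<open>x $ i = s * \<gamma> x\<close>.\<close>

definition graph_point ::
  "'n \<Rightarrow> real \<Rightarrow> (real ^ 'n \<Rightarrow> real) \<Rightarrow> ('n::finite \<Rightarrow> real) \<Rightarrow> real ^ 'n" where
  "graph_point i s \<gamma> y = (\<chi> j. if j = i then s * \<gamma> (\<chi> l. if l = i then 0 else y l) else y j)"

definition patch_integrand ::
  "'n::finite patch \<Rightarrow> (real ^ 'n \<Rightarrow> complex) \<Rightarrow> ('n \<Rightarrow> real) \<Rightarrow> complex" where
  "patch_integrand = (\<lambda>(i, s, \<gamma>, \<phi>) f y.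
     (let x = graph_point i s \<gamma> y
      in (\<phi> x * sqrt (1 + (\<Sum>j\<in>UNIV. (partial j \<gamma> x)\<^sup>2))) *\<^sub>R f x))"

definition patch_measure :: "'n::finite patch \<Rightarrow> ('n \<Rightarrow> real) measure" where
  "patch_measure = (\<lambda>(i, s, \<gamma>, \<phi>). (\<Pi>\<^sub>M j\<in>UNIV - {i}. lborel))"

definition surface_integrable :: "(real ^ 'n::finite) set \<Rightarrow> (real ^ 'n \<Rightarrow> complex) \<Rightarrow> bool" where
  "surface_integrable \<Omega> f \<longleftrightarrow>
     (\<forall>p\<in>set (the_atlas \<Omega>). integrable (patch_measure p) (patch_integrand p f))"

definition surface_integral :: "(real ^ 'n::finite) set \<Rightarrow> (real ^ 'n \<Rightarrow> complex) \<Rightarrow> complex" where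
  "surface_integral \<Omega> f =
     (\<Sum>p\<leftarrow>the_atlas \<Omega>. \<integral>y. patch_integrand p f y \<partial>patch_measure p)"


section \<open>Boundary operators and the variational problem\<close>

definition normal_deriv ::
  "(real ^ 'n::finite) set \<Rightarrow> nat \<Rightarrow> (real ^ 'n \<Rightarrow> complex) \<Rightarrow> real ^ 'n \<Rightarrow> complex" where
  "normal_deriv \<Omega> j v x = boundary_value \<Omega> ((dir_deriv (outer_normal \<Omega> x) ^^ j) v) x"

text \<open>The linear differential operator of order \<open>k\<close> on the boundary with coefficients \<open>d\<close>.\<close>

definition boundary_op ::
  "(real ^ 'n) set \<Rightarrow> nat \<Rightarrow> (('n::finite \<Rightarrow> nat) \<Rightarrow> real ^ 'n \<Rightarrow> complex) \<Rightarrow>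
   (real ^ 'n \<Rightarrow> complex) \<Rightarrow> real ^ 'n \<Rightarrow> complex" where
  "boundary_op \<Omega> k d z x = (\<Sum>\<alpha> | mi_order \<alpha> \<le> k. d \<alpha> x * boundary_value \<Omega> (mi_deriv \<alpha> z) x)"

definition non_characteristic ::
  "(real ^ 'n) set \<Rightarrow> nat \<Rightarrow> (('n::finite \<Rightarrow> nat) \<Rightarrow> real ^ 'n \<Rightarrow> complex) \<Rightarrow> bool" where
  "non_characteristic \<Omega> k d \<longleftrightarrow>
     (\<forall>x\<in>frontier \<Omega>.
        (\<Sum>\<alpha> | mi_order \<alpha> = k. d \<alpha> x * of_real (mi_power (outer_normal \<Omega> x) \<alpha>)) \<noteq> 0)"

definition B_op :: "nat \<Rightarrow> (real ^ 'n::finite \<Rightarrow> complex) \<Rightarrow> real ^ 'n \<Rightarrow> complex" where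
  "B_op m z x = (\<Sum>\<alpha> | mi_order \<alpha> \<le> m. (-1) ^ mi_order \<alpha> * mi_deriv (\<lambda>i. 2 * \<alpha> i) z x)"

text \<open>\<open>d k\<close> is the coefficient family of the operator of order \<open>k\<close>. Existence of the boundary
  integrals is part of the identity; Bochner integrals of non-integrable functions would be 0.\<close>

definition green_identity ::
  "(real ^ 'n) set \<Rightarrow> nat \<Rightarrow> (nat \<Rightarrow> ('n::finite \<Rightarrow> nat) \<Rightarrow> real ^ 'n \<Rightarrow> complex) \<Rightarrow> bool" where
  "green_identity \<Omega> m d \<longleftrightarrow>
     (\<forall>v\<in>C_closure (2 * m) \<Omega>. \<forall>z\<in>C_closure (2 * m) \<Omega>.
        (\<forall>j<m. surface_integrable \<Omega>
           (\<lambda>x. cnj (normal_deriv \<Omega> j v x) * boundary_op \<Omega> (2 * m - 1 - j) (d (2 * m - 1 - j)) z x)) \<and>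
        (\<Sum>\<alpha> | mi_order \<alpha> \<le> m. L2_inner \<Omega> (mi_deriv \<alpha> z) (mi_deriv \<alpha> v)) =
        L2_inner \<Omega> (B_op m z) v +
        (\<Sum>j<m. surface_integral \<Omega>
           (\<lambda>x. cnj (normal_deriv \<Omega> j v x) * boundary_op \<Omega> (2 * m - 1 - j) (d (2 * m - 1 - j)) z x)))"

text \<open>The weak form of \<open>B_op m z = u\<close> in \<open>\<Omega>\<close> with boundary conditions
  \<open>boundary_op \<Omega> (2 * m - 1 - j) (d (2 * m - 1 - j)) z = 0\<close> for \<open>j < m\<close>, where \<open>d\<close> satisfies
  \<open>green_identity \<Omega> m d\<close>: under these conditions the boundary terms of the identity vanish,
  which is why \<open>d\<close> no longer occurs.\<close>

definition variational_solution ::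
  "(real ^ 'n::finite) set \<Rightarrow> nat \<Rightarrow> (real ^ 'n \<Rightarrow> complex) \<Rightarrow> (real ^ 'n \<Rightarrow> complex) \<Rightarrow> bool" where
  "variational_solution \<Omega> m u z \<longleftrightarrow> z \<in> Hm \<Omega> m \<and>
     (\<forall>v\<in>Hm \<Omega> m.
        (\<Sum>\<alpha> | mi_order \<alpha> \<le> m. L2_inner \<Omega> (weak_deriv \<Omega> \<alpha> z) (weak_deriv \<Omega> \<alpha> v))
        = L2_inner \<Omega> u v)"

end

theory Submission
  imports Defs
begin

text \<open>
Two facts that do not depend on each other are combined.

\<^emph>\<open>The variational problem.\<close> Its weak form is the equation that defines the adjoint of the
embedding, so the point is that the adjoint exists and that two solutions agree almost
everywhere. Existence is the Riesz representation theorem (\<open>semi_inner.Riesz\<close>), applied to the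
functional \<open>v \<mapsto> \<langle>u, v\<rangle>\<close> on \<open>H\<^sup>m\<close>. It needs completeness of \<open>H\<^sup>m\<close> (\<open>Hm_complete\<close>), which follows
from completeness of \<open>L\<^sub>2\<close> (\<open>L2_complete\<close>) because the identity that defines weak derivatives
survives \<open>L\<^sub>2\<close> limits. Weak derivatives are determined almost everywhere by the fundamental lemma
of the calculus of variations (\<open>AE_zero_of_test\<close>).

\<^emph>\<open>The boundary operators.\<close> Integration by parts in \<open>\<langle>D\<^sup>\<alpha> z, D\<^sup>\<alpha> v\<rangle>\<close> leaves boundary integrals of
products of a derivative of \<open>z\<close>, a derivative of \<open>v\<close> of order less than \<open>m\<close>, and a component of
the normal \<open>n\<close>. On the boundary every derivative splits into a normal and a tangential part,
\[ \partial_i = n_i \partial_n + \sum_k n_k (n_k \partial_i - n_i \partial_k) , \]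
and the tangential operators satisfy
\[ \int_{\partial\Omega} (n_k \partial_i f - n_i \partial_k f)\,dS
   = \int_\Omega (\partial_k \partial_i f - \partial_i \partial_k f)\,dx = 0 \]
by the divergence theorem. For a product \<open>f\<close> this moves a tangential derivative from \<open>v\<close> to \<open>z\<close>
(\<open>normal_tangential_split\<close>); no calculus on the surface is involved, only an extension of the
normal to a vector field on the whole space. Repetition leaves normal derivatives of \<open>v\<close> alone
(\<open>reduce_to_normal_derivatives\<close>), and the operators that multiply them are the \<open>N\<^sub>k\<close>. An operator
produced by moving a tangential derivative has a principal symbol that vanishes at \<open>n\<close>. Hence the
symbol of the operator of order \<open>2m - 1 - j\<close> at \<open>n\<close> comes from the multi-indices of order \<open>m\<close>
alone; it is \<open>(-1)\<^sup>m\<^sup>-\<^sup>1\<^sup>-\<^sup>j\<close> times the sum of the squares \<open>(n\<^sup>\<alpha>)\<^sup>2\<close>, which is not 0 since \<open>n\<close> is a unit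
vector.

\<^emph>\<open>The divergence theorem\<close> (\<open>divergence\<close>) is localised with the atlas of the boundary. Above a
graph the derivative across the graph is integrated along lines, and the others are reduced to it
by flowing parallel to the graph, which preserves volume (\<open>horizontal_integral\<close>). The atlas sums
to 1 on the boundary only, so a part of the function remains that vanishes on the boundary without
vanishing near it; translation invariance of the integral takes care of it
(\<open>vanishing_divergence\<close>).
\<close>

section \<open>Functions smooth up to a set\<close>

definition ext_on :: "'a::topological_space set \<Rightarrow> 'a set \<Rightarrow> ('a \<Rightarrow> 'b::topological_space) \<Rightarrow> bool" where
  "ext_on V U f \<longleftrightarrow> (\<exists>g. continuous_on V g \<and> (\<forall>x\<in>U. g x = f x))"

text \<open>The derivatives up to order \<open>k\<close> exist on \<open>U\<close> and extend continuously to \<open>V\<close>. For \<open>V = U\<close> this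
  is \<open>C_on\<close>, for \<open>V = closure U\<close> it is the regularity in \<open>C_closure\<close>; with the second set as a
  parameter each closure property is proved once for both.\<close>
primrec Cext ::
  "(real ^ 'n) set \<Rightarrow> nat \<Rightarrow> (real ^ 'n) set \<Rightarrow> (real ^ 'n::finite \<Rightarrow> 'b::real_normed_vector) \<Rightarrow> bool" where
  "Cext V 0 U f \<longleftrightarrow> ext_on V U f"
| "Cext V (Suc k) U f \<longleftrightarrow> ext_on V U f \<and>
     (\<forall>i. (\<forall>x\<in>U. (\<lambda>t. f (x + t *\<^sub>R axis i 1)) differentiable (at 0)) \<and> Cext V k U (partial i f))"

lemma ext_on_self: "ext_on U U f \<longleftrightarrow> continuous_on U f"
  unfolding ext_on_def using continuous_on_cong[of U U] by metis

lemma C_on_eq_Cext: "C_on k U f \<longleftrightarrow> Cext U k U f"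
  by (induction k arbitrary: f) (auto simp: ext_on_self)

lemma ext_on_mono: "ext_on V U f \<Longrightarrow> U' \<subseteq> U \<Longrightarrow> V' \<subseteq> V \<Longrightarrow> ext_on V' U' f"
  unfolding ext_on_def by (meson continuous_on_subset subsetD)

lemma ext_on_cong: "ext_on V U f \<Longrightarrow> (\<And>x. x \<in> U \<Longrightarrow> f x = g x) \<Longrightarrow> ext_on V U g"
  unfolding ext_on_def by fastforce

lemma Cext_mono: "Cext V k U f \<Longrightarrow> U' \<subseteq> U \<Longrightarrow> V' \<subseteq> V \<Longrightarrow> Cext V' k U' f"
  by (induction k arbitrary: f) (auto intro: ext_on_mono)

lemma Cext_Suc: "Cext V (Suc k) U f \<Longrightarrow> Cext V k U f"
  by (induction k arbitrary: f) auto

lemma Cext_le: "Cext V k U f \<Longrightarrow> j \<le> k \<Longrightarrow> Cext V j U f"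
  by (induction k) (auto simp: le_Suc_eq dest: Cext_Suc simp del: Cext.simps)

lemma Cext_partial: "Cext V (Suc k) U f \<Longrightarrow> Cext V k U (partial i f)"
  by simp

lemma Cext_ext_on: "Cext V k U f \<Longrightarrow> ext_on V U f"
  by (cases k) auto

lemma partialI:
  "((\<lambda>t. f (x + t *\<^sub>R axis i 1)) has_vector_derivative D) (at 0) \<Longrightarrow> partial i f x = D"
  unfolding dir_deriv_def by (rule vector_derivative_at)

lemma Cext_has_partial:
  assumes "Cext V (Suc k) U f" "x \<in> U"
  shows "((\<lambda>t. f (x + t *\<^sub>R axis i 1)) has_vector_derivative partial i f x) (at 0)"
  using assms by (simp add: dir_deriv_def vector_derivative_works[symmetric])

lemma eventually_line_in_open:
  fixes x w :: "'a::real_normed_vector"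
  assumes "open U" "x \<in> U"
  shows "\<forall>\<^sub>F t in nhds (0::real). x + t *\<^sub>R w \<in> U"
proof -
  have "((\<lambda>t. x + t *\<^sub>R w) \<longlongrightarrow> x + 0 *\<^sub>R w) (nhds 0)"
    by (intro tendsto_intros filterlim_ident)
  then show ?thesis using assms by (simp add: topological_tendstoD)
qed

lemma has_vector_derivative_line_cong:
  fixes x w :: "'a::real_normed_vector"
  assumes "open U" "x \<in> U" "\<And>y. y \<in> U \<Longrightarrow> f y = g y"
    and "((\<lambda>t. f (x + t *\<^sub>R w)) has_vector_derivative D) (at 0)"
  shows "((\<lambda>t. g (x + t *\<^sub>R w)) has_vector_derivative D) (at 0)"
proof -
  have "\<forall>\<^sub>F t in nhds (0::real). f (x + t *\<^sub>R w) = g (x + t *\<^sub>R w)"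
    using eventually_line_in_open[OF assms(1,2), of w] by eventually_elim (simp add: assms)
  then have "\<forall>\<^sub>F t in at (0::real). f (x + t *\<^sub>R w) = g (x + t *\<^sub>R w)"
    by (simp add: eventually_at_filter eventually_mono)
  from has_derivative_transform_eventually[OF assms(4)[unfolded has_vector_derivative_def] this]
  show ?thesis using assms(2,3) unfolding has_vector_derivative_def by simp
qed

lemma partial_cong:
  assumes "open U" "\<And>y. y \<in> U \<Longrightarrow> f y = g y" "x \<in> U"
  shows "dir_deriv w f x = dir_deriv w g x"
proof -
  have "\<forall>\<^sub>F t in nhds (0::real). f (x + t *\<^sub>R w) = g (x + t *\<^sub>R w)"
    using eventually_line_in_open[OF assms(1,3), of w] by eventually_elim (simp add: assms)
  then show ?thesis unfolding dir_deriv_def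
    by (intro vector_derivative_cong_eq) auto
qed

lemma Cext_cong:
  assumes "open U"
  shows "Cext V k U f \<Longrightarrow> (\<And>x. x \<in> U \<Longrightarrow> f x = g x) \<Longrightarrow> Cext V k U g"
proof (induction k arbitrary: f g)
  case 0
  then show ?case by (auto intro: ext_on_cong)
next
  case (Suc k)
  have "((\<lambda>t. g (x + t *\<^sub>R axis i 1)) has_vector_derivative partial i f x) (at 0)" if "x \<in> U" for i x
    using has_vector_derivative_line_cong[OF assms that Suc.prems(2) Cext_has_partial[OF Suc.prems(1) that]] .
  moreover have "ext_on V U g" using Suc.prems by (auto intro: ext_on_cong)
  moreover have "Cext V k U (partial i g)" for i
    by (rule Suc.IH[OF Cext_partial[OF Suc.prems(1)]]) (rule partial_cong[OF assms Suc.prems(2)])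
  ultimately show ?case by (auto intro: differentiableI_vector)
qed

lemma Cext_SucI:
  assumes "ext_on V U f"
    and "\<And>i x. x \<in> U \<Longrightarrow> ((\<lambda>t. f (x + t *\<^sub>R axis i 1)) has_vector_derivative g i x) (at 0)"
    and "\<And>i. Cext V k U (g i)" "open U"
  shows "Cext V (Suc k) U f"
proof -
  have "g i x = partial i f x" if "x \<in> U" for i x
    using partialI[OF assms(2)[OF that]] by simp
  then show ?thesis
    using assms(1) differentiableI_vector[OF assms(2)] Cext_cong[OF assms(4,3)] by auto
qed

lemma ext_on_add:
  fixes f g :: "_ \<Rightarrow> 'b::real_normed_vector"
  shows "ext_on V U f \<Longrightarrow> ext_on V U g \<Longrightarrow> ext_on V U (\<lambda>x. f x + g x)"
proof -
  assume "ext_on V U f" "ext_on V U g"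
  then obtain f' g' where *: "continuous_on V f'" "\<forall>x\<in>U. f' x = f x" "continuous_on V g'" "\<forall>x\<in>U. g' x = g x"
    unfolding ext_on_def by auto
  then show ?thesis unfolding ext_on_def
    by (intro exI[of _ "\<lambda>x. f' x + g' x"]) (auto intro: continuous_on_add)
qed

lemma ext_on_const: "ext_on V U (\<lambda>x. c)"
  unfolding ext_on_def by (rule exI[of _ "\<lambda>x. c"]) auto

lemma ext_on_bilinear:
  assumes "bounded_bilinear B" "ext_on V U f" "ext_on V U g"
  shows "ext_on V U (\<lambda>x. B (f x) (g x))"
proof -
  obtain f' g' where *: "continuous_on V f'" "\<forall>x\<in>U. f' x = f x" "continuous_on V g'" "\<forall>x\<in>U. g' x = g x"
    using assms unfolding ext_on_def by auto
  show ?thesis unfolding ext_on_def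
    using * bounded_bilinear.continuous_on[OF assms(1)] by (intro exI[of _ "\<lambda>x. B (f' x) (g' x)"]) auto
qed

lemma ext_on_linear:
  assumes "bounded_linear L" "ext_on V U f"
  shows "ext_on V U (\<lambda>x. L (f x))"
proof -
  obtain f' where *: "continuous_on V f'" "\<forall>x\<in>U. f' x = f x"
    using assms unfolding ext_on_def by auto
  show ?thesis unfolding ext_on_def
    using * bounded_linear.continuous_on[OF assms(1)] by (intro exI[of _ "\<lambda>x. L (f' x)"]) auto
qed

lemma Cext_const: "open U \<Longrightarrow> Cext V k U (\<lambda>x. c)"
proof (induction k arbitrary: c)
  case (Suc k)
  then show ?case
    by (intro Cext_SucI[where g = "\<lambda>i x. 0"]) (auto intro: ext_on_const)
qed (auto intro: ext_on_const)

lemma Cext_add: "open U \<Longrightarrow> Cext V k U f \<Longrightarrow> Cext V k U g \<Longrightarrow> Cext V k U (\<lambda>x. f x + g x)"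
proof (induction k arbitrary: f g)
  case (Suc k)
  show ?case
  proof (rule Cext_SucI[where g = "\<lambda>i x. partial i f x + partial i g x"])
    show "ext_on V U (\<lambda>x. f x + g x)" using Suc.prems Cext_ext_on ext_on_add by blast
    show "Cext V k U (\<lambda>x. partial i f x + partial i g x)" for i
      using Suc Cext_partial by blast
    show "((\<lambda>t. f (x + t *\<^sub>R axis i 1) + g (x + t *\<^sub>R axis i 1)) has_vector_derivative
         partial i f x + partial i g x) (at 0)" if "x \<in> U" for x i
      by (intro has_vector_derivative_add Cext_has_partial[OF Suc.prems(2) that] Cext_has_partial[OF Suc.prems(3) that])
  qed (use Suc in auto)
qed (auto intro: ext_on_add)

lemma Cext_bilinear:
  assumes "bounded_bilinear B" "open U"
  shows "Cext V k U f \<Longrightarrow> Cext V k U g \<Longrightarrow> Cext V k U (\<lambda>x. B (f x) (g x))"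
proof (induction k arbitrary: f g)
  case (Suc k)
  show ?case
  proof (rule Cext_SucI[where g = "\<lambda>i x. B (f x) (partial i g x) + B (partial i f x) (g x)"])
    show "ext_on V U (\<lambda>x. B (f x) (g x))" by (intro ext_on_bilinear[OF assms(1)] Cext_ext_on[OF Suc.prems(1)] Cext_ext_on[OF Suc.prems(2)])
    show "Cext V k U (\<lambda>x. B (f x) (partial i g x) + B (partial i f x) (g x))" for i
      by (intro Cext_add assms(2) Suc.IH Cext_partial[OF Suc.prems(1)] Cext_partial[OF Suc.prems(2)]
          Cext_Suc[OF Suc.prems(1)] Cext_Suc[OF Suc.prems(2)])
    show "((\<lambda>t. B (f (x + t *\<^sub>R axis i 1)) (g (x + t *\<^sub>R axis i 1))) has_vector_derivative
         B (f x) (partial i g x) + B (partial i f x) (g x)) (at 0)" if "x \<in> U" for x i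
      using bounded_bilinear.has_vector_derivative[OF assms(1) Cext_has_partial[OF Suc.prems(1) that] Cext_has_partial[OF Suc.prems(2) that]]
      by simp
  qed (use assms in auto)
qed (auto intro: ext_on_bilinear[OF assms(1)])

lemma Cext_linear:
  assumes "bounded_linear L" "open U"
  shows "Cext V k U f \<Longrightarrow> Cext V k U (\<lambda>x. L (f x))"
proof (induction k arbitrary: f)
  case (Suc k)
  show ?case
  proof (rule Cext_SucI[where g = "\<lambda>i x. L (partial i f x)"])
    show "ext_on V U (\<lambda>x. L (f x))" by (intro ext_on_linear[OF assms(1)] Cext_ext_on[OF Suc.prems])
    show "Cext V k U (\<lambda>x. L (partial i f x))" for i
      using Suc.prems Cext_partial by (intro Suc.IH) blast+
    show "((\<lambda>t. L (f (x + t *\<^sub>R axis i 1))) has_vector_derivative L (partial i f x)) (at 0)" if "x \<in> U" for x i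
      using bounded_linear.has_vector_derivative[OF assms(1) Cext_has_partial[OF Suc.prems(1) that]] .
  qed (use assms in auto)
qed (auto intro: ext_on_linear[OF assms(1)])

lemma Cext_mult:
  fixes f g :: "real ^ 'n::finite \<Rightarrow> 'b::real_normed_algebra"
  shows "open U \<Longrightarrow> Cext V k U f \<Longrightarrow> Cext V k U g \<Longrightarrow> Cext V k U (\<lambda>x. f x * g x)"
  by (rule Cext_bilinear[OF bounded_bilinear_mult])

lemma Cext_scaleR:
  "open U \<Longrightarrow> Cext V k U f \<Longrightarrow> Cext V k U g \<Longrightarrow> Cext V k U (\<lambda>x. f x *\<^sub>R g x)"
  by (rule Cext_bilinear[OF bounded_bilinear_scaleR])

lemma Cext_of_real:
  "open U \<Longrightarrow> Cext V k U f \<Longrightarrow> Cext V k U (\<lambda>x. of_real (f x) :: complex)"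
  by (rule Cext_linear[OF bounded_linear_of_real])

lemma Cext_cnj: "open U \<Longrightarrow> Cext V k U f \<Longrightarrow> Cext V k U (\<lambda>x. cnj (f x))"
  by (rule Cext_linear[OF bounded_linear_cnj])

lemma Cext_minus: "open U \<Longrightarrow> Cext V k U f \<Longrightarrow> Cext V k U (\<lambda>x. - f x)"
  by (rule Cext_linear[OF bounded_linear_minus[OF bounded_linear_ident]])

lemma Cext_diff: "open U \<Longrightarrow> Cext V k U f \<Longrightarrow> Cext V k U g \<Longrightarrow> Cext V k U (\<lambda>x. f x - g x)"
  using Cext_add[of U V k f "\<lambda>x. - g x"] Cext_minus by auto

lemma Cext_sum:
  assumes "open U"
  shows "(\<And>a. a \<in> A \<Longrightarrow> Cext V k U (f a)) \<Longrightarrow> Cext V k U (\<lambda>x. \<Sum>a\<in>A. f a x)"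
  by (induction A rule: infinite_finite_induct) (auto intro: Cext_add Cext_const assms)

lemma Cext_prod:
  fixes f :: "_ \<Rightarrow> real ^ 'n::finite \<Rightarrow> 'b::{real_normed_algebra, comm_ring_1}"
  assumes "open U"
  shows "(\<And>a. a \<in> A \<Longrightarrow> Cext V k U (f a)) \<Longrightarrow> Cext V k U (\<lambda>x. \<Prod>a\<in>A. f a x)"
  by (induction A rule: infinite_finite_induct) (auto intro: Cext_mult Cext_const assms)

lemma Cext_proj: "open U \<Longrightarrow> Cext V k U (\<lambda>x. x $ i)"
proof (cases k)
  case 0
  show ?thesis unfolding 0 by (auto simp: ext_on_def intro!: exI[of _ "\<lambda>x. x $ i"] continuous_intros)
next
  case (Suc j)
  assume "open U"
  show ?thesis unfolding Suc
  proof (rule Cext_SucI[where g = "\<lambda>l x. axis l 1 $ i"])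
    show "ext_on V U (\<lambda>x. x $ i)"
      by (auto simp: ext_on_def intro!: exI[of _ "\<lambda>x. x $ i"] continuous_intros)
    show "((\<lambda>t. (x + t *\<^sub>R axis l 1) $ i) has_vector_derivative axis l 1 $ i) (at 0)" for l x
      by (auto intro!: derivative_eq_intros)
  qed (auto intro: Cext_const \<open>open U\<close>)
qed

text \<open>The function \<open>h 0\<close> comes with the sequence of its derivatives, so that the induction on the
  order covers every \<open>h j\<close> at once.\<close>
lemma Cext_compose:
  fixes f :: "real ^ 'n::finite \<Rightarrow> real" and h :: "nat \<Rightarrow> real \<Rightarrow> real"
  assumes "open U" and h: "\<And>j t. t \<in> S \<Longrightarrow> (h j has_real_derivative h (Suc j) t) (at t)"
    and f: "\<And>x. x \<in> U \<Longrightarrow> f x \<in> S"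
  shows "C_on k U f \<Longrightarrow> C_on k U (\<lambda>x. h j (f x))"
  unfolding C_on_eq_Cext
proof (induction k arbitrary: j)
  case 0
  have "continuous_on S (h j)"
    using h by (meson DERIV_isCont continuous_at_imp_continuous_on)
  then show ?case using 0 f unfolding Cext.simps ext_on_self
    by (metis continuous_on_compose2 image_subsetI)
next
  case (Suc k)
  show ?case
  proof (rule Cext_SucI[where g = "\<lambda>i x. h (Suc j) (f x) * partial i f x"])
    have "continuous_on S (h j)"
      using h by (meson DERIV_isCont continuous_at_imp_continuous_on)
    then show "ext_on U U (\<lambda>x. h j (f x))"
      using Suc.prems f unfolding Cext.simps ext_on_self
      by (metis continuous_on_compose2 image_subsetI)
    show "Cext U k U (\<lambda>x. h (Suc j) (f x) * partial i f x)" for i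
      using Suc by (intro Cext_mult assms Suc.IH) (auto intro: Cext_Suc simp del: Cext.simps dest: Cext_partial)
    show "((\<lambda>t. h j (f (x + t *\<^sub>R axis i 1))) has_vector_derivative h (Suc j) (f x) * partial i f x) (at 0)"
      if "x \<in> U" for i x
    proof -
      have "((\<lambda>t. f (x + t *\<^sub>R axis i 1)) has_real_derivative partial i f x) (at 0)"
        using Cext_has_partial[OF Suc.prems that] by (simp add: has_real_derivative_iff_has_vector_derivative)
      from DERIV_chain2[OF _ this, of "h j" "h (Suc j) (f x)"] h[OF f[OF that], of j]
      show ?thesis by (simp add: has_real_derivative_iff_has_vector_derivative)
    qed
  qed (use assms in auto)
qed

lemma C_on_powr:
  fixes f :: "real ^ 'n::finite \<Rightarrow> real"
  assumes "open U" "\<And>x. x \<in> U \<Longrightarrow> f x > 0" "C_on k U f"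
  shows "C_on k U (\<lambda>x. f x powr a)"
proof -
  have "((\<lambda>t. (\<Prod>l<j. a - real l) * t powr (a - real j)) has_real_derivative
      (\<Prod>l<Suc j. a - real l) * t powr (a - real (Suc j))) (at t)" if "t \<in> {0<..}" for j and t :: real
    using that by (auto intro!: derivative_eq_intros simp: algebra_simps)
  from Cext_compose[where h = "\<lambda>j t. (\<Prod>l<j. a - real l) * t powr (a - real j)" and j = 0 and S = "{0<..}", OF assms(1) this _ assms(3)] assms(2)
  show ?thesis by simp
qed

section \<open>Iterated partial derivatives\<close>

text \<open>Lists of directions keep the order of differentiation visible, and integration by parts can
  take them off one by one.\<close>
definition pd :: "'n list \<Rightarrow> (real ^ 'n::finite \<Rightarrow> 'b::real_normed_vector) \<Rightarrow> real ^ 'n \<Rightarrow> 'b" where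
  "pd is f = foldr partial is f"

lemma pd_Nil [simp]: "pd [] f = f" and pd_Cons [simp]: "pd (i # is) f = partial i (pd is f)"
  and pd_append: "pd (is @ js) f = pd is (pd js f)"
  by (auto simp: pd_def)

lemma pd_snoc: "pd (is @ [i]) f = pd is (partial i f)"
  by (simp add: pd_append)

lemma Cext_pd: "Cext V (k + length is) U f \<Longrightarrow> Cext V k U (pd is f)"
proof (induction "is" arbitrary: k)
  case (Cons i "is")
  have "Cext V (Suc k) U (pd is f)" using Cons.IH[of "Suc k"] Cons.prems by simp
  then show ?case using Cext_partial by simp
qed simp

lemma Cext_pd_le: "Cext V k U f \<Longrightarrow> j + length is \<le> k \<Longrightarrow> Cext V j U (pd is f)"
  by (meson Cext_le Cext_pd)

lemma CextI_pd:
  assumes "C_on k U f" "open U" "\<And>is. length is \<le> k \<Longrightarrow> ext_on V U (pd is f)"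
  shows "Cext V k U f"
  using assms(1,3)
proof (induction k arbitrary: f)
  case 0
  from 0(2)[of "[]"] show ?case by simp
next
  case (Suc k)
  have "Cext V k U (partial i f)" for i
    using Suc.prems(2)[of "_ @ [i]"] by (intro Suc.IH) (use Suc.prems(1) in \<open>auto simp: pd_snoc\<close>)
  moreover have "ext_on V U f" using Suc.prems(2)[of "[]"] by simp
  ultimately show ?case using Suc.prems by simp
qed

lemma partial_along_line:
  assumes "Cext V (Suc k) U f" "x + t0 *\<^sub>R axis i 1 \<in> U"
  shows "((\<lambda>t. f (x + t *\<^sub>R axis i 1)) has_vector_derivative partial i f (x + t0 *\<^sub>R axis i 1)) (at t0)"
proof -
  let ?y = "x + t0 *\<^sub>R axis i 1"
  have *: "((\<lambda>t. f (?y + t *\<^sub>R axis i 1)) has_vector_derivative partial i f ?y) (at (t0 - t0))"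
    using Cext_has_partial[OF assms] by simp
  have "((\<lambda>t. t - t0) has_vector_derivative 1) (at t0)"
    by (auto intro!: derivative_eq_intros)
  from vector_diff_chain_at[OF this *]
  have "((\<lambda>t. f (?y + (t - t0) *\<^sub>R axis i 1)) has_vector_derivative partial i f ?y) (at t0)"
    by (simp add: o_def)
  moreover have "?y + (t - t0) *\<^sub>R axis i 1 = x + t *\<^sub>R axis i 1" for t
    by (simp add: algebra_simps)
  ultimately show ?thesis by (simp only:)
qed

text \<open>The mean value inequality, centred at an approximate value \<open>c\<close> of the derivative.\<close>
lemma mean_value_bound:
  fixes f :: "real \<Rightarrow> 'b::real_normed_vector"
  assumes "\<And>t. t \<in> closed_segment 0 s \<Longrightarrow> (f has_vector_derivative f' t) (at t)"
    and "\<And>t. t \<in> closed_segment 0 s \<Longrightarrow> norm (f' t - c) \<le> B"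
  shows "norm (f s - f 0 - s *\<^sub>R c) \<le> B * \<bar>s\<bar>"
proof -
  let ?g = "\<lambda>t. f t - t *\<^sub>R c"
  have "norm (?g s - ?g 0) \<le> B * norm (s - 0)"
  proof (rule differentiable_bound[where S = "closed_segment 0 s" and f' = "\<lambda>t h. h *\<^sub>R (f' t - c)"])
    fix t assume t: "t \<in> closed_segment 0 s"
    have "(?g has_vector_derivative f' t - 1 *\<^sub>R c) (at t within closed_segment 0 s)"
      by (intro has_vector_derivative_diff has_vector_derivative_at_within[OF assms(1)[OF t]])
         (auto intro!: derivative_eq_intros)
    then show "(?g has_derivative (\<lambda>h. h *\<^sub>R (f' t - c))) (at t within closed_segment 0 s)"
      by (simp add: has_vector_derivative_def)
    show "onorm (\<lambda>h. h *\<^sub>R (f' t - c)) \<le> B"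
      using assms(2)[OF t] by (intro onorm_le) (auto simp: mult.commute[of B] intro!: mult_left_mono)
  qed auto
  then show ?thesis by (simp add: algebra_simps)
qed

text \<open>Continuous partial derivatives give a total derivative: the coordinates are changed one at a
  time, and the mean value inequality is used for each of them.\<close>
lemma Cext_has_derivative:
  fixes f :: "real ^ 'n::finite \<Rightarrow> 'b::real_normed_vector"
  assumes "C_on 1 U f" "open U" "x \<in> U"
  shows "(f has_derivative (\<lambda>v. \<Sum>i\<in>UNIV. (v $ i) *\<^sub>R partial i f x)) (at x)"
  unfolding has_derivative_at_alt
proof (intro conjI allI impI)
  show "bounded_linear (\<lambda>v. \<Sum>i\<in>UNIV. (v $ i) *\<^sub>R partial i f x)"
    by (intro bounded_linear_sum bounded_linear_scaleR_left[THEN bounded_linear_compose] bounded_linear_vec_nth)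
next
  fix e :: real assume "e > 0"
  define N where "N = real CARD('n)"
  have N: "N > 0" by (simp add: N_def)
  have f1: "Cext U (Suc 0) U f" using assms(1) by (simp only: C_on_eq_Cext One_nat_def)
  have "\<forall>\<^sub>F y in nhds x. y \<in> U \<and> (\<forall>i. dist (partial i f y) (partial i f x) < e / N)"
  proof (intro eventually_conj eventually_all_finite)
    show "\<forall>\<^sub>F y in nhds x. y \<in> U" using assms eventually_nhds by blast
    fix i
    have "continuous_on U (partial i f)" using f1 by (simp add: ext_on_self)
    then have "isCont (partial i f) x" using assms continuous_on_eq_continuous_at by blast
    then have "(partial i f \<longlongrightarrow> partial i f x) (nhds x)" by (simp add: continuous_at tendsto_at_iff_tendsto_nhds)
    then show "\<forall>\<^sub>F y in nhds x. dist (partial i f y) (partial i f x) < e / N"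
      using \<open>e > 0\<close> N by (simp add: tendstoD)
  qed
  then obtain d where d: "d > 0" "\<And>y. dist y x < d \<Longrightarrow> y \<in> U \<and> (\<forall>i. dist (partial i f y) (partial i f x) < e / N)"
    unfolding eventually_nhds_metric by blast
  show "\<exists>d>0. \<forall>y. norm (y - x) < d \<longrightarrow>
      norm (f y - f x - (\<Sum>i\<in>UNIV. ((y - x) $ i) *\<^sub>R partial i f x)) \<le> e * norm (y - x)"
  proof (intro exI[of _ d] conjI allI impI)
    fix y assume y: "norm (y - x) < d"
    define v where "v = y - x"
    define vS where "vS S = (\<chi> i. if i \<in> S then v $ i else 0)" for S
    have "norm (f (x + vS S) - f x - (\<Sum>i\<in>S. (v $ i) *\<^sub>R partial i f x)) \<le> real (card S) * (e / N * norm v)"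
      if "finite S" for S using that
    proof (induction S)
      case empty
      have "vS {} = 0" by (simp add: vS_def vec_eq_iff)
      then show ?case by simp
    next
      case (insert j S)
      have near: "dist (x + vS S + t *\<^sub>R axis j 1) x < d" if "t \<in> closed_segment 0 (v $ j)" for t
      proof -
        have t: "\<bar>t\<bar> \<le> \<bar>v $ j\<bar>" using that by (auto simp: closed_segment_eq_real_ivl split: if_splits)
        have "norm (vS S + t *\<^sub>R axis j 1) \<le> norm v"
          using t insert.hyps by (intro norm_le_componentwise_cart) (auto simp: vS_def axis_def)
        then show ?thesis using y by (simp add: dist_norm v_def add.assoc)
      qed
      have *: "norm (f (x + vS S + v $ j *\<^sub>R axis j 1) - f (x + vS S + 0 *\<^sub>R axis j 1) - v $ j *\<^sub>R partial j f x)
        \<le> e / N * \<bar>v $ j\<bar>"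
      proof (rule mean_value_bound[where f = "\<lambda>t. f (x + vS S + t *\<^sub>R axis j 1)"])
        fix t assume t: "t \<in> closed_segment 0 (v $ j)"
        show "((\<lambda>t. f (x + vS S + t *\<^sub>R axis j 1)) has_vector_derivative
            partial j f (x + vS S + t *\<^sub>R axis j 1)) (at t)"
          using d(2)[OF near[OF t]] by (intro partial_along_line[OF f1]) simp
        show "norm (partial j f (x + vS S + t *\<^sub>R axis j 1) - partial j f x) \<le> e / N"
          using d(2)[OF near[OF t]] by (simp add: dist_norm less_imp_le)
      qed
      have "vS S + v $ j *\<^sub>R axis j 1 = vS (insert j S)"
        using insert.hyps by (auto simp: vS_def axis_def vec_eq_iff)
      with * have "norm (f (x + vS (insert j S)) - f (x + vS S) - v $ j *\<^sub>R partial j f x) \<le> e / N * \<bar>v $ j\<bar>"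
        by (simp add: add.assoc)
      also have "\<dots> \<le> e / N * norm v"
        using \<open>e > 0\<close> N component_le_norm_cart[of v j] by (intro mult_left_mono) auto
      finally have "norm (f (x + vS (insert j S)) - f (x + vS S) - v $ j *\<^sub>R partial j f x) \<le> e / N * norm v" .
      from add_mono[OF this insert.IH] norm_triangle_ineq[of "f (x + vS (insert j S)) - f (x + vS S) - v $ j *\<^sub>R partial j f x"
         "f (x + vS S) - f x - (\<Sum>i\<in>S. (v $ i) *\<^sub>R partial i f x)"]
      show ?case using insert.hyps by (simp add: algebra_simps add_divide_distrib)
    qed
    note * = this[OF finite_class.finite_UNIV]
    have "x + vS UNIV = y" by (simp add: vS_def v_def vec_eq_iff)
    moreover have "real CARD('n) * (e / N * norm v) = e * norm v" using N by (simp add: N_def)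
    ultimately show "norm (f y - f x - (\<Sum>i\<in>UNIV. ((y - x) $ i) *\<^sub>R partial i f x)) \<le> e * norm (y - x)"
      using * by (simp only: v_def)
  qed (use d in auto)
qed

lemma dir_deriv_eq_sum_partial:
  assumes "C_on 1 U f" "open U" "x \<in> U"
  shows "dir_deriv w f x = (\<Sum>i\<in>UNIV. (w $ i) *\<^sub>R partial i f x)"
proof -
  have 1: "((\<lambda>t. x + t *\<^sub>R w) has_vector_derivative w) (at 0)"
    by (auto intro!: derivative_eq_intros)
  have "(f has_derivative (\<lambda>v. \<Sum>i\<in>UNIV. (v $ i) *\<^sub>R partial i f x)) (at (x + 0 *\<^sub>R w))"
    using Cext_has_derivative[OF assms] by simp
  from diff_chain_at[OF 1[unfolded has_vector_derivative_def] this]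
  have "((\<lambda>t. f (x + t *\<^sub>R w)) has_derivative (\<lambda>t. \<Sum>i\<in>UNIV. ((t *\<^sub>R w) $ i) *\<^sub>R partial i f x)) (at 0)"
    by (simp add: o_def)
  moreover have "(\<Sum>i\<in>UNIV. ((t *\<^sub>R w) $ i) *\<^sub>R partial i f x) = t *\<^sub>R (\<Sum>i\<in>UNIV. (w $ i) *\<^sub>R partial i f x)" for t
    by (simp add: scaleR_sum_right)
  ultimately show ?thesis unfolding dir_deriv_def
    by (intro vector_derivative_at) (simp add: has_vector_derivative_def)
qed

text \<open>The second difference of \<open>f\<close> is symmetric in \<open>i\<close> and \<open>j\<close>, and divided by the square of the step
  it approximates a mixed derivative; this is why mixed derivatives are symmetric.\<close>
lemma second_difference:
  fixes f :: "real ^ 'n::finite \<Rightarrow> 'b::real_normed_vector"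
  assumes "C_on 2 U f" "open U" "x \<in> U" "e > 0"
  shows "\<exists>d>0. \<forall>s. \<bar>s\<bar> < d \<longrightarrow>
    norm (f (x + s *\<^sub>R axis i 1 + s *\<^sub>R axis j 1) - f (x + s *\<^sub>R axis i 1) - f (x + s *\<^sub>R axis j 1) + f x
        - (s * s) *\<^sub>R partial j (partial i f) x) \<le> e * (s * s)"
proof -
  have f2: "Cext U (Suc (Suc 0)) U f" using assms(1) by (simp only: C_on_eq_Cext numeral_2_eq_2)
  have "continuous_on U (partial j (partial i f))" using f2 by (simp add: ext_on_self)
  then have "isCont (partial j (partial i f)) x" using assms continuous_on_eq_continuous_at by blast
  then have "(partial j (partial i f) \<longlongrightarrow> partial j (partial i f) x) (nhds x)"
    by (simp add: continuous_at tendsto_at_iff_tendsto_nhds)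
  then have "\<forall>\<^sub>F y in nhds x. y \<in> U \<and> dist (partial j (partial i f) y) (partial j (partial i f) x) < e"
    using assms tendstoD[of _ _ "nhds x" e] eventually_nhds_in_open[of U x] by (intro eventually_conj) auto
  then obtain d where d: "d > 0" "\<And>y. dist y x < d \<Longrightarrow> y \<in> U \<and> dist (partial j (partial i f) y) (partial j (partial i f) x) < e"
    unfolding eventually_nhds_metric by blast
  show ?thesis
  proof (intro exI[of _ "d/2"] conjI allI impI)
    fix s :: real assume s: "\<bar>s\<bar> < d / 2"
    have near: "dist (x + a *\<^sub>R axis i 1 + b *\<^sub>R axis j 1) x < d"
      if "a \<in> closed_segment 0 s" "b \<in> closed_segment 0 s" for a b
    proof -
      have "\<bar>a\<bar> \<le> \<bar>s\<bar>" "\<bar>b\<bar> \<le> \<bar>s\<bar>"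
        using that by (auto simp: closed_segment_eq_real_ivl split: if_splits)
      moreover have "norm (a *\<^sub>R axis i 1 + b *\<^sub>R axis j (1::real)) \<le> \<bar>a\<bar> + \<bar>b\<bar>"
        by (rule norm_triangle_le) simp
      ultimately show ?thesis using s by (simp add: dist_norm add.assoc)
    qed
    let ?u = "\<lambda>a. f (x + s *\<^sub>R axis j 1 + a *\<^sub>R axis i 1) - f (x + a *\<^sub>R axis i 1)"
    have "norm (?u s - ?u 0 - s *\<^sub>R (s *\<^sub>R partial j (partial i f) x)) \<le> (e * \<bar>s\<bar>) * \<bar>s\<bar>"
    proof (rule mean_value_bound)
      fix a assume a: "a \<in> closed_segment 0 s"
      have 1: "x + s *\<^sub>R axis j 1 + a *\<^sub>R axis i 1 \<in> U" "x + a *\<^sub>R axis i 1 \<in> U"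
        using d(2)[OF near[OF a, of s]] d(2)[OF near[OF a, of 0]] by (auto simp: algebra_simps)
      show "(?u has_vector_derivative
          partial i f (x + s *\<^sub>R axis j 1 + a *\<^sub>R axis i 1) - partial i f (x + a *\<^sub>R axis i 1)) (at a)"
        by (intro has_vector_derivative_diff partial_along_line[OF f2] 1)
      have "norm (partial i f (x + a *\<^sub>R axis i 1 + s *\<^sub>R axis j 1) - partial i f (x + a *\<^sub>R axis i 1 + 0 *\<^sub>R axis j 1)
           - s *\<^sub>R partial j (partial i f) x) \<le> e * \<bar>s\<bar>"
      proof (rule mean_value_bound[where f = "\<lambda>b. partial i f (x + a *\<^sub>R axis i 1 + b *\<^sub>R axis j 1)"])
        fix b assume b: "b \<in> closed_segment 0 s"
        note n = d(2)[OF near[OF a b]]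
        show "((\<lambda>b. partial i f (x + a *\<^sub>R axis i 1 + b *\<^sub>R axis j 1)) has_vector_derivative
            partial j (partial i f) (x + a *\<^sub>R axis i 1 + b *\<^sub>R axis j 1)) (at b)"
          using n by (intro partial_along_line[OF Cext_partial[OF f2]]) auto
        show "norm (partial j (partial i f) (x + a *\<^sub>R axis i 1 + b *\<^sub>R axis j 1) - partial j (partial i f) x) \<le> e"
          using n by (simp add: dist_norm less_imp_le)
      qed
      then show "norm (partial i f (x + s *\<^sub>R axis j 1 + a *\<^sub>R axis i 1) - partial i f (x + a *\<^sub>R axis i 1)
          - s *\<^sub>R partial j (partial i f) x) \<le> e * \<bar>s\<bar>"
        by (simp add: algebra_simps)
    qed
    then show "norm (f (x + s *\<^sub>R axis i 1 + s *\<^sub>R axis j 1) - f (x + s *\<^sub>R axis i 1) - f (x + s *\<^sub>R axis j 1) + f x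
        - (s * s) *\<^sub>R partial j (partial i f) x) \<le> e * (s * s)"
      by (simp add: algebra_simps)
  qed (use d in auto)
qed

lemma partial_commute:
  fixes f :: "real ^ 'n::finite \<Rightarrow> 'b::real_normed_vector"
  assumes "C_on 2 U f" "open U" "x \<in> U"
  shows "partial i (partial j f) x = partial j (partial i f) x"
proof (rule ccontr)
  assume ne: "partial i (partial j f) x \<noteq> partial j (partial i f) x"
  define e where "e = norm (partial i (partial j f) x - partial j (partial i f) x) / 3"
  have e: "e > 0" using ne by (simp add: e_def)
  obtain d1 where d1: "d1 > 0" "\<And>s. \<bar>s\<bar> < d1 \<Longrightarrow>
    norm (f (x + s *\<^sub>R axis i 1 + s *\<^sub>R axis j 1) - f (x + s *\<^sub>R axis i 1) - f (x + s *\<^sub>R axis j 1) + f x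
        - (s * s) *\<^sub>R partial j (partial i f) x) \<le> e * (s * s)"
    using second_difference[OF assms e, of i j] by blast
  obtain d2 where d2: "d2 > 0" "\<And>s. \<bar>s\<bar> < d2 \<Longrightarrow>
    norm (f (x + s *\<^sub>R axis j 1 + s *\<^sub>R axis i 1) - f (x + s *\<^sub>R axis j 1) - f (x + s *\<^sub>R axis i 1) + f x
        - (s * s) *\<^sub>R partial i (partial j f) x) \<le> e * (s * s)"
    using second_difference[OF assms e, of j i] by blast
  define s where "s = min d1 d2 / 2"
  have s: "s > 0" "\<bar>s\<bar> < d1" "\<bar>s\<bar> < d2" using d1(1) d2(1) by (auto simp: s_def)
  define D where "D = f (x + s *\<^sub>R axis i 1 + s *\<^sub>R axis j 1) - f (x + s *\<^sub>R axis i 1) - f (x + s *\<^sub>R axis j 1) + f x"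
  have A: "norm (D - (s * s) *\<^sub>R partial j (partial i f) x) \<le> e * (s * s)"
    using d1(2)[OF s(2)] by (simp add: D_def)
  have B: "norm (D - (s * s) *\<^sub>R partial i (partial j f) x) \<le> e * (s * s)"
    using d2(2)[OF s(3)] by (simp add: D_def algebra_simps)
  have "norm ((s * s) *\<^sub>R (partial i (partial j f) x - partial j (partial i f) x)) \<le> 2 * e * (s * s)"
    using norm_triangle_ineq4[of "D - (s * s) *\<^sub>R partial j (partial i f) x" "D - (s * s) *\<^sub>R partial i (partial j f) x"] A B
    by (simp add: algebra_simps)
  then have "(s * s) * (3 * e) \<le> 2 * e * (s * s)" by (simp add: e_def)
  then show False using e s(1) by (simp add: algebra_simps)
qed

lemma Cext_imp_C_on: "Cext V k U f \<Longrightarrow> U \<subseteq> V \<Longrightarrow> C_on k U f"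
  using Cext_mono[of V k U f U U] by (simp add: C_on_eq_Cext)

lemma C_on_imp_Cext: "C_on k UNIV f \<Longrightarrow> Cext V k U f"
  using Cext_mono[of UNIV k UNIV f U V] by (simp add: C_on_eq_Cext)

lemma C_on_le: "C_on k U f \<Longrightarrow> j \<le> k \<Longrightarrow> C_on j U f"
  by (metis C_on_eq_Cext Cext_le)

lemma C_on_pd: "C_on k U f \<Longrightarrow> j + length is \<le> k \<Longrightarrow> C_on j U (pd is f)"
  by (metis C_on_eq_Cext Cext_pd_le)

lemma pd_move_front:
  fixes f :: "real ^ 'n::finite \<Rightarrow> 'b::real_normed_vector"
  assumes U: "open U" and f: "C_on k U f"
  shows "length (as @ i # bs) \<le> k \<Longrightarrow> x \<in> U \<Longrightarrow> pd (as @ i # bs) f x = pd (i # as @ bs) f x"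
proof (induction as arbitrary: x)
  case (Cons a as)
  have "pd ((a # as) @ i # bs) f x = partial a (pd (as @ i # bs) f) x" by simp
  also have "\<dots> = partial a (pd (i # as @ bs) f) x"
    using Cons.prems by (intro partial_cong[OF U Cons.IH]) auto
  also have "\<dots> = partial i (partial a (pd (as @ bs) f)) x"
    using Cons.prems by (subst partial_commute[OF C_on_pd[OF f] U]) auto
  finally show ?case by simp
qed simp

lemma pd_permute:
  fixes f :: "real ^ 'n::finite \<Rightarrow> 'b::real_normed_vector"
  assumes U: "open U" and f: "C_on k U f"
  shows "mset is = mset js \<Longrightarrow> length is \<le> k \<Longrightarrow> x \<in> U \<Longrightarrow> pd is f x = pd js f x"
proof (induction "is" arbitrary: js x)
  case (Cons i "is")
  have "i \<in> set js" using Cons.prems(1) by (metis list.set_intros(1) set_mset_mset)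
  then obtain as bs where js: "js = as @ i # bs" by (meson split_list)
  have m: "mset is = mset (as @ bs)" using Cons.prems(1) by (simp add: js)
  have l: "length js = Suc (length is)" using Cons.prems(1) by (metis length_Cons mset_eq_length)
  have "pd (i # is) f x = partial i (pd (as @ bs) f) x"
    using Cons.prems unfolding pd_Cons by (intro partial_cong[OF U Cons.IH[OF m]]) auto
  also have "\<dots> = pd js f x"
    using pd_move_front[OF U f, of as i bs x] Cons.prems l by (simp add: js)
  finally show ?case .
qed simp

lemma mi_enum: "distinct (mi_enum :: 'n::finite list)" "set (mi_enum :: 'n list) = UNIV"
  using someI_ex[of "\<lambda>xs :: 'n list. distinct xs \<and> set xs = UNIV"] finite_distinct_list[of "UNIV :: 'n set"]
  unfolding mi_enum_def by auto

definition mi_list :: "('n::finite \<Rightarrow> nat) \<Rightarrow> 'n list" where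
  "mi_list \<alpha> = concat (map (\<lambda>i. replicate (\<alpha> i) i) mi_enum)"

lemma mi_deriv_eq_pd:
  fixes f :: "real ^ 'n::finite \<Rightarrow> 'b::real_normed_vector"
  shows "mi_deriv \<alpha> f = pd (mi_list \<alpha>) f"
proof -
  have "(partial i ^^ k) g = pd (replicate k i) g" for i k and g :: "real ^ 'n \<Rightarrow> 'b"
    by (induction k) auto
  then have "foldr (\<lambda>i g. (partial i ^^ \<alpha> i) g) xs f = pd (concat (map (\<lambda>i. replicate (\<alpha> i) i) xs)) f" for xs
    by (induction xs) (auto simp: pd_append)
  then show ?thesis by (simp add: mi_deriv_def mi_list_def)
qed

lemma count_mi_list: "count (mset (mi_list \<alpha>)) i = \<alpha> i"
proof -
  have "distinct xs \<Longrightarrow> count (mset (concat (map (\<lambda>i. replicate (\<alpha> i) i) xs))) i = (if i \<in> set xs then \<alpha> i else 0)" for xs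
    by (induction xs) auto
  from this[OF mi_enum(1)] show ?thesis by (simp add: mi_list_def mi_enum)
qed

lemma length_mi_list: "length (mi_list \<alpha>) = mi_order \<alpha>"
proof -
  have "length (mi_list \<alpha>) = (\<Sum>i\<in>UNIV. count (mset (mi_list \<alpha>)) i)"
    unfolding size_mset[symmetric] size_multiset_overloaded_eq
    by (rule sum.mono_neutral_left) (auto simp: count_eq_zero_iff)
  then show ?thesis by (simp add: count_mi_list mi_order_def)
qed

definition mi_of :: "'n::finite list \<Rightarrow> ('n \<Rightarrow> nat)" where "mi_of is = count (mset is)"

lemma mset_mi_list: "mset (mi_list (mi_of is)) = mset is"
  by (auto intro: multiset_eqI simp: count_mi_list mi_of_def)

lemma mi_order_mi_of [simp]: "mi_order (mi_of is) = length is"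
  by (metis length_mi_list mset_mi_list size_mset)

lemma mi_deriv_mi_of:
  assumes "open U" "C_on k U f" "length is \<le> k" "x \<in> U"
  shows "mi_deriv (mi_of is) f x = pd is f x"
  unfolding mi_deriv_eq_pd
  by (rule pd_permute[OF assms(1,2) mset_mi_list _ assms(4)]) (simp add: length_mi_list assms)

text \<open>\<open>C_closure\<close> speaks of one order of differentiation for each multi-index; symmetry of mixed
  derivatives extends this to all orders.\<close>
lemma C_closure_imp_Cext:
  assumes "open \<Omega>" "f \<in> C_closure k \<Omega>"
  shows "Cext (closure \<Omega>) k \<Omega> f"
proof (rule CextI_pd)
  show f: "C_on k \<Omega> f" using assms by (simp add: C_closure_def)
  show "ext_on (closure \<Omega>) \<Omega> (pd is f)" if "length is \<le> k" for "is"
  proof -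
    have "ext_on (closure \<Omega>) \<Omega> (mi_deriv (mi_of is) f)"
      using assms that unfolding C_closure_def ext_on_def by auto
    then show ?thesis
      by (rule ext_on_cong) (rule mi_deriv_mi_of[OF assms(1) f that])
  qed
qed fact

section \<open>Smooth cut-off functions\<close>

text \<open>The functions \<open>p(1/t) exp(-1/t)\<close>, continued by 0, form a family that is closed under
  differentiation. This is the reason why \<open>exp(-1/t)\<close> is smooth at 0.\<close>
definition flat :: "real poly \<Rightarrow> real \<Rightarrow> real" where
  "flat p t = (if t > 0 then poly p (1 / t) * exp (- (1 / t)) else 0)"

definition flat_next :: "real poly \<Rightarrow> real poly" where
  "flat_next p = monom 1 2 * (p - pderiv p)"

lemma poly_times_exp_tendsto_0: "((\<lambda>x. poly p x * exp (- x)) \<longlongrightarrow> (0::real)) at_top"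
proof -
  have "((\<lambda>x. \<Sum>i\<le>degree p. coeff p i * (x ^ i / exp x)) \<longlongrightarrow> (\<Sum>i\<le>degree p. coeff p i * 0)) at_top"
    by (intro tendsto_intros tendsto_power_div_exp_0)
  then show ?thesis
    by (simp add: poly_altdef sum_distrib_right exp_minus divide_inverse mult.assoc)
qed

text \<open>At \<open>t = 0\<close> the difference quotient is again of the form \<open>q(1/t) exp(-1/t)\<close>, and the exponential
  beats the polynomial.\<close>
lemma flat_has_derivative: "(flat p has_real_derivative flat (flat_next p) t) (at t)"
proof -
  consider "t > 0" | "t < 0" | "t = 0" by linarith
  then show ?thesis
  proof cases
    case 1
    have "((\<lambda>t. poly p (1 / t) * exp (- (1 / t))) has_real_derivative flat (flat_next p) t) (at t)"
      using 1 by (auto intro!: derivative_eq_intros simp: flat_def flat_next_def poly_monom field_simps power2_eq_square)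
    moreover have "\<forall>\<^sub>F s in nhds t. flat p s = poly p (1 / s) * exp (- (1 / s))"
      using eventually_nhds_in_open[of "{0<..}" t] 1 by (auto elim!: eventually_mono simp: flat_def)
    ultimately show ?thesis by (subst DERIV_cong_ev) auto
  next
    case 2
    have "\<forall>\<^sub>F s in nhds t. flat p s = 0"
      using eventually_nhds_in_open[of "{..<0}" t] 2 by (auto elim!: eventually_mono simp: flat_def)
    then show ?thesis using 2 by (subst DERIV_cong_ev[where g = "\<lambda>_. 0"]) (auto simp: flat_def)
  next
    case 3
    have "filterlim (\<lambda>h::real. inverse h) at_top (at_right 0)" by (rule filterlim_inverse_at_top_right)
    from filterlim_compose[OF poly_times_exp_tendsto_0[of "pCons 0 p"] this]
    have "((\<lambda>h. poly (pCons 0 p) (inverse h) * exp (- inverse h)) \<longlongrightarrow> 0) (at_right 0)" .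
    then have r: "((\<lambda>h. flat p h / h) \<longlongrightarrow> 0) (at_right 0)"
      by (rule Lim_transform_eventually) (auto simp: eventually_at_filter flat_def field_simps)
    have l: "((\<lambda>h. flat p h / h) \<longlongrightarrow> 0) (at_left 0)"
      by (rule tendsto_eventually) (auto simp: eventually_at_filter flat_def)
    have "((\<lambda>h. flat p h / h) \<longlongrightarrow> 0) (at 0)" using filterlim_split_at l r by blast
    then show ?thesis using 3 by (simp add: DERIV_def flat_def)
  qed
qed

abbreviation cutoff :: "real \<Rightarrow> real" where "cutoff \<equiv> flat 1"

lemma cutoff_nonneg: "0 \<le> cutoff t" and cutoff_pos_iff: "0 < cutoff t \<longleftrightarrow> 0 < t"
  and cutoff_le_1: "cutoff t \<le> 1"
  by (auto simp: flat_def)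

lemma C_on_cutoff:
  assumes "open U" "C_on k U f"
  shows "C_on k U (\<lambda>x. cutoff (f x))"
  using Cext_compose[of U UNIV "\<lambda>j. flat ((flat_next ^^ j) 1)" f k 0] assms flat_has_derivative by simp

text \<open>A smooth function that is positive exactly on the open box with corners \<open>a\<close> and \<open>b\<close>; a large
  \<open>c\<close> makes its rise at the faces steep.\<close>
definition box_bump :: "real \<Rightarrow> real ^ 'n \<Rightarrow> real ^ 'n \<Rightarrow> real ^ 'n::finite \<Rightarrow> real" where
  "box_bump c a b x = (\<Prod>i\<in>UNIV. cutoff (c * (x $ i - a $ i)) * cutoff (c * (b $ i - x $ i)))"

lemma box_bump_nonneg: "0 \<le> box_bump c a b x"
  unfolding box_bump_def by (intro prod_nonneg mult_nonneg_nonneg cutoff_nonneg ballI)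

lemma box_bump_le_1: "box_bump c a b x \<le> 1"
  unfolding box_bump_def
  by (intro prod_le_1 conjI mult_nonneg_nonneg mult_le_one cutoff_nonneg cutoff_le_1)

lemma box_bump_pos_iff:
  assumes "c > 0" shows "0 < box_bump c a b x \<longleftrightarrow> x \<in> box a b"
proof -
  have "0 < box_bump c a b x \<longleftrightarrow> box_bump c a b x \<noteq> 0" using box_bump_nonneg[of c a b x] by linarith
  also have "\<dots> \<longleftrightarrow> (\<forall>i. cutoff (c * (x $ i - a $ i)) > 0 \<and> cutoff (c * (b $ i - x $ i)) > 0)"
    using cutoff_nonneg by (force simp: box_bump_def less_le)
  also have "\<dots> \<longleftrightarrow> x \<in> box a b"
    using assms by (simp add: cutoff_pos_iff zero_less_mult_iff mem_box_cart)
  finally show ?thesis .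
qed

lemma C_on_box_bump: "C_on k UNIV (box_bump c a b)"
proof -
  have "C_on k UNIV (\<lambda>x::real ^ 'a. c * (x $ i - a $ i))" "C_on k UNIV (\<lambda>x. c * (b $ i - x $ i))" for i
    unfolding C_on_eq_Cext by (intro Cext_mult Cext_diff Cext_const Cext_proj open_UNIV)+
  then have "Cext UNIV k UNIV (\<lambda>x. cutoff (c * (x $ i - a $ i)))" "Cext UNIV k UNIV (\<lambda>x. cutoff (c * (b $ i - x $ i)))" for i
    using C_on_cutoff[OF open_UNIV] unfolding C_on_eq_Cext by blast+
  then show ?thesis unfolding C_on_eq_Cext box_bump_def
    by (intro Cext_prod Cext_mult open_UNIV)
qed

lemma closure_support_box_bump:
  assumes "c > 0" shows "closure {x. box_bump c a b x \<noteq> 0} \<subseteq> cbox a b"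
proof -
  have "{x. box_bump c a b x \<noteq> 0} \<subseteq> cbox a b"
    using box_bump_pos_iff[OF assms, of a b] box_bump_nonneg[of c a b] box_subset_cbox[of a b] by (force simp: less_le)
  then show ?thesis by (rule closure_minimal) (rule closed_cbox)
qed

lemma test_functionsI:
  assumes "\<And>k. C_on k UNIV \<phi>" "{x. \<phi> x \<noteq> 0} \<subseteq> K" "compact K" "K \<subseteq> U"
  shows "\<phi> \<in> test_functions U"
proof -
  have "closure {x. \<phi> x \<noteq> 0} \<subseteq> K"
    by (rule closure_minimal[OF assms(2)]) (simp add: assms compact_imp_closed)
  moreover from this have "compact (closure {x. \<phi> x \<noteq> 0})"
    by (meson assms(3) bounded_subset closed_closure compact_eq_bounded_closed)
  ultimately show ?thesis using assms unfolding test_functions_def by auto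
qed

lemma box_bump_test_function:
  assumes "c > 0" "cbox a b \<subseteq> U"
  shows "box_bump c a b \<in> test_functions U" "(\<lambda>x. complex_of_real (box_bump c a b x)) \<in> test_functions U"
proof -
  have "{x. box_bump c a b x \<noteq> 0} \<subseteq> cbox a b"
    by (rule order_trans[OF closure_subset closure_support_box_bump[OF assms(1)]])
  moreover from this have "{x. complex_of_real (box_bump c a b x) \<noteq> 0} \<subseteq> cbox a b" by simp
  moreover have "C_on k UNIV (\<lambda>x. complex_of_real (box_bump c a b x))" for k
    using Cext_of_real[OF open_UNIV] C_on_box_bump unfolding C_on_eq_Cext by blast
  ultimately show "box_bump c a b \<in> test_functions U" "(\<lambda>x. complex_of_real (box_bump c a b x)) \<in> test_functions U"
    by (simp_all add: test_functionsI[OF _ _ compact_cbox assms(2)] C_on_box_bump)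
qed

text \<open>Bumps on boxes that cover \<open>F\<close> are divided by their sum. That the result sums to 1 is asked on
  \<open>F\<close> alone, which is what \<open>boundary_atlas\<close> demands.\<close>
lemma partition_of_unity:
  fixes F :: "(real ^ 'n::finite) set"
  assumes F: "compact F" and U: "\<And>x. x \<in> F \<Longrightarrow> open (U x)" "\<And>x. x \<in> F \<Longrightarrow> x \<in> U x"
  obtains X \<phi> where "finite X" "X \<subseteq> F" "\<And>p. p \<in> X \<Longrightarrow> \<phi> p \<in> test_functions (U p)"
    "\<And>p x. 0 \<le> \<phi> p x" "\<And>x. x \<in> F \<Longrightarrow> (\<Sum>p\<in>X. \<phi> p x) = (1::real)"
proof -
  have "\<exists>a b. cbox a b \<subseteq> U p \<and> p \<in> box a b" if "p \<in> F" for p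
    using open_contains_cbox[OF U(1) U(2)] that by metis
  then obtain a b where ab: "\<And>p. p \<in> F \<Longrightarrow> cbox (a p) (b p) \<subseteq> U p" "\<And>p. p \<in> F \<Longrightarrow> p \<in> box (a p) (b p)"
    by metis
  obtain X where X: "X \<subseteq> F" "finite X" "F \<subseteq> (\<Union>p\<in>X. box (a p) (b p))"
    by (rule compactE_image[OF F, of F "\<lambda>p. box (a p) (b p)"]) (use ab(2) in \<open>auto intro: open_box\<close>)
  define \<psi> where "\<psi> p = box_bump 1 (a p) (b p)" for p
  define \<Psi> where "\<Psi> x = (\<Sum>p\<in>X. \<psi> p x)" for x
  have \<psi>: "0 \<le> \<psi> p x" for p x by (simp add: \<psi>_def box_bump_nonneg)
  have C\<Psi>: "Cext UNIV k UNIV \<Psi>" for k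
    unfolding \<Psi>_def \<psi>_def using C_on_box_bump by (intro Cext_sum open_UNIV) (simp add: C_on_eq_Cext)
  have pos: "\<Psi> x > 0" if "x \<in> F" for x
  proof -
    obtain p where p: "p \<in> X" "x \<in> box (a p) (b p)" using X(3) \<open>x \<in> F\<close> by blast
    then have "\<psi> p x > 0" by (simp add: \<psi>_def box_bump_pos_iff)
    then show ?thesis unfolding \<Psi>_def using p(1) X(2) \<psi> by (meson sum_pos2)
  qed
  obtain c where c: "c > 0" "\<And>x. x \<in> F \<Longrightarrow> c \<le> \<Psi> x"
  proof (cases "F = {}")
    case False
    have "continuous_on F \<Psi>" using C\<Psi>[of 0] by (auto simp: ext_on_self intro: continuous_on_subset)
    from continuous_attains_inf[OF F False this] pos that show ?thesis by blast
  qed (use that[of 1] in auto)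
  \<comment> \<open>\<open>\<Psi>\<close> may vanish away from \<open>F\<close>; the extra term keeps the denominator positive there and is 0 on \<open>F\<close>.\<close>
  define G where "G x = \<Psi> x + cutoff (c - \<Psi> x)" for x
  have Gpos: "G x > 0" for x
  proof (cases "\<Psi> x < c")
    case True
    then have "cutoff (c - \<Psi> x) > 0" by (simp add: cutoff_pos_iff)
    moreover have "\<Psi> x \<ge> 0" unfolding \<Psi>_def by (intro sum_nonneg \<psi>)
    ultimately show ?thesis by (simp add: G_def)
  next
    case False
    then show ?thesis using c cutoff_nonneg[of "c - \<Psi> x"] by (simp add: G_def)
  qed
  have GF: "G x = \<Psi> x" if "x \<in> F" for x using c(2)[OF that] by (simp add: G_def flat_def)
  have "C_on k UNIV (\<lambda>x. c - \<Psi> x)" for k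
    unfolding C_on_eq_Cext by (intro Cext_diff Cext_const open_UNIV C\<Psi>)
  then have "Cext UNIV k UNIV (\<lambda>x. cutoff (c - \<Psi> x))" for k
    using C_on_cutoff[OF open_UNIV] C_on_eq_Cext by blast
  then have "C_on k UNIV G" for k
    unfolding G_def C_on_eq_Cext by (intro Cext_add open_UNIV C\<Psi>)
  then have inv: "Cext UNIV k UNIV (\<lambda>x. G x powr (- 1))" for k
    using C_on_powr[OF open_UNIV] Gpos C_on_eq_Cext by blast
  show ?thesis
  proof (rule that[of X "\<lambda>p x. \<psi> p x * G x powr (- 1)"])
    fix p assume p: "p \<in> X"
    have "{x. \<psi> p x \<noteq> 0} \<subseteq> cbox (a p) (b p)"
      unfolding \<psi>_def by (rule order_trans[OF closure_subset closure_support_box_bump]) simp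
    then show "(\<lambda>x. \<psi> p x * G x powr (- 1)) \<in> test_functions (U p)"
    proof (intro test_functionsI[where K = "cbox (a p) (b p)"])
      show "C_on k UNIV (\<lambda>x. \<psi> p x * G x powr - 1)" for k
        unfolding C_on_eq_Cext \<psi>_def using C_on_box_bump inv by (intro Cext_mult open_UNIV) (auto simp: C_on_eq_Cext)
    qed (use ab p X in auto)
  next
    fix x assume "x \<in> F"
    then have "(\<Sum>p\<in>X. \<psi> p x * G x powr - 1) = \<Psi> x * G x powr - 1"
      by (simp only: \<Psi>_def sum_distrib_right)
    then show "(\<Sum>p\<in>X. \<psi> p x * G x powr - 1) = 1"
      using GF[OF \<open>x \<in> F\<close>] Gpos[of x] by (simp add: powr_minus)
  qed (use X \<psi> in auto)
qed

lemma graph_patch_le: "graph_patch k \<Omega> i s \<gamma> U \<Longrightarrow> j \<le> k \<Longrightarrow> graph_patch j \<Omega> i s \<gamma> U"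
  unfolding graph_patch_def using C_on_le[of k UNIV \<gamma> j] by blast

lemma C_boundary_le: "C_boundary k \<Omega> \<Longrightarrow> j \<le> k \<Longrightarrow> C_boundary j \<Omega>"
  unfolding C_boundary_def by (meson graph_patch_le)

lemma boundary_partition:
  fixes \<Omega> :: "(real ^ 'n::finite) set"
  assumes "bounded \<Omega>" "C_boundary k \<Omega>"
  obtains P :: "'n patch list" where "\<And>i s \<gamma> \<phi>. (i, s, \<gamma>, \<phi>) \<in> set P \<Longrightarrow> \<exists>U. graph_patch k \<Omega> i s \<gamma> U \<and> \<phi> \<in> test_functions U \<and> (\<forall>x. 0 \<le> \<phi> x)"
    "\<And>x. x \<in> frontier \<Omega> \<Longrightarrow> (\<Sum>(i, s, \<gamma>, \<phi>)\<leftarrow>P. \<phi> x) = 1"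
proof -
  obtain i s \<gamma> U where g: "\<And>x. x \<in> frontier \<Omega> \<Longrightarrow> x \<in> U x \<and> graph_patch k \<Omega> (i x) (s x) (\<gamma> x) (U x)"
    using assms(2) unfolding C_boundary_def by metis
  have U: "open (U x)" "x \<in> U x" if "x \<in> frontier \<Omega>" for x
    using g[OF that] by (auto simp: graph_patch_def)
  obtain X \<phi> where X: "finite X" "X \<subseteq> frontier \<Omega>" "\<And>p. p \<in> X \<Longrightarrow> \<phi> p \<in> test_functions (U p)"
    "\<And>p x. 0 \<le> \<phi> p x" "\<And>x. x \<in> frontier \<Omega> \<Longrightarrow> (\<Sum>p\<in>X. \<phi> p x) = (1::real)"
    by (rule partition_of_unity[OF compact_frontier_bounded[OF assms(1)] U]) (assumption, assumption, rule that)
  obtain xs where xs: "set xs = X" "distinct xs" using X(1) finite_distinct_list by blast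
  show ?thesis
  proof (rule that[of "map (\<lambda>p. (i p, s p, \<gamma> p, \<phi> p)) xs"])
    fix x assume "x \<in> frontier \<Omega>"
    then show "(\<Sum>(i, s, \<gamma>, \<phi>)\<leftarrow>map (\<lambda>p. (i p, s p, \<gamma> p, \<phi> p)) xs. \<phi> x) = 1"
      using X(5) xs by (simp add: o_def sum_list_distinct_conv_sum_set)
  next
    fix i' s' \<gamma>' \<phi>' assume "(i', s', \<gamma>', \<phi>') \<in> set (map (\<lambda>p. (i p, s p, \<gamma> p, \<phi> p)) xs)"
    then obtain p where p: "p \<in> X" "(i', s', \<gamma>', \<phi>') = (i p, s p, \<gamma> p, \<phi> p)" using xs by auto
    then show "\<exists>U. graph_patch k \<Omega> i' s' \<gamma>' U \<and> \<phi>' \<in> test_functions U \<and> (\<forall>x. 0 \<le> \<phi>' x)"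
      using X(2-4) g by (intro exI[of _ "U p"]) auto
  qed
qed

lemma boundary_atlas_the_atlas:
  fixes \<Omega> :: "(real ^ 'n::finite) set"
  assumes "bounded \<Omega>" "C_boundary 1 \<Omega>"
  shows "boundary_atlas \<Omega> (the_atlas \<Omega>)"
proof -
  obtain P :: "'n patch list" where "\<And>i s \<gamma> \<phi>. (i, s, \<gamma>, \<phi>) \<in> set P \<Longrightarrow> \<exists>U. graph_patch 1 \<Omega> i s \<gamma> U \<and> \<phi> \<in> test_functions U \<and> (\<forall>x. 0 \<le> \<phi> x)"
    "\<And>x. x \<in> frontier \<Omega> \<Longrightarrow> (\<Sum>(i, s, \<gamma>, \<phi>)\<leftarrow>P. \<phi> x) = 1"
    by (rule boundary_partition[OF assms]) (rule that)
  then have "boundary_atlas \<Omega> P" unfolding boundary_atlas_def by (auto simp only: split_paired_all prod.case)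
  then show ?thesis unfolding the_atlas_def by (rule someI)
qed

section \<open>The exterior normal\<close>

text \<open>The normalised gradient of \<open>\<gamma> x - s * x $ i\<close>, a function that is negative in the domain and
  positive outside.\<close>
definition graph_normal :: "'n::finite \<Rightarrow> real \<Rightarrow> (real ^ 'n \<Rightarrow> real) \<Rightarrow> real ^ 'n \<Rightarrow> real ^ 'n" where
  "graph_normal i s \<gamma> x =
     (1 / sqrt (1 + (\<Sum>j\<in>UNIV. (partial j \<gamma> x)\<^sup>2))) *\<^sub>R (\<chi> j. partial j \<gamma> x - (if j = i then s else 0))"

lemma graph_partial_self:
  assumes "graph_patch k \<Omega> i s \<gamma> U"
  shows "partial i \<gamma> x = 0"
proof -
  have "\<gamma> (x + t *\<^sub>R axis i 1) = \<gamma> x" for t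
    using assms unfolding graph_patch_def by (auto simp: axis_def)
  then show ?thesis unfolding dir_deriv_def by simp
qed

text \<open>The sets where \<open>\<gamma> x\<close> is less and where it is greater than \<open>s * x $ i\<close> are open, and one is in
  the domain, the other outside; a point of the graph is reached from the domain along the axis
  \<open>i\<close>.\<close>
lemma graph_frontier_iff:
  assumes "graph_patch 1 \<Omega> i s \<gamma> U" "open \<Omega>" "x \<in> U"
  shows "x \<in> frontier \<Omega> \<longleftrightarrow> \<gamma> x = s * x $ i"
proof -
  note g = assms(1)[unfolded graph_patch_def]
  have cont: "continuous_on UNIV \<gamma>" using g by (simp add: One_nat_def)
  have s: "s = 1 \<or> s = -1" using g by auto
  show ?thesis
  proof
    assume fr: "x \<in> frontier \<Omega>"
    then have "x \<notin> \<Omega>" using assms(2) frontier_disjoint_eq by blast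
    then have "\<not> \<gamma> x < s * x $ i" using g assms(3) by blast
    moreover have "\<not> \<gamma> x > s * x $ i"
    proof
      assume "\<gamma> x > s * x $ i"
      moreover have "open ({y. s * y $ i < \<gamma> y} \<inter> U)"
        using g cont by (intro open_Int open_Collect_less continuous_intros) (auto simp: continuous_on_eq_continuous_at)
      moreover have "{y. s * y $ i < \<gamma> y} \<inter> U \<inter> \<Omega> = {}" using g by force
      ultimately have "x \<notin> closure \<Omega>" using assms(3) by (metis (no_types, lifting) IntI empty_iff mem_Collect_eq open_Int_closure_eq_empty)
      then show False using fr by (simp add: frontier_def)
    qed
    ultimately show "\<gamma> x = s * x $ i" by simp
  next
    assume eq: "\<gamma> x = s * x $ i"
    have "x \<notin> \<Omega> \<inter> U" using g eq by simp
    then have "x \<notin> \<Omega>" using assms(3) by blast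
    moreover have "x \<in> closure \<Omega>"
    proof (rule ccontr)
      assume "x \<notin> closure \<Omega>"
      then have "open (- closure \<Omega> \<inter> U)" "x \<in> - closure \<Omega> \<inter> U" using g assms(3) by auto
      from eventually_line_in_open[OF this, of "s *\<^sub>R axis i 1"]
      have ev: "\<forall>\<^sub>F t in at_right (0::real). x + t *\<^sub>R (s *\<^sub>R axis i 1) \<in> - closure \<Omega> \<inter> U"
        by (simp add: eventually_at_filter eventually_mono)
      have "\<forall>\<^sub>F t in at_right (0::real). False"
        using ev eventually_at_right_less[of 0]
      proof eventually_elim
        case (elim t)
        let ?y = "x + t *\<^sub>R (s *\<^sub>R axis i 1)"
        have "\<gamma> ?y = \<gamma> x" using g by (auto simp: axis_def)
        also have "\<dots> < s * ?y $ i" using s elim(2) eq by (auto simp: algebra_simps)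
        finally have "?y \<in> \<Omega>" using g elim by blast
        then show False using elim closure_subset by blast
      qed
      then show False by simp
    qed
    ultimately show "x \<in> frontier \<Omega>" using assms(2) by (simp add: frontier_def interior_open)
  qed
qed

lemma norm_graph_normal:
  assumes "graph_patch 1 \<Omega> i s \<gamma> U"
  shows "norm (graph_normal i s \<gamma> x) = 1"
proof -
  have s: "s * s = 1" using assms unfolding graph_patch_def by auto
  have "(\<Sum>j\<in>UNIV. (partial j \<gamma> x - (if j = i then s else 0))\<^sup>2) = (\<Sum>j\<in>UNIV. (partial j \<gamma> x)\<^sup>2 + (if j = i then 1 else 0))"
    using graph_partial_self[OF assms, of x] s by (intro sum.cong) (auto simp: power2_eq_square)
  also have "\<dots> = 1 + (\<Sum>j\<in>UNIV. (partial j \<gamma> x)\<^sup>2)" by (simp add: sum.distrib)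
  finally have "norm (\<chi> j. partial j \<gamma> x - (if j = i then s else 0)) = sqrt (1 + (\<Sum>j\<in>UNIV. (partial j \<gamma> x)\<^sup>2))"
    by (simp add: norm_vec_def L2_set_def)
  moreover have "1 + (\<Sum>j\<in>UNIV. (partial j \<gamma> x)\<^sup>2) > 0" by (intro add_pos_nonneg sum_nonneg) auto
  ultimately show ?thesis by (simp add: graph_normal_def)
qed

text \<open>For \<open>y\<close> in the graph, \<open>n \<bullet> (y - x)\<close> is up to a factor the error of the linear approximation of
  \<open>\<gamma>\<close> at \<open>x\<close>.\<close>
lemma graph_normal_tangent:
  assumes gp: "graph_patch 1 \<Omega> i s \<gamma> U" and op: "open \<Omega>" and x: "x \<in> frontier \<Omega>" "x \<in> U"
  defines "n \<equiv> graph_normal i s \<gamma> x"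
  shows "((\<lambda>y. (n \<bullet> (y - x)) / norm (y - x)) \<longlongrightarrow> 0) (at x within frontier \<Omega>)"
proof -
  note g = gp[unfolded graph_patch_def]
  define q where "q = sqrt (1 + (\<Sum>j\<in>UNIV. (partial j \<gamma> x)\<^sup>2))"
  have q: "q > 0" unfolding q_def by (intro real_sqrt_gt_zero add_pos_nonneg sum_nonneg) auto
  have "(\<gamma> has_derivative (\<lambda>v. \<Sum>j\<in>UNIV. (v $ j) *\<^sub>R partial j \<gamma> x)) (at x within frontier \<Omega>)"
    using Cext_has_derivative[of UNIV \<gamma> x] g by (auto intro: has_derivative_at_withinI)
  then have "((\<lambda>y. (\<gamma> y - \<gamma> x - (\<Sum>j\<in>UNIV. ((y - x) $ j) *\<^sub>R partial j \<gamma> x)) /\<^sub>R norm (y - x)) \<longlongrightarrow> 0) (at x within frontier \<Omega>)"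
    by (simp add: has_derivative_within inverse_eq_divide diff_diff_eq)
  then have "((\<lambda>y. - ((\<gamma> y - \<gamma> x - (\<Sum>j\<in>UNIV. ((y - x) $ j) *\<^sub>R partial j \<gamma> x)) /\<^sub>R norm (y - x)) / q) \<longlongrightarrow> - 0 / q) (at x within frontier \<Omega>)"
    using q by (intro tendsto_intros) auto
  moreover have "\<forall>\<^sub>F y in at x within frontier \<Omega>. - ((\<gamma> y - \<gamma> x - (\<Sum>j\<in>UNIV. ((y - x) $ j) *\<^sub>R partial j \<gamma> x)) /\<^sub>R norm (y - x)) / q
      = (n \<bullet> (y - x)) / norm (y - x)"
  proof -
    have "\<forall>\<^sub>F y in at x within frontier \<Omega>. y \<in> U \<and> y \<in> frontier \<Omega>"
      using eventually_at_in_open'[of U x] g x unfolding eventually_at_filter eventually_nhds by blast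
    then show ?thesis
    proof eventually_elim
      case (elim y)
      define S where "S = (\<Sum>j\<in>UNIV. ((y - x) $ j) *\<^sub>R partial j \<gamma> x)"
      have "\<gamma> y = s * y $ i" "\<gamma> x = s * x $ i"
        using graph_frontier_iff[OF gp op] elim x by auto
      then have gy: "\<gamma> y - \<gamma> x = s * (y - x) $ i" by (simp add: right_diff_distrib)
      have 1: "n \<bullet> (y - x) = (\<Sum>j\<in>UNIV. (partial j \<gamma> x - (if j = i then s else 0)) * (y - x) $ j) / q"
        unfolding n_def graph_normal_def q_def by (simp add: inner_vec_def sum_divide_distrib)
      have "(\<Sum>j\<in>UNIV. (partial j \<gamma> x - (if j = i then s else 0)) * v $ j)
        = (\<Sum>j\<in>UNIV. (v $ j) *\<^sub>R partial j \<gamma> x - (if j = i then s * v $ i else 0))" for v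
        by (intro sum.cong) (auto simp: algebra_simps)
      from this[of "y - x"] have 2: "(\<Sum>j\<in>UNIV. (partial j \<gamma> x - (if j = i then s else 0)) * (y - x) $ j) = S - s * (y - x) $ i"
        by (simp add: sum_subtractf S_def)
      show ?case
        unfolding S_def[symmetric] gy 1 2 by (simp add: divide_inverse algebra_simps)
    qed
  qed
  ultimately show ?thesis by (simp add: tendsto_cong)
qed

text \<open>The function \<open>\<gamma> x - s * x $ i\<close> vanishes at the boundary point and has a positive derivative in
  the direction of its gradient.\<close>
lemma graph_normal_sides:
  assumes gp: "graph_patch 1 \<Omega> i s \<gamma> U" and op: "open \<Omega>" and x: "x \<in> frontier \<Omega>" "x \<in> U"
  defines "n \<equiv> graph_normal i s \<gamma> x"
  shows "\<forall>\<^sub>F t in at_right 0. x - t *\<^sub>R n \<in> \<Omega> \<and> x + t *\<^sub>R n \<notin> \<Omega>"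
proof -
  note g = gp[unfolded graph_patch_def]
  define q where "q = sqrt (1 + (\<Sum>j\<in>UNIV. (partial j \<gamma> x)\<^sup>2))"
  have q: "q > 0" unfolding q_def by (intro real_sqrt_gt_zero add_pos_nonneg sum_nonneg) auto
  have q2: "q * q = 1 + (\<Sum>j\<in>UNIV. (partial j \<gamma> x)\<^sup>2)"
    unfolding q_def by (simp add: sum_nonneg)
  have s: "s * s = 1" using g by auto
  have n: "n $ j = (partial j \<gamma> x - (if j = i then s else 0)) / q" for j
    by (simp add: n_def graph_normal_def q_def)
  define f where "f t = \<gamma> (x + t *\<^sub>R n) - s * (x + t *\<^sub>R n) $ i" for t
  have f0: "f 0 = 0" using graph_frontier_iff[OF gp op x(2)] x(1) by (simp add: f_def)
  have "(\<gamma> has_derivative (\<lambda>v. \<Sum>j\<in>UNIV. (v $ j) *\<^sub>R partial j \<gamma> x)) (at (x + 0 *\<^sub>R n))"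
    using Cext_has_derivative[of UNIV \<gamma> x] g by auto
  moreover have "((\<lambda>t. x + t *\<^sub>R n) has_derivative (\<lambda>t. t *\<^sub>R n)) (at 0)"
    by (auto intro!: derivative_eq_intros)
  ultimately have "((\<lambda>t. \<gamma> (x + t *\<^sub>R n)) has_derivative (\<lambda>t. \<Sum>j\<in>UNIV. ((t *\<^sub>R n) $ j) *\<^sub>R partial j \<gamma> x)) (at 0)"
    using diff_chain_at[of "\<lambda>t. x + t *\<^sub>R n" "\<lambda>t. t *\<^sub>R n" 0 \<gamma>
      "\<lambda>v. \<Sum>j\<in>UNIV. (v $ j) *\<^sub>R partial j \<gamma> x"] by (simp add: o_def)
  then have "(f has_derivative (\<lambda>t. (\<Sum>j\<in>UNIV. ((t *\<^sub>R n) $ j) *\<^sub>R partial j \<gamma> x) - s * (t * n $ i))) (at 0)"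
    unfolding f_def by (auto intro!: derivative_eq_intros)
  moreover have "(\<Sum>j\<in>UNIV. ((t *\<^sub>R n) $ j) *\<^sub>R partial j \<gamma> x) - s * (t * n $ i) = q * t" for t
  proof -
    have "(\<Sum>j\<in>UNIV. ((t *\<^sub>R n) $ j) *\<^sub>R partial j \<gamma> x) = (\<Sum>j\<in>UNIV. t / q * (partial j \<gamma> x)\<^sup>2)"
      using graph_partial_self[OF gp, of x] by (intro sum.cong) (auto simp: n power2_eq_square)
    also have "\<dots> = t / q * (q * q - 1)" by (simp add: q2 sum_distrib_left)
    finally have "(\<Sum>j\<in>UNIV. ((t *\<^sub>R n) $ j) *\<^sub>R partial j \<gamma> x) = t / q * (q * q - 1)" .
    moreover have "s * (t * n $ i) = - ((s * s) * t / q)"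
      using graph_partial_self[OF gp, of x] by (simp add: n)
    moreover have "t / q * (q * q - 1) + t / q = q * t" using q by (simp add: field_simps)
    ultimately show ?thesis by (simp add: s)
  qed
  ultimately have D: "(f has_real_derivative q) (at 0)"
    by (simp add: has_field_derivative_def)
  obtain d1 where d1: "d1 > 0" "\<And>h. 0 < h \<Longrightarrow> h < d1 \<Longrightarrow> f h > 0"
    using DERIV_pos_inc_right[OF D q] f0 by auto
  obtain d2 where d2: "d2 > 0" "\<And>h. 0 < h \<Longrightarrow> h < d2 \<Longrightarrow> f (- h) < 0"
    using DERIV_pos_inc_left[OF D q] f0 by auto
  have "\<forall>\<^sub>F t in at_right (0::real). x + t *\<^sub>R n \<in> U" "\<forall>\<^sub>F t in at_right (0::real). x + t *\<^sub>R (- n) \<in> U"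
    using eventually_line_in_open[of U x] g x(2) by (meson at_within_le_nhds filter_leD)+
  moreover have "\<forall>\<^sub>F t in at_right (0::real). 0 < t \<and> t < min d1 d2"
    using eventually_at_right_real[of 0 "min d1 d2"] d1(1) d2(1) by (auto simp: eventually_at_filter elim: eventually_mono)
  ultimately show ?thesis
  proof eventually_elim
    case (elim t)
    have "\<gamma> (x + t *\<^sub>R n) > s * (x + t *\<^sub>R n) $ i" using d1(2)[of t] elim by (simp add: f_def)
    then have "x + t *\<^sub>R n \<notin> \<Omega>" using g elim(1) by force
    moreover have "\<gamma> (x - t *\<^sub>R n) < s * (x - t *\<^sub>R n) $ i" using d2(2)[of t] elim by (simp add: f_def)
    then have "x - t *\<^sub>R n \<in> \<Omega>" using g elim(2) by auto
    ultimately show ?case by simp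
  qed
qed

text \<open>The limit is evaluated along the curve in the graph that lies over the line in direction
  \<open>j\<close>.\<close>
lemma normal_orthogonal_graph_tangent:
  assumes gp: "graph_patch 1 \<Omega> i s \<gamma> U" and op: "open \<Omega>" and x: "x \<in> frontier \<Omega>" "x \<in> U" and "j \<noteq> i"
    and lim: "((\<lambda>y. (n \<bullet> (y - x)) / norm (y - x)) \<longlongrightarrow> 0) (at x within frontier \<Omega>)"
  shows "n $ j + s * partial j \<gamma> x * n $ i = 0"
proof -
  note g = gp[unfolded graph_patch_def]
  have s: "s * s = 1" using g by auto
  define c where "c h = x + h *\<^sub>R axis j 1 + (s * (\<gamma> (x + h *\<^sub>R axis j 1) - \<gamma> x)) *\<^sub>R axis i 1" for h
  have "Cext UNIV (Suc 0) UNIV \<gamma>" using g by (simp only: C_on_eq_Cext One_nat_def)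
  from Cext_has_partial[OF this] have D: "((\<lambda>t. \<gamma> (x + t *\<^sub>R axis j 1)) has_vector_derivative partial j \<gamma> x) (at 0)"
    by simp
  define T where "T = axis j 1 + (s * partial j \<gamma> x) *\<^sub>R axis i (1::real)"
  have "((\<lambda>h. (\<gamma> (x + h *\<^sub>R axis j 1) - \<gamma> x) / h) \<longlongrightarrow> partial j \<gamma> x) (at 0)"
    using D unfolding has_real_derivative_iff_has_vector_derivative[symmetric] DERIV_def by simp
  then have "((\<lambda>h. axis j 1 + (s * ((\<gamma> (x + h *\<^sub>R axis j 1) - \<gamma> x) / h)) *\<^sub>R axis i 1) \<longlongrightarrow> T) (at 0)"
    unfolding T_def by (intro tendsto_intros)
  then have cT: "((\<lambda>h. (c h - x) /\<^sub>R h) \<longlongrightarrow> T) (at 0)"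
    by (rule Lim_transform_eventually) (auto simp: eventually_at_filter c_def scaleR_add_right divide_inverse mult.commute)
  have c_fr: "\<forall>\<^sub>F h in at 0. c h \<in> frontier \<Omega> \<and> c h \<noteq> x"
  proof -
    have "isCont \<gamma> x" using g by (simp add: One_nat_def continuous_on_eq_continuous_at)
    then have "((\<lambda>h. \<gamma> (x + h *\<^sub>R axis j 1)) \<longlongrightarrow> \<gamma> x) (at 0)"
      by (rule isCont_tendsto_compose) (auto intro!: tendsto_eq_intros)
    then have "(c \<longlongrightarrow> x) (at 0)" unfolding c_def by (auto intro!: tendsto_eq_intros)
    then have "\<forall>\<^sub>F h in at 0. c h \<in> U" using g x topological_tendstoD by blast
    moreover have "\<forall>\<^sub>F h in at (0::real). h \<noteq> 0" by (simp add: eventually_at_filter)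
    ultimately show ?thesis
    proof eventually_elim
      case (elim h)
      have "\<gamma> (c h) = \<gamma> (x + h *\<^sub>R axis j 1)" using g by (auto simp: c_def axis_def)
      moreover have "\<gamma> x = s * x $ i" using graph_frontier_iff[OF gp op x(2)] x(1) by simp
      ultimately have "\<gamma> (c h) = s * c h $ i"
        using s \<open>j \<noteq> i\<close> by (simp add: c_def axis_def algebra_simps mult.assoc[symmetric])
      then have "c h \<in> frontier \<Omega>" using graph_frontier_iff[OF gp op elim(1)] by simp
      moreover have "c h $ j \<noteq> x $ j" using elim(2) \<open>j \<noteq> i\<close> by (simp add: c_def axis_def)
      ultimately show ?case by auto
    qed
  qed
  have clim: "filterlim c (at x within frontier \<Omega>) (at 0)"
  proof -
    have "((\<lambda>h. x + h *\<^sub>R ((c h - x) /\<^sub>R h)) \<longlongrightarrow> x + 0 *\<^sub>R T) (at 0)"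
      by (intro tendsto_intros cT)
    then have "((\<lambda>h. x + h *\<^sub>R ((c h - x) /\<^sub>R h)) \<longlongrightarrow> x) (at 0)" by simp
    then have "(c \<longlongrightarrow> x) (at 0)"
      by (rule Lim_transform_eventually) (auto simp: eventually_at_filter)
    then show ?thesis using c_fr by (auto simp: filterlim_at elim: eventually_mono)
  qed
  have "((\<lambda>h. \<bar>(n \<bullet> (c h - x)) / norm (c h - x)\<bar> * norm ((c h - x) /\<^sub>R h)) \<longlongrightarrow> \<bar>0\<bar> * norm T) (at 0)"
    by (intro tendsto_intros cT filterlim_compose[OF lim clim])
  then have "((\<lambda>h. \<bar>n \<bullet> ((c h - x) /\<^sub>R h)\<bar>) \<longlongrightarrow> 0) (at 0)"
    unfolding abs_zero mult_zero_left
  proof (rule Lim_transform_eventually)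
    show "\<forall>\<^sub>F h in at 0. \<bar>(n \<bullet> (c h - x)) / norm (c h - x)\<bar> * norm ((c h - x) /\<^sub>R h) = \<bar>n \<bullet> ((c h - x) /\<^sub>R h)\<bar>"
      using c_fr
    proof eventually_elim
      case (elim h)
      have "norm ((c h - x) /\<^sub>R h) = norm (c h - x) / \<bar>h\<bar>"
        by (simp only: norm_scaleR abs_inverse real_norm_def divide_inverse mult.commute)
      moreover have "n \<bullet> ((c h - x) /\<^sub>R h) = (n \<bullet> (c h - x)) / h"
        by (simp only: inner_scaleR_right divide_inverse mult.commute)
      ultimately show ?case using elim by (simp add: abs_divide)
    qed
  qed
  moreover have "((\<lambda>h. \<bar>n \<bullet> ((c h - x) /\<^sub>R h)\<bar>) \<longlongrightarrow> \<bar>n \<bullet> T\<bar>) (at 0)"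
    by (intro tendsto_intros cT)
  ultimately have "\<bar>n \<bullet> T\<bar> = 0" using tendsto_unique[OF at_neq_bot] by blast
  then show ?thesis by (simp add: T_def inner_add_right inner_axis mult.commute)
qed

text \<open>Orthogonality to the tangent vectors over the axes other than \<open>i\<close> determines the line of the
  normal, and the two sides of the boundary determine its orientation.\<close>
lemma outer_normal_graph:
  assumes gp: "graph_patch 1 \<Omega> i s \<gamma> U" and op: "open \<Omega>" and x: "x \<in> frontier \<Omega>" "x \<in> U"
  shows "outer_normal \<Omega> x = graph_normal i s \<gamma> x"
  unfolding outer_normal_def
proof (rule the_equality)
  let ?n = "graph_normal i s \<gamma> x"
  show "norm ?n = 1 \<and> ((\<lambda>y. (?n \<bullet> (y - x)) / norm (y - x)) \<longlongrightarrow> 0) (at x within frontier \<Omega>) \<and>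
    (\<forall>\<^sub>F t in at_right 0. x - t *\<^sub>R ?n \<in> \<Omega> \<and> x + t *\<^sub>R ?n \<notin> \<Omega>)"
    using norm_graph_normal[OF gp] graph_normal_tangent[OF assms] graph_normal_sides[OF assms] by blast
  fix n
  assume n: "norm n = 1 \<and> ((\<lambda>y. (n \<bullet> (y - x)) / norm (y - x)) \<longlongrightarrow> 0) (at x within frontier \<Omega>) \<and>
    (\<forall>\<^sub>F t in at_right 0. x - t *\<^sub>R n \<in> \<Omega> \<and> x + t *\<^sub>R n \<notin> \<Omega>)"
  have s: "s * s = 1" using gp unfolding graph_patch_def by auto
  define q where "q = sqrt (1 + (\<Sum>j\<in>UNIV. (partial j \<gamma> x)\<^sup>2))"
  have q: "q > 0" unfolding q_def by (intro real_sqrt_gt_zero add_pos_nonneg sum_nonneg) auto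
  have "n $ j = (- (s * n $ i) * q) * ?n $ j" for j
  proof (cases "j = i")
    case True
    have "?n $ i = - s / q"
      using graph_partial_self[OF gp, of x] by (simp add: graph_normal_def q_def[symmetric])
    then have "(- (s * n $ i) * q) * ?n $ i = (s * s) * n $ i * (q / q)"
      by (simp add: ac_simps)
    then show ?thesis using q s True by simp
  next
    case False
    have "n $ j = - (s * partial j \<gamma> x * n $ i)"
      using normal_orthogonal_graph_tangent[OF gp op x False] n by force
    then show ?thesis using q False by (simp add: graph_normal_def q_def[symmetric])
  qed
  then obtain l where l: "n = l *\<^sub>R ?n" by (metis vec_eq_iff vector_scaleR_component real_scaleR_def)
  then have "\<bar>l\<bar> = 1" using n norm_graph_normal[OF gp] by (metis mult.right_neutral norm_scaleR)
  moreover have "l \<noteq> -1"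
  proof
    assume "l = -1"
    then have "n = - ?n" using l by simp
    then have "\<forall>\<^sub>F t in at_right 0. x - t *\<^sub>R (- ?n) \<in> \<Omega>" using n by (auto elim: eventually_mono)
    with graph_normal_sides[OF assms] have "\<forall>\<^sub>F t in at_right (0::real). False"
      by eventually_elim simp
    then show False by simp
  qed
  ultimately show "n = ?n" using l by (metis abs_eq_iff' scaleR_one abs_one)
qed

text \<open>The formula for the normal of a graph makes sense on the whole space, and a partition of unity
  glues the local fields. An extension of the normal is needed because its components get
  differentiated when derivatives are moved from one factor to the other.\<close>
lemma normal_field_exists:
  fixes \<Omega> :: "(real ^ 'n::finite) set"
  assumes "bounded \<Omega>" "open \<Omega>" "C_boundary (Suc k) \<Omega>"
  obtains \<nu> :: "real ^ 'n \<Rightarrow> real ^ 'n" where "\<And>j. C_on k UNIV (\<lambda>x. \<nu> x $ j)"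
    "\<And>x. x \<in> frontier \<Omega> \<Longrightarrow> \<nu> x = outer_normal \<Omega> x"
proof -
  obtain P :: "'n patch list" where P: "\<And>i s \<gamma> \<phi>. (i, s, \<gamma>, \<phi>) \<in> set P \<Longrightarrow> \<exists>U. graph_patch (Suc k) \<Omega> i s \<gamma> U \<and> \<phi> \<in> test_functions U \<and> (\<forall>x. 0 \<le> \<phi> x)"
    "\<And>x. x \<in> frontier \<Omega> \<Longrightarrow> (\<Sum>(i, s, \<gamma>, \<phi>)\<leftarrow>P. \<phi> x) = 1"
    by (rule boundary_partition[OF assms(1,3)]) (rule that)
  define \<nu> where "\<nu> x = (\<Sum>(i, s, \<gamma>, \<phi>)\<leftarrow>P. \<phi> x *\<^sub>R graph_normal i s \<gamma> x)" for x
  show ?thesis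
  proof (rule that[of \<nu>])
    fix j
    have "Cext UNIV k UNIV (\<lambda>x. (\<Sum>(i, s, \<gamma>, \<phi>)\<leftarrow>Q. \<phi> x *\<^sub>R graph_normal i s \<gamma> x) $ j)" if "set Q \<subseteq> set P" for Q
      using that
    proof (induction Q)
      case (Cons p Q)
      obtain i s \<gamma> \<phi> where p: "p = (i, s, \<gamma>, \<phi>)" by (cases p)
      obtain U where U: "graph_patch (Suc k) \<Omega> i s \<gamma> U" "\<phi> \<in> test_functions U" using P(1)[of i s \<gamma> \<phi>] Cons.prems p by auto
      have \<phi>: "Cext UNIV k UNIV \<phi>" using U(2) unfolding test_functions_def C_on_eq_Cext by blast
      have d\<gamma>: "Cext UNIV k UNIV (partial l \<gamma>)" for l
        using U(1) unfolding graph_patch_def C_on_eq_Cext by (intro Cext_partial) blast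
      have pos: "1 + (\<Sum>l\<in>UNIV. partial l \<gamma> x * partial l \<gamma> x) > 0" for x
        by (intro add_pos_nonneg sum_nonneg) auto
      have "Cext UNIV k UNIV (\<lambda>x. (1 + (\<Sum>l\<in>UNIV. partial l \<gamma> x * partial l \<gamma> x)) powr (- (1/2)))"
        by (rule C_on_powr[unfolded C_on_eq_Cext, OF open_UNIV pos])
           (intro Cext_add Cext_const Cext_sum Cext_mult open_UNIV d\<gamma>)
      then have "Cext UNIV k UNIV (\<lambda>x. \<phi> x * ((1 + (\<Sum>l\<in>UNIV. partial l \<gamma> x * partial l \<gamma> x)) powr (- (1/2)) *
          (partial j \<gamma> x - (if j = i then s else 0))))"
        by (intro Cext_mult Cext_diff Cext_const open_UNIV \<phi> d\<gamma>)
      then have "Cext UNIV k UNIV (\<lambda>x. (\<phi> x *\<^sub>R graph_normal i s \<gamma> x) $ j)"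
        by (rule Cext_cong[OF open_UNIV])
           (simp add: graph_normal_def powr_minus power2_eq_square powr_half_sqrt[OF less_imp_le[OF pos]] inverse_eq_divide)
      then have "Cext UNIV k UNIV (\<lambda>x. (\<phi> x *\<^sub>R graph_normal i s \<gamma> x) $ j + (\<Sum>(i, s, \<gamma>, \<phi>)\<leftarrow>Q. \<phi> x *\<^sub>R graph_normal i s \<gamma> x) $ j)"
        using Cons by (intro Cext_add open_UNIV) auto
      then show ?case by (simp add: p)
    qed (simp add: Cext_const)
    from this[of P] show "C_on k UNIV (\<lambda>x. \<nu> x $ j)" by (simp add: C_on_eq_Cext \<nu>_def)
  next
    fix x assume x: "x \<in> frontier \<Omega>"
    have "(case p of (i, s, \<gamma>, \<phi>) \<Rightarrow> \<phi> x *\<^sub>R graph_normal i s \<gamma> x) = (case p of (i, s, \<gamma>, \<phi>) \<Rightarrow> \<phi> x) *\<^sub>R outer_normal \<Omega> x"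
      if pP: "p \<in> set P" for p
    proof -
      obtain i s \<gamma> \<phi> where p: "p = (i, s, \<gamma>, \<phi>)" by (cases p)
      obtain U where U: "graph_patch (Suc k) \<Omega> i s \<gamma> U" "\<phi> \<in> test_functions U"
        using P(1)[of i s \<gamma> \<phi>] pP p by blast
      show ?thesis
      proof (cases "\<phi> x = 0")
        case False
        then have "x \<in> U"
          using U(2) closure_subset[of "{x. \<phi> x \<noteq> 0}"] unfolding test_functions_def by blast
        then show ?thesis using outer_normal_graph[OF graph_patch_le[OF U(1)] assms(2) x] by (simp add: p)
      qed (simp add: p)
    qed
    then have "\<nu> x = (\<Sum>p\<leftarrow>P. (case p of (i, s, \<gamma>, \<phi>) \<Rightarrow> \<phi> x) *\<^sub>R outer_normal \<Omega> x)"
      unfolding \<nu>_def by (intro arg_cong[of _ _ sum_list] map_cong) auto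
    also have "\<dots> = (\<Sum>p\<leftarrow>P. (case p of (i, s, \<gamma>, \<phi>) \<Rightarrow> \<phi> x)) *\<^sub>R outer_normal \<Omega> x"
      by (induction P) (auto simp: scaleR_add_left)
    finally show "\<nu> x = outer_normal \<Omega> x" using P(2)[OF x] by simp
  qed
qed

section \<open>Lebesgue measure, one coordinate singled out\<close>

abbreviation upd :: "'n \<Rightarrow> ('n \<Rightarrow> real) \<Rightarrow> real \<Rightarrow> real ^ 'n::finite" where
  "upd i y t \<equiv> (\<chi> j. (y(i := t)) j)"

lemma measurable_vec_lambda_PiM: "(\<lambda>f. \<chi> j. f j) \<in> borel_measurable (Pi\<^sub>M (UNIV :: 'n::finite set) (\<lambda>_. lborel :: real measure))"
proof -
  have "(\<lambda>f. (\<chi> j. f j) \<bullet> b) \<in> borel_measurable (Pi\<^sub>M (UNIV :: 'n set) (\<lambda>_. lborel :: real measure))"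
    if bB: "b \<in> Basis" for b :: "real ^ 'n"
  proof -
    obtain i where b: "b = axis i 1" using bB by (auto simp: Basis_vec_def)
    have "(\<lambda>f. f i) \<in> borel_measurable (Pi\<^sub>M (UNIV :: 'n set) (\<lambda>_. lborel :: real measure))"
      using measurable_component_singleton[of i UNIV "\<lambda>_. lborel :: real measure"] by simp
    then show ?thesis by (simp add: b inner_axis)
  qed
  then show ?thesis by (simp add: borel_measurable_euclidean_space[of "\<lambda>f. \<chi> j. f j"])
qed

lemma lborel_vec_eq: "(lborel :: (real ^ 'n::finite) measure) = distr (Pi\<^sub>M UNIV (\<lambda>_. lborel)) borel (\<lambda>f. \<chi> j. f j)"
proof (rule lborel_eqI)
  fix l u :: "real ^ 'n" assume le: "\<And>b. b \<in> Basis \<Longrightarrow> l \<bullet> b \<le> u \<bullet> b"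
  interpret product_sigma_finite "\<lambda>_::'n. lborel :: real measure" ..
  have le': "l $ j \<le> u $ j" for j using le[of "axis j 1"] by (simp add: inner_axis axis_in_Basis_iff)
  have "emeasure (distr (Pi\<^sub>M UNIV (\<lambda>_. lborel)) borel (\<lambda>f. \<chi> j. f j)) (box l u)
      = emeasure (Pi\<^sub>M UNIV (\<lambda>_::'n. lborel)) ((\<lambda>f. \<chi> j. f j) -` box l u \<inter> space (Pi\<^sub>M UNIV (\<lambda>_::'n. lborel)))"
    using measurable_vec_lambda_PiM by (intro emeasure_distr) auto
  also have "(\<lambda>f. \<chi> j. f j) -` box l u \<inter> space (Pi\<^sub>M UNIV (\<lambda>_::'n. lborel)) = Pi\<^sub>E UNIV (\<lambda>j. {l $ j<..<u $ j})"
    by (fastforce simp: mem_box_cart space_PiM PiE_iff)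
  also have "emeasure (Pi\<^sub>M UNIV (\<lambda>_::'n. lborel)) \<dots> = (\<Prod>j\<in>UNIV. emeasure lborel {l $ j<..<u $ j})"
    by (intro emeasure_PiM) auto
  also have "\<dots> = (\<Prod>j\<in>UNIV. ennreal ((u - l) $ j))"
    using le' by (intro prod.cong) auto
  also have "\<dots> = ennreal (\<Prod>j\<in>UNIV. (u - l) $ j)"
    using le' by (intro prod_ennreal) auto
  also have "(\<Prod>j\<in>UNIV. (u - l) $ j) = (\<Prod>b\<in>Basis. (u - l) \<bullet> b)"
  proof -
    have 1: "Basis = range (\<lambda>j::'n. axis j (1::real))" by (auto simp: Basis_vec_def)
    have 2: "inj (\<lambda>j::'n. axis j (1::real))" by (auto simp: inj_def axis_eq_axis)
    show ?thesis unfolding 1 prod.reindex[OF 2] by (simp add: inner_axis)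
  qed
  finally show "emeasure (distr (Pi\<^sub>M UNIV (\<lambda>_. lborel)) borel (\<lambda>f. \<chi> j. f j)) (box l u) = (\<Prod>b\<in>Basis. (u - l) \<bullet> b)" .
qed simp

lemma lborel_nn_integral_split:
  fixes g :: "real ^ 'n::finite \<Rightarrow> ennreal"
  assumes g: "g \<in> borel_measurable borel"
  shows "(\<integral>\<^sup>+ x. g x \<partial>lborel) = (\<integral>\<^sup>+ y. \<integral>\<^sup>+ t. g (upd i y t) \<partial>lborel \<partial>(Pi\<^sub>M (UNIV - {i}) (\<lambda>_. lborel)))"
proof -
  interpret product_sigma_finite "\<lambda>_::'n. lborel :: real measure" ..
  have U: "insert i (UNIV - {i}) = (UNIV :: 'n set)" by auto
  have m: "(\<lambda>f. g (\<chi> j. f j)) \<in> borel_measurable (Pi\<^sub>M (UNIV :: 'n set) (\<lambda>_. lborel))"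
    using measurable_compose[OF measurable_vec_lambda_PiM g] .
  have "(\<integral>\<^sup>+ x. g x \<partial>lborel) = (\<integral>\<^sup>+ f. g (\<chi> j. f j) \<partial>Pi\<^sub>M UNIV (\<lambda>_. lborel))"
    using g by (subst lborel_vec_eq) (simp add: nn_integral_distr measurable_vec_lambda_PiM)
  also have "\<dots> = (\<integral>\<^sup>+ y. \<integral>\<^sup>+ t. g (upd i y t) \<partial>lborel \<partial>(Pi\<^sub>M (UNIV - {i}) (\<lambda>_. lborel)))"
    using product_nn_integral_insert[of "UNIV - {i}" i, unfolded U, OF _ _ m] by simp
  finally show ?thesis .
qed

lemma lborel_integral_split:
  fixes g :: "real ^ 'n::finite \<Rightarrow> 'b::{banach, second_countable_topology}"
  assumes g: "integrable lborel g"
  shows "(\<integral>x. g x \<partial>lborel) = (\<integral>y. \<integral>t. g (upd i y t) \<partial>lborel \<partial>(Pi\<^sub>M (UNIV - {i}) (\<lambda>_. lborel)))"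
proof -
  interpret product_sigma_finite "\<lambda>_::'n. lborel :: real measure" ..
  have U: "insert i (UNIV - {i}) = (UNIV :: 'n set)" by auto
  have gm: "g \<in> borel_measurable borel" using borel_measurable_integrable[OF g] by simp
  have m: "integrable (Pi\<^sub>M (UNIV :: 'n set) (\<lambda>_. lborel)) (\<lambda>f. g (\<chi> j. f j))"
    using g by (subst (asm) lborel_vec_eq) (rule integrable_distr[OF measurable_vec_lambda_PiM])
  have "(\<integral>x. g x \<partial>lborel) = (\<integral>f. g (\<chi> j. f j) \<partial>Pi\<^sub>M UNIV (\<lambda>_. lborel))"
    using gm by (subst lborel_vec_eq) (simp add: integral_distr measurable_vec_lambda_PiM)
  also have "\<dots> = (\<integral>y. \<integral>t. g (upd i y t) \<partial>lborel \<partial>(Pi\<^sub>M (UNIV - {i}) (\<lambda>_. lborel)))"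
    using product_integral_insert[of "UNIV - {i}" i, unfolded U, OF _ _ m] by simp
  finally show ?thesis .
qed

text \<open>On each line in direction \<open>i\<close> the map is a translation.\<close>
lemma lborel_distr_shear:
  fixes \<eta> :: "real ^ 'n::finite \<Rightarrow> real"
  assumes \<eta>: "\<eta> \<in> borel_measurable borel" and ind: "\<And>x y. (\<And>j. j \<noteq> i \<Longrightarrow> x $ j = y $ j) \<Longrightarrow> \<eta> x = \<eta> y"
  shows "distr lborel borel (\<lambda>x. x + \<eta> x *\<^sub>R axis i 1) = lborel"
proof (rule measure_eqI)
  let ?S = "\<lambda>x. x + \<eta> x *\<^sub>R axis i 1"
  have S: "?S \<in> borel_measurable borel" using \<eta> by measurable
  fix A assume "A \<in> sets (distr lborel borel ?S)"
  then have A: "A \<in> sets borel" by simp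
  have "emeasure (distr lborel borel ?S) A = (\<integral>\<^sup>+ x. indicator A x \<partial>distr lborel borel ?S)"
    using A by simp
  also have "\<dots> = (\<integral>\<^sup>+ x. indicator A (?S x) \<partial>lborel)"
    using S A by (intro nn_integral_distr) auto
  also have "\<dots> = (\<integral>\<^sup>+ y. \<integral>\<^sup>+ t. indicator A (?S (upd i y t)) \<partial>lborel \<partial>(Pi\<^sub>M (UNIV - {i}) (\<lambda>_. lborel)))"
    using S A by (intro lborel_nn_integral_split measurable_compose[OF S]) auto
  also have "\<dots> = (\<integral>\<^sup>+ y. \<integral>\<^sup>+ t. indicator A (upd i y t) \<partial>lborel \<partial>(Pi\<^sub>M (UNIV - {i}) (\<lambda>_. lborel)))"
  proof (rule nn_integral_cong)
    fix y :: "'n \<Rightarrow> real"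
    have "?S (upd i y t) = upd i y (\<eta> (upd i y 0) + 1 * t)" for t
      using ind[of "upd i y t" "upd i y 0"] by (auto simp: vec_eq_iff axis_def)
    moreover have "(\<lambda>t. upd i y t) \<in> borel_measurable borel"
    proof (intro borel_measurable_continuous_onI continuous_on_vec_lambda)
      show "continuous_on UNIV (\<lambda>t. (y(i := t)) j)" for j by (cases "j = i") auto
    qed
    then have "(\<lambda>t. indicator A (upd i y t) :: ennreal) \<in> borel_measurable borel"
      using A by measurable
    ultimately show "(\<integral>\<^sup>+ t. indicator A (?S (upd i y t)) \<partial>lborel) = (\<integral>\<^sup>+ t. indicator A (upd i y t) \<partial>lborel)"
      using nn_integral_real_affine[of "\<lambda>t. indicator A (upd i y t)" 1 "\<eta> (upd i y 0)"] by simp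
  qed
  also have "\<dots> = (\<integral>\<^sup>+ x. indicator A x \<partial>lborel)"
    using A by (intro lborel_nn_integral_split[symmetric]) auto
  finally show "emeasure (distr lborel borel ?S) A = emeasure lborel A" using A by simp
qed simp

lemma lborel_integral_shear_translate:
  fixes G :: "real ^ 'n::finite \<Rightarrow> 'b::{banach, second_countable_topology}"
  assumes G: "integrable lborel G" and \<eta>: "\<eta> \<in> borel_measurable borel"
    and ind: "\<And>x y. (\<And>j. j \<noteq> i \<Longrightarrow> x $ j = y $ j) \<Longrightarrow> \<eta> x = \<eta> y"
  shows "integrable lborel (\<lambda>x. G (x + c + \<eta> (x + c) *\<^sub>R axis i 1))" (is ?I)
    "(\<integral>x. G (x + c + \<eta> (x + c) *\<^sub>R axis i 1) \<partial>lborel) = (\<integral>x. G x \<partial>lborel)" (is ?E)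
proof -
  let ?S = "\<lambda>x. x + \<eta> x *\<^sub>R axis i 1"
  have S: "?S \<in> measurable lborel borel" using \<eta> by simp
  have T: "(+) c \<in> measurable lborel borel" by simp
  have 1: "integrable lborel (\<lambda>x. G (?S x))"
    using G integrable_distr[OF S, of G] by (simp add: lborel_distr_shear[OF \<eta> ind])
  from integrable_distr[OF T, of "\<lambda>x. G (?S x)"] 1 show ?I
    by (simp add: lborel_distr_plus add.commute[of c])
  have m: "G \<in> borel_measurable borel" "(\<lambda>x. G (?S x)) \<in> borel_measurable borel"
    using borel_measurable_integrable[OF G] borel_measurable_integrable[OF 1] by simp_all
  have "(\<integral>x. G x \<partial>lborel) = (\<integral>x. G (?S x) \<partial>lborel)"
    using integral_distr[OF S m(1)] by (simp add: lborel_distr_shear[OF \<eta> ind])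
  also have "\<dots> = (\<integral>x. G (?S (c + x)) \<partial>lborel)"
    using integral_distr[OF T m(2)] by (simp add: lborel_distr_plus)
  finally show ?E by (simp add: add.commute[of c])
qed

text \<open>Each line in direction \<open>i\<close> meets the graph in a single point.\<close>
lemma graph_null_set:
  fixes \<gamma> :: "real ^ 'n::finite \<Rightarrow> real"
  assumes "continuous_on UNIV \<gamma>" "s * s = 1" and ind: "\<And>x y. (\<And>j. j \<noteq> i \<Longrightarrow> x $ j = y $ j) \<Longrightarrow> \<gamma> x = \<gamma> y"
  shows "{x. \<gamma> x = s * x $ i} \<in> null_sets lborel"
proof -
  let ?A = "{x. \<gamma> x = s * x $ i}"
  have "closed ?A" using assms(1)
    by (intro closed_Collect_eq continuous_intros) (auto simp: continuous_on_eq_continuous_at)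
  then have A: "?A \<in> sets borel" by (rule borel_closed)
  have "emeasure lborel ?A = (\<integral>\<^sup>+ x. indicator ?A x \<partial>lborel)" using A by simp
  also have "\<dots> = (\<integral>\<^sup>+ y. \<integral>\<^sup>+ t. indicator ?A (upd i y t) \<partial>lborel \<partial>(Pi\<^sub>M (UNIV - {i}) (\<lambda>_. lborel)))"
    using A by (intro lborel_nn_integral_split) auto
  also have "\<dots> = (\<integral>\<^sup>+ y. 0 \<partial>(Pi\<^sub>M (UNIV - {i}) (\<lambda>_::'n. lborel :: real measure)))"
  proof (rule nn_integral_cong)
    fix y :: "'n \<Rightarrow> real"
    have "indicator ?A (upd i y t) = (indicator {s * \<gamma> (upd i y 0)} t :: ennreal)" for t
    proof -
      have "\<gamma> (upd i y t) = \<gamma> (upd i y 0)" by (rule ind) simp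
      moreover have "\<gamma> (upd i y 0) = s * t \<longleftrightarrow> t = s * \<gamma> (upd i y 0)"
        using assms(2) by (metis mult.assoc mult_1)
      ultimately show ?thesis by (auto simp: indicator_def)
    qed
    then show "(\<integral>\<^sup>+ t. indicator ?A (upd i y t) \<partial>lborel) = 0" by simp
  qed
  finally show ?thesis using A by (intro null_setsI) auto
qed

lemma FTC_halfline:
  fixes u :: "real \<Rightarrow> complex"
  assumes d: "\<And>t. t > 0 \<Longrightarrow> (u has_vector_derivative u' t) (at t)"
    and c: "continuous_on {0<..} u'" and b: "\<And>t. t > 0 \<Longrightarrow> norm (u' t) \<le> M"
    and z: "\<And>t. t > T \<Longrightarrow> t > 0 \<Longrightarrow> u t = 0" and l: "(u \<longlongrightarrow> L) (at_right 0)"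
  shows "(\<integral>t. indicator {0<..} t *\<^sub>R u' t \<partial>lborel) = - L"
proof -
  have z': "u' t = 0" if "t > T" "t > 0" for t
  proof -
    have "(u has_vector_derivative 0) (at t)"
      by (rule has_vector_derivative_transform_within_open[of "\<lambda>_. 0" 0 t "{max T 0<..}"]) (use that z in auto)
    then show ?thesis using d[OF that(2)] vector_derivative_unique_at by blast
  qed
  have int: "integrable lborel (\<lambda>t. indicator {0<..} t *\<^sub>R u' t)"
  proof (rule integrableI_bounded_set[where A = "{0..max T 0}" and B = M])
    show "(\<lambda>t. indicator {0<..} t *\<^sub>R u' t) \<in> borel_measurable lborel"
      using borel_measurable_continuous_on_indicator[OF _ c] by simp
  qed (use z' b in \<open>auto simp: indicator_def emeasure_lborel_Icc_eq intro!: AE_I2 order_trans[OF norm_ge_zero b[of 1]]\<close>)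
  have "(LBINT t=0..\<infinity>. u' t) = 0 - L"
  proof (rule interval_integral_FTC_integrable[where F = u])
    show "isCont u' x" if "0 < ereal x" for x
      using c that by (simp add: continuous_on_eq_continuous_at)
    have "einterval 0 \<infinity> = {0<..}" by (auto simp: einterval_def)
    then show "set_integrable lborel (einterval 0 \<infinity>) u'"
      using int by (simp add: set_integrable_def)
    show "((u \<circ> real_of_ereal) \<longlongrightarrow> L) (at_right 0)"
      using l by (simp add: zero_ereal_def ereal_tendsto_simps)
    have "(u \<longlongrightarrow> 0) at_top"
      by (rule tendsto_eventually) (use eventually_gt_at_top[of "max T 0"] z in \<open>auto elim!: eventually_mono\<close>)
    then show "((u \<circ> real_of_ereal) \<longlongrightarrow> 0) (at_left \<infinity>)"
      by (simp add: ereal_tendsto_simps)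
  qed (use d in auto)
  moreover have "einterval 0 \<infinity> = {0<..}" by (auto simp: einterval_def)
  ultimately show ?thesis by (simp add: interval_lebesgue_integral_def set_lebesgue_integral_def)
qed

section \<open>The divergence theorem above a graph\<close>

lemma C_on_1_continuous: "C_on 1 U f \<Longrightarrow> continuous_on U f" "C_on 1 U f \<Longrightarrow> continuous_on U (partial i f)"
  by (simp_all add: One_nat_def)

lemma bounded_support_integrable:
  fixes f :: "'a::euclidean_space \<Rightarrow> 'b::{banach, second_countable_topology}"
  assumes "open V" "continuous_on V f" "\<And>x. x \<in> V \<Longrightarrow> norm (f x) \<le> M" "\<And>x. x \<in> V \<Longrightarrow> norm x > R \<Longrightarrow> f x = 0"
  shows "integrable lborel (\<lambda>x. indicator V x *\<^sub>R f x)"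
proof (rule integrableI_bounded_set[where A = "cball 0 R" and B = "\<bar>M\<bar>"])
  show "(\<lambda>x. indicator V x *\<^sub>R f x) \<in> borel_measurable lborel"
    using borel_measurable_continuous_on_indicator[OF _ assms(2)] assms(1) by simp
  show "AE x in lborel. x \<in> cball 0 R \<longrightarrow> norm (indicator V x *\<^sub>R f x) \<le> \<bar>M\<bar>"
    using assms(3) by (intro AE_I2) (force simp: indicator_def)
  show "emeasure lborel (cball (0::'a) R) < \<infinity>" by (rule emeasure_lborel_cball_finite)
qed (use assms(4) in \<open>auto simp: indicator_def intro!: AE_I2\<close>)

lemma has_vector_derivative_quotient:
  assumes "(f has_vector_derivative D) (at 0)"
  shows "((\<lambda>h. (f h - f 0) /\<^sub>R h) \<longlongrightarrow> D) (at (0::real))"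
proof -
  have "((\<lambda>y. (1 / norm (y - 0)) *\<^sub>R (f y - (f 0 + (y - 0) *\<^sub>R D))) \<longlongrightarrow> 0) (at 0)"
    using assms unfolding has_vector_derivative_def has_derivative_within by blast
  then have "((\<lambda>y. norm ((1 / norm (y - 0)) *\<^sub>R (f y - (f 0 + (y - 0) *\<^sub>R D)))) \<longlongrightarrow> 0) (at 0)"
    by (rule tendsto_norm_zero)
  then have "((\<lambda>h. norm ((f h - f 0) /\<^sub>R h - D)) \<longlongrightarrow> 0) (at 0)"
  proof (rule Lim_transform_eventually)
    have "norm ((1 / norm (y - 0)) *\<^sub>R (f y - (f 0 + (y - 0) *\<^sub>R D))) = norm ((f y - f 0) /\<^sub>R y - D)" if "y \<noteq> 0" for y :: real
    proof -
      have "(f y - f 0) /\<^sub>R y - D = (1 / y) *\<^sub>R (f y - (f 0 + (y - 0) *\<^sub>R D))"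
        using that by (simp add: scaleR_diff_right scaleR_add_right inverse_eq_divide)
      then show ?thesis by simp
    qed
    then show "\<forall>\<^sub>F y in at 0. norm ((1 / norm (y - 0)) *\<^sub>R (f y - (f 0 + (y - 0) *\<^sub>R D))) = norm ((f y - f 0) /\<^sub>R y - D)"
      by (auto simp: eventually_at_filter)
  qed
  then show ?thesis using Lim_null tendsto_norm_zero_iff by blast
qed

lemma continuous_bounded_on_cball:
  fixes f :: "'a::euclidean_space \<Rightarrow> 'b::real_normed_vector"
  assumes "continuous_on UNIV f"
  obtains B where "B \<ge> 0" "\<And>x. norm x \<le> R \<Longrightarrow> norm (f x) \<le> B"
proof -
  have "compact (f ` cball 0 R)"
    using assms by (intro compact_continuous_image) (auto intro: continuous_on_subset)
  then have "bounded (f ` cball 0 R)" by (rule compact_imp_bounded)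
  then obtain B where "\<forall>y\<in>f ` cball 0 R. norm y \<le> B"
    unfolding bounded_iff ..
  then have "norm (f x) \<le> \<bar>B\<bar>" if "norm x \<le> R" for x using that by force
  then show ?thesis using that[of "\<bar>B\<bar>"] by simp
qed

locale half_graph =
  fixes i :: "'n::finite" and s :: real and \<gamma> :: "real ^ 'n \<Rightarrow> real" and V
    and F :: "real ^ 'n \<Rightarrow> complex" and M R :: real
  assumes s: "s \<in> {1, -1}" and \<gamma>: "C_on 1 UNIV \<gamma>"
    and ind: "\<And>x y. (\<And>j. j \<noteq> i \<Longrightarrow> x $ j = y $ j) \<Longrightarrow> \<gamma> x = \<gamma> y"
    and V: "V = {x. \<gamma> x < s * x $ i}"
    and F: "C_on 1 V F" and bF: "\<And>x. x \<in> V \<Longrightarrow> norm (F x) \<le> M" and bF': "\<And>x j. x \<in> V \<Longrightarrow> norm (partial j F x) \<le> M"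
    and F0: "\<And>x. x \<in> V \<Longrightarrow> norm x > R \<Longrightarrow> F x = 0"
begin

lemma ss: "s * s = 1" using s by auto

lemma cont_\<gamma>: "continuous_on UNIV \<gamma>" and cont_d\<gamma>: "continuous_on UNIV (partial k \<gamma>)"
  using C_on_1_continuous[OF \<gamma>] by auto

lemma open_V: "open V"
  unfolding V using cont_\<gamma> by (intro open_Collect_less continuous_intros) (auto simp: continuous_on_eq_continuous_at)

lemma partial_F0: "x \<in> V \<Longrightarrow> norm x > R \<Longrightarrow> partial j F x = 0"
proof -
  assume x: "x \<in> V" "norm x > R"
  have "open {x::real ^ 'n. norm x > R}" by (intro open_Collect_less continuous_intros)
  then have "open (V \<inter> {x. norm x > R})" using open_V by blast
  then have "partial j F x = partial j (\<lambda>_. 0) x"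
    by (rule partial_cong) (use F0 x in auto)
  then show ?thesis by (simp add: dir_deriv_def)
qed

lemma M_nonneg: "x \<in> V \<Longrightarrow> 0 \<le> M"
  using bF order_trans norm_ge_zero by blast

lemma integrable_weighted:
  assumes "continuous_on UNIV (\<eta> :: _ \<Rightarrow> real)"
  shows "integrable lborel (\<lambda>x. indicator V x *\<^sub>R (\<eta> x *\<^sub>R partial k F x))"
proof -
  obtain B where B: "B \<ge> 0" "\<And>x. norm x \<le> R \<Longrightarrow> norm (\<eta> x) \<le> B"
    using continuous_bounded_on_cball[OF assms] by blast
  show ?thesis
  proof (rule bounded_support_integrable[OF open_V, where M = "\<bar>B\<bar> * M" and R = R])
    show "continuous_on V (\<lambda>x. \<eta> x *\<^sub>R partial k F x)"
      using assms C_on_1_continuous(2)[OF F] by (intro continuous_intros) (auto intro: continuous_on_subset)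
    fix x assume x: "x \<in> V"
    show "norm x > R \<Longrightarrow> \<eta> x *\<^sub>R partial k F x = 0" using partial_F0[OF x] by simp
    then show "norm (\<eta> x *\<^sub>R partial k F x) \<le> \<bar>B\<bar> * M"
    proof (cases "norm x > R")
      case True
      then show ?thesis using partial_F0[OF x] M_nonneg[OF x] by simp
    next
      case False
      then have "\<bar>\<eta> x\<bar> \<le> \<bar>B\<bar>" using B(2)[of x] by simp
      then show ?thesis using bF'[OF x, of k] by (simp add: mult_mono)
    qed
  qed
qed

text \<open>On each line in direction \<open>i\<close> the fundamental theorem of calculus leaves the value on the graph.
  The weight \<open>\<eta>\<close>, constant on these lines, allows the slopes of the graph as factors.\<close>
lemma vertical_integral:
  assumes \<eta>: "continuous_on UNIV \<eta>" and \<eta>i: "\<And>x y. (\<And>j. j \<noteq> i \<Longrightarrow> x $ j = y $ j) \<Longrightarrow> \<eta> x = \<eta> y"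
    and lim: "\<And>y. ((\<lambda>t. F (graph_point i s \<gamma> y + (s * t) *\<^sub>R axis i 1)) \<longlongrightarrow> F' (graph_point i s \<gamma> y)) (at_right 0)"
  shows "(\<integral>x. indicator V x *\<^sub>R (\<eta> x *\<^sub>R partial i F x) \<partial>lborel)
    = (\<integral>y. (- s * \<eta> (graph_point i s \<gamma> y)) *\<^sub>R F' (graph_point i s \<gamma> y) \<partial>(Pi\<^sub>M (UNIV - {i}) (\<lambda>_. lborel)))"
  unfolding lborel_integral_split[OF integrable_weighted[OF \<eta>], of i i]
proof (rule Bochner_Integration.integral_cong[OF refl])
  fix y :: "'n \<Rightarrow> real"
  let ?g = "\<lambda>x. indicator V x *\<^sub>R (\<eta> x *\<^sub>R partial i F x)"
  define p where "p = graph_point i s \<gamma> y"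
  have F1: "Cext V (Suc 0) V F" using F by (simp only: C_on_eq_Cext One_nat_def)
  have pi: "s * p $ i = \<gamma> p"
  proof -
    have "\<gamma> p = \<gamma> (\<chi> l. if l = i then 0 else y l)" by (rule ind) (simp add: p_def graph_point_def)
    then show ?thesis using ss by (simp add: p_def graph_point_def mult.assoc[symmetric])
  qed
  have up: "upd i y (p $ i + s * t) = p + (s * t) *\<^sub>R axis i 1" for t
    by (auto simp: vec_eq_iff axis_def p_def graph_point_def)
  have inV: "p + (s * t) *\<^sub>R axis i 1 \<in> V \<longleftrightarrow> t > 0" for t
  proof -
    have "\<gamma> (p + (s * t) *\<^sub>R axis i 1) = \<gamma> p" by (rule ind) (simp add: axis_def)
    moreover have "s * (p + (s * t) *\<^sub>R axis i 1) $ i = \<gamma> p + t"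
      using pi ss by (simp add: algebra_simps mult.assoc[symmetric])
    ultimately show ?thesis unfolding V by simp
  qed
  have \<eta>p: "\<eta> (p + (s * t) *\<^sub>R axis i 1) = \<eta> p" for t
    by (rule \<eta>i) (simp add: axis_def)
  have FTC: "(\<integral>t. indicator {0<..} t *\<^sub>R (s *\<^sub>R partial i F (p + (s * t) *\<^sub>R axis i 1)) \<partial>lborel) = - F' p"
  proof (rule FTC_halfline[where u = "\<lambda>t. F (p + (s * t) *\<^sub>R axis i 1)" and M = M and T = "R + norm p"])
    fix t :: real assume t: "t > 0"
    have "((\<lambda>t. F (p + t *\<^sub>R axis i 1)) has_vector_derivative partial i F (p + (s * t) *\<^sub>R axis i 1)) (at (s * t))"
      using t inV by (intro partial_along_line[OF F1]) simp
    moreover have "((\<lambda>t. s * t) has_vector_derivative s) (at t)"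
      by (auto intro!: derivative_eq_intros simp: has_real_derivative_iff_has_vector_derivative[symmetric])
    ultimately show "((\<lambda>t. F (p + (s * t) *\<^sub>R axis i 1)) has_vector_derivative s *\<^sub>R partial i F (p + (s * t) *\<^sub>R axis i 1)) (at t)"
      using vector_diff_chain_at[of "\<lambda>t. s * t" s t "\<lambda>t. F (p + t *\<^sub>R axis i 1)"] by (simp add: o_def)
    show "norm (s *\<^sub>R partial i F (p + (s * t) *\<^sub>R axis i 1)) \<le> M"
    proof -
      have "norm (s *\<^sub>R z) = norm z" for z :: complex using s by auto
      then show ?thesis using bF'[OF inV[THEN iffD2, OF t], of i] by (simp only:)
    qed
    assume "t > R + norm p"
    moreover have "norm ((s * t) *\<^sub>R axis i (1::real)) = t" using s t by auto
    then have "t \<le> norm (p + (s * t) *\<^sub>R axis i 1) + norm p"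
      by (metis add.commute add_diff_cancel_left' norm_triangle_ineq4)
    ultimately show "F (p + (s * t) *\<^sub>R axis i 1) = 0" using inV t by (intro F0) auto
  next
    show "continuous_on {0<..} (\<lambda>t. s *\<^sub>R partial i F (p + (s * t) *\<^sub>R axis i 1))"
      using inV by (intro continuous_on_scaleR continuous_on_const continuous_on_compose2[OF C_on_1_continuous(2)[OF F]] continuous_intros) auto
  qed (use lim in \<open>simp add: p_def\<close>)
  have "(\<integral>t. ?g (upd i y t) \<partial>lborel) = (\<integral>t. ?g (upd i y (p $ i + s * t)) \<partial>lborel)"
    using lborel_integral_real_affine[of s "\<lambda>t. ?g (upd i y t)" "p $ i"] s by auto
  also have "\<dots> = (\<integral>t. (s * \<eta> p) *\<^sub>R (indicator {0<..} t *\<^sub>R (s *\<^sub>R partial i F (p + (s * t) *\<^sub>R axis i 1))) \<partial>lborel)"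
  proof (intro Bochner_Integration.integral_cong refl)
    fix t
    have "s * \<eta> p * s = \<eta> p" using ss by (metis mult.assoc mult.commute mult_1)
    then show "?g (upd i y (p $ i + s * t)) = (s * \<eta> p) *\<^sub>R (indicator {0<..} t *\<^sub>R (s *\<^sub>R partial i F (p + (s * t) *\<^sub>R axis i 1)))"
      unfolding up \<eta>p indicator_def inV by simp
  qed
  also have "\<dots> = (s * \<eta> p) *\<^sub>R (- F' p)" by (simp only: integral_scaleR_right FTC)
  finally show "(\<integral>t. ?g (upd i y t) \<partial>lborel) = (- s * \<eta> (graph_point i s \<gamma> y)) *\<^sub>R F' (graph_point i s \<gamma> y)"
    by (simp add: p_def)
qed

text \<open>The flow \<open>S h\<close> moves points parallel to the graph; it preserves \<open>V\<close> and Lebesgue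
  measure. Differentiating \<open>\<integral> F \<circ> S h = \<integral> F\<close> at \<open>h = 0\<close> trades a derivative in a
  direction \<open>k \<noteq> i\<close> for one in the direction \<open>i\<close>.\<close>
lemma horizontal_integral:
  assumes "k \<noteq> i"
  shows "(\<integral>x. indicator V x *\<^sub>R partial k F x \<partial>lborel) = (\<integral>x. indicator V x *\<^sub>R ((- s * partial k \<gamma> x) *\<^sub>R partial i F x) \<partial>lborel)"
proof -
  define S where "S h x = x + h *\<^sub>R axis k 1 + (s * (\<gamma> (x + h *\<^sub>R axis k 1) - \<gamma> x)) *\<^sub>R axis i 1" for h x
  define D where "D x = partial k F x + (s * partial k \<gamma> x) *\<^sub>R partial i F x" for x
  define G where "G x = indicator V x *\<^sub>R F x" for x
  have \<gamma>1: "Cext UNIV (Suc 0) UNIV \<gamma>" using \<gamma> by (simp only: C_on_eq_Cext One_nat_def)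
  have \<gamma>S: "\<gamma> (S h x) = \<gamma> (x + h *\<^sub>R axis k 1)" for h x by (rule ind) (simp add: S_def axis_def)
  have SV: "S h x \<in> V \<longleftrightarrow> x \<in> V" for h x
  proof -
    have "s * S h x $ i = s * x $ i + (\<gamma> (x + h *\<^sub>R axis k 1) - \<gamma> x)"
      using assms ss by (simp add: S_def axis_def algebra_simps mult.assoc[symmetric])
    then show ?thesis unfolding V by (simp add: \<gamma>S)
  qed
  have d\<gamma>_ind: "partial k \<gamma> x = partial k \<gamma> y" if xy: "\<And>j. j \<noteq> i \<Longrightarrow> x $ j = y $ j" for x y
  proof -
    have "\<gamma> (x + t *\<^sub>R axis k 1) = \<gamma> (y + t *\<^sub>R axis k 1)" for t by (rule ind) (simp add: xy)
    then show ?thesis by (simp add: dir_deriv_def)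
  qed
  have S_deriv: "((\<lambda>h. S h x) has_vector_derivative axis k 1 + (s * partial k \<gamma> (S h x)) *\<^sub>R axis i 1) (at h)" for h x
  proof -
    have "((\<lambda>h. \<gamma> (x + h *\<^sub>R axis k 1)) has_real_derivative partial k \<gamma> (x + h *\<^sub>R axis k 1)) (at h)"
      using partial_along_line[OF \<gamma>1] by (simp add: has_real_derivative_iff_has_vector_derivative)
    then have "((\<lambda>h. s * (\<gamma> (x + h *\<^sub>R axis k 1) - \<gamma> x)) has_vector_derivative s * partial k \<gamma> (x + h *\<^sub>R axis k 1)) (at h)"
      unfolding has_real_derivative_iff_has_vector_derivative[symmetric] by (auto intro!: derivative_eq_intros)
    from bounded_linear.has_vector_derivative[OF bounded_linear_scaleR_left this, of "axis i 1"]
    have "((\<lambda>h. (s * (\<gamma> (x + h *\<^sub>R axis k 1) - \<gamma> x)) *\<^sub>R axis i (1::real)) has_vector_derivative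
        (s * partial k \<gamma> (x + h *\<^sub>R axis k 1)) *\<^sub>R axis i 1) (at h)" .
    moreover have "((\<lambda>h. x + h *\<^sub>R axis k 1) has_vector_derivative axis k 1) (at h)"
      by (auto intro!: derivative_eq_intros)
    moreover have "partial k \<gamma> (S h x) = partial k \<gamma> (x + h *\<^sub>R axis k 1)"
      by (rule d\<gamma>_ind) (simp add: S_def axis_def)
    ultimately show ?thesis unfolding S_def
      using has_vector_derivative_add[of "\<lambda>h. x + h *\<^sub>R axis k 1"] by simp
  qed
  have FS: "((\<lambda>h. F (S h x)) has_vector_derivative D (S h x)) (at h)" if "x \<in> V" for x h
  proof -
    have "S h x \<in> V" using SV that by simp
    from Cext_has_derivative[OF F open_V this] S_deriv[unfolded has_vector_derivative_def]
    have "((\<lambda>h. F (S h x)) has_derivative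
       (\<lambda>t. \<Sum>j\<in>UNIV. (t *\<^sub>R (axis k 1 + (s * partial k \<gamma> (S h x)) *\<^sub>R axis i 1)) $ j *\<^sub>R partial j F (S h x))) (at h)"
      using diff_chain_at[of "\<lambda>h. S h x" _ h F] unfolding o_def by blast
    moreover have "(\<Sum>j\<in>UNIV. (t *\<^sub>R (axis k 1 + (s * partial k \<gamma> (S h x)) *\<^sub>R axis i 1)) $ j *\<^sub>R partial j F (S h x))
      = t *\<^sub>R D (S h x)" for t
    proof -
      have "(\<Sum>j\<in>UNIV. (t *\<^sub>R (axis k 1 + (s * partial k \<gamma> (S h x)) *\<^sub>R axis i 1)) $ j *\<^sub>R partial j F (S h x))
        = (\<Sum>j\<in>UNIV. (if j = k then t *\<^sub>R partial k F (S h x) else 0) + (if j = i then t *\<^sub>R (s * partial k \<gamma> (S h x)) *\<^sub>R partial i F (S h x) else 0))"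
        using assms by (intro sum.cong) (auto simp: axis_def)
      then show ?thesis by (simp add: sum.distrib D_def scaleR_add_right)
    qed
    ultimately show ?thesis by (simp add: has_vector_derivative_def)
  qed
  have contF: "continuous_on V F" "continuous_on V (partial j F)" for j using C_on_1_continuous[OF F] by auto
  have intG: "integrable lborel G"
    unfolding G_def using bounded_support_integrable[OF open_V contF(1) bF F0] .
  define \<eta> where "\<eta> h x = s * (\<gamma> x - \<gamma> (x - h *\<^sub>R axis k 1))" for h x
  have \<eta>: "\<eta> h \<in> borel_measurable borel" for h
    unfolding \<eta>_def using cont_\<gamma>
    by (intro borel_measurable_continuous_onI continuous_intros continuous_on_compose2[OF cont_\<gamma>]) auto
  have \<eta>i: "\<eta> h x = \<eta> h y" if "\<And>j. j \<noteq> i \<Longrightarrow> x $ j = y $ j" for h x y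
    using ind[of x y] ind[of "x - h *\<^sub>R axis k 1" "y - h *\<^sub>R axis k 1"] that by (simp add: \<eta>_def)
  have S_eq: "S h x = x + h *\<^sub>R axis k 1 + \<eta> h (x + h *\<^sub>R axis k 1) *\<^sub>R axis i 1" for h x
    by (simp add: S_def \<eta>_def)
  have GS: "integrable lborel (\<lambda>x. G (S h x))" "(\<integral>x. G (S h x) \<partial>lborel) = (\<integral>x. G x \<partial>lborel)" for h
    unfolding S_eq using lborel_integral_shear_translate[OF intG \<eta> \<eta>i] by auto
  have contS: "continuous_on UNIV (\<lambda>p. S (fst p) (snd p))"
    unfolding S_def by (intro continuous_intros continuous_on_compose2[OF cont_\<gamma>]) auto
  obtain R' where R': "\<And>h x. \<bar>h\<bar> \<le> 1 \<Longrightarrow> norm (S h x) \<le> R \<Longrightarrow> norm x \<le> R'"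
  proof -
    have "compact ((\<lambda>p. S (fst p) (snd p)) ` ({-1..1} \<times> cball 0 R))"
      using contS by (intro compact_continuous_image compact_Times) (auto intro: continuous_on_subset)
    then have "bounded ((\<lambda>p. S (fst p) (snd p)) ` ({-1..1} \<times> cball 0 R))" by (rule compact_imp_bounded)
    then obtain R' where "\<forall>y\<in>(\<lambda>p. S (fst p) (snd p)) ` ({-1..1} \<times> cball 0 R). norm y \<le> R'"
      unfolding bounded_iff ..
    then have R': "norm (S h x) \<le> R'" if "\<bar>h\<bar> \<le> 1" "norm x \<le> R" for h x
      using that by (fastforce simp: abs_le_iff)
    have "S (- h) (S h x) = x" for h x
    proof -
      have "\<gamma> (S h x + (- h) *\<^sub>R axis k 1) = \<gamma> x" by (rule ind) (simp add: S_def axis_def)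
      then show ?thesis unfolding S_def[of "- h"] \<gamma>S by (simp add: S_def algebra_simps)
    qed
    then show ?thesis using that[of R'] R'[of "- h" "S h x" for h x] by (metis abs_minus_cancel)
  qed
  obtain B where B: "B \<ge> 0" "\<And>x. norm x \<le> R \<Longrightarrow> norm (partial k \<gamma> x) \<le> B"
    using continuous_bounded_on_cball[OF cont_d\<gamma>] by blast
  define C where "C = \<bar>M\<bar> + B * \<bar>M\<bar>"
  have C0: "C \<ge> 0" using B(1) by (simp add: C_def)
  have D0: "D x = 0" if "x \<in> V" "norm x > R" for x
    using partial_F0[OF that] by (simp add: D_def)
  have C: "norm (D x) \<le> C" if x: "x \<in> V" for x
  proof (cases "norm x > R")
    case True
    then show ?thesis using D0[OF x] C0 by simp
  next
    case False
    then have "\<bar>s * partial k \<gamma> x\<bar> \<le> B" using B(2)[of x] s by (auto simp: abs_mult)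
    then have "norm ((s * partial k \<gamma> x) *\<^sub>R partial i F x) \<le> B * \<bar>M\<bar>"
      using bF'[OF x, of i] B(1) unfolding norm_scaleR by (intro mult_mono) auto
    moreover have "norm (partial k F x) \<le> \<bar>M\<bar>" using bF'[OF x, of k] by simp
    ultimately show ?thesis unfolding D_def C_def by (intro norm_triangle_le add_mono)
  qed
  define h where "h n = 1 / real (Suc n)" for n
  have h: "h n > 0" "h n \<le> 1" for n by (auto simp: h_def)
  have hlim: "h \<longlonglongrightarrow> 0" unfolding h_def using LIMSEQ_inverse_real_of_nat by (simp add: inverse_eq_divide)
  have "(\<lambda>n. \<integral>x. (G (S (h n) x) - G x) /\<^sub>R h n \<partial>lborel) \<longlonglongrightarrow> (\<integral>x. indicator V x *\<^sub>R D x \<partial>lborel)"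
  proof (rule integral_dominated_convergence[where w = "\<lambda>x. indicator (cball 0 (max R R')) x *\<^sub>R C"])
    have "continuous_on V D"
      unfolding D_def using contF cont_d\<gamma> by (intro continuous_intros) (auto intro: continuous_on_subset)
    from borel_measurable_continuous_on_indicator[OF borel_open[OF open_V] this]
    show "(\<lambda>x. indicator V x *\<^sub>R D x) \<in> borel_measurable lborel" by simp
    show "(\<lambda>x. (G (S (h n) x) - G x) /\<^sub>R h n) \<in> borel_measurable lborel" for n
      by (intro borel_measurable_scaleR borel_measurable_diff borel_measurable_const
          borel_measurable_integrable[OF GS(1)] borel_measurable_integrable[OF intG])
    show "integrable lborel (\<lambda>x::real ^ 'n. indicator (cball 0 (max R R')) x *\<^sub>R C)"
      by (rule integrableI_bounded_set[where A = "cball 0 (max R R')" and B = "\<bar>C\<bar>"])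
         (use emeasure_lborel_cball_finite[of "0::real ^ 'n"] in \<open>auto simp: indicator_def\<close>)
    show "AE x in lborel. (\<lambda>n. (G (S (h n) x) - G x) /\<^sub>R h n) \<longlonglongrightarrow> indicator V x *\<^sub>R D x"
    proof (rule AE_I2)
      fix x
      show "(\<lambda>n. (G (S (h n) x) - G x) /\<^sub>R h n) \<longlonglongrightarrow> indicator V x *\<^sub>R D x"
      proof (cases "x \<in> V")
        case True
        have S0: "S 0 x = x" by (simp add: S_def)
        have "((\<lambda>h. (F (S h x) - F x) /\<^sub>R h) \<longlongrightarrow> D x) (at 0)"
          using has_vector_derivative_quotient[OF FS[OF True, of 0]] S0 by simp
        moreover have "filterlim h (at 0) sequentially"
          using hlim h(1) by (auto simp: filterlim_at less_imp_neq[symmetric] intro!: always_eventually)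
        ultimately have "(\<lambda>n. (F (S (h n) x) - F x) /\<^sub>R h n) \<longlonglongrightarrow> D x"
          by (rule filterlim_compose)
        then show ?thesis using True SV by (simp add: G_def)
      qed (simp add: G_def SV)
    qed
    show "AE x in lborel. norm ((G (S (h n) x) - G x) /\<^sub>R h n) \<le> indicator (cball 0 (max R R')) x *\<^sub>R C" for n
    proof (rule AE_I2)
      fix x
      show "norm ((G (S (h n) x) - G x) /\<^sub>R h n) \<le> indicator (cball 0 (max R R')) x *\<^sub>R C"
      proof (cases "x \<in> V \<and> norm x \<le> max R R'")
        case True
        then have x: "x \<in> V" by simp
        have "norm (F (S (h n) x) - F (S 0 x) - h n *\<^sub>R 0) \<le> C * \<bar>h n\<bar>"
          using FS[OF x] C SV x by (intro mean_value_bound) auto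
        then have "norm (G (S (h n) x) - G x) \<le> C * h n"
          using h(1)[of n] x SV by (simp add: G_def S_def)
        then show ?thesis using True h(1)[of n] by (simp add: divide_simps mult.commute)
      next
        case False
        have "G (S (h n) x) = 0 \<and> G x = 0"
        proof (cases "x \<in> V")
          case True
          then have "norm x > R" "norm x > R'" using False by auto
          then have "\<not> norm (S (h n) x) \<le> R" using R'[of "h n" x] h[of n] by auto
          then show ?thesis using F0 SV True \<open>norm x > R\<close> by (simp add: G_def)
        qed (simp add: G_def SV)
        moreover have "0 \<le> indicator (cball 0 (max R R')) x *\<^sub>R C" using C0 by (simp add: indicator_def)
        ultimately show ?thesis by simp
      qed
    qed
  qed
  moreover have "(\<integral>x. (G (S (h n) x) - G x) /\<^sub>R h n \<partial>lborel) = 0" for n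
    using GS[of "h n"] intG by simp
  ultimately have "(\<lambda>n. 0) \<longlonglongrightarrow> (\<integral>x. indicator V x *\<^sub>R D x \<partial>lborel)"
    by (simp only:)
  then have D0': "(\<integral>x. indicator V x *\<^sub>R D x \<partial>lborel) = 0"
    by (simp add: LIMSEQ_const_iff)
  have D_split: "(\<integral>x. indicator V x *\<^sub>R D x \<partial>lborel) = (\<integral>x. indicator V x *\<^sub>R partial k F x \<partial>lborel)
     - (\<integral>x. indicator V x *\<^sub>R ((- s * partial k \<gamma> x) *\<^sub>R partial i F x) \<partial>lborel)"
  proof -
    have 1: "integrable lborel (\<lambda>x. indicator V x *\<^sub>R partial k F x)"
      using integrable_weighted[of "\<lambda>_. 1" k] by simp
    have 2: "integrable lborel (\<lambda>x. indicator V x *\<^sub>R ((- s * partial k \<gamma> x) *\<^sub>R partial i F x))"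
      by (rule integrable_weighted) (intro continuous_intros cont_d\<gamma>)
    show ?thesis unfolding Bochner_Integration.integral_diff[OF 1 2, symmetric]
      by (intro Bochner_Integration.integral_cong) (auto simp: D_def algebra_simps)
  qed
  show ?thesis using trans[OF D_split[symmetric] D0'] unfolding right_minus_eq .
qed

text \<open>The factor of \<open>F'\<close> is the component \<open>k\<close> of the exterior normal times the area element of the
  graph.\<close>
lemma divergence_above_graph:
  assumes lim: "\<And>y. ((\<lambda>t. F (graph_point i s \<gamma> y + (s * t) *\<^sub>R axis i 1)) \<longlongrightarrow> F' (graph_point i s \<gamma> y)) (at_right 0)"
  shows "(\<integral>x. indicator V x *\<^sub>R partial k F x \<partial>lborel)
    = (\<integral>y. (partial k \<gamma> (graph_point i s \<gamma> y) - (if k = i then s else 0)) *\<^sub>R F' (graph_point i s \<gamma> y) \<partial>(Pi\<^sub>M (UNIV - {i}) (\<lambda>_. lborel)))"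
proof (cases "k = i")
  case True
  have "partial i \<gamma> x = 0" for x
  proof -
    have "\<gamma> (x + t *\<^sub>R axis i 1) = \<gamma> x" for t by (rule ind) (simp add: axis_def)
    then show ?thesis by (simp add: dir_deriv_def)
  qed
  then show ?thesis using vertical_integral[of "\<lambda>_. 1", OF _ _ lim] True by simp
next
  case False
  have "partial k \<gamma> x = partial k \<gamma> y" if xy: "\<And>j. j \<noteq> i \<Longrightarrow> x $ j = y $ j" for x y
  proof -
    have "\<gamma> (x + t *\<^sub>R axis k 1) = \<gamma> (y + t *\<^sub>R axis k 1)" for t by (rule ind) (simp add: xy)
    then show ?thesis by (simp add: dir_deriv_def)
  qed
  note d\<gamma>_ind = this
  have "(\<integral>x. indicator V x *\<^sub>R partial k F x \<partial>lborel)
    = (\<integral>y. (- s * (- s * partial k \<gamma> (graph_point i s \<gamma> y))) *\<^sub>R F' (graph_point i s \<gamma> y) \<partial>(Pi\<^sub>M (UNIV - {i}) (\<lambda>_. lborel)))"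
    unfolding horizontal_integral[OF False]
  proof (rule vertical_integral[OF _ _ lim])
    show "continuous_on UNIV (\<lambda>x. - s * partial k \<gamma> x)" by (intro continuous_intros cont_d\<gamma>)
    show "- s * partial k \<gamma> x = - s * partial k \<gamma> y" if "\<And>j. j \<noteq> i \<Longrightarrow> x $ j = y $ j" for x y
      using d\<gamma>_ind[of x y] that by simp
  qed
  then show ?thesis using False ss by (simp add: mult.assoc[symmetric])
qed

end

section \<open>Rules for partial derivatives\<close>

lemma partial_bilinear:
  assumes "bounded_bilinear B" "Cext V (Suc k) U f" "Cext V (Suc k) U g" "x \<in> U"
  shows "partial i (\<lambda>x. B (f x) (g x)) x = B (f x) (partial i g x) + B (partial i f x) (g x)"
  using bounded_bilinear.has_vector_derivative[OF assms(1) Cext_has_partial[OF assms(2,4)] Cext_has_partial[OF assms(3,4)]]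
  by (intro partialI) simp

lemmas partial_mult = partial_bilinear[OF bounded_bilinear_mult]

lemma partial_linear:
  assumes "bounded_linear L" "Cext V (Suc k) U f" "x \<in> U"
  shows "partial i (\<lambda>x. L (f x)) x = L (partial i f x)"
  by (intro partialI bounded_linear.has_vector_derivative[OF assms(1) Cext_has_partial[OF assms(2,3)]])

lemma partial_add:
  assumes "Cext V (Suc k) U f" "Cext V (Suc k) U g" "x \<in> U"
  shows "partial i (\<lambda>x. f x + g x) x = partial i f x + partial i g x"
  by (intro partialI has_vector_derivative_add Cext_has_partial[OF assms(1,3)] Cext_has_partial[OF assms(2,3)])

lemma partial_const [simp]: "partial i (\<lambda>_. c) x = 0"
  by (simp add: dir_deriv_def)

lemma partial_sum:
  assumes "\<And>a. a \<in> A \<Longrightarrow> Cext V (Suc k) U (f a)" "x \<in> U"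
  shows "partial i (\<lambda>x. \<Sum>a\<in>A. f a x) x = (\<Sum>a\<in>A. partial i (f a) x)"
  by (intro partialI has_vector_derivative_sum Cext_has_partial[OF assms(1) assms(2)])

lemma C_on_Un:
  assumes "open A" "open B"
  shows "C_on k A f \<Longrightarrow> C_on k B f \<Longrightarrow> C_on k (A \<union> B) f"
  by (induction k arbitrary: f) (auto intro: continuous_on_open_Un assms)

lemma C_on_subset: "C_on k U f \<Longrightarrow> W \<subseteq> U \<Longrightarrow> C_on k W f"
  unfolding C_on_eq_Cext by (rule Cext_mono)

lemma C_on_cong: "open U \<Longrightarrow> C_on k U f \<Longrightarrow> (\<And>x. x \<in> U \<Longrightarrow> f x = g x) \<Longrightarrow> C_on k U g"
  unfolding C_on_eq_Cext by (rule Cext_cong)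

section \<open>Boundary values\<close>

lemma frontier_at_within_ne_bot:
  assumes "open \<Omega>" "x \<in> frontier \<Omega>" shows "at x within \<Omega> \<noteq> bot"
proof -
  have "x \<notin> \<Omega>" "x \<in> closure \<Omega>" using assms by (auto simp: frontier_def interior_open)
  then have "x islimpt \<Omega>" by (auto simp: closure_def)
  then show ?thesis by (simp add: trivial_limit_within)
qed

lemma boundary_valueI:
  assumes "open \<Omega>" "x \<in> frontier \<Omega>" "(f \<longlongrightarrow> l) (at x within \<Omega>)"
  shows "boundary_value \<Omega> f x = l"
  unfolding boundary_value_def by (rule tendsto_Lim[OF frontier_at_within_ne_bot[OF assms(1,2)] assms(3)])

lemma ext_tendsto:
  assumes "open \<Omega>" "x \<in> frontier \<Omega>" "continuous_on (closure \<Omega>) g" "\<And>x. x \<in> \<Omega> \<Longrightarrow> g x = f x"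
  shows "(f \<longlongrightarrow> g x) (at x within \<Omega>)"
proof -
  have "x \<in> closure \<Omega>" using assms(2) by (simp add: frontier_def)
  then have "(g \<longlongrightarrow> g x) (at x within closure \<Omega>)" using assms(3) by (simp add: continuous_on)
  then have "(g \<longlongrightarrow> g x) (at x within \<Omega>)" using closure_subset by (rule tendsto_within_subset)
  then show ?thesis
    by (rule Lim_transform_eventually) (use assms(4) in \<open>auto simp: eventually_at_filter\<close>)
qed

lemma boundary_value_ext:
  assumes "open \<Omega>" "x \<in> frontier \<Omega>" "continuous_on (closure \<Omega>) g" "\<And>x. x \<in> \<Omega> \<Longrightarrow> g x = f x"
  shows "boundary_value \<Omega> f x = g x"
  by (rule boundary_valueI[OF assms(1,2) ext_tendsto[OF assms]])

lemma boundary_value_tendsto: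
  assumes "open \<Omega>" "x \<in> frontier \<Omega>" "ext_on (closure \<Omega>) \<Omega> f"
  shows "(f \<longlongrightarrow> boundary_value \<Omega> f x) (at x within \<Omega>)"
proof -
  obtain g where g: "continuous_on (closure \<Omega>) g" "\<And>x. x \<in> \<Omega> \<Longrightarrow> g x = f x"
    using assms(3) unfolding ext_on_def by blast
  show ?thesis using ext_tendsto[OF assms(1,2) g] boundary_value_ext[OF assms(1,2) g] by simp
qed

lemma continuous_on_boundary_value:
  assumes "open \<Omega>" "ext_on (closure \<Omega>) \<Omega> f"
  shows "continuous_on (frontier \<Omega>) (boundary_value \<Omega> f)"
proof -
  obtain g where g: "continuous_on (closure \<Omega>) g" "\<And>x. x \<in> \<Omega> \<Longrightarrow> g x = f x"
    using assms(2) unfolding ext_on_def by blast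
  have "continuous_on (frontier \<Omega>) g" using g(1) by (rule continuous_on_subset) (auto simp: frontier_def)
  then show ?thesis
    using boundary_value_ext[OF assms(1) _ g] by (subst continuous_on_cong[OF refl, of _ _ g]) auto
qed

lemma boundary_value_mult:
  assumes "open \<Omega>" "x \<in> frontier \<Omega>" "ext_on (closure \<Omega>) \<Omega> f" "ext_on (closure \<Omega>) \<Omega> g"
  shows "boundary_value \<Omega> (\<lambda>x. f x * g x) x = boundary_value \<Omega> f x * boundary_value \<Omega> g x"
  by (intro boundary_valueI assms tendsto_mult boundary_value_tendsto)

lemma boundary_value_add:
  assumes "open \<Omega>" "x \<in> frontier \<Omega>" "ext_on (closure \<Omega>) \<Omega> f" "ext_on (closure \<Omega>) \<Omega> g"
  shows "boundary_value \<Omega> (\<lambda>x. f x + g x) x = boundary_value \<Omega> f x + boundary_value \<Omega> g x"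
  by (intro boundary_valueI assms tendsto_add boundary_value_tendsto)

lemma boundary_value_sum:
  assumes "open \<Omega>" "x \<in> frontier \<Omega>" "\<And>a. a \<in> A \<Longrightarrow> ext_on (closure \<Omega>) \<Omega> (f a)"
  shows "boundary_value \<Omega> (\<lambda>x. \<Sum>a\<in>A. f a x) x = (\<Sum>a\<in>A. boundary_value \<Omega> (f a) x)"
  by (intro boundary_valueI assms tendsto_sum boundary_value_tendsto)

lemma boundary_value_cnj:
  assumes "open \<Omega>" "x \<in> frontier \<Omega>" "ext_on (closure \<Omega>) \<Omega> f"
  shows "boundary_value \<Omega> (\<lambda>x. cnj (f x)) x = cnj (boundary_value \<Omega> f x)"
  by (intro boundary_valueI assms tendsto_cnj boundary_value_tendsto)

lemma boundary_value_continuous: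
  assumes "open \<Omega>" "x \<in> frontier \<Omega>" "continuous_on UNIV f"
  shows "boundary_value \<Omega> f x = f x"
  using assms(3) by (intro boundary_value_ext assms(1,2)) (auto intro: continuous_on_subset)

lemma boundary_value_cong:
  assumes "open \<Omega>" "x \<in> frontier \<Omega>" "\<And>y. y \<in> \<Omega> \<Longrightarrow> f y = g y"
  shows "boundary_value \<Omega> f x = boundary_value \<Omega> g x"
proof -
  have "(f \<longlongrightarrow> l) (at x within \<Omega>) \<longleftrightarrow> (g \<longlongrightarrow> l) (at x within \<Omega>)" for l
    by (rule tendsto_cong) (use assms(3) in \<open>auto simp: eventually_at_filter\<close>)
  then show ?thesis by (simp add: boundary_value_def Topological_Spaces.Lim_def)
qed

lemma ext_on_bounded:
  fixes f :: "'a::heine_borel \<Rightarrow> 'b::real_normed_vector"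
  assumes "bounded \<Omega>" "ext_on (closure \<Omega>) \<Omega> f"
  obtains B where "B \<ge> 0" "\<And>x. x \<in> \<Omega> \<Longrightarrow> norm (f x) \<le> B"
proof -
  obtain g where g: "continuous_on (closure \<Omega>) g" "\<And>x. x \<in> \<Omega> \<Longrightarrow> g x = f x"
    using assms(2) unfolding ext_on_def by blast
  have "bounded (g ` closure \<Omega>)"
    using assms(1) g(1) by (intro compact_imp_bounded compact_continuous_image) auto
  then obtain B where "\<forall>y\<in>g ` closure \<Omega>. norm y \<le> B" unfolding bounded_iff ..
  then have "norm (f x) \<le> \<bar>B\<bar>" if "x \<in> \<Omega>" for x
    using that g(2) closure_subset[of \<Omega>] by force
  then show ?thesis using that[of "\<bar>B\<bar>"] by simp
qed

lemma Cext_1_bounded: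
  fixes f :: "real ^ 'n::finite \<Rightarrow> 'b::real_normed_vector"
  assumes "bounded \<Omega>" "Cext (closure \<Omega>) 1 \<Omega> f"
  obtains M where "M \<ge> 0" "\<And>x. x \<in> \<Omega> \<Longrightarrow> norm (f x) \<le> M" "\<And>x j. x \<in> \<Omega> \<Longrightarrow> norm (partial j f x) \<le> M"
proof -
  obtain B where B: "B \<ge> 0" "\<And>x. x \<in> \<Omega> \<Longrightarrow> norm (f x) \<le> B"
    by (rule ext_on_bounded[OF assms(1), of f]) (use assms(2) in \<open>auto simp: One_nat_def\<close>)
  have "\<exists>C\<ge>0. \<forall>x\<in>\<Omega>. norm (partial j f x) \<le> C" for j
    by (rule ext_on_bounded[OF assms(1), of "partial j f"]) (use assms(2) in \<open>auto simp: One_nat_def\<close>)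
  then obtain C where C: "\<And>j. C j \<ge> 0" "\<And>j x. x \<in> \<Omega> \<Longrightarrow> norm (partial j f x) \<le> C j" by metis
  have "C j \<le> (\<Sum>j\<in>UNIV. C j)" for j using C(1) by (intro member_le_sum) auto
  then have "norm (partial j f x) \<le> B + (\<Sum>j\<in>UNIV. C j)" if "x \<in> \<Omega>" for j x
    using C(2)[OF that, of j] B(1) by (smt (verit))
  moreover have "(\<Sum>j\<in>UNIV. C j) \<ge> 0" by (intro sum_nonneg C)
  ultimately show ?thesis using that[of "B + (\<Sum>j\<in>UNIV. C j)"] B by force
qed

lemma ext_on_integrable:
  fixes f :: "'a::euclidean_space \<Rightarrow> 'b::{banach, second_countable_topology}"
  assumes "open \<Omega>" "bounded \<Omega>" "ext_on (closure \<Omega>) \<Omega> f"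
  shows "integrable lborel (\<lambda>x. indicator \<Omega> x *\<^sub>R f x)"
proof -
  obtain B where B: "\<And>x. x \<in> \<Omega> \<Longrightarrow> norm (f x) \<le> B" using ext_on_bounded[OF assms(2,3)] by blast
  obtain R where "\<And>x. x \<in> \<Omega> \<Longrightarrow> norm x \<le> R" using assms(2) unfolding bounded_iff by blast
  moreover have "continuous_on \<Omega> f" using ext_on_mono[OF assms(3) order_refl closure_subset] by (simp add: ext_on_self)
  ultimately show ?thesis by (intro bounded_support_integrable[where R = R, OF assms(1) _ B]) force+
qed

section \<open>Surface integrals\<close>

locale smooth_domain =
  fixes \<Omega> :: "(real ^ 'n::finite) set"
  assumes open_\<Omega>: "open \<Omega>" and bounded_\<Omega>: "bounded \<Omega>" and C1_boundary: "C_boundary 1 \<Omega>"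
begin

lemma atlas_patch:
  assumes "(i, s, \<gamma>, \<phi>) \<in> set (the_atlas \<Omega>)"
  obtains U where "graph_patch 1 \<Omega> i s \<gamma> U" "\<phi> \<in> test_functions U"
  using boundary_atlas_the_atlas[OF bounded_\<Omega> C1_boundary] assms unfolding boundary_atlas_def by blast

lemma atlas_sum: "x \<in> frontier \<Omega> \<Longrightarrow> (\<Sum>(i, s, \<gamma>, \<phi>)\<leftarrow>the_atlas \<Omega>. \<phi> x) = 1"
  using boundary_atlas_the_atlas[OF bounded_\<Omega> C1_boundary] unfolding boundary_atlas_def by blast

lemma graph_point_eq:
  assumes "graph_patch 1 \<Omega> i s \<gamma> U"
  shows "\<gamma> (graph_point i s \<gamma> y) = s * graph_point i s \<gamma> y $ i"
proof -
  have "\<gamma> (graph_point i s \<gamma> y) = \<gamma> (\<chi> l. if l = i then 0 else y l)"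
    using assms unfolding graph_patch_def by (auto simp: graph_point_def)
  moreover have "s * s = 1" using assms unfolding graph_patch_def by auto
  ultimately show ?thesis by (simp add: graph_point_def mult.assoc[symmetric])
qed

lemma graph_point_frontier:
  assumes "graph_patch 1 \<Omega> i s \<gamma> U" "\<phi> \<in> test_functions U" "\<phi> (graph_point i s \<gamma> y) \<noteq> 0"
  shows "graph_point i s \<gamma> y \<in> frontier \<Omega> \<inter> U"
proof -
  have "graph_point i s \<gamma> y \<in> U"
    using assms(2,3) closure_subset[of "{x. \<phi> x \<noteq> 0}"] unfolding test_functions_def by blast
  then show ?thesis using graph_frontier_iff[OF assms(1) open_\<Omega>] graph_point_eq[OF assms(1)] by auto
qed

lemma patch_integrand_cong:
  assumes "p \<in> set (the_atlas \<Omega>)" "\<And>x. x \<in> frontier \<Omega> \<Longrightarrow> f x = g x"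
  shows "patch_integrand p f = patch_integrand p g"
proof -
  obtain i s \<gamma> \<phi> where p: "p = (i, s, \<gamma>, \<phi>)" by (cases p)
  obtain U where U: "graph_patch 1 \<Omega> i s \<gamma> U" "\<phi> \<in> test_functions U" using atlas_patch assms(1) p by blast
  have "\<phi> (graph_point i s \<gamma> y) = 0 \<or> f (graph_point i s \<gamma> y) = g (graph_point i s \<gamma> y)" for y
    using graph_point_frontier[OF U, of y] assms(2) by blast
  then show ?thesis unfolding patch_integrand_def p by (auto simp: Let_def fun_eq_iff)
qed

lemma surface_integral_cong:
  assumes "\<And>x. x \<in> frontier \<Omega> \<Longrightarrow> f x = g x"
  shows "surface_integral \<Omega> f = surface_integral \<Omega> g"
  unfolding surface_integral_def using patch_integrand_cong[OF _ assms] by (simp cong: map_cong)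

lemma graph_point_measurable:
  assumes "continuous_on UNIV \<gamma>"
  shows "graph_point i s \<gamma> \<in> borel_measurable (Pi\<^sub>M (UNIV - {i}) (\<lambda>_::'n. lborel :: real measure))"
proof -
  let ?M = "Pi\<^sub>M (UNIV - {i}) (\<lambda>_::'n. lborel :: real measure)"
  have comp: "(\<lambda>y. y j) \<in> borel_measurable ?M" if "j \<noteq> i" for j
    using measurable_component_singleton[of j "UNIV - {i}" "\<lambda>_. lborel :: real measure"] that by simp
  have vec: "f \<in> borel_measurable ?M" if f: "\<And>j. (\<lambda>y. f y $ j) \<in> borel_measurable ?M" for f :: "_ \<Rightarrow> real ^ 'n"
    unfolding borel_measurable_euclidean_space[of f]
  proof
    fix b :: "real ^ 'n" assume "b \<in> Basis"
    then obtain j where b: "b = axis j 1" by (auto simp: Basis_vec_def)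
    show "(\<lambda>x. f x \<bullet> b) \<in> borel_measurable ?M" using f[of j] by (simp add: b inner_axis)
  qed
  have "(\<lambda>y. \<chi> l. if l = i then 0 else y l) \<in> borel_measurable ?M"
  proof (rule vec)
    show "(\<lambda>y. (\<chi> l. if l = i then 0 else y l) $ j) \<in> borel_measurable ?M" for j
      using comp[of j] by (cases "j = i") auto
  qed
  from measurable_compose[OF this borel_measurable_continuous_onI[OF assms]]
  have g: "(\<lambda>y. \<gamma> (\<chi> l. if l = i then 0 else y l)) \<in> borel_measurable ?M" .
  show ?thesis
  proof (rule vec)
    show "(\<lambda>y. graph_point i s \<gamma> y $ j) \<in> borel_measurable ?M" for j
      using comp[of j] g by (cases "j = i") (auto simp: graph_point_def)
  qed
qed

text \<open>The integrand sees \<open>f\<close> at boundary points only, so \<open>f\<close> may be replaced by a continuous extension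
  to the whole space.\<close>
lemma surface_integrableI:
  assumes "continuous_on (frontier \<Omega>) f"
  shows "surface_integrable \<Omega> f"
  unfolding surface_integrable_def
proof
  fix p assume pP: "p \<in> set (the_atlas \<Omega>)"
  obtain i s \<gamma> \<phi> where p: "p = (i, s, \<gamma>, \<phi>)" by (cases p)
  obtain U where U: "graph_patch 1 \<Omega> i s \<gamma> U" "\<phi> \<in> test_functions U" using atlas_patch pP p by blast
  have \<gamma>: "C_on 1 UNIV \<gamma>" using U(1) by (simp add: graph_patch_def)
  have c\<phi>: "continuous_on UNIV \<phi>" using U(2) unfolding test_functions_def by (auto dest: spec[of _ 0])
  obtain g where g: "continuous_on UNIV g" "\<And>x. x \<in> frontier \<Omega> \<Longrightarrow> g x = f x"
    using Tietze_unbounded[of "frontier \<Omega>" f UNIV] assms by auto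
  define H where "H x = (\<phi> x * sqrt (1 + (\<Sum>j\<in>UNIV. (partial j \<gamma> x)\<^sup>2))) *\<^sub>R g x" for x
  have cH: "continuous_on UNIV H" unfolding H_def
    by (intro continuous_intros c\<phi> g(1) C_on_1_continuous(2)[OF \<gamma>])
  have eq: "patch_integrand p f = (\<lambda>y. H (graph_point i s \<gamma> y))"
    using patch_integrand_cong[OF pP, of f g] g(2) by (simp add: patch_integrand_def p H_def Let_def fun_eq_iff)
  have "compact (closure {x. \<phi> x \<noteq> 0})" using U(2) by (simp add: test_functions_def)
  then have "bounded {x. \<phi> x \<noteq> 0}" using compact_imp_bounded bounded_subset closure_subset by metis
  then obtain R where R: "\<And>x. \<phi> x \<noteq> 0 \<Longrightarrow> norm x \<le> R" unfolding bounded_iff by blast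
  obtain B where B: "B \<ge> 0" "\<And>x. norm x \<le> R \<Longrightarrow> norm (H x) \<le> B"
    using continuous_bounded_on_cball[OF cH] by blast
  let ?M = "Pi\<^sub>M (UNIV - {i}) (\<lambda>_::'n. lborel :: real measure)"
  interpret product_sigma_finite "\<lambda>_::'n. lborel :: real measure" ..
  have "integrable ?M (\<lambda>y. H (graph_point i s \<gamma> y))"
  proof (rule integrableI_bounded_set[where A = "Pi\<^sub>E (UNIV - {i}) (\<lambda>_. {-R..R})" and B = B])
    show "Pi\<^sub>E (UNIV - {i}) (\<lambda>_. {-R..R}) \<in> sets ?M" by (intro sets_PiM_I_finite) auto
    have "continuous_on UNIV \<gamma>" using C_on_1_continuous(1)[OF \<gamma>] .
    from measurable_compose[OF graph_point_measurable[OF this] borel_measurable_continuous_onI[OF cH]]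
    show "(\<lambda>y. H (graph_point i s \<gamma> y)) \<in> borel_measurable ?M" .
    have "emeasure ?M (Pi\<^sub>E (UNIV - {i}) (\<lambda>_. {-R..R})) = (\<Prod>j\<in>UNIV - {i}. emeasure lborel {-R..R})"
      by (intro emeasure_PiM) auto
    also have "\<dots> < \<infinity>" by (auto simp: emeasure_lborel_Icc_eq ennreal_prod_eq_top less_top power_less_top_ennreal)
    finally show "emeasure ?M (Pi\<^sub>E (UNIV - {i}) (\<lambda>_. {-R..R})) < \<infinity>" .
    have "norm (H x) \<le> B" for x
      using B R[of x] by (cases "\<phi> x = 0") (auto simp: H_def)
    then show "AE y in ?M. y \<in> Pi\<^sub>E (UNIV - {i}) (\<lambda>_. {-R..R}) \<longrightarrow> norm (H (graph_point i s \<gamma> y)) \<le> B" by simp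
    show "AE y in ?M. y \<notin> Pi\<^sub>E (UNIV - {i}) (\<lambda>_. {-R..R}) \<longrightarrow> H (graph_point i s \<gamma> y) = 0"
    proof (rule AE_I2, rule impI)
      fix y assume y: "y \<in> space ?M" "y \<notin> Pi\<^sub>E (UNIV - {i}) (\<lambda>_. {-R..R})"
      then obtain j where j: "j \<noteq> i" "y j \<notin> {-R..R}" by (auto simp: space_PiM PiE_iff)
      have "graph_point i s \<gamma> y $ j = y j" using j(1) by (simp add: graph_point_def)
      then have "\<not> norm (graph_point i s \<gamma> y) \<le> R"
        using j(2) component_le_norm_cart[of "graph_point i s \<gamma> y" j] by auto
      then show "H (graph_point i s \<gamma> y) = 0" using R by (auto simp: H_def)
    qed
  qed
  then show "integrable (patch_measure p) (patch_integrand p f)"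
    unfolding eq by (simp add: patch_measure_def p)
qed

lemma surface_integral_add:
  assumes "surface_integrable \<Omega> f" "surface_integrable \<Omega> g"
  shows "surface_integral \<Omega> (\<lambda>x. f x + g x) = surface_integral \<Omega> f + surface_integral \<Omega> g"
proof -
  have "patch_integrand p (\<lambda>x. f x + g x) = (\<lambda>y. patch_integrand p f y + patch_integrand p g y)" for p
    by (cases p) (simp add: patch_integrand_def Let_def scaleR_add_right fun_eq_iff)
  then show ?thesis using assms
    unfolding surface_integral_def surface_integrable_def by (simp add: sum_list_addf[symmetric] cong: map_cong)
qed

lemma surface_integral_mult:
  "surface_integral \<Omega> (\<lambda>x. c * f x) = c * surface_integral \<Omega> f"
proof -
  have "patch_integrand p (\<lambda>x. c * f x) = (\<lambda>y. c * patch_integrand p f y)" for p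
    by (cases p) (simp add: patch_integrand_def Let_def fun_eq_iff)
  then show ?thesis
    unfolding surface_integral_def by (simp add: sum_list_const_mult)
qed

lemma surface_integral_sum:
  assumes "\<And>a. a \<in> A \<Longrightarrow> continuous_on (frontier \<Omega>) (f a)"
  shows "surface_integral \<Omega> (\<lambda>x. \<Sum>a\<in>A. f a x) = (\<Sum>a\<in>A. surface_integral \<Omega> (f a))"
  using assms
proof (induction A rule: infinite_finite_induct)
  case (insert a A)
  then show ?case
    by (simp add: surface_integral_add surface_integrableI continuous_on_sum)
qed (use surface_integral_mult[of 0 "\<lambda>_. 0"] in auto)

section \<open>The divergence theorem\<close>

lemma frontier_null: "frontier \<Omega> \<in> null_sets lborel"
proof -
  have "frontier \<Omega> \<subseteq> (\<Union>(i, s, \<gamma>, \<phi>)\<in>set (the_atlas \<Omega>). {x. \<gamma> x = s * x $ i})"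
  proof
    fix x assume x: "x \<in> frontier \<Omega>"
    have "\<exists>p\<in>set (the_atlas \<Omega>). (case p of (i, s, \<gamma>, \<phi>) \<Rightarrow> \<phi> x) \<noteq> 0"
    proof (rule ccontr)
      assume "\<not> ?thesis"
      moreover have "(\<forall>p\<in>set P. g p = 0) \<Longrightarrow> (\<Sum>p\<leftarrow>P. g p) = 0" for P :: "'n patch list" and g :: "'n patch \<Rightarrow> real"
        by (induction P) auto
      ultimately have "(\<Sum>p\<leftarrow>the_atlas \<Omega>. case p of (i, s, \<gamma>, \<phi>) \<Rightarrow> \<phi> x) = 0"
        by blast
      then show False using atlas_sum[OF x] by simp
    qed
    then obtain i s \<gamma> \<phi> where p: "(i, s, \<gamma>, \<phi>) \<in> set (the_atlas \<Omega>)" "\<phi> x \<noteq> 0" by auto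
    then obtain U where U: "graph_patch 1 \<Omega> i s \<gamma> U" "\<phi> \<in> test_functions U" using atlas_patch by blast
    have "x \<in> U" using U(2) p(2) closure_subset[of "{x. \<phi> x \<noteq> 0}"] unfolding test_functions_def by blast
    then have "\<gamma> x = s * x $ i" using graph_frontier_iff[OF U(1) open_\<Omega>] x by blast
    then show "x \<in> (\<Union>(i, s, \<gamma>, \<phi>)\<in>set (the_atlas \<Omega>). {x. \<gamma> x = s * x $ i})" using p(1) by force
  qed
  moreover have "(\<Union>(i, s, \<gamma>, \<phi>)\<in>set (the_atlas \<Omega>). {x. \<gamma> x = s * x $ i}) \<in> null_sets lborel"
  proof (rule null_sets_UN')
    fix p assume pP: "p \<in> set (the_atlas \<Omega>)"
    obtain i s \<gamma> \<phi> where p: "p = (i, s, \<gamma>, \<phi>)" by (cases p)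
    obtain U where U: "graph_patch 1 \<Omega> i s \<gamma> U" using atlas_patch pP p by blast
    have "{x. \<gamma> x = s * x $ i} \<in> null_sets lborel"
      using U C_on_1_continuous(1)[of UNIV \<gamma>] unfolding graph_patch_def by (intro graph_null_set) auto
    then show "(case p of (i, s, \<gamma>, \<phi>) \<Rightarrow> {x. \<gamma> x = s * x $ i}) \<in> null_sets lborel" by (simp add: p)
  qed (simp add: countable_finite)
  ultimately show ?thesis by (meson borel_closed frontier_closed null_sets_subset sets_lborel[THEN equalityD2, THEN subsetD])
qed

lemma test_function_C_on: "\<phi> \<in> test_functions U \<Longrightarrow> C_on k UNIV \<phi>"
  by (simp add: test_functions_def)

text \<open>Since the support of \<open>\<phi>\<close> lies in the patch, \<open>\<phi> f\<close> continued by 0 is continuously differentiable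
  in the whole region above the graph.\<close>
lemma patch_divergence:
  assumes pP: "(i, s, \<gamma>, \<phi>) \<in> set (the_atlas \<Omega>)" and f: "Cext (closure \<Omega>) 1 \<Omega> f"
  shows "(\<integral>x. indicator \<Omega> x *\<^sub>R partial k (\<lambda>x. \<phi> x *\<^sub>R f x) x \<partial>lborel)
    = (\<integral>y. patch_integrand (i, s, \<gamma>, \<phi>) (\<lambda>x. boundary_value \<Omega> f x * of_real (outer_normal \<Omega> x $ k)) y
        \<partial>patch_measure (i, s, \<gamma>, \<phi>))"
proof -
  obtain U where U: "graph_patch 1 \<Omega> i s \<gamma> U" "\<phi> \<in> test_functions U" using atlas_patch pP by blast
  note g = U(1)[unfolded graph_patch_def]
  have \<gamma>: "C_on 1 UNIV \<gamma>" using g by blast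
  have s: "s * s = 1" using g by auto
  define K where "K = closure {x. \<phi> x \<noteq> 0}"
  have K: "closed K" "K \<subseteq> U" and \<phi>0: "\<And>x. x \<notin> K \<Longrightarrow> \<phi> x = 0"
    using U(2) closure_subset[of "{x. \<phi> x \<noteq> 0}"] unfolding test_functions_def K_def by auto
  define V where "V = {x. \<gamma> x < s * x $ i}"
  have oV: "open V" unfolding V_def using C_on_1_continuous(1)[OF \<gamma>]
    by (intro open_Collect_less continuous_intros) (auto simp: continuous_on_eq_continuous_at)
  have VU: "V \<inter> U = \<Omega> \<inter> U" using g unfolding V_def by blast
  define F where "F x = (if x \<in> \<Omega> then \<phi> x *\<^sub>R f x else 0)" for x
  have \<phi>f: "Cext (closure \<Omega>) 1 \<Omega> (\<lambda>x. \<phi> x *\<^sub>R f x)"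
    by (intro Cext_scaleR open_\<Omega> f C_on_imp_Cext test_function_C_on[OF U(2)])
  obtain M where M: "M \<ge> 0" "\<And>x. x \<in> \<Omega> \<Longrightarrow> norm (\<phi> x *\<^sub>R f x) \<le> M"
      "\<And>x j. x \<in> \<Omega> \<Longrightarrow> norm (partial j (\<lambda>x. \<phi> x *\<^sub>R f x) x) \<le> M"
    using Cext_1_bounded[OF bounded_\<Omega> \<phi>f] by blast
  obtain R where R: "\<And>x. x \<in> \<Omega> \<Longrightarrow> norm x \<le> R" using bounded_\<Omega> unfolding bounded_iff by blast
  have split: "V = (V \<inter> U) \<union> (V - K)" using K by blast
  have oVU: "open (V \<inter> U)" and oVK: "open (- K)" using oV g K by auto
  have FVU: "F x = \<phi> x *\<^sub>R f x" if "x \<in> V \<inter> U" for x using that VU by (auto simp: F_def)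
  have FK: "F x = 0" if "x \<in> - K" for x using that \<phi>0 by (auto simp: F_def)
  have pF1: "partial j F x = partial j (\<lambda>x. \<phi> x *\<^sub>R f x) x" if "x \<in> V \<inter> U" for x j
    by (rule partial_cong[OF oVU FVU that])
  have pF0: "partial j F x = 0" if "x \<in> - K" for x j
  proof -
    have "partial j F x = partial j (\<lambda>_. 0) x" by (rule partial_cong[OF oVK FK that])
    then show ?thesis by simp
  qed
  have pf0: "partial j (\<lambda>x. \<phi> x *\<^sub>R f x) x = 0" if "x \<in> - K" for x j
  proof -
    have "partial j (\<lambda>x. \<phi> x *\<^sub>R f x) x = partial j (\<lambda>_. 0) x" by (rule partial_cong[OF oVK _ that]) (simp add: \<phi>0)
    then show ?thesis by simp
  qed
  have "C_on 1 (V \<inter> U) F"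
  proof (rule C_on_cong[OF oVU C_on_subset[OF Cext_imp_C_on[OF \<phi>f closure_subset]]])
    show "\<phi> x *\<^sub>R f x = F x" if "x \<in> V \<inter> U" for x using FVU[OF that] by simp
  qed (use VU in blast)
  moreover have "C_on 1 (V - K) F"
  proof (rule C_on_cong[of _ _ "\<lambda>_. 0"])
    show "open (V - K)" using oV K by blast
    then show "C_on 1 (V - K) (\<lambda>_. 0 :: complex)" unfolding C_on_eq_Cext by (rule Cext_const)
  qed (simp add: FK)
  ultimately have "C_on 1 ((V \<inter> U) \<union> (V - K)) F" using oVU oV K by (intro C_on_Un) auto
  then have CF: "C_on 1 V F" using split by simp
  define F' where "F' x = \<phi> x *\<^sub>R boundary_value \<Omega> f x" for x
  interpret hg: half_graph i s \<gamma> V F M R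
  proof
    show "norm (F x) \<le> M" for x using M by (simp add: F_def)
    show "norm (partial j F x) \<le> M" if "x \<in> V" for x j
    proof (cases "x \<in> U")
      case True
      then have "x \<in> V \<inter> U" using that by blast
      then show ?thesis using M(3)[of x j] VU by (subst pF1) auto
    next
      case False
      then have "x \<in> - K" using K by blast
      then show ?thesis using pF0[of x j] M(1) by simp
    qed
    show "F x = 0" if "norm x > R" for x using R[of x] that by (force simp: F_def)
  qed (use g CF V_def in auto)
  have lim: "((\<lambda>t. F (graph_point i s \<gamma> y + (s * t) *\<^sub>R axis i 1)) \<longlongrightarrow> F' (graph_point i s \<gamma> y)) (at_right 0)" for y
  proof -
    let ?p = "graph_point i s \<gamma> y"
    let ?c = "\<lambda>t. ?p + (s * t) *\<^sub>R axis i (1::real)"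
    have c: "(?c \<longlongrightarrow> ?p) (at_right 0)" by (auto intro!: tendsto_eq_intros)
    show ?thesis
    proof (cases "?p \<in> U")
      case True
      then have fr: "?p \<in> frontier \<Omega>"
        using graph_frontier_iff[OF U(1) open_\<Omega>] graph_point_eq[OF U(1)] by blast
      have "\<forall>\<^sub>F t in at_right 0. ?c t \<in> U" using c g True topological_tendstoD by blast
      moreover have "\<forall>\<^sub>F t in at_right (0::real). t > 0" by (simp add: eventually_at_right_less)
      ultimately have ev: "\<forall>\<^sub>F t in at_right 0. ?c t \<in> \<Omega> \<and> ?c t \<in> U"
      proof eventually_elim
        case (elim t)
        have "\<gamma> (?c t) = \<gamma> ?p" using g by (auto simp: axis_def)
        also have "\<dots> < s * ?c t $ i"
          using graph_point_eq[OF U(1), of y] s elim(2) by (simp add: algebra_simps mult.assoc[symmetric])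
        finally show ?case using g elim(1) by blast
      qed
      have "filterlim ?c (at ?p within \<Omega>) (at_right 0)"
        unfolding filterlim_at using c ev
        by (auto elim!: eventually_mono) (use fr open_\<Omega> in \<open>auto simp: frontier_def interior_open\<close>)
      moreover have "((\<lambda>x. \<phi> x *\<^sub>R f x) \<longlongrightarrow> F' ?p) (at ?p within \<Omega>)"
      proof -
        have "continuous_on UNIV \<phi>" using test_function_C_on[OF U(2), of 0] by simp
        then have "(\<phi> \<longlongrightarrow> \<phi> ?p) (at ?p within \<Omega>)"
          by (metis UNIV_I continuous_on subset_UNIV tendsto_within_subset)
        then show ?thesis unfolding F'_def
          using boundary_value_tendsto[OF open_\<Omega> fr Cext_ext_on[OF f]] by (rule tendsto_scaleR)
      qed
      ultimately have "((\<lambda>t. \<phi> (?c t) *\<^sub>R f (?c t)) \<longlongrightarrow> F' ?p) (at_right 0)"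
        by (rule filterlim_compose[rotated])
      then show ?thesis
        by (rule Lim_transform_eventually) (use ev in \<open>auto simp: F_def elim!: eventually_mono\<close>)
    next
      case False
      then have "?p \<in> - K" using K by blast
      then have "\<forall>\<^sub>F t in at_right 0. ?c t \<in> - K" using c oVK topological_tendstoD by blast
      then have "\<forall>\<^sub>F t in at_right 0. F (?c t) = F' ?p"
      proof eventually_elim
        case (elim t)
        then show ?case using FK[of "?c t"] \<phi>0[of ?p] \<open>?p \<in> - K\<close> by (simp add: F'_def)
      qed
      then show ?thesis by (rule tendsto_eventually)
    qed
  qed
  have "(\<integral>x. indicator \<Omega> x *\<^sub>R partial k (\<lambda>x. \<phi> x *\<^sub>R f x) x \<partial>lborel) = (\<integral>x. indicator V x *\<^sub>R partial k F x \<partial>lborel)"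
  proof (rule Bochner_Integration.integral_cong[OF refl])
    fix x
    show "indicator \<Omega> x *\<^sub>R partial k (\<lambda>x. \<phi> x *\<^sub>R f x) x = indicator V x *\<^sub>R partial k F x"
    proof (cases "x \<in> K")
      case True
      then have "x \<in> \<Omega> \<longleftrightarrow> x \<in> V" using VU K by blast
      moreover have "x \<in> V \<Longrightarrow> partial k F x = partial k (\<lambda>x. \<phi> x *\<^sub>R f x) x"
        using pF1[of x k] True K by blast
      ultimately show ?thesis by (auto simp: indicator_def)
    next
      case False
      then show ?thesis using pF0[of x k] pf0[of x k] by simp
    qed
  qed
  also have "\<dots> = (\<integral>y. (partial k \<gamma> (graph_point i s \<gamma> y) - (if k = i then s else 0)) *\<^sub>R F' (graph_point i s \<gamma> y) \<partial>(Pi\<^sub>M (UNIV - {i}) (\<lambda>_. lborel)))"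
    by (rule hg.divergence_above_graph[OF lim])
  also have "\<dots> = (\<integral>y. patch_integrand (i, s, \<gamma>, \<phi>) (\<lambda>x. boundary_value \<Omega> f x * of_real (outer_normal \<Omega> x $ k)) y
        \<partial>patch_measure (i, s, \<gamma>, \<phi>))"
    unfolding patch_measure_def prod.case
  proof (rule Bochner_Integration.integral_cong[OF refl])
    fix y
    let ?p = "graph_point i s \<gamma> y"
    show "(partial k \<gamma> ?p - (if k = i then s else 0)) *\<^sub>R F' ?p
      = patch_integrand (i, s, \<gamma>, \<phi>) (\<lambda>x. boundary_value \<Omega> f x * of_real (outer_normal \<Omega> x $ k)) y"
    proof (cases "\<phi> ?p = 0")
      case False
      then have fr: "?p \<in> frontier \<Omega>" "?p \<in> U" using graph_point_frontier[OF U] by auto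
      define q where "q = sqrt (1 + (\<Sum>j\<in>UNIV. (partial j \<gamma> ?p)\<^sup>2))"
      have q: "q > 0" unfolding q_def by (intro real_sqrt_gt_zero add_pos_nonneg sum_nonneg) auto
      have "q * outer_normal \<Omega> ?p $ k = partial k \<gamma> ?p - (if k = i then s else 0)"
        using q unfolding outer_normal_graph[OF U(1) open_\<Omega> fr] by (simp add: graph_normal_def q_def[symmetric])
      then have "partial k \<gamma> ?p - (if k = i then s else 0) = q * outer_normal \<Omega> ?p $ k" by simp
      then show ?thesis
        by (simp add: patch_integrand_def Let_def F'_def q_def[symmetric] scaleR_conv_of_real mult_ac)
    qed (simp add: patch_integrand_def Let_def F'_def)
  qed
  finally show ?thesis .
qed

lemma vanishing_line_bound:
  assumes g: "continuous_on UNIV g" "\<And>x. x \<notin> \<Omega> \<Longrightarrow> g x = 0" and C: "C_on 1 \<Omega> g"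
    and M: "M \<ge> 0" "\<And>x. x \<in> \<Omega> \<Longrightarrow> norm (partial k g x) \<le> M"
  shows "norm (g (x + h *\<^sub>R axis k 1) - g x) \<le> 2 * M * \<bar>h\<bar>"
proof -
  let ?e = "axis k (1::real)"
  have C1: "Cext \<Omega> (Suc 0) \<Omega> g" using C by (simp only: C_on_eq_Cext One_nat_def)
  \<comment> \<open>Towards a segment that leaves \<open>\<Omega>\<close>, follow it up to its first exit point, where \<open>g = 0\<close>.\<close>
  have exit: "norm (g x) \<le> M * \<bar>h\<bar>" if r1: "r \<in> closed_segment 0 h" and r2: "x + r *\<^sub>R ?e \<notin> \<Omega>" for x h r
  proof (cases "x \<in> \<Omega>")
    case False
    then show ?thesis using g(2) M(1) by simp
  next
    case True
    define Z where "Z = {t \<in> {0..1}. x + (t * h) *\<^sub>R ?e \<notin> \<Omega>}"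
    have "closed Z"
    proof -
      have "closed ((\<lambda>t. x + (t * h) *\<^sub>R ?e) -` (- \<Omega>))"
        using open_\<Omega> by (intro closed_vimage continuous_intros) auto
      moreover have "Z = {0..1} \<inter> (\<lambda>t. x + (t * h) *\<^sub>R ?e) -` (- \<Omega>)" by (auto simp: Z_def)
      ultimately show ?thesis by (simp add: closed_Int)
    qed
    moreover have "Z \<noteq> {}"
    proof -
      obtain t where "0 \<le> t" "t \<le> 1" "r = t * h" using r1 by (auto simp: in_segment)
      then have "t \<in> Z" using r2 by (simp add: Z_def)
      then show ?thesis by blast
    qed
    moreover have bZ: "bdd_below Z" by (auto simp: Z_def bdd_below_def)
    ultimately have IZ: "Inf Z \<in> Z" by (simp add: closed_contains_Inf)
    define p where "p = Inf Z"
    have p: "0 \<le> p" "p \<le> 1" "x + (p * h) *\<^sub>R ?e \<notin> \<Omega>" using IZ by (auto simp: p_def Z_def)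
    have before: "x + (t * h) *\<^sub>R ?e \<in> \<Omega>" if "0 \<le> t" "t < p" for t
    proof (rule ccontr)
      assume "x + (t * h) *\<^sub>R ?e \<notin> \<Omega>"
      then have "t \<in> Z" using that p by (simp add: Z_def)
      then show False using cInf_lower[OF _ bZ, of t] that by (simp add: p_def)
    qed
    have p0: "p > 0" using True p by (cases "p = 0") auto
    have "norm (g (x + (p * h) *\<^sub>R ?e) - g (x + (0 * h) *\<^sub>R ?e)) \<le> M * \<bar>h\<bar> * p - M * \<bar>h\<bar> * 0"
    proof (rule differentiable_bound_general[OF p0, where f = "\<lambda>t. g (x + (t * h) *\<^sub>R ?e)" and \<phi> = "\<lambda>t. M * \<bar>h\<bar> * t"])
      show "continuous_on {0..p} (\<lambda>t. g (x + (t * h) *\<^sub>R ?e))"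
        by (intro continuous_on_compose2[OF g(1)] continuous_intros) auto
      fix t assume t: "0 < t" "t < p"
      have "((\<lambda>t. g (x + t *\<^sub>R ?e)) has_vector_derivative partial k g (x + (t * h) *\<^sub>R ?e)) (at (t * h))"
        using before[of t] t by (intro partial_along_line[OF C1]) simp
      moreover have "((\<lambda>t. t * h) has_vector_derivative h) (at t)"
        by (auto intro!: derivative_eq_intros simp: has_real_derivative_iff_has_vector_derivative[symmetric])
      ultimately show "((\<lambda>t. g (x + (t * h) *\<^sub>R ?e)) has_vector_derivative h *\<^sub>R partial k g (x + (t * h) *\<^sub>R ?e)) (at t)"
        using vector_diff_chain_at[of "\<lambda>t. t * h" h t "\<lambda>t. g (x + t *\<^sub>R ?e)"] by (simp add: o_def)
      show "((\<lambda>t. M * \<bar>h\<bar> * t) has_vector_derivative M * \<bar>h\<bar>) (at t)"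
        by (auto intro!: derivative_eq_intros simp: has_real_derivative_iff_has_vector_derivative[symmetric])
      show "norm (h *\<^sub>R partial k g (x + (t * h) *\<^sub>R ?e)) \<le> M * \<bar>h\<bar>"
        using M(2)[OF before[of t]] t by (simp add: mult.commute[of M] mult_left_mono)
    qed (intro continuous_intros)
    then have "norm (g x) \<le> M * \<bar>h\<bar> * p" using g(2)[OF p(3)] by simp
    also have "\<dots> \<le> M * \<bar>h\<bar> * 1" using p M(1) by (intro mult_left_mono) auto
    finally show ?thesis by simp
  qed
  show ?thesis
  proof (cases "\<forall>r\<in>closed_segment 0 h. x + r *\<^sub>R ?e \<in> \<Omega>")
    case True
    have "norm (g (x + h *\<^sub>R ?e) - g (x + 0 *\<^sub>R ?e) - h *\<^sub>R 0) \<le> M * \<bar>h\<bar>"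
      using True M(2) partial_along_line[OF C1, of x _ k] by (intro mean_value_bound) auto
    moreover have "M * \<bar>h\<bar> \<le> 2 * M * \<bar>h\<bar>" using M(1) by (simp add: mult_right_mono)
    ultimately show ?thesis by simp
  next
    case False
    then obtain r where r: "r \<in> closed_segment 0 h" "x + r *\<^sub>R ?e \<notin> \<Omega>" by blast
    have "h - r \<in> closed_segment 0 h" using r(1) by (auto simp: closed_segment_eq_real_ivl split: if_splits)
    then have "r - h \<in> closed_segment 0 (- h)" by (auto simp: closed_segment_eq_real_ivl split: if_splits)
    moreover have "x + h *\<^sub>R ?e + (r - h) *\<^sub>R ?e \<notin> \<Omega>" using r(2) by (simp add: algebra_simps)
    ultimately have "norm (g (x + h *\<^sub>R ?e)) \<le> M * \<bar>- h\<bar>" by (rule exit)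
    moreover have "norm (g x) \<le> M * \<bar>h\<bar>" by (rule exit[OF r])
    ultimately show ?thesis using norm_triangle_ineq4[of "g (x + h *\<^sub>R ?e)" "g x"] by simp
  qed
qed

text \<open>Translation invariance makes the integral of every difference quotient of \<open>g\<close> vanish. The
  quotients are bounded because \<open>g\<close> is Lipschitz along lines, and they converge off the boundary,
  which is a null set.\<close>
lemma vanishing_divergence:
  fixes g :: "real ^ 'n \<Rightarrow> complex"
  assumes g: "continuous_on UNIV g" "\<And>x. x \<notin> \<Omega> \<Longrightarrow> g x = 0" and C: "C_on 1 \<Omega> g"
    and M: "M \<ge> 0" "\<And>x. x \<in> \<Omega> \<Longrightarrow> norm (partial k g x) \<le> M"
  shows "(\<integral>x. indicator \<Omega> x *\<^sub>R partial k g x \<partial>lborel) = 0"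
proof -
  let ?e = "axis k (1::real)"
  obtain R where R: "\<And>x. x \<in> \<Omega> \<Longrightarrow> norm x \<le> R" using bounded_\<Omega> unfolding bounded_iff by blast
  define h where "h n = 1 / real (Suc n)" for n
  have h: "h n > 0" "h n \<le> 1" for n by (auto simp: h_def)
  have hlim: "h \<longlonglongrightarrow> 0" unfolding h_def using LIMSEQ_inverse_real_of_nat by (simp add: inverse_eq_divide)
  have hlim': "filterlim h (at 0) sequentially"
    using hlim h(1) by (auto simp: filterlim_at less_imp_neq[symmetric] intro!: always_eventually)
  have gR: "g x = 0" if "norm x > R" for x using R[of x] g(2)[of x] that by force
  obtain B where B: "B \<ge> 0" "\<And>x. norm x \<le> R \<Longrightarrow> norm (g x) \<le> B" using continuous_bounded_on_cball[OF g(1)] by blast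
  have "integrable lborel (\<lambda>x. indicator UNIV x *\<^sub>R g x)"
  proof (rule bounded_support_integrable[where M = B and R = R])
    show "norm (g x) \<le> B" for x using B gR[of x] by (cases "norm x \<le> R") auto
  qed (use g gR in auto)
  then have intg: "integrable lborel g" by simp
  have T: "integrable lborel (\<lambda>x. g (x + c))" "(\<integral>x. g (x + c) \<partial>lborel) = (\<integral>x. g x \<partial>lborel)" for c
    using lborel_integral_shear_translate[OF intg, of "\<lambda>_. 0" k c] by simp_all
  have "(\<lambda>n. \<integral>x. (g (x + h n *\<^sub>R ?e) - g x) /\<^sub>R h n \<partial>lborel) \<longlonglongrightarrow> (\<integral>x. indicator \<Omega> x *\<^sub>R partial k g x \<partial>lborel)"
  proof (rule integral_dominated_convergence[where w = "\<lambda>x. indicator (cball 0 (R + 1)) x *\<^sub>R (2 * M)"])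
    from borel_measurable_continuous_on_indicator[OF borel_open[OF open_\<Omega>] C_on_1_continuous(2)[OF C]]
    show "(\<lambda>x. indicator \<Omega> x *\<^sub>R partial k g x) \<in> borel_measurable lborel" by simp
    show "(\<lambda>x. (g (x + h n *\<^sub>R ?e) - g x) /\<^sub>R h n) \<in> borel_measurable lborel" for n
      by (intro borel_measurable_scaleR borel_measurable_diff borel_measurable_const
          borel_measurable_integrable[OF T(1)] borel_measurable_integrable[OF intg])
    show "integrable lborel (\<lambda>x::real ^ 'n. indicator (cball 0 (R + 1)) x *\<^sub>R (2 * M))"
      by (rule integrableI_bounded_set[where A = "cball 0 (R + 1)" and B = "2 * M"])
         (use emeasure_lborel_cball_finite[of "0::real ^ 'n"] M in \<open>auto simp: indicator_def\<close>)
    have "AE x in lborel. x \<notin> frontier \<Omega>" using frontier_null by (rule AE_not_in)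
    then show "AE x in lborel. (\<lambda>n. (g (x + h n *\<^sub>R ?e) - g x) /\<^sub>R h n) \<longlonglongrightarrow> indicator \<Omega> x *\<^sub>R partial k g x"
    proof eventually_elim
      case (elim x)
      show ?case
      proof (cases "x \<in> \<Omega>")
        case True
        have "Cext \<Omega> (Suc 0) \<Omega> g" using C by (simp only: C_on_eq_Cext One_nat_def)
        from has_vector_derivative_quotient[OF Cext_has_partial[OF this True]]
        have "((\<lambda>h. (g (x + h *\<^sub>R ?e) - g x) /\<^sub>R h) \<longlongrightarrow> partial k g x) (at 0)" by simp
        from filterlim_compose[OF this hlim'] True show ?thesis by simp
      next
        case False
        then have x: "x \<in> - closure \<Omega>" using elim open_\<Omega> by (auto simp: frontier_def interior_open)
        have "((\<lambda>n. x + h n *\<^sub>R ?e) \<longlongrightarrow> x + 0 *\<^sub>R ?e) sequentially" by (intro tendsto_intros hlim)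
        then have "\<forall>\<^sub>F n in sequentially. x + h n *\<^sub>R ?e \<in> - closure \<Omega>"
          using x by (intro topological_tendstoD) auto
        then have "\<forall>\<^sub>F n in sequentially. (g (x + h n *\<^sub>R ?e) - g x) /\<^sub>R h n = 0"
        proof eventually_elim
          case (elim n)
          then have "x + h n *\<^sub>R ?e \<notin> \<Omega>" using closure_subset by blast
          then show ?case using g(2) False by simp
        qed
        then show ?thesis using False by (simp add: tendsto_eventually)
      qed
    qed
    show "AE x in lborel. norm ((g (x + h n *\<^sub>R ?e) - g x) /\<^sub>R h n) \<le> indicator (cball 0 (R + 1)) x *\<^sub>R (2 * M)" for n
    proof (rule AE_I2)
      fix x
      show "norm ((g (x + h n *\<^sub>R ?e) - g x) /\<^sub>R h n) \<le> indicator (cball 0 (R + 1)) x *\<^sub>R (2 * M)"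
      proof (cases "norm x \<le> R + 1")
        case True
        have "norm (g (x + h n *\<^sub>R ?e) - g x) \<le> 2 * M * h n"
          using vanishing_line_bound[OF assms, where x = x and h = "h n"] h(1)[of n] by simp
        then show ?thesis using True h(1)[of n] by (simp add: divide_simps mult.commute)
      next
        case False
        have "norm x \<le> norm (x + h n *\<^sub>R ?e) + norm (h n *\<^sub>R ?e)"
          by (metis add_diff_cancel_right' norm_triangle_ineq4)
        then have "norm (x + h n *\<^sub>R ?e) > R" using False h[of n] by simp
        then show ?thesis using gR[of x] gR[of "x + h n *\<^sub>R ?e"] False M(1) by simp
      qed
    qed
  qed
  moreover have "(\<integral>x. (g (x + h n *\<^sub>R ?e) - g x) /\<^sub>R h n \<partial>lborel) = 0" for n
    using T[of "h n *\<^sub>R ?e"] intg by simp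
  ultimately have "(\<lambda>n. 0) \<longlonglongrightarrow> (\<integral>x. indicator \<Omega> x *\<^sub>R partial k g x \<partial>lborel)"
    by (simp only:)
  then show ?thesis by (simp add: LIMSEQ_const_iff)
qed

text \<open>The part of \<open>f\<close> that the atlas does not capture, \<open>(1 - \<Phi>) f\<close>, vanishes on the boundary but
  possibly not near it; so it has no compact support in \<open>\<Omega>\<close> and is treated by
  \<open>vanishing_divergence\<close>.\<close>
theorem divergence:
  fixes f :: "real ^ 'n \<Rightarrow> complex"
  assumes f: "Cext (closure \<Omega>) 1 \<Omega> f"
  shows "(\<integral>x. indicator \<Omega> x *\<^sub>R partial k f x \<partial>lborel)
    = surface_integral \<Omega> (\<lambda>x. boundary_value \<Omega> f x * of_real (outer_normal \<Omega> x $ k))"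
proof -
  let ?b = "\<lambda>x. boundary_value \<Omega> f x * of_real (outer_normal \<Omega> x $ k)"
  define \<Phi> where "\<Phi> P x = (\<Sum>(i, s, \<gamma>, \<phi>)\<leftarrow>P. \<phi> x)" for P :: "'n patch list" and x :: "real ^ 'n"
  have \<Phi>: "C_on 1 UNIV (\<Phi> P)" if "set P \<subseteq> set (the_atlas \<Omega>)" for P
    using that
  proof (induction P)
    case (Cons p P)
    obtain i s \<gamma> \<phi> where p: "p = (i, s, \<gamma>, \<phi>)" by (cases p)
    obtain U where U: "graph_patch 1 \<Omega> i s \<gamma> U" "\<phi> \<in> test_functions U" using atlas_patch[of i s \<gamma> \<phi>] Cons.prems p by auto
    have "Cext UNIV 1 UNIV (\<lambda>x. \<phi> x + \<Phi> P x)"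
      using Cons.IH Cons.prems test_function_C_on[OF U(2), of 1] unfolding C_on_eq_Cext
      by (intro Cext_add) (simp_all del: Cext.simps)
    then show ?case by (simp add: C_on_eq_Cext \<Phi>_def p)
  next
    case Nil
    have "\<Phi> [] = (\<lambda>_. 0)" by (simp add: \<Phi>_def fun_eq_iff)
    then show ?case unfolding C_on_eq_Cext by (simp only: Cext_const[OF open_UNIV])
  qed
  have Pf: "Cext (closure \<Omega>) 1 \<Omega> (\<lambda>x. \<Phi> P x *\<^sub>R f x)" if "set P \<subseteq> set (the_atlas \<Omega>)" for P
    by (intro Cext_scaleR open_\<Omega> f C_on_imp_Cext \<Phi> that)
  have int: "integrable lborel (\<lambda>x. indicator \<Omega> x *\<^sub>R partial k u x)" if "Cext (closure \<Omega>) 1 \<Omega> u" for u :: "real ^ 'n \<Rightarrow> complex"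
    using that by (intro ext_on_integrable[OF open_\<Omega> bounded_\<Omega>] Cext_ext_on[of _ 0] Cext_partial) simp
  have add: "(\<integral>x. indicator \<Omega> x *\<^sub>R partial k (\<lambda>x. u x + v x) x \<partial>lborel)
      = (\<integral>x. indicator \<Omega> x *\<^sub>R partial k u x \<partial>lborel) + (\<integral>x. indicator \<Omega> x *\<^sub>R partial k v x \<partial>lborel)"
    if "Cext (closure \<Omega>) 1 \<Omega> u" "Cext (closure \<Omega>) 1 \<Omega> v" for u v :: "real ^ 'n \<Rightarrow> complex"
    unfolding Bochner_Integration.integral_add[OF int[OF that(1)] int[OF that(2)], symmetric]
    using partial_add[of "closure \<Omega>" 0 \<Omega> u v] that
    by (intro Bochner_Integration.integral_cong) (auto simp: indicator_def)
  have part: "(\<integral>x. indicator \<Omega> x *\<^sub>R partial k (\<lambda>x. \<Phi> P x *\<^sub>R f x) x \<partial>lborel)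
      = (\<Sum>p\<leftarrow>P. \<integral>y. patch_integrand p ?b y \<partial>patch_measure p)" if "set P \<subseteq> set (the_atlas \<Omega>)" for P
    using that
  proof (induction P)
    case Nil
    then show ?case by (simp add: \<Phi>_def)
  next
    case (Cons p P)
    obtain i s \<gamma> \<phi> where p: "p = (i, s, \<gamma>, \<phi>)" by (cases p)
    obtain U where U: "graph_patch 1 \<Omega> i s \<gamma> U" "\<phi> \<in> test_functions U" using atlas_patch[of i s \<gamma> \<phi>] Cons.prems p by auto
    have "Cext (closure \<Omega>) 1 \<Omega> (\<lambda>x. \<phi> x *\<^sub>R f x)"
      by (intro Cext_scaleR open_\<Omega> f C_on_imp_Cext test_function_C_on[OF U(2)])
    moreover have "(\<lambda>x. \<Phi> (p # P) x *\<^sub>R f x) = (\<lambda>x. \<phi> x *\<^sub>R f x + \<Phi> P x *\<^sub>R f x)"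
      by (simp add: \<Phi>_def p scaleR_add_left fun_eq_iff)
    ultimately show ?case
      using Cons patch_divergence[of i s \<gamma> \<phi>, OF _ f, of k] Pf[of P] by (simp add: add p)
  qed
  let ?P = "the_atlas \<Omega>"
  define g where "g x = (if x \<in> \<Omega> then (1 - \<Phi> ?P x) *\<^sub>R f x else 0)" for x
  have gf: "Cext (closure \<Omega>) 1 \<Omega> (\<lambda>x. (1 - \<Phi> ?P x) *\<^sub>R f x)"
    by (intro Cext_scaleR Cext_diff Cext_const open_\<Omega> f C_on_imp_Cext \<Phi>[OF order_refl])
  have Cg: "Cext (closure \<Omega>) 1 \<Omega> g"
    by (rule Cext_cong[OF open_\<Omega> gf]) (simp add: g_def)
  obtain M where M: "M \<ge> 0" "\<And>x. x \<in> \<Omega> \<Longrightarrow> norm (partial k g x) \<le> M"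
    by (rule Cext_1_bounded[OF bounded_\<Omega> Cg], rule that, assumption, assumption)
  have "continuous_on UNIV g"
  proof -
    obtain f' where f': "continuous_on (closure \<Omega>) f'" "\<And>x. x \<in> \<Omega> \<Longrightarrow> f' x = f x"
      using Cext_ext_on[OF f] unfolding ext_on_def by blast
    have "continuous_on (closure \<Omega> \<union> closure (- \<Omega>)) (\<lambda>x. if x \<in> \<Omega> then (1 - \<Phi> ?P x) *\<^sub>R f' x else 0)"
    proof (rule continuous_on_If)
      show "continuous_on (closure \<Omega>) (\<lambda>x. (1 - \<Phi> ?P x) *\<^sub>R f' x)"
        using C_on_1_continuous(1)[OF \<Phi>[OF order_refl]] f'(1) by (intro continuous_intros) (auto intro: continuous_on_subset)
      fix x assume "x \<in> closure \<Omega>" "x \<notin> \<Omega>"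
      then have "x \<in> frontier \<Omega>" using open_\<Omega> by (simp add: frontier_def interior_open)
      then show "(1 - \<Phi> ?P x) *\<^sub>R f' x = 0" using atlas_sum by (simp add: \<Phi>_def)
    next
      fix x assume "x \<in> closure (- \<Omega>)" "x \<in> \<Omega>"
      then show "(1 - \<Phi> ?P x) *\<^sub>R f' x = 0" using open_\<Omega> by (simp add: closure_complement interior_open)
    qed auto
    moreover have "closure \<Omega> \<union> closure (- \<Omega>) = UNIV" using closure_subset[of \<Omega>] closure_subset[of "- \<Omega>"] by blast
    moreover have "(\<lambda>x. if x \<in> \<Omega> then (1 - \<Phi> ?P x) *\<^sub>R f' x else 0) = g" using f'(2) by (auto simp: g_def fun_eq_iff)
    ultimately show ?thesis by (simp only:)
  qed
  then have "(\<integral>x. indicator \<Omega> x *\<^sub>R partial k g x \<partial>lborel) = 0"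
    by (rule vanishing_divergence[OF _ _ Cext_imp_C_on[OF Cg closure_subset] M]) (simp add: g_def)
  moreover have "(\<integral>x. indicator \<Omega> x *\<^sub>R partial k f x \<partial>lborel) = (\<integral>x. indicator \<Omega> x *\<^sub>R partial k (\<lambda>x. g x + \<Phi> ?P x *\<^sub>R f x) x \<partial>lborel)"
  proof (rule Bochner_Integration.integral_cong[OF refl])
    fix x
    have "partial k f x = partial k (\<lambda>x. g x + \<Phi> ?P x *\<^sub>R f x) x" if "x \<in> \<Omega>"
      by (rule partial_cong[OF open_\<Omega> _ that]) (simp add: g_def algebra_simps)
    then show "indicator \<Omega> x *\<^sub>R partial k f x = indicator \<Omega> x *\<^sub>R partial k (\<lambda>x. g x + \<Phi> ?P x *\<^sub>R f x) x"
      by (auto simp: indicator_def)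
  qed
  ultimately show ?thesis using add[OF Cg Pf[OF order_refl]] part[OF order_refl] by (simp add: surface_integral_def)
qed

end

declare Cext.simps(2) [simp del] C_on.simps(2) [simp del]

section \<open>Integration by parts\<close>

locale normal_domain = smooth_domain \<Omega> for \<Omega> :: "(real ^ 'n::finite) set" +
  fixes \<nu> :: "real ^ 'n \<Rightarrow> real ^ 'n" and r :: nat
  assumes C_\<nu>: "\<And>j. C_on r UNIV (\<lambda>x. \<nu> x $ j)"
    and \<nu>_normal: "\<And>x. x \<in> frontier \<Omega> \<Longrightarrow> \<nu> x = outer_normal \<Omega> x"
begin

abbreviation CE :: "nat \<Rightarrow> (real ^ 'n \<Rightarrow> complex) \<Rightarrow> bool" where "CE k f \<equiv> Cext (closure \<Omega>) k \<Omega> f"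

definition n :: "'n \<Rightarrow> real ^ 'n \<Rightarrow> complex" where "n j x = of_real (\<nu> x $ j)"

definition bd_int :: "(real ^ 'n \<Rightarrow> complex) \<Rightarrow> complex" where
  "bd_int f = surface_integral \<Omega> (boundary_value \<Omega> f)"

definition vol_int :: "(real ^ 'n \<Rightarrow> complex) \<Rightarrow> complex" where
  "vol_int f = (\<integral>x. indicator \<Omega> x *\<^sub>R f x \<partial>lborel)"

lemma C_n: "C_on r UNIV (n j)"
proof -
  have "Cext UNIV r UNIV (\<lambda>x. \<nu> x $ j)" using C_\<nu> by (simp add: C_on_eq_Cext)
  from Cext_of_real[OF open_UNIV this] show ?thesis by (simp add: C_on_eq_Cext n_def[abs_def])
qed

lemma CE_n: "k \<le> r \<Longrightarrow> CE k (n j)"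
  using C_n C_on_imp_Cext C_on_le by blast

lemma cont_n: "continuous_on UNIV (n j)"
  using C_on_le[OF C_n, of 0] by simp

lemma CE_0: "CE k f \<Longrightarrow> CE 0 f"
  using Cext_ext_on by auto

lemma CE_mult: "CE k f \<Longrightarrow> CE k g \<Longrightarrow> CE k (\<lambda>x. f x * g x)"
  by (rule Cext_mult[OF open_\<Omega>])

lemma CE_partial: "CE (Suc k) f \<Longrightarrow> CE k (partial i f)" by (rule Cext_partial)

lemma continuous_tr: "CE k f \<Longrightarrow> continuous_on (frontier \<Omega>) (boundary_value \<Omega> f)"
  by (intro continuous_on_boundary_value open_\<Omega> Cext_ext_on)

lemma bd_int_cong: "(\<And>x. x \<in> frontier \<Omega> \<Longrightarrow> boundary_value \<Omega> f x = boundary_value \<Omega> g x) \<Longrightarrow> bd_int f = bd_int g"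
  unfolding bd_int_def by (rule surface_integral_cong)

lemma bd_int_cong_interior: "(\<And>x. x \<in> \<Omega> \<Longrightarrow> f x = g x) \<Longrightarrow> bd_int f = bd_int g"
  by (rule bd_int_cong) (rule boundary_value_cong[OF open_\<Omega>])

lemma bd_int_add: "CE k f \<Longrightarrow> CE l g \<Longrightarrow> bd_int (\<lambda>x. f x + g x) = bd_int f + bd_int g"
proof -
  assume f: "CE k f" and g: "CE l g"
  have "bd_int (\<lambda>x. f x + g x) = surface_integral \<Omega> (\<lambda>x. boundary_value \<Omega> f x + boundary_value \<Omega> g x)"
    unfolding bd_int_def by (intro surface_integral_cong boundary_value_add open_\<Omega> Cext_ext_on[OF f] Cext_ext_on[OF g])
  also have "\<dots> = bd_int f + bd_int g"
    unfolding bd_int_def by (intro surface_integral_add surface_integrableI continuous_tr[OF f] continuous_tr[OF g])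
  finally show ?thesis .
qed

lemma bd_int_sum: "(\<And>a. a \<in> A \<Longrightarrow> CE k (f a)) \<Longrightarrow> bd_int (\<lambda>x. \<Sum>a\<in>A. f a x) = (\<Sum>a\<in>A. bd_int (f a))"
proof -
  assume f: "\<And>a. a \<in> A \<Longrightarrow> CE k (f a)"
  have "bd_int (\<lambda>x. \<Sum>a\<in>A. f a x) = surface_integral \<Omega> (\<lambda>x. \<Sum>a\<in>A. boundary_value \<Omega> (f a) x)"
    unfolding bd_int_def by (intro surface_integral_cong boundary_value_sum open_\<Omega> Cext_ext_on[OF f])
  also have "\<dots> = (\<Sum>a\<in>A. bd_int (f a))"
    unfolding bd_int_def by (intro surface_integral_sum continuous_tr[OF f])
  finally show ?thesis .
qed

lemma vol_int_add: "CE k f \<Longrightarrow> CE l g \<Longrightarrow> vol_int (\<lambda>x. f x + g x) = vol_int f + vol_int g"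
  unfolding vol_int_def scaleR_add_right
  by (intro Bochner_Integration.integral_add ext_on_integrable[OF open_\<Omega> bounded_\<Omega>] Cext_ext_on)

lemma vol_int_cong: "(\<And>x. x \<in> \<Omega> \<Longrightarrow> f x = g x) \<Longrightarrow> vol_int f = vol_int g"
  unfolding vol_int_def by (intro Bochner_Integration.integral_cong) (auto simp: indicator_def)

lemma vol_int_sum: "(\<And>a. a \<in> A \<Longrightarrow> CE k (f a)) \<Longrightarrow> vol_int (\<lambda>x. \<Sum>a\<in>A. f a x) = (\<Sum>a\<in>A. vol_int (f a))"
  unfolding vol_int_def scaleR_sum_right
  by (intro Bochner_Integration.integral_sum ext_on_integrable[OF open_\<Omega> bounded_\<Omega>] Cext_ext_on)

lemma vol_int_cmult: "vol_int (\<lambda>x. c * f x) = c * vol_int f"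
  unfolding vol_int_def by (simp flip: integral_mult_right_zero)

lemma divergence_n: "CE 1 f \<Longrightarrow> vol_int (partial k f) = bd_int (\<lambda>x. f x * n k x)"
proof -
  assume f: "CE 1 f"
  have "boundary_value \<Omega> (\<lambda>x. f x * n k x) x = boundary_value \<Omega> f x * of_real (outer_normal \<Omega> x $ k)" if "x \<in> frontier \<Omega>" for x
    using boundary_value_mult[OF open_\<Omega> that Cext_ext_on[OF f] Cext_ext_on[OF CE_n[of 0]]]
      boundary_value_continuous[OF open_\<Omega> that cont_n] \<nu>_normal[OF that] by (simp add: n_def)
  then show ?thesis unfolding vol_int_def bd_int_def divergence[OF f] by (intro surface_integral_cong) simp
qed

lemma by_parts:
  assumes "CE 1 a" "CE 1 b"
  shows "vol_int (\<lambda>x. a x * partial k b x) = - vol_int (\<lambda>x. partial k a x * b x) + bd_int (\<lambda>x. a x * b x * n k x)"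
proof -
  have 1: "CE (Suc 0) a" "CE (Suc 0) b" using assms by (simp_all only: One_nat_def)
  have "vol_int (\<lambda>x. a x * partial k b x) + vol_int (\<lambda>x. partial k a x * b x) = vol_int (\<lambda>x. a x * partial k b x + partial k a x * b x)"
    by (rule vol_int_add[symmetric, of 0 _ 0]) (intro CE_mult CE_partial CE_0[OF assms(1)] CE_0[OF assms(2)] 1)+
  also have "\<dots> = vol_int (partial k (\<lambda>x. a x * b x))"
    by (rule vol_int_cong) (rule partial_mult[OF 1, symmetric])
  also have "\<dots> = bd_int (\<lambda>x. a x * b x * n k x)"
    by (rule divergence_n) (intro CE_mult assms)
  finally show ?thesis by (simp add: algebra_simps)
qed

text \<open>Each step moves the first of the remaining derivatives from \<open>b\<close> to \<open>a\<close>; \<open>q\<close> counts the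
  derivatives moved before.\<close>
lemma by_parts_list:
  "CE (length is) a \<Longrightarrow> CE (length is) b \<Longrightarrow>
    vol_int (\<lambda>x. a x * pd is b x) = (-1) ^ length is * vol_int (\<lambda>x. pd (rev is) a x * b x)
      + (\<Sum>q<length is. (-1) ^ q * bd_int (\<lambda>x. pd (rev (take q is)) a x * pd (drop (Suc q) is) b x * n (is ! q) x))"
proof (induction "is" arbitrary: a)
  case (Cons i "is")
  have a: "CE (length is) (partial i a)" using Cons.prems by (intro CE_partial) simp
  have b: "CE (length is) b" using Cons.prems(2) by (rule Cext_le) simp
  have a1: "CE 1 a" using Cons.prems(1) by (rule Cext_le) simp
  have b1: "CE 1 (pd is b)" using Cons.prems(2) by (rule Cext_pd_le) simp
  have "vol_int (\<lambda>x. a x * pd (i # is) b x) = - vol_int (\<lambda>x. partial i a x * pd is b x) + bd_int (\<lambda>x. a x * pd is b x * n i x)"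
    unfolding pd_Cons by (rule by_parts[OF a1 b1])
  also have "vol_int (\<lambda>x. partial i a x * pd is b x) = (-1) ^ length is * vol_int (\<lambda>x. pd (rev (i # is)) a x * b x)
      + (\<Sum>q<length is. (-1) ^ q * bd_int (\<lambda>x. pd (rev (take (Suc q) (i # is))) a x * pd (drop (Suc (Suc q)) (i # is)) b x * n ((i # is) ! Suc q) x))"
    unfolding Cons.IH[OF a b] by (simp add: pd_snoc)
  finally show ?case
    by (simp add: sum.lessThan_Suc_shift sum_negf del: sum.lessThan_Suc)
qed simp

text \<open>By the divergence theorem both sides are volume integrals of a mixed second derivative.\<close>
lemma tangential_integral_symmetric:
  assumes "CE 2 f" shows "bd_int (\<lambda>x. partial i f x * n k x) = bd_int (\<lambda>x. partial k f x * n i x)"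
proof -
  have 2: "CE (Suc (Suc 0)) f" using assms by (simp only: numeral_2_eq_2)
  have 1: "CE 1 (partial j f)" for j using CE_partial[OF 2] by (simp only: One_nat_def)
  have "vol_int (partial k (partial i f)) = vol_int (partial i (partial k f))"
    by (intro vol_int_cong partial_commute[OF Cext_imp_C_on[OF assms closure_subset] open_\<Omega>])
  then show ?thesis using divergence_n[OF 1] by simp
qed

lemma sum_n_squares: "x \<in> frontier \<Omega> \<Longrightarrow> (\<Sum>k\<in>UNIV. n k x * n k x) = 1"
proof -
  assume x: "x \<in> frontier \<Omega>"
  obtain i s \<gamma> U where U: "x \<in> U" "graph_patch 1 \<Omega> i s \<gamma> U"
    using C1_boundary x unfolding C_boundary_def by blast
  have "norm (\<nu> x) = 1"
    using norm_graph_normal[OF U(2)] outer_normal_graph[OF U(2) open_\<Omega> x U(1)] \<nu>_normal[OF x] by simp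
  then have "(\<Sum>k\<in>UNIV. \<nu> x $ k * \<nu> x $ k) = 1"
    by (simp add: norm_eq_1 inner_vec_def)
  then have "complex_of_real (\<Sum>k\<in>UNIV. \<nu> x $ k * \<nu> x $ k) = 1" by simp
  then show ?thesis by (simp add: n_def)
qed

text \<open>What the tangential operators \<open>n\<^sub>k \<partial>\<^sub>i - n\<^sub>i \<partial>\<^sub>k\<close>, weighted with \<open>n\<^sub>k\<close>, turn into when they are moved to
  the other factor.\<close>
definition tang :: "'n \<Rightarrow> (real ^ 'n \<Rightarrow> complex) \<Rightarrow> real ^ 'n \<Rightarrow> complex" where
  "tang i a x = (\<Sum>k\<in>UNIV. n i x * partial k (\<lambda>x. a x * n k x) x - n k x * partial i (\<lambda>x. a x * n k x) x)"

text \<open>Because \<open>n\<close> is a unit vector, \<open>\<partial>\<^sub>i b\<close> is on the boundary the sum of \<open>n\<^sub>i \<partial>\<^sub>n b\<close> and of the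
  \<open>n\<^sub>k (n\<^sub>k \<partial>\<^sub>i b - n\<^sub>i \<partial>\<^sub>k b)\<close>. The symmetry of tangential integrals for the products \<open>a n\<^sub>k b\<close>
  moves the latter to \<open>a\<close>.\<close>
lemma normal_tangential_split:
  assumes a: "CE 2 a" and b: "CE 2 b" and r: "2 \<le> r"
  shows "bd_int (\<lambda>x. a x * partial i b x) =
    bd_int (\<lambda>x. a x * n i x * (\<Sum>k\<in>UNIV. n k x * partial k b x)) + bd_int (\<lambda>x. tang i a x * b x)"
proof -
  have an: "CE 2 (\<lambda>x. a x * n k x)" for k by (intro CE_mult a CE_n r)
  have 2: "CE (Suc (Suc 0)) f" if "CE 2 f" for f using that by (simp only: numeral_2_eq_2)
  have p1: "CE (Suc 0) (partial j f)" if "CE 2 f" for f j by (rule CE_partial[OF 2[OF that]])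
  note p0 = CE_0[OF p1]
  note C0 = CE_0[OF a] CE_0[OF b] CE_n[of 0] p0[OF a] p0[OF b] p0[OF an] CE_0[OF an]
  have sum0: "CE 0 (\<lambda>x. \<Sum>k\<in>UNIV. f k x)" if "\<And>k. CE 0 (f k)" for f :: "'n \<Rightarrow> _"
    using that by (intro Cext_sum open_\<Omega>)
  have D: "partial j (\<lambda>x. a x * n k x * b x) x = a x * n k x * partial j b x + partial j (\<lambda>x. a x * n k x) x * b x"
    if "x \<in> \<Omega>" for j k x by (rule partial_mult[OF 2[OF an] 2[OF b] that])
  have step: "bd_int (\<lambda>x. a x * n k x * partial i b x * n k x) + bd_int (\<lambda>x. partial i (\<lambda>x. a x * n k x) x * b x * n k x)
     = bd_int (\<lambda>x. a x * n k x * partial k b x * n i x) + bd_int (\<lambda>x. partial k (\<lambda>x. a x * n k x) x * b x * n i x)" for k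
  proof -
    have "bd_int (\<lambda>x. a x * n k x * partial i b x * n k x) + bd_int (\<lambda>x. partial i (\<lambda>x. a x * n k x) x * b x * n k x)
      = bd_int (\<lambda>x. a x * n k x * partial i b x * n k x + partial i (\<lambda>x. a x * n k x) x * b x * n k x)"
      by (rule bd_int_add[symmetric, of 0 _ 0]) (intro CE_mult C0 le0)+
    also have "\<dots> = bd_int (\<lambda>x. partial i (\<lambda>x. a x * n k x * b x) x * n k x)"
      by (rule bd_int_cong_interior) (subst D, assumption, simp add: algebra_simps)
    also have "\<dots> = bd_int (\<lambda>x. partial k (\<lambda>x. a x * n k x * b x) x * n i x)"
      by (intro tangential_integral_symmetric CE_mult an b)
    also have "\<dots> = bd_int (\<lambda>x. a x * n k x * partial k b x * n i x + partial k (\<lambda>x. a x * n k x) x * b x * n i x)"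
      by (rule bd_int_cong_interior) (subst D, assumption, simp add: algebra_simps)
    also have "\<dots> = bd_int (\<lambda>x. a x * n k x * partial k b x * n i x) + bd_int (\<lambda>x. partial k (\<lambda>x. a x * n k x) x * b x * n i x)"
      by (rule bd_int_add[of 0 _ 0]) (intro CE_mult C0 le0)+
    finally show ?thesis .
  qed
  have 1: "bd_int (\<lambda>x. a x * partial i b x) = (\<Sum>k\<in>UNIV. bd_int (\<lambda>x. a x * n k x * partial i b x * n k x))"
  proof -
    have "bd_int (\<lambda>x. a x * partial i b x) = bd_int (\<lambda>x. (a x * partial i b x) * (\<Sum>k\<in>UNIV. n k x * n k x))"
    proof (rule bd_int_cong)
      fix x assume x: "x \<in> frontier \<Omega>"
      have "boundary_value \<Omega> (\<lambda>x. (a x * partial i b x) * (\<Sum>k\<in>UNIV. n k x * n k x)) x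
        = boundary_value \<Omega> (\<lambda>x. a x * partial i b x) x * boundary_value \<Omega> (\<lambda>x. \<Sum>k\<in>UNIV. n k x * n k x) x"
        by (intro boundary_value_mult open_\<Omega> x Cext_ext_on[of _ 0] CE_mult sum0 C0 le0)
      also have "boundary_value \<Omega> (\<lambda>x. \<Sum>k\<in>UNIV. n k x * n k x) x = (\<Sum>k\<in>UNIV. n k x * n k x)"
        by (intro boundary_value_continuous open_\<Omega> x continuous_intros cont_n)
      finally show "boundary_value \<Omega> (\<lambda>x. a x * partial i b x) x = boundary_value \<Omega> (\<lambda>x. (a x * partial i b x) * (\<Sum>k\<in>UNIV. n k x * n k x)) x"
        using sum_n_squares[OF x] by simp
    qed
    also have "\<dots> = bd_int (\<lambda>x. \<Sum>k\<in>UNIV. a x * n k x * partial i b x * n k x)"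
      by (rule bd_int_cong_interior) (simp add: sum_distrib_left mult_ac)
    also have "\<dots> = (\<Sum>k\<in>UNIV. bd_int (\<lambda>x. a x * n k x * partial i b x * n k x))"
      by (rule bd_int_sum[of _ 0]) (intro CE_mult C0 le0)
    finally show ?thesis .
  qed
  have 2: "bd_int (\<lambda>x. a x * n i x * (\<Sum>k\<in>UNIV. n k x * partial k b x)) = (\<Sum>k\<in>UNIV. bd_int (\<lambda>x. a x * n k x * partial k b x * n i x))"
  proof -
    have "bd_int (\<lambda>x. a x * n i x * (\<Sum>k\<in>UNIV. n k x * partial k b x)) = bd_int (\<lambda>x. \<Sum>k\<in>UNIV. a x * n k x * partial k b x * n i x)"
      by (rule bd_int_cong_interior) (simp add: sum_distrib_left mult_ac)
    also have "\<dots> = (\<Sum>k\<in>UNIV. bd_int (\<lambda>x. a x * n k x * partial k b x * n i x))"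
      by (rule bd_int_sum[of _ 0]) (intro CE_mult C0 le0)
    finally show ?thesis .
  qed
  have 3: "bd_int (\<lambda>x. tang i a x * b x) + (\<Sum>k\<in>UNIV. bd_int (\<lambda>x. partial i (\<lambda>x. a x * n k x) x * b x * n k x))
     = (\<Sum>k\<in>UNIV. bd_int (\<lambda>x. partial k (\<lambda>x. a x * n k x) x * b x * n i x))"
  proof -
    have "bd_int (\<lambda>x. tang i a x * b x) + (\<Sum>k\<in>UNIV. bd_int (\<lambda>x. partial i (\<lambda>x. a x * n k x) x * b x * n k x))
      = bd_int (\<lambda>x. tang i a x * b x) + bd_int (\<lambda>x. \<Sum>k\<in>UNIV. partial i (\<lambda>x. a x * n k x) x * b x * n k x)"
      by (subst bd_int_sum[of _ 0]) (intro CE_mult C0 le0 refl)+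
    also have "\<dots> = bd_int (\<lambda>x. tang i a x * b x + (\<Sum>k\<in>UNIV. partial i (\<lambda>x. a x * n k x) x * b x * n k x))"
      unfolding tang_def
      by (rule bd_int_add[symmetric, of 0 _ 0]) (intro CE_mult sum0 Cext_diff open_\<Omega> C0 le0)+
    also have "\<dots> = bd_int (\<lambda>x. \<Sum>k\<in>UNIV. partial k (\<lambda>x. a x * n k x) x * b x * n i x)"
      by (rule bd_int_cong_interior) (simp add: tang_def sum_distrib_left sum_distrib_right sum.distrib[symmetric] algebra_simps)
    also have "\<dots> = (\<Sum>k\<in>UNIV. bd_int (\<lambda>x. partial k (\<lambda>x. a x * n k x) x * b x * n i x))"
      by (rule bd_int_sum[of _ 0]) (intro CE_mult C0 le0)
    finally show ?thesis .
  qed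
  have "(\<Sum>k\<in>UNIV. bd_int (\<lambda>x. a x * n k x * partial i b x * n k x)) + (\<Sum>k\<in>UNIV. bd_int (\<lambda>x. partial i (\<lambda>x. a x * n k x) x * b x * n k x))
     = (\<Sum>k\<in>UNIV. bd_int (\<lambda>x. a x * n k x * partial k b x * n i x)) + (\<Sum>k\<in>UNIV. bd_int (\<lambda>x. partial k (\<lambda>x. a x * n k x) x * b x * n i x))"
    unfolding sum.distrib[symmetric] by (intro sum.cong refl step)
  then show ?thesis unfolding 1 2 3[symmetric] by (simp add: add.assoc[symmetric])
qed

section \<open>Differential operators and their symbols\<close>

text \<open>An operator of order \<open>p\<close> is given by coefficients indexed by lists of at most \<open>p\<close> directions.\<close>

type_synonym 'k coeffs = "'k list \<Rightarrow> real ^ 'k \<Rightarrow> complex"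

text \<open>The coefficients of longer lists are 0, so that an operator of order \<open>p\<close> can be regarded as
  one of order \<open>p + 1\<close> without changing its coefficients.\<close>
definition smooth_coeffs :: "nat \<Rightarrow> nat \<Rightarrow> 'n coeffs \<Rightarrow> bool" where
  "smooth_coeffs q p c \<longleftrightarrow> (\<forall>is. C_on q UNIV (c is)) \<and> (\<forall>is. length is > p \<longrightarrow> c is = (\<lambda>_. 0))"

definition oper :: "nat \<Rightarrow> 'n coeffs \<Rightarrow> (real ^ 'n \<Rightarrow> complex) \<Rightarrow> real ^ 'n \<Rightarrow> complex" where
  "oper p c z x = (\<Sum>is | length is \<le> p. c is x * pd is z x)"

definition nprod :: "'n list \<Rightarrow> real ^ 'n \<Rightarrow> complex" where
  "nprod is x = prod_list (map (\<lambda>i. n i x) is)"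

text \<open>The principal symbol of the operator of order \<open>p\<close>, evaluated at the normal.\<close>
definition symbol_at_normal :: "nat \<Rightarrow> 'n coeffs \<Rightarrow> real ^ 'n \<Rightarrow> complex" where
  "symbol_at_normal p c x = (\<Sum>is | length is = p. c is x * nprod is x)"

lemma finite_lists_le: "finite {is :: 'n list. length is \<le> p}" and finite_lists_eq: "finite {is :: 'n list. length is = p}"
  using finite_lists_length_le[of "UNIV :: 'n set" p] finite_lists_length_eq[of "UNIV :: 'n set" p] by auto

lemma CE_of_C_on: "C_on q UNIV f \<Longrightarrow> CE q f" by (rule C_on_imp_Cext)

lemma CE_oper:
  assumes "smooth_coeffs q p c" "CE (p + q) z" shows "CE q (oper p c z)"
proof -
  have "CE q (c is)" for "is" using assms(1) unfolding smooth_coeffs_def by (intro CE_of_C_on) blast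
  moreover have "CE q (pd is z)" if "length is \<le> p" for "is" using assms(2) by (rule Cext_pd_le) (use that in simp)
  ultimately show ?thesis unfolding oper_def[abs_def] by (intro Cext_sum CE_mult open_\<Omega>) auto
qed

lemma smooth_coeffs_le: "smooth_coeffs q p c \<Longrightarrow> q' \<le> q \<Longrightarrow> smooth_coeffs q' p c"
  unfolding smooth_coeffs_def using C_on_le by blast

definition cmul :: "(real ^ 'n \<Rightarrow> complex) \<Rightarrow> 'n coeffs \<Rightarrow> 'n coeffs" where
  "cmul g c = (\<lambda>is x. g x * c is x)"

lemma smooth_coeffs_cmul: "smooth_coeffs q p c \<Longrightarrow> C_on q UNIV g \<Longrightarrow> smooth_coeffs q p (cmul g c)"
  unfolding smooth_coeffs_def cmul_def C_on_eq_Cext by (auto intro: Cext_mult)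

lemma oper_cmul: "oper p (cmul g c) z x = g x * oper p c z x"
  by (simp add: oper_def cmul_def sum_distrib_left mult.assoc)

lemma symbol_cmul: "symbol_at_normal p (cmul g c) x = g x * symbol_at_normal p c x"
  by (simp add: symbol_at_normal_def cmul_def sum_distrib_left mult.assoc)

text \<open>The derivative of a term falls on the coefficient or prolongs the list.\<close>
definition dcoeff :: "'n \<Rightarrow> 'n coeffs \<Rightarrow> 'n coeffs" where
  "dcoeff k c is x = partial k (c is) x + (case is of [] \<Rightarrow> 0 | j # js \<Rightarrow> if j = k then c js x else 0)"

lemma smooth_coeffs_dcoeff:
  assumes "smooth_coeffs (Suc q) p c" shows "smooth_coeffs q (Suc p) (dcoeff k c)"
  unfolding smooth_coeffs_def
proof (intro conjI allI impI)
  fix "is"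
  have c: "Cext UNIV (Suc q) UNIV (c js)" for js using assms unfolding smooth_coeffs_def C_on_eq_Cext by blast
  have "Cext UNIV q UNIV (\<lambda>x. case is of [] \<Rightarrow> 0 | j # js \<Rightarrow> if j = k then c js x else 0)"
    using Cext_Suc[OF c] by (cases "is"; cases "hd is = k") (simp_all add: Cext_const)
  then show "C_on q UNIV (dcoeff k c is)"
    unfolding C_on_eq_Cext dcoeff_def[abs_def] by (intro Cext_add open_UNIV Cext_partial[OF c])
  assume l: "Suc p < length is"
  then obtain j js where "is": "is = j # js" by (cases "is") auto
  then show "dcoeff k c is = (\<lambda>_. 0)"
    using l assms unfolding smooth_coeffs_def dcoeff_def[abs_def] by auto
qed

lemma sum_prepend:
  fixes f :: "'n list \<Rightarrow> 'n list \<Rightarrow> complex"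
  assumes "finite S" "finite T" "(#) k ` T \<subseteq> S" "\<And>j js. j # js \<in> S \<Longrightarrow> js \<in> T"
  shows "(\<Sum>is\<in>S. case is of [] \<Rightarrow> 0 | j # js \<Rightarrow> if j = k then f js is else 0) = (\<Sum>js\<in>T. f js (k # js))"
proof -
  have "(\<Sum>is\<in>S. case is of [] \<Rightarrow> 0 | j # js \<Rightarrow> if j = k then f js is else 0)
    = (\<Sum>is\<in>(#) k ` T. case is of [] \<Rightarrow> 0 | j # js \<Rightarrow> if j = k then f js is else 0)"
    using assms by (intro sum.mono_neutral_right) (auto split: list.splits)
  also have "\<dots> = (\<Sum>js\<in>T. f js (k # js))"
    by (subst sum.reindex) auto
  finally show ?thesis .
qed

lemma oper_dcoeff:
  assumes c: "smooth_coeffs (Suc q) p c" and z: "CE (Suc p) z" and x: "x \<in> \<Omega>"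
  shows "oper (Suc p) (dcoeff k c) z x = partial k (oper p c z) x"
proof -
  have c1: "CE (Suc 0) (c is)" for "is"
  proof -
    have h: "C_on (Suc q) UNIV (c is)" using c unfolding smooth_coeffs_def by blast
    show ?thesis by (intro CE_of_C_on C_on_le[OF h]) simp
  qed
  have z1: "CE (Suc 0) (pd is z)" if "length is \<le> p" for "is"
    using that by (intro Cext_pd_le[OF z]) auto
  have "partial k (oper p c z) x = (\<Sum>is | length is \<le> p. partial k (\<lambda>x. c is x * pd is z x) x)"
    unfolding oper_def[abs_def] by (rule partial_sum[of _ "closure \<Omega>" 0, OF _ x]) (intro CE_mult c1 z1, simp)
  also have "\<dots> = (\<Sum>is | length is \<le> p. c is x * pd (k # is) z x + partial k (c is) x * pd is z x)"
    by (intro sum.cong refl) (simp add: partial_mult[OF c1 z1 x])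
  also have "\<dots> = (\<Sum>is | length is \<le> p. c is x * pd (k # is) z x) + (\<Sum>is | length is \<le> p. partial k (c is) x * pd is z x)"
    by (rule sum.distrib)
  also have "(\<Sum>is | length is \<le> p. partial k (c is) x * pd is z x) = (\<Sum>is | length is \<le> Suc p. partial k (c is) x * pd is z x)"
  proof (rule sum.mono_neutral_left[OF finite_lists_le])
    show "\<forall>is\<in>{is. length is \<le> Suc p} - {is. length is \<le> p}. partial k (c is) x * pd is z x = 0"
      using c unfolding smooth_coeffs_def by (auto simp: not_le)
  qed auto
  also have "(\<Sum>is | length is \<le> p. c is x * pd (k # is) z x)
     = (\<Sum>is | length is \<le> Suc p. case is of [] \<Rightarrow> 0 | j # js \<Rightarrow> if j = k then c js x * pd is z x else 0)"
    by (rule sum_prepend[symmetric, OF finite_lists_le finite_lists_le]) auto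
  also have "\<dots> + (\<Sum>is | length is \<le> Suc p. partial k (c is) x * pd is z x) = oper (Suc p) (dcoeff k c) z x"
    unfolding oper_def sum.distrib[symmetric] dcoeff_def
    by (intro sum.cong refl) (auto simp: algebra_simps split: list.splits)
  finally show ?thesis by simp
qed

lemma symbol_dcoeff:
  assumes "smooth_coeffs q p c"
  shows "symbol_at_normal (Suc p) (dcoeff k c) x = n k x * symbol_at_normal p c x"
proof -
  have "symbol_at_normal (Suc p) (dcoeff k c) x
    = (\<Sum>is | length is = Suc p. case is of [] \<Rightarrow> 0 | j # js \<Rightarrow> if j = k then c js x * nprod is x else 0)"
    unfolding symbol_at_normal_def
  proof (intro sum.cong refl)
    fix "is" :: "'n list" assume "is \<in> {is. length is = Suc p}"
    then have "c is = (\<lambda>_. 0)" using assms unfolding smooth_coeffs_def by simp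
    then show "dcoeff k c is x * nprod is x = (case is of [] \<Rightarrow> 0 | j # js \<Rightarrow> if j = k then c js x * nprod is x else 0)"
      by (auto simp: dcoeff_def split: list.splits)
  qed
  also have "\<dots> = (\<Sum>js | length js = p. c js x * nprod (k # js) x)"
    by (rule sum_prepend[OF finite_lists_eq finite_lists_eq]) auto
  also have "\<dots> = n k x * symbol_at_normal p c x"
    by (simp add: symbol_at_normal_def nprod_def sum_distrib_left mult_ac)
  finally show ?thesis .
qed

text \<open>The coefficients of \<open>tang i\<close> applied to an operator.\<close>
definition tcoeff :: "'n \<Rightarrow> 'n coeffs \<Rightarrow> 'n coeffs" where
  "tcoeff i c is x = (\<Sum>k\<in>UNIV. n i x * dcoeff k (cmul (n k) c) is x - n k x * dcoeff i (cmul (n k) c) is x)"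

lemma smooth_coeffs_tcoeff:
  assumes "smooth_coeffs (Suc q) p c" "Suc q \<le> r" shows "smooth_coeffs q (Suc p) (tcoeff i c)"
proof -
  have g: "smooth_coeffs q (Suc p) (dcoeff j (cmul (n k) c))" for j k
    by (intro smooth_coeffs_dcoeff smooth_coeffs_cmul assms(1) C_on_le[OF C_n assms(2)])
  have nq: "Cext UNIV q UNIV (n k)" for k using C_on_le[OF C_n, of q] assms(2) by (simp add: C_on_eq_Cext)
  have "C_on q UNIV (tcoeff i c is)" for "is"
    using g unfolding smooth_coeffs_def C_on_eq_Cext tcoeff_def[abs_def]
    by (intro Cext_sum Cext_diff Cext_mult open_UNIV nq) auto
  moreover have "tcoeff i c is = (\<lambda>_. 0)" if "length is > Suc p" for "is"
    using g that unfolding smooth_coeffs_def by (simp add: tcoeff_def[abs_def])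
  ultimately show ?thesis unfolding smooth_coeffs_def by blast
qed

lemma oper_tcoeff:
  assumes c: "smooth_coeffs (Suc q) p c" "Suc q \<le> r" and z: "CE (Suc p) z" and x: "x \<in> \<Omega>"
  shows "oper (Suc p) (tcoeff i c) z x = tang i (oper p c z) x"
proof -
  have "oper (Suc p) (tcoeff i c) z x = (\<Sum>k\<in>UNIV. n i x * oper (Suc p) (dcoeff k (cmul (n k) c)) z x
      - n k x * oper (Suc p) (dcoeff i (cmul (n k) c)) z x)"
    unfolding oper_def tcoeff_def sum_distrib_right sum_distrib_left sum_subtractf[symmetric]
    by (subst sum.swap) (simp add: algebra_simps)
  also have "\<dots> = tang i (oper p c z) x"
  proof -
    have "oper (Suc p) (dcoeff j (cmul (n k) c)) z x = partial j (\<lambda>x. oper p c z x * n k x) x" for j k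
      using oper_dcoeff[OF smooth_coeffs_cmul[OF c(1) C_on_le[OF C_n c(2)]] z x, of j k]
      by (simp add: oper_cmul[abs_def] mult.commute)
    then show ?thesis by (simp add: tang_def)
  qed
  finally show ?thesis .
qed

text \<open>The symbol of \<open>n\<^sub>i \<partial>\<^sub>k - n\<^sub>k \<partial>\<^sub>i\<close> vanishes at \<open>n\<close>.\<close>
lemma symbol_tcoeff:
  assumes c: "smooth_coeffs q p c" "q \<le> r"
  shows "symbol_at_normal (Suc p) (tcoeff i c) x = 0"
proof -
  have "symbol_at_normal (Suc p) (tcoeff i c) x = (\<Sum>k\<in>UNIV. n i x * symbol_at_normal (Suc p) (dcoeff k (cmul (n k) c)) x
      - n k x * symbol_at_normal (Suc p) (dcoeff i (cmul (n k) c)) x)"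
    unfolding symbol_at_normal_def tcoeff_def sum_distrib_right sum_distrib_left sum_subtractf[symmetric]
    by (subst sum.swap) (simp add: algebra_simps)
  also have "\<dots> = 0"
    by (simp add: symbol_dcoeff[OF smooth_coeffs_cmul[OF c(1) C_on_le[OF C_n c(2)]]] symbol_cmul mult_ac)
  finally show ?thesis .
qed

section \<open>Reduction to normal derivatives\<close>

text \<open>The derivatives \<open>js\<close> followed by \<open>t\<close> derivatives in the direction of the normal, which is not
  itself differentiated. For empty \<open>js\<close> this is the normal derivative of order \<open>t\<close> in the sense of
  \<open>normal_deriv\<close>.\<close>
definition mixed :: "nat \<Rightarrow> 'n list \<Rightarrow> (real ^ 'n \<Rightarrow> complex) \<Rightarrow> real ^ 'n \<Rightarrow> complex" where
  "mixed t js w x = (\<Sum>ks | length ks = t. nprod ks x * pd (ks @ js) w x)"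

text \<open>The form \<open>F\<close> can be written with normal derivatives of \<open>w\<close> only, and \<open>\<sigma> j\<close> is the symbol at the
  normal of the operator that multiplies the one of order \<open>j\<close>. That operator is always counted as
  one of order \<open>2m - 1 - j\<close>; if its actual order is lower, its symbol is 0.\<close>
definition normal_form :: "nat \<Rightarrow> ((real ^ 'n \<Rightarrow> complex) \<Rightarrow> (real ^ 'n \<Rightarrow> complex) \<Rightarrow> complex) \<Rightarrow> (nat \<Rightarrow> real ^ 'n \<Rightarrow> complex) \<Rightarrow> bool" where
  "normal_form m F \<sigma> \<longleftrightarrow> (\<exists>c. (\<forall>j<m. smooth_coeffs 0 (2 * m - 1 - j) (c j)) \<and>
     (\<forall>j<m. \<forall>x\<in>frontier \<Omega>. symbol_at_normal (2 * m - 1 - j) (c j) x = \<sigma> j x) \<and>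
     (\<forall>z w. CE (2 * m) z \<longrightarrow> CE (2 * m) w \<longrightarrow>
        F z w = (\<Sum>j<m. bd_int (\<lambda>x. oper (2 * m - 1 - j) (c j) z x * mixed j [] w x))))"

lemma CE_nprod: "q \<le> r \<Longrightarrow> CE q (nprod is)"
  unfolding nprod_def[abs_def]
  by (induction "is") (auto intro!: Cext_const Cext_mult CE_n open_\<Omega> simp del: Cext.simps)

lemma C_nprod: "q \<le> r \<Longrightarrow> C_on q UNIV (nprod is)"
  unfolding nprod_def[abs_def] C_on_eq_Cext
  by (induction "is") (auto intro!: Cext_const Cext_mult C_on_le[OF C_n, unfolded C_on_eq_Cext] simp del: Cext.simps)

lemma CE_mixed: "CE k w \<Longrightarrow> t + length js + q \<le> k \<Longrightarrow> q \<le> r \<Longrightarrow> CE q (mixed t js w)"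
  unfolding mixed_def[abs_def]
  by (intro Cext_sum CE_mult open_\<Omega> CE_nprod Cext_pd_le[of _ k]) auto

lemma normal_form_cong:
  assumes "normal_form m F \<sigma>" "\<And>z w. CE (2 * m) z \<Longrightarrow> CE (2 * m) w \<Longrightarrow> G z w = F z w"
    "\<And>j x. j < m \<Longrightarrow> x \<in> frontier \<Omega> \<Longrightarrow> \<sigma> j x = \<tau> j x"
  shows "normal_form m G \<tau>"
proof -
  obtain c where c: "\<forall>j<m. smooth_coeffs 0 (2 * m - 1 - j) (c j)"
     "\<forall>j<m. \<forall>x\<in>frontier \<Omega>. symbol_at_normal (2 * m - 1 - j) (c j) x = \<sigma> j x"
     "\<forall>z w. CE (2 * m) z \<longrightarrow> CE (2 * m) w \<longrightarrow> F z w = (\<Sum>j<m. bd_int (\<lambda>x. oper (2 * m - 1 - j) (c j) z x * mixed j [] w x))"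
    using assms(1) unfolding normal_form_def by blast
  show ?thesis unfolding normal_form_def
    by (rule exI[of _ c]) (use c assms(2,3) in simp)
qed

lemma normal_form_add:
  assumes "normal_form m F \<sigma>" "normal_form m G \<tau>"
  shows "normal_form m (\<lambda>z w. F z w + G z w) (\<lambda>j x. \<sigma> j x + \<tau> j x)"
proof -
  obtain c where c: "\<forall>j<m. smooth_coeffs 0 (2 * m - 1 - j) (c j)"
     "\<forall>j<m. \<forall>x\<in>frontier \<Omega>. symbol_at_normal (2 * m - 1 - j) (c j) x = \<sigma> j x"
     "\<forall>z w. CE (2 * m) z \<longrightarrow> CE (2 * m) w \<longrightarrow> F z w = (\<Sum>j<m. bd_int (\<lambda>x. oper (2 * m - 1 - j) (c j) z x * mixed j [] w x))"
    using assms(1) unfolding normal_form_def by blast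
  obtain d where d: "\<forall>j<m. smooth_coeffs 0 (2 * m - 1 - j) (d j)"
     "\<forall>j<m. \<forall>x\<in>frontier \<Omega>. symbol_at_normal (2 * m - 1 - j) (d j) x = \<tau> j x"
     "\<forall>z w. CE (2 * m) z \<longrightarrow> CE (2 * m) w \<longrightarrow> G z w = (\<Sum>j<m. bd_int (\<lambda>x. oper (2 * m - 1 - j) (d j) z x * mixed j [] w x))"
    using assms(2) unfolding normal_form_def by blast
  show ?thesis unfolding normal_form_def
  proof (intro exI[of _ "\<lambda>j is x. c j is x + d j is x"] conjI allI impI ballI)
    fix j assume j: "j < m"
    show "smooth_coeffs 0 (2 * m - 1 - j) (\<lambda>is x. c j is x + d j is x)"
      using c(1) d(1) j unfolding smooth_coeffs_def by (auto intro: continuous_on_add)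
    show "symbol_at_normal (2 * m - 1 - j) (\<lambda>is x. c j is x + d j is x) x = \<sigma> j x + \<tau> j x" if "x \<in> frontier \<Omega>" for x
      using c(2) d(2) j that by (auto simp: symbol_at_normal_def distrib_right sum.distrib)
  next
    fix z w assume zw: "CE (2 * m) z" "CE (2 * m) w"
    have "bd_int (\<lambda>x. oper (2 * m - 1 - j) (\<lambda>is x. c j is x + d j is x) z x * mixed j [] w x)
      = bd_int (\<lambda>x. oper (2 * m - 1 - j) (c j) z x * mixed j [] w x) + bd_int (\<lambda>x. oper (2 * m - 1 - j) (d j) z x * mixed j [] w x)" if "j < m" for j
    proof -
      have "CE 0 (oper (2 * m - 1 - j) e z)" if "smooth_coeffs 0 (2 * m - 1 - j) e" for e
        using that by (rule CE_oper) (rule Cext_le[OF zw(1)], simp)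
      moreover have "CE 0 (mixed j [] w)" using zw(2) by (rule CE_mixed) (use that in auto)
      ultimately have "bd_int (\<lambda>x. oper (2 * m - 1 - j) (c j) z x * mixed j [] w x + oper (2 * m - 1 - j) (d j) z x * mixed j [] w x)
        = bd_int (\<lambda>x. oper (2 * m - 1 - j) (c j) z x * mixed j [] w x) + bd_int (\<lambda>x. oper (2 * m - 1 - j) (d j) z x * mixed j [] w x)"
        using c(1) d(1) that by (intro bd_int_add[of 0 _ 0] CE_mult) blast+
      then show ?thesis by (simp add: oper_def distrib_right sum.distrib)
    qed
    then show "F z w + G z w = (\<Sum>j<m. bd_int (\<lambda>x. oper (2 * m - 1 - j) (\<lambda>is x. c j is x + d j is x) z x * mixed j [] w x))"
      using c(3) d(3) zw by (simp add: sum.distrib)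
  qed
qed

lemma bd_int_zero: "bd_int (\<lambda>_. 0) = 0"
  using bd_int_sum[of "{}" 0 "\<lambda>_ _. 0"] by simp

lemma oper_zero [simp]: "oper p (\<lambda>_ _. 0) z x = 0" and symbol_zero [simp]: "symbol_at_normal p (\<lambda>_ _. 0) x = 0"
  by (simp_all add: oper_def symbol_at_normal_def)

lemma smooth_coeffs_zero: "smooth_coeffs q p (\<lambda>_ _. 0)"
  unfolding smooth_coeffs_def C_on_eq_Cext by (simp only: Cext_const[OF open_UNIV] simp_thms)

lemma normal_form_zero: "normal_form m (\<lambda>z w. 0) (\<lambda>j x. 0)"
  unfolding normal_form_def by (rule exI[of _ "\<lambda>_ _ _. 0"]) (simp add: smooth_coeffs_zero bd_int_zero)

lemma normal_form_sum:
  assumes "finite A" "\<And>a. a \<in> A \<Longrightarrow> normal_form m (F a) (\<sigma> a)"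
  shows "normal_form m (\<lambda>z w. \<Sum>a\<in>A. F a z w) (\<lambda>j x. \<Sum>a\<in>A. \<sigma> a j x)"
  using assms by (induction A) (auto intro: normal_form_add normal_form_zero)

lemma mixed_Suc: "mixed (Suc t) js w x = (\<Sum>ks | length ks = t. nprod ks x * (\<Sum>k\<in>UNIV. n k x * pd (k # ks @ js) w x))"
proof -
  have "{ks :: 'n list. length ks = Suc t} = (\<lambda>(ks, k). k # ks) ` ({ks. length ks = t} \<times> UNIV)"
    by (auto simp: length_Suc_conv)
  moreover have "inj_on (\<lambda>(ks, k). k # ks) ({ks :: 'n list. length ks = t} \<times> UNIV)" by (auto simp: inj_on_def)
  ultimately have "mixed (Suc t) js w x = (\<Sum>(ks, k)\<in>{ks. length ks = t} \<times> UNIV. nprod (k # ks) x * pd (k # ks @ js) w x)"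
    unfolding mixed_def by (simp add: sum.reindex case_prod_unfold)
  also have "\<dots> = (\<Sum>ks | length ks = t. \<Sum>k\<in>UNIV. nprod (k # ks) x * pd (k # ks @ js) w x)"
    by (rule sum.cartesian_product[symmetric])
  finally show ?thesis by (simp add: nprod_def sum_distrib_left mult_ac)
qed

lemma mixed_0: "mixed 0 js w x = pd js w x"
  by (simp add: mixed_def nprod_def)

text \<open>In the first summand the direction \<open>i\<close> has been replaced by the normal. In the others one
  derivative has left \<open>w\<close>, and the operator on \<open>z\<close> has gained one.\<close>
lemma reduce_step:
  assumes m: "Suc (t + length js) < m" "m + 1 \<le> r" and p: "p = 2 * m - 2 - (t + length js)"
    and c: "smooth_coeffs (t + length js + 3) p c" and z: "CE (2 * m) z" and w: "CE (2 * m) w"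
  shows "bd_int (\<lambda>x. oper p c z x * mixed t (i # js) w x)
    = bd_int (\<lambda>x. oper p (cmul (n i) c) z x * mixed (Suc t) js w x)
      + (\<Sum>ks | length ks = t. bd_int (\<lambda>x. oper (Suc p) (tcoeff i (cmul (nprod ks) c)) z x * mixed 0 (ks @ js) w x))"
proof -
  define Q where "Q = t + length js"
  have pQ: "p + (Q + 2) = 2 * m" using m p by (simp add: Q_def)
  have r: "2 \<le> r" "Q + 3 \<le> r" using m by (auto simp: Q_def)
  have g: "smooth_coeffs (Q + 3) p (cmul (nprod ks) c)" for ks
    using c r by (intro smooth_coeffs_cmul C_nprod) (auto simp: Q_def)
  have a: "CE 2 (oper p (cmul (nprod ks) c) z)" for ks
    using CE_oper[OF smooth_coeffs_le[OF g[of ks], of 2] Cext_le[OF z, of "p + 2"]] pQ by simp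
  have b: "CE 2 (pd (ks @ js) w)" if "length ks = t" for ks
    using w by (rule Cext_pd_le) (use m that in simp)
  have pb: "CE 0 (pd (k # ks @ js) w)" if "length ks = t" for k ks
    using w by (rule Cext_pd_le) (use m that in simp)
  have cn: "CE 0 (n k)" for k by (rule CE_n) simp
  have t0: "CE 0 (oper (Suc p) (tcoeff i (cmul (nprod ks) c)) z)" for ks
  proof (rule CE_oper)
    show "smooth_coeffs 0 (Suc p) (tcoeff i (cmul (nprod ks) c))"
      using smooth_coeffs_le[OF g, of 1] r by (intro smooth_coeffs_tcoeff) auto
    show "CE (Suc p + 0) z" by (rule Cext_le[OF z]) (use pQ in simp)
  qed
  have "bd_int (\<lambda>x. oper p c z x * mixed t (i # js) w x)
    = bd_int (\<lambda>x. \<Sum>ks | length ks = t. oper p (cmul (nprod ks) c) z x * partial i (pd (ks @ js) w) x)"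
  proof (rule bd_int_cong_interior)
    fix x assume x: "x \<in> \<Omega>"
    have "pd (ks @ i # js) w x = partial i (pd (ks @ js) w) x" if "length ks = t" for ks
      using pd_move_front[OF open_\<Omega> Cext_imp_C_on[OF w closure_subset], of ks i js x] that m x by simp
    then show "oper p c z x * mixed t (i # js) w x = (\<Sum>ks | length ks = t. oper p (cmul (nprod ks) c) z x * partial i (pd (ks @ js) w) x)"
      by (simp add: mixed_def sum_distrib_left oper_cmul mult_ac)
  qed
  also have "\<dots> = (\<Sum>ks | length ks = t. bd_int (\<lambda>x. oper p (cmul (nprod ks) c) z x * partial i (pd (ks @ js) w) x))"
    using pb[of _ i] by (intro bd_int_sum[of _ 0] CE_mult CE_0[OF a]) auto
  also have "\<dots> = (\<Sum>ks | length ks = t. bd_int (\<lambda>x. oper p (cmul (nprod ks) c) z x * n i x * (\<Sum>k\<in>UNIV. n k x * pd (k # ks @ js) w x))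
     + bd_int (\<lambda>x. oper (Suc p) (tcoeff i (cmul (nprod ks) c)) z x * mixed 0 (ks @ js) w x))"
  proof (intro sum.cong refl)
    fix ks assume "ks \<in> {ks :: 'n list. length ks = t}"
    then have ks: "length ks = t" by simp
    have "bd_int (\<lambda>x. tang i (oper p (cmul (nprod ks) c) z) x * pd (ks @ js) w x)
      = bd_int (\<lambda>x. oper (Suc p) (tcoeff i (cmul (nprod ks) c)) z x * mixed 0 (ks @ js) w x)"
    proof (rule bd_int_cong_interior)
      fix x assume x: "x \<in> \<Omega>"
      have "CE (Suc p) z" by (rule Cext_le[OF z]) (use pQ in simp)
      from oper_tcoeff[OF smooth_coeffs_le[OF g] _ this x, of 0 i ks] r
      show "tang i (oper p (cmul (nprod ks) c) z) x * pd (ks @ js) w x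
        = oper (Suc p) (tcoeff i (cmul (nprod ks) c)) z x * mixed 0 (ks @ js) w x"
        by (simp add: mixed_0)
    qed
    then show "bd_int (\<lambda>x. oper p (cmul (nprod ks) c) z x * partial i (pd (ks @ js) w) x)
      = bd_int (\<lambda>x. oper p (cmul (nprod ks) c) z x * n i x * (\<Sum>k\<in>UNIV. n k x * pd (k # ks @ js) w x))
        + bd_int (\<lambda>x. oper (Suc p) (tcoeff i (cmul (nprod ks) c)) z x * mixed 0 (ks @ js) w x)"
      using normal_tangential_split[OF a b[OF ks] r(1), of ks i] by simp
  qed
  also have "\<dots> = (\<Sum>ks | length ks = t. bd_int (\<lambda>x. oper p (cmul (nprod ks) c) z x * n i x * (\<Sum>k\<in>UNIV. n k x * pd (k # ks @ js) w x)))
     + (\<Sum>ks | length ks = t. bd_int (\<lambda>x. oper (Suc p) (tcoeff i (cmul (nprod ks) c)) z x * mixed 0 (ks @ js) w x))"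
    by (rule sum.distrib)
  also have "(\<Sum>ks | length ks = t. bd_int (\<lambda>x. oper p (cmul (nprod ks) c) z x * n i x * (\<Sum>k\<in>UNIV. n k x * pd (k # ks @ js) w x)))
    = bd_int (\<lambda>x. \<Sum>ks | length ks = t. oper p (cmul (nprod ks) c) z x * n i x * (\<Sum>k\<in>UNIV. n k x * pd (k # ks @ js) w x))"
    by (rule bd_int_sum[of _ 0, symmetric]) (intro CE_mult CE_0[OF a] cn Cext_sum open_\<Omega> pb, simp)
  also have "\<dots> = bd_int (\<lambda>x. oper p (cmul (n i) c) z x * mixed (Suc t) js w x)"
    by (rule bd_int_cong_interior) (simp add: mixed_Suc sum_distrib_left oper_cmul mult_ac)
  finally show ?thesis .
qed

text \<open>Induction on the number \<open>Q\<close> of derivatives on \<open>w\<close>, and for given \<open>Q\<close> on the number of those that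
  are not yet normal. Terms in which a tangential derivative has been moved have smaller \<open>Q\<close> and
  symbol 0; so a nonzero symbol is left for \<open>j = Q\<close> only. Every move costs one derivative of the
  coefficients, and the divergence theorem for second derivatives needs two more.\<close>
lemma reduce_to_normal_derivatives:
  assumes r: "m + 1 \<le> r"
  shows "t + length js = Q \<Longrightarrow> Q < m \<Longrightarrow> smooth_coeffs (Q + 2) (2 * m - 1 - Q) c \<Longrightarrow>
    normal_form m (\<lambda>z w. bd_int (\<lambda>x. oper (2 * m - 1 - Q) c z x * mixed t js w x))
      (\<lambda>j x. if j = Q then symbol_at_normal (2 * m - 1 - Q) c x * nprod js x else 0)"
proof (induction Q arbitrary: t js c rule: less_induct)
  case (less Q)
  note outer = less.IH
  from less.prems show ?case
  proof (induction js arbitrary: t c)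
    case Nil
    then have t: "t = Q" by simp
    show ?case unfolding normal_form_def
    proof (intro exI[of _ "\<lambda>j. if j = Q then c else (\<lambda>_ _. 0)"] conjI allI impI ballI)
      fix j assume "j < m"
      show "smooth_coeffs 0 (2 * m - 1 - j) (if j = Q then c else (\<lambda>_ _. 0))"
        using smooth_coeffs_le[OF Nil(3)] smooth_coeffs_zero by auto
      show "symbol_at_normal (2 * m - 1 - j) (if j = Q then c else (\<lambda>_ _. 0)) x = (if j = Q then symbol_at_normal (2 * m - 1 - Q) c x * nprod [] x else 0)" for x
        by (simp add: nprod_def)
    next
      fix z w
      have "(\<Sum>j<m. bd_int (\<lambda>x. oper (2 * m - 1 - j) (if j = Q then c else (\<lambda>_ _. 0)) z x * mixed j [] w x))
        = (\<Sum>j<m. if j = Q then bd_int (\<lambda>x. oper (2 * m - 1 - Q) c z x * mixed Q [] w x) else 0)"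
        by (intro sum.cong refl) (simp add: bd_int_zero)
      then show "bd_int (\<lambda>x. oper (2 * m - 1 - Q) c z x * mixed t [] w x)
        = (\<Sum>j<m. bd_int (\<lambda>x. oper (2 * m - 1 - j) (if j = Q then c else (\<lambda>_ _. 0)) z x * mixed j [] w x))"
        using Nil(2) by (simp add: t)
    qed
  next
    case (Cons i js)
    define p where "p = 2 * m - 1 - Q"
    have Q: "Q = Suc (t + length js)" using Cons.prems(1) by simp
    have p': "p = 2 * m - 2 - (t + length js)" using Q by (simp add: p_def)
    have Sp: "Suc p = 2 * m - 1 - (Q - 1)" using Q Cons.prems(2) by (simp add: p_def)
    have c: "smooth_coeffs (Q + 2) p c" using Cons.prems(3) by (simp add: p_def)
    have ci: "smooth_coeffs (Q + 2) p (cmul (n i) c)"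
      using c r Cons.prems(2) by (intro smooth_coeffs_cmul C_on_le[OF C_n]) auto
    have ck: "smooth_coeffs (Q + 1) (Suc p) (tcoeff i (cmul (nprod ks) c))" for ks
      using c r Cons.prems(2) by (intro smooth_coeffs_tcoeff smooth_coeffs_cmul C_nprod) auto
    have 1: "normal_form m (\<lambda>z w. bd_int (\<lambda>x. oper p (cmul (n i) c) z x * mixed (Suc t) js w x))
        (\<lambda>j x. if j = Q then symbol_at_normal p (cmul (n i) c) x * nprod js x else 0)"
      unfolding p_def using Q Cons.prems(2) ci by (intro Cons.IH) (auto simp: p_def)
    have 2: "normal_form m (\<lambda>z w. bd_int (\<lambda>x. oper (Suc p) (tcoeff i (cmul (nprod ks) c)) z x * mixed 0 (ks @ js) w x))
        (\<lambda>j x. if j = Q - 1 then symbol_at_normal (Suc p) (tcoeff i (cmul (nprod ks) c)) x * nprod (ks @ js) x else 0)"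
      if "ks \<in> {ks. length ks = t}" for ks
      unfolding Sp using Q Cons.prems(2) that ck[of ks, unfolded Sp] by (intro outer) auto
    have s0: "symbol_at_normal (Suc p) (tcoeff i (cmul (nprod ks) c)) x = 0" for ks x
      using c r Cons.prems(2) by (intro symbol_tcoeff[of 0] smooth_coeffs_cmul C_nprod smooth_coeffs_le[OF c]) auto
    show ?case unfolding p_def[symmetric]
    proof (rule normal_form_cong[OF normal_form_add[OF 1 normal_form_sum[OF finite_lists_eq[of t] 2]]])
      fix z w assume "CE (2 * m) z" "CE (2 * m) w"
      then show "bd_int (\<lambda>x. oper p c z x * mixed t (i # js) w x)
        = bd_int (\<lambda>x. oper p (cmul (n i) c) z x * mixed (Suc t) js w x)
        + (\<Sum>ks | length ks = t. bd_int (\<lambda>x. oper (Suc p) (tcoeff i (cmul (nprod ks) c)) z x * mixed 0 (ks @ js) w x))"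
        using Q Cons.prems(2) r c by (intro reduce_step[where m = m] p') (auto simp: numeral_3_eq_3)
    next
      fix j x
      show "(if j = Q then symbol_at_normal p (cmul (n i) c) x * nprod js x else 0)
        + (\<Sum>ks | length ks = t. if j = Q - 1 then symbol_at_normal (Suc p) (tcoeff i (cmul (nprod ks) c)) x * nprod (ks @ js) x else 0)
        = (if j = Q then symbol_at_normal p c x * nprod (i # js) x else 0)"
        by (simp add: s0 symbol_cmul nprod_def mult_ac cong: if_cong)
    qed
  qed
qed

section \<open>Green's identity\<close>

lemma vol_int_eq_lebesgue: "CE k f \<Longrightarrow> (\<integral>x. f x \<partial>lebesgue_on \<Omega>) = vol_int f"
proof -
  assume f: "CE k f"
  have "integrable lborel (\<lambda>x. indicator \<Omega> x *\<^sub>R f x)"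
    by (rule ext_on_integrable[OF open_\<Omega> bounded_\<Omega> Cext_ext_on[OF f]])
  from integral_completion[OF borel_measurable_integrable[OF this]]
  have "(\<integral>x. indicator \<Omega> x *\<^sub>R f x \<partial>lebesgue) = vol_int f" by (simp add: vol_int_def)
  moreover have "(\<integral>x. f x \<partial>lebesgue_on \<Omega>) = (\<integral>x. indicator \<Omega> x *\<^sub>R f x \<partial>lebesgue)"
    using open_\<Omega> by (intro integral_restrict_space) auto
  ultimately show ?thesis by simp
qed

lemma pd_cnj: "CE k f \<Longrightarrow> length is \<le> k \<Longrightarrow> x \<in> \<Omega> \<Longrightarrow> pd is (\<lambda>x. cnj (f x)) x = cnj (pd is f x)"
proof (induction "is" arbitrary: x)
  case (Cons i "is")
  have "pd (i # is) (\<lambda>x. cnj (f x)) x = partial i (\<lambda>x. cnj (pd is f x)) x"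
    using Cons unfolding pd_Cons by (intro partial_cong[OF open_\<Omega>]) auto
  also have "\<dots> = cnj (partial i (pd is f) x)"
    using Cons.prems by (intro partial_linear[where V = "closure \<Omega>" and k = 0, OF bounded_linear_cnj _ Cons.prems(3)] Cext_pd_le[of _ k]) auto
  finally show ?case by simp
qed simp

lemma iterated_dir_deriv:
  "CE k f \<Longrightarrow> j \<le> k \<Longrightarrow> x \<in> \<Omega> \<Longrightarrow>
    (dir_deriv v ^^ j) f x = (\<Sum>is | length is = j. of_real (prod_list (map (\<lambda>i. v $ i) is)) * pd is f x)"
proof (induction j arbitrary: x)
  case 0
  then show ?case by simp
next
  case (Suc j)
  define g where "g x = (\<Sum>is | length is = j. of_real (prod_list (map (\<lambda>i. v $ i) is)) * pd is f x)" for x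
  have p1: "CE (Suc 0) (pd is f)" if "length is = j" for "is"
    using Suc.prems(1) by (rule Cext_pd_le) (use that Suc.prems in simp)
  have c1: "CE (Suc 0) (\<lambda>_. c)" for c by (rule Cext_const[OF open_\<Omega>])
  have g1: "CE (Suc 0) g" unfolding g_def by (intro Cext_sum open_\<Omega> CE_mult c1 p1) simp
  have pg: "partial i g x = (\<Sum>is | length is = j. of_real (prod_list (map (\<lambda>i. v $ i) is)) * pd (i # is) f x)" for i
  proof -
    have "partial i g x = (\<Sum>is | length is = j. partial i (\<lambda>x. of_real (prod_list (map (\<lambda>i. v $ i) is)) * pd is f x) x)"
      unfolding g_def[abs_def] by (rule partial_sum[of _ "closure \<Omega>" 0, OF _ Suc.prems(3)]) (intro CE_mult c1 p1, simp)
    also have "\<dots> = (\<Sum>is | length is = j. of_real (prod_list (map (\<lambda>i. v $ i) is)) * pd (i # is) f x)"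
      by (intro sum.cong refl) (simp add: partial_mult[OF c1 p1 Suc.prems(3)])
    finally show ?thesis .
  qed
  have "(dir_deriv v ^^ Suc j) f x = dir_deriv v ((dir_deriv v ^^ j) f) x" by simp
  also have "\<dots> = dir_deriv v g x"
    using Suc by (intro partial_cong[OF open_\<Omega>]) (auto simp: g_def)
  also have "\<dots> = (\<Sum>i\<in>UNIV. (v $ i) *\<^sub>R partial i g x)"
    using Cext_imp_C_on[OF g1 closure_subset] by (intro dir_deriv_eq_sum_partial[OF _ open_\<Omega> Suc.prems(3)]) simp
  also have "\<dots> = (\<Sum>i\<in>UNIV. \<Sum>is | length is = j. of_real (prod_list (map (\<lambda>i. v $ i) (i # is))) * pd (i # is) f x)"
    by (simp add: pg scaleR_conv_of_real sum_distrib_left mult.assoc)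
  also have "\<dots> = (\<Sum>(i, is)\<in>UNIV \<times> {is. length is = j}. of_real (prod_list (map (\<lambda>i. v $ i) (i # is))) * pd (i # is) f x)"
    by (rule sum.cartesian_product)
  also have "\<dots> = (\<Sum>is | length is = Suc j. of_real (prod_list (map (\<lambda>i. v $ i) is)) * pd is f x)"
  proof -
    have "{is :: 'n list. length is = Suc j} = (\<lambda>(i, is). i # is) ` (UNIV \<times> {is. length is = j})"
      by (auto simp: length_Suc_conv)
    moreover have "inj_on (\<lambda>(i, is). i # is) (UNIV \<times> {is :: 'n list. length is = j})" by (auto simp: inj_on_def)
    ultimately show ?thesis by (simp add: sum.reindex case_prod_unfold)
  qed
  finally show ?case .
qed

text \<open>\<open>normal_deriv\<close> differentiates in a direction that is fixed at \<open>x\<close>, and so does \<open>mixed\<close>, whose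
  factors \<open>n\<close> stand outside the derivatives; both agree after passing to boundary values.\<close>
lemma normal_deriv_eq:
  assumes v: "CE k v" and j: "j \<le> k" and x: "x \<in> frontier \<Omega>"
  shows "cnj (normal_deriv \<Omega> j v x) = boundary_value \<Omega> (mixed j [] (\<lambda>x. cnj (v x))) x"
proof -
  let ?c = "\<lambda>is. of_real (prod_list (map (\<lambda>i. \<nu> x $ i) is)) :: complex"
  have p0: "CE 0 (pd is u)" if "length is = j" "CE k u" for "is" u
    using that(2) by (rule Cext_pd_le) (use that j in simp)
  have cv: "CE k (\<lambda>x. cnj (v x))" by (rule Cext_cnj[OF open_\<Omega> v])
  have tc: "boundary_value \<Omega> (\<lambda>y. c) x = c" for c by (rule boundary_value_continuous[OF open_\<Omega> x]) simp
  have npx: "nprod is x = ?c is" for "is"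
    unfolding nprod_def n_def by (induction "is") auto
  have "normal_deriv \<Omega> j v x = boundary_value \<Omega> (\<lambda>y. \<Sum>is | length is = j. ?c is * pd is v y) x"
    unfolding normal_deriv_def \<nu>_normal[OF x, symmetric]
    by (rule boundary_value_cong[OF open_\<Omega> x]) (rule iterated_dir_deriv[OF v j])
  also have "\<dots> = (\<Sum>is | length is = j. boundary_value \<Omega> (\<lambda>y. ?c is * pd is v y) x)"
    by (rule boundary_value_sum[OF open_\<Omega> x], rule Cext_ext_on[of _ 0]) (intro CE_mult Cext_const open_\<Omega> p0 v, simp)
  also have "\<dots> = (\<Sum>is | length is = j. ?c is * boundary_value \<Omega> (pd is v) x)"
    by (intro sum.cong refl) (subst boundary_value_mult[OF open_\<Omega> x ext_on_const Cext_ext_on[OF p0[OF _ v]]], simp_all add: tc)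
  finally have "cnj (normal_deriv \<Omega> j v x) = (\<Sum>is | length is = j. ?c is * cnj (boundary_value \<Omega> (pd is v) x))"
    by simp
  also have "\<dots> = (\<Sum>is | length is = j. ?c is * boundary_value \<Omega> (pd is (\<lambda>x. cnj (v x))) x)"
  proof (intro sum.cong refl)
    fix "is" assume "is \<in> {is :: 'n list. length is = j}"
    then have l: "length is = j" by simp
    have "boundary_value \<Omega> (pd is (\<lambda>x. cnj (v x))) x = boundary_value \<Omega> (\<lambda>y. cnj (pd is v y)) x"
      using l j by (intro boundary_value_cong[OF open_\<Omega> x] pd_cnj[OF v]) auto
    then show "?c is * cnj (boundary_value \<Omega> (pd is v) x) = ?c is * boundary_value \<Omega> (pd is (\<lambda>x. cnj (v x))) x"
      by (simp add: boundary_value_cnj[OF open_\<Omega> x Cext_ext_on[OF p0[OF l v]]])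
  qed
  also have "\<dots> = (\<Sum>is | length is = j. boundary_value \<Omega> (\<lambda>y. nprod is y * pd (is @ []) (\<lambda>x. cnj (v x)) y) x)"
  proof (intro sum.cong refl)
    fix "is" assume "is \<in> {is :: 'n list. length is = j}"
    then have l: "length is = j" by simp
    have "continuous_on UNIV (nprod is)" using C_nprod[of 0] by simp
    then have "boundary_value \<Omega> (nprod is) x = ?c is" using boundary_value_continuous[OF open_\<Omega> x] npx by simp
    then show "?c is * boundary_value \<Omega> (pd is (\<lambda>x. cnj (v x))) x = boundary_value \<Omega> (\<lambda>y. nprod is y * pd (is @ []) (\<lambda>x. cnj (v x)) y) x"
      using boundary_value_mult[OF open_\<Omega> x Cext_ext_on[OF CE_nprod[of 0]] Cext_ext_on[OF p0[OF l cv]]] by simp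
  qed
  also have "\<dots> = boundary_value \<Omega> (mixed j [] (\<lambda>x. cnj (v x))) x"
    unfolding mixed_def
    by (rule boundary_value_sum[OF open_\<Omega> x, symmetric], rule Cext_ext_on[of _ 0]) (simp only: append_Nil2 mem_Collect_eq, intro CE_mult CE_nprod p0 cv, simp_all only: le0)
  finally show ?thesis .
qed

text \<open>For the list \<open>L\<close> of a multi-index, the boundary term of step \<open>q\<close> has \<open>Q q\<close> derivatives on \<open>w\<close> and
  \<open>2 * length L - 1 - Q q\<close> on \<open>z\<close>. The latter is the top order \<open>2m - 1 - Q q\<close> exactly when the
  length is \<open>m\<close>, and then the directions of the \<open>z\<close> factor, the \<open>w\<close> factor and the normal
  component together are two copies of \<open>L\<close>.\<close>
lemma normal_form_by_parts:
  assumes r: "m + 1 \<le> r" and L: "length L \<le> m"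
  shows "normal_form m (\<lambda>z w. \<Sum>q<length L. (-1) ^ q * bd_int (\<lambda>x. pd (rev (take q L)) (pd L z) x * pd (drop (Suc q) L) w x * n (L ! q) x))
    (\<lambda>j x. if length L = m then (-1) ^ (m - 1 - j) * (nprod L x)\<^sup>2 else 0)"
proof -
  define Q where "Q q = length L - Suc q" for q
  define ls where "ls q = rev (take q L) @ L" for q
  define c where "c q = (\<lambda>is x. if is = ls q then (-1) ^ q * n (L ! q) x else 0)" for q
  have len: "length (ls q) = q + length L" if "q < length L" for q using that by (simp add: ls_def)
  have lsp: "length (ls q) \<le> 2 * m - 1 - Q q" if "q < length L" for q
    using len[OF that] that L by (simp add: Q_def)
  have smooth_coeffs: "smooth_coeffs (Q q + 2) (2 * m - 1 - Q q) (c q)" if q: "q < length L" for q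
    unfolding smooth_coeffs_def
  proof (intro conjI allI impI)
    fix "is"
    have "Cext UNIV (Q q + 2) UNIV (\<lambda>x. (-1) ^ q * n (L ! q) x)"
      using C_on_le[OF C_n, of "Q q + 2"] q L r
      by (intro Cext_mult Cext_const open_UNIV) (simp_all add: C_on_eq_Cext Q_def)
    then show "C_on (Q q + 2) UNIV (c q is)"
      unfolding c_def C_on_eq_Cext by (cases "is = ls q") (simp_all add: Cext_const)
    assume "length is > 2 * m - 1 - Q q"
    then have "is \<noteq> ls q" using lsp[OF q] by auto
    then show "c q is = (\<lambda>_. 0)" by (simp add: c_def)
  qed
  have op: "oper (2 * m - 1 - Q q) (c q) z x = (-1) ^ q * n (L ! q) x * pd (ls q) z x" if "q < length L" for q z x
  proof -
    have "oper (2 * m - 1 - Q q) (c q) z x = (\<Sum>is | length is \<le> 2 * m - 1 - Q q. if is = ls q then (-1) ^ q * n (L ! q) x * pd (ls q) z x else 0)"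
      unfolding oper_def by (intro sum.cong) (auto simp: c_def)
    then show ?thesis using lsp[OF that] by (simp add: finite_lists_le)
  qed
  have sy: "symbol_at_normal (2 * m - 1 - Q q) (c q) x * nprod (drop (Suc q) L) x = (if length L = m then (-1) ^ q * (nprod L x)\<^sup>2 else 0)"
    if q: "q < length L" for q x
  proof -
    have "symbol_at_normal (2 * m - 1 - Q q) (c q) x = (\<Sum>is | length is = 2 * m - 1 - Q q. if is = ls q then (-1) ^ q * n (L ! q) x * nprod (ls q) x else 0)"
      unfolding symbol_at_normal_def by (intro sum.cong) (auto simp: c_def)
    then have 1: "symbol_at_normal (2 * m - 1 - Q q) (c q) x = (if length (ls q) = 2 * m - 1 - Q q then (-1) ^ q * n (L ! q) x * nprod (ls q) x else 0)"
      by (simp add: finite_lists_eq)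
    have 2: "length (ls q) = 2 * m - 1 - Q q \<longleftrightarrow> length L = m"
      using len[OF q] q L by (auto simp: Q_def)
    have "nprod L x = nprod (take q L @ L ! q # drop (Suc q) L) x" using q by (simp add: id_take_nth_drop[symmetric])
    also have "\<dots> = nprod (rev (take q L)) x * n (L ! q) x * nprod (drop (Suc q) L) x"
      by (simp add: nprod_def rev_map[symmetric] prod_list.rev)
    finally show ?thesis unfolding 1 2 by (simp add: ls_def nprod_def power2_eq_square)
  qed
  have "normal_form m (\<lambda>z w. \<Sum>q<length L. bd_int (\<lambda>x. oper (2 * m - 1 - Q q) (c q) z x * mixed 0 (drop (Suc q) L) w x))
      (\<lambda>j x. \<Sum>q<length L. if j = Q q then symbol_at_normal (2 * m - 1 - Q q) (c q) x * nprod (drop (Suc q) L) x else 0)"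
    using r L smooth_coeffs by (intro normal_form_sum reduce_to_normal_derivatives) (auto simp: Q_def)
  then show ?thesis
  proof (rule normal_form_cong)
    fix z w assume z: "CE (2 * m) z" and w: "CE (2 * m) w"
    show "(\<Sum>q<length L. (-1) ^ q * bd_int (\<lambda>x. pd (rev (take q L)) (pd L z) x * pd (drop (Suc q) L) w x * n (L ! q) x))
      = (\<Sum>q<length L. bd_int (\<lambda>x. oper (2 * m - 1 - Q q) (c q) z x * mixed 0 (drop (Suc q) L) w x))"
    proof (intro sum.cong refl)
      fix q assume "q \<in> {..<length L}"
      then have q: "q < length L" by simp
      let ?f = "\<lambda>x. pd (rev (take q L)) (pd L z) x * pd (drop (Suc q) L) w x * n (L ! q) x"
      have f: "CE 0 ?f"
        unfolding pd_append[symmetric] using q L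
        by (intro CE_mult CE_n Cext_pd_le[OF z] Cext_pd_le[OF w]) auto
      have "(-1) ^ q * bd_int ?f = surface_integral \<Omega> (\<lambda>x. (-1) ^ q * boundary_value \<Omega> ?f x)"
        unfolding bd_int_def by (rule surface_integral_mult[symmetric])
      also have "\<dots> = bd_int (\<lambda>x. (-1) ^ q * ?f x)"
        unfolding bd_int_def
        by (rule surface_integral_cong)
           (subst boundary_value_mult[OF open_\<Omega> _ ext_on_const Cext_ext_on[OF f]], simp_all add: boundary_value_continuous[OF open_\<Omega>])
      also have "\<dots> = bd_int (\<lambda>x. oper (2 * m - 1 - Q q) (c q) z x * mixed 0 (drop (Suc q) L) w x)"
        by (rule bd_int_cong_interior, unfold op[OF q]) (simp add: mixed_0 ls_def pd_append)
      finally show "(-1) ^ q * bd_int ?f = bd_int (\<lambda>x. oper (2 * m - 1 - Q q) (c q) z x * mixed 0 (drop (Suc q) L) w x)" .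
    qed
  next
    fix j x assume j: "j < m"
    have "(\<Sum>q<length L. if j = Q q then symbol_at_normal (2 * m - 1 - Q q) (c q) x * nprod (drop (Suc q) L) x else 0)
      = (\<Sum>q<length L. if q = m - 1 - j then (if length L = m then (-1) ^ (m - 1 - j) * (nprod L x)\<^sup>2 else 0) else 0)"
    proof (intro sum.cong refl)
      fix q assume "q \<in> {..<length L}"
      then have q: "q < length L" by simp
      show "(if j = Q q then symbol_at_normal (2 * m - 1 - Q q) (c q) x * nprod (drop (Suc q) L) x else 0)
        = (if q = m - 1 - j then (if length L = m then (-1) ^ (m - 1 - j) * (nprod L x)\<^sup>2 else 0) else 0)"
      proof (cases "length L = m")
        case True
        then have "j = Q q \<longleftrightarrow> q = m - 1 - j" using q j by (auto simp: Q_def)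
        then show ?thesis unfolding sy[OF q] using True by auto
      next
        case False
        then show ?thesis unfolding sy[OF q] by simp
      qed
    qed
    also have "\<dots> = (if length L = m then (-1) ^ (m - 1 - j) * (nprod L x)\<^sup>2 else 0)"
      using j by auto
    finally show "(\<Sum>q<length L. if j = Q q then symbol_at_normal (2 * m - 1 - Q q) (c q) x * nprod (drop (Suc q) L) x else 0)
      = (if length L = m then (-1) ^ (m - 1 - j) * (nprod L x)\<^sup>2 else 0)" .
  qed
qed

lemma green_volume:
  assumes z: "CE (2 * m) z" and v: "CE (2 * m) v"
  shows "(\<Sum>\<alpha> | mi_order \<alpha> \<le> m. L2_inner \<Omega> (mi_deriv \<alpha> z) (mi_deriv \<alpha> v)) = L2_inner \<Omega> (B_op m z) v
    + (\<Sum>\<alpha> | mi_order \<alpha> \<le> m. \<Sum>q<length (mi_list \<alpha>). (-1) ^ q *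
        bd_int (\<lambda>x. pd (rev (take q (mi_list \<alpha>))) (pd (mi_list \<alpha>) z) x * pd (drop (Suc q) (mi_list \<alpha>)) (\<lambda>x. cnj (v x)) x * n (mi_list \<alpha> ! q) x))"
proof -
  define w where "w x = cnj (v x)" for x
  have w: "CE (2 * m) w" unfolding w_def by (rule Cext_cnj[OF open_\<Omega> v])
  let ?L = "\<lambda>\<alpha>::'n \<Rightarrow> nat. mi_list \<alpha>"
  have pz: "CE 0 (pd is z)" "CE 0 (pd is v)" "CE 0 (pd is w)" if "length is \<le> 2 * m" for "is"
  proof -
    show "CE 0 (pd is z)" by (rule Cext_pd_le[OF z]) (use that in simp)
    show "CE 0 (pd is v)" by (rule Cext_pd_le[OF v]) (use that in simp)
    show "CE 0 (pd is w)" by (rule Cext_pd_le[OF w]) (use that in simp)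
  qed
  have w0: "CE 0 w" using pz(3)[of "[]"] by simp
  have "L2_inner \<Omega> (mi_deriv \<alpha> z) (mi_deriv \<alpha> v) = vol_int (\<lambda>x. (-1) ^ mi_order \<alpha> * (mi_deriv (\<lambda>i. 2 * \<alpha> i) z x * w x))
    + (\<Sum>q<length (?L \<alpha>). (-1) ^ q * bd_int (\<lambda>x. pd (rev (take q (?L \<alpha>))) (pd (?L \<alpha>) z) x * pd (drop (Suc q) (?L \<alpha>)) w x * n (?L \<alpha> ! q) x))"
    if \<alpha>: "mi_order \<alpha> \<le> m" for \<alpha>
  proof -
    have l: "length (?L \<alpha>) \<le> m" using \<alpha> by (simp add: length_mi_list)
    have "L2_inner \<Omega> (mi_deriv \<alpha> z) (mi_deriv \<alpha> v) = vol_int (\<lambda>x. pd (?L \<alpha>) z x * cnj (pd (?L \<alpha>) v x))"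
      unfolding L2_inner_def mi_deriv_eq_pd using l by (intro vol_int_eq_lebesgue[of 0] CE_mult pz Cext_cnj open_\<Omega>) auto
    also have "\<dots> = vol_int (\<lambda>x. pd (?L \<alpha>) z x * pd (?L \<alpha>) w x)"
      using l by (intro vol_int_cong) (auto simp: w_def[abs_def] pd_cnj[OF v])
    also have "\<dots> = (-1) ^ length (?L \<alpha>) * vol_int (\<lambda>x. pd (rev (?L \<alpha>)) (pd (?L \<alpha>) z) x * w x)
      + (\<Sum>q<length (?L \<alpha>). (-1) ^ q * bd_int (\<lambda>x. pd (rev (take q (?L \<alpha>))) (pd (?L \<alpha>) z) x * pd (drop (Suc q) (?L \<alpha>)) w x * n (?L \<alpha> ! q) x))"
      using l by (intro by_parts_list Cext_pd_le[OF z] Cext_le[OF w]) auto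
    also have "vol_int (\<lambda>x. pd (rev (?L \<alpha>)) (pd (?L \<alpha>) z) x * w x) = vol_int (\<lambda>x. mi_deriv (\<lambda>i. 2 * \<alpha> i) z x * w x)"
    proof (rule vol_int_cong)
      fix x assume x: "x \<in> \<Omega>"
      have "mset (rev (?L \<alpha>) @ ?L \<alpha>) = mset (?L (\<lambda>i. 2 * \<alpha> i))"
        by (rule multiset_eqI) (simp add: count_mi_list)
      from pd_permute[OF open_\<Omega> Cext_imp_C_on[OF z closure_subset] this _ x] l
      show "pd (rev (?L \<alpha>)) (pd (?L \<alpha>) z) x * w x = mi_deriv (\<lambda>i. 2 * \<alpha> i) z x * w x"
        by (simp add: pd_append mi_deriv_eq_pd)
    qed
    finally show ?thesis by (simp add: vol_int_cmult length_mi_list)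
  qed
  then have "(\<Sum>\<alpha> | mi_order \<alpha> \<le> m. L2_inner \<Omega> (mi_deriv \<alpha> z) (mi_deriv \<alpha> v))
    = (\<Sum>\<alpha> | mi_order \<alpha> \<le> m. vol_int (\<lambda>x. (-1) ^ mi_order \<alpha> * (mi_deriv (\<lambda>i. 2 * \<alpha> i) z x * w x)))
    + (\<Sum>\<alpha> | mi_order \<alpha> \<le> m. \<Sum>q<length (?L \<alpha>). (-1) ^ q * bd_int (\<lambda>x. pd (rev (take q (?L \<alpha>))) (pd (?L \<alpha>) z) x * pd (drop (Suc q) (?L \<alpha>)) w x * n (?L \<alpha> ! q) x))"
    by (simp add: sum.distrib)
  also have "(\<Sum>\<alpha> | mi_order \<alpha> \<le> m. vol_int (\<lambda>x. (-1) ^ mi_order \<alpha> * (mi_deriv (\<lambda>i. 2 * \<alpha> i) z x * w x))) = L2_inner \<Omega> (B_op m z) v"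
  proof -
    have t: "CE 0 (\<lambda>x. (-1) ^ mi_order \<alpha> * (mi_deriv (\<lambda>i. 2 * \<alpha> i) z x * w x))" if "mi_order \<alpha> \<le> m" for \<alpha>
    proof -
      have "mi_order (\<lambda>i. 2 * \<alpha> i) = 2 * mi_order \<alpha>" by (simp add: mi_order_def sum_distrib_left)
      then show ?thesis unfolding mi_deriv_eq_pd using that
        by (intro CE_mult Cext_const open_\<Omega> pz w0) (simp add: length_mi_list)
    qed
    have "(\<Sum>\<alpha> | mi_order \<alpha> \<le> m. vol_int (\<lambda>x. (-1) ^ mi_order \<alpha> * (mi_deriv (\<lambda>i. 2 * \<alpha> i) z x * w x)))
      = vol_int (\<lambda>x. \<Sum>\<alpha> | mi_order \<alpha> \<le> m. (-1) ^ mi_order \<alpha> * (mi_deriv (\<lambda>i. 2 * \<alpha> i) z x * w x))"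
      by (rule vol_int_sum[of _ 0, symmetric]) (use t in simp)
    also have "\<dots> = vol_int (\<lambda>x. B_op m z x * cnj (v x))"
      by (rule vol_int_cong) (simp add: B_op_def w_def sum_distrib_right mult.assoc)
    also have "\<dots> = L2_inner \<Omega> (B_op m z) v"
      unfolding L2_inner_def
    proof (rule vol_int_eq_lebesgue[of 0, symmetric])
      have "CE 0 (\<lambda>x. \<Sum>\<alpha> | mi_order \<alpha> \<le> m. (-1) ^ mi_order \<alpha> * (mi_deriv (\<lambda>i. 2 * \<alpha> i) z x * w x))"
        by (intro Cext_sum open_\<Omega> t) simp
      then show "CE 0 (\<lambda>x. B_op m z x * cnj (v x))"
        by (rule Cext_cong[OF open_\<Omega>]) (simp add: B_op_def w_def sum_distrib_right mult.assoc)
    qed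
    finally show ?thesis .
  qed
  finally show ?thesis by (simp add: w_def[abs_def])
qed

text \<open>All summands are squares of real numbers, and the multi-index that takes \<open>m\<close> times a direction
  in which the normal has a nonzero component gives a positive one.\<close>
lemma symbol_nonzero:
  assumes x: "x \<in> frontier \<Omega>"
  shows "(\<Sum>\<alpha> | mi_order \<alpha> = m. (nprod (mi_list \<alpha>) x)\<^sup>2) \<noteq> 0"
proof -
  obtain i where i: "\<nu> x $ i \<noteq> 0"
  proof -
    have "\<not> (\<forall>k. n k x = 0)"
    proof
      assume "\<forall>k. n k x = 0"
      then have "(\<Sum>k\<in>UNIV. n k x * n k x) = 0" by simp
      then show False using sum_n_squares[OF x] by simp
    qed
    then show ?thesis using that by (auto simp: n_def)
  qed
  let ?p = "\<lambda>\<alpha>. prod_list (map (\<lambda>i. \<nu> x $ i) (mi_list \<alpha>))"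
  have np: "nprod is x = of_real (prod_list (map (\<lambda>i. \<nu> x $ i) is))" for "is"
    unfolding nprod_def n_def by (induction "is") auto
  define \<beta> where "\<beta> j = (if j = i then m else 0)" for j
  have \<beta>: "mi_order \<beta> = m" by (simp add: \<beta>_def mi_order_def)
  have "set (mi_list \<beta>) \<subseteq> {i}"
  proof
    fix j assume "j \<in> set (mi_list \<beta>)"
    then have "count (mset (mi_list \<beta>)) j \<noteq> 0" by simp
    then have "\<beta> j \<noteq> 0" unfolding count_mi_list .
    then show "j \<in> {i}" by (auto simp: \<beta>_def split: if_splits)
  qed
  then have "?p \<beta> \<noteq> 0" using i by (auto simp: prod_list_zero_iff)
  moreover have "finite {\<alpha> :: 'n \<Rightarrow> nat. mi_order \<alpha> = m}"
    by (rule finite_subset[OF _ finite_mi_order_le[of m]]) auto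
  ultimately have "(\<Sum>\<alpha> | mi_order \<alpha> = m. (?p \<alpha>)\<^sup>2) > 0"
    using \<beta> by (intro sum_pos2[of _ \<beta>]) auto
  then have "complex_of_real (\<Sum>\<alpha> | mi_order \<alpha> = m. (?p \<alpha>)\<^sup>2) \<noteq> 0" unfolding of_real_eq_0_iff by linarith
  then show ?thesis by (simp add: np)
qed

text \<open>The operators are given by coefficients of lists; adding these over the lists with a common
  multi-index gives coefficients in the sense of \<open>boundary_op\<close>.\<close>
theorem green:
  assumes r: "m + 1 \<le> r"
  shows "\<exists>d. (\<forall>k\<in>{m..<2 * m}. non_characteristic \<Omega> k (d k)) \<and> green_identity \<Omega> m d"
proof -
  let ?A = "{\<alpha> :: 'n \<Rightarrow> nat. mi_order \<alpha> \<le> m}"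
  have "normal_form m (\<lambda>z w. \<Sum>\<alpha>\<in>?A. \<Sum>q<length (mi_list \<alpha>). (-1) ^ q *
        bd_int (\<lambda>x. pd (rev (take q (mi_list \<alpha>))) (pd (mi_list \<alpha>) z) x * pd (drop (Suc q) (mi_list \<alpha>)) w x * n (mi_list \<alpha> ! q) x))
      (\<lambda>j x. \<Sum>\<alpha>\<in>?A. if length (mi_list \<alpha>) = m then (-1) ^ (m - 1 - j) * (nprod (mi_list \<alpha>) x)\<^sup>2 else 0)"
    by (intro normal_form_sum finite_mi_order_le normal_form_by_parts r) (simp add: length_mi_list)
  then obtain c where c: "\<forall>j<m. smooth_coeffs 0 (2 * m - 1 - j) (c j)"
     "\<forall>j<m. \<forall>x\<in>frontier \<Omega>. symbol_at_normal (2 * m - 1 - j) (c j) x = (\<Sum>\<alpha>\<in>?A. if length (mi_list \<alpha>) = m then (-1) ^ (m - 1 - j) * (nprod (mi_list \<alpha>) x)\<^sup>2 else 0)"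
     "\<forall>z w. CE (2 * m) z \<longrightarrow> CE (2 * m) w \<longrightarrow> (\<Sum>\<alpha>\<in>?A. \<Sum>q<length (mi_list \<alpha>). (-1) ^ q *
        bd_int (\<lambda>x. pd (rev (take q (mi_list \<alpha>))) (pd (mi_list \<alpha>) z) x * pd (drop (Suc q) (mi_list \<alpha>)) w x * n (mi_list \<alpha> ! q) x))
       = (\<Sum>j<m. bd_int (\<lambda>x. oper (2 * m - 1 - j) (c j) z x * mixed j [] w x))"
    unfolding normal_form_def by blast
  define d where "d k \<alpha> x = (\<Sum>is | length is \<le> k \<and> mi_of is = \<alpha>. c (2 * m - 1 - k) is x)" for k \<alpha> x
  have mi_of_prod: "of_real (mi_power (outer_normal \<Omega> x) (mi_of is)) = nprod is x" if "x \<in> frontier \<Omega>" for x "is"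
  proof -
    have "(\<Prod>i\<in>UNIV. (\<nu> x $ i) ^ count (mset is) i) = prod_list (map (\<lambda>i. \<nu> x $ i) is)"
    proof (induction "is")
      case (Cons a "is")
      have "(\<nu> x $ i) ^ count (mset (a # is)) i = (if i = a then \<nu> x $ i else 1) * (\<nu> x $ i) ^ count (mset is) i" for i
        by simp
      then show ?case using Cons.IH by (simp only: prod.distrib) simp
    qed simp
    moreover have "nprod is x = of_real (prod_list (map (\<lambda>i. \<nu> x $ i) is))"
      unfolding nprod_def n_def by (induction "is") auto
    ultimately show ?thesis using \<nu>_normal[OF that] by (simp add: mi_power_def mi_of_def)
  qed
  have nonchar: "non_characteristic \<Omega> k (d k)" if k: "k \<in> {m..<2 * m}" for k
    unfolding non_characteristic_def
  proof
    fix x assume x: "x \<in> frontier \<Omega>"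
    define j where "j = 2 * m - 1 - k"
    have j: "j < m" "k = 2 * m - 1 - j" using k by (auto simp: j_def)
    have "(\<Sum>\<alpha> | mi_order \<alpha> = k. d k \<alpha> x * of_real (mi_power (outer_normal \<Omega> x) \<alpha>))
      = (\<Sum>\<alpha> | mi_order \<alpha> = k. \<Sum>is | is \<in> {is. length is = k} \<and> mi_of is = \<alpha>. c j is x * nprod is x)"
    proof (intro sum.cong refl)
      fix \<alpha> :: "'n \<Rightarrow> nat" assume "\<alpha> \<in> {\<alpha>. mi_order \<alpha> = k}"
      then have "length is = k" if "mi_of is = \<alpha>" for "is" :: "'n list"
        using mi_order_mi_of[of "is"] that by simp
      then have "{is. length is \<le> k \<and> mi_of is = \<alpha>} = {is. is \<in> {is. length is = k} \<and> mi_of is = \<alpha>}" by auto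
      then show "d k \<alpha> x * of_real (mi_power (outer_normal \<Omega> x) \<alpha>)
        = (\<Sum>is | is \<in> {is. length is = k} \<and> mi_of is = \<alpha>. c j is x * nprod is x)"
        unfolding d_def sum_distrib_right j_def[symmetric]
        by (intro sum.cong) (auto simp: mi_of_prod[OF x, symmetric])
    qed
    also have "\<dots> = (\<Sum>is | length is = k. c j is x * nprod is x)"
      using finite_mi_order_le[of k] by (intro sum.group finite_lists_eq) (auto elim: finite_subset[rotated])
    also have "\<dots> = (\<Sum>\<alpha>\<in>?A. if length (mi_list \<alpha>) = m then (-1) ^ (m - 1 - j) * (nprod (mi_list \<alpha>) x)\<^sup>2 else 0)"
      using c(2) j x unfolding symbol_at_normal_def by auto
    also have "\<dots> = (\<Sum>\<alpha>\<in>{\<alpha>\<in>?A. length (mi_list \<alpha>) = m}. (-1) ^ (m - 1 - j) * (nprod (mi_list \<alpha>) x)\<^sup>2)"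
      by (rule sum.inter_filter[symmetric, OF finite_mi_order_le])
    also have "{\<alpha>\<in>?A. length (mi_list \<alpha>) = m} = {\<alpha>. mi_order \<alpha> = m}" by (auto simp: length_mi_list)
    also have "(\<Sum>\<alpha> | mi_order \<alpha> = m. (-1) ^ (m - 1 - j) * (nprod (mi_list \<alpha>) x)\<^sup>2)
      = (-1) ^ (m - 1 - j) * (\<Sum>\<alpha> | mi_order \<alpha> = m. (nprod (mi_list \<alpha>) x)\<^sup>2)"
      by (rule sum_distrib_left[symmetric])
    also have "\<dots> \<noteq> 0" using symbol_nonzero[OF x] by simp
    finally show "(\<Sum>\<alpha> | mi_order \<alpha> = k. d k \<alpha> x * of_real (mi_power (outer_normal \<Omega> x) \<alpha>)) \<noteq> 0" .
  qed
  have bop: "boundary_op \<Omega> (2 * m - 1 - j) (d (2 * m - 1 - j)) z x = boundary_value \<Omega> (oper (2 * m - 1 - j) (c j) z) x"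
    if j: "j < m" and z: "CE (2 * m) z" and x: "x \<in> frontier \<Omega>" for j z x
  proof -
    let ?k = "2 * m - 1 - j"
    have jk: "2 * m - 1 - ?k = j" using j by simp
    have pz: "CE 0 (pd is z)" if "length is \<le> ?k" for "is" using z by (rule Cext_pd_le) (use that in simp)
    have cc: "C_on 0 UNIV (c j is)" for "is" using c(1) j unfolding smooth_coeffs_def by blast
    have "boundary_op \<Omega> ?k (d ?k) z x = (\<Sum>\<alpha> | mi_order \<alpha> \<le> ?k. \<Sum>is | is \<in> {is. length is \<le> ?k} \<and> mi_of is = \<alpha>.
        c j is x * boundary_value \<Omega> (pd is z) x)"
      unfolding boundary_op_def
    proof (intro sum.cong refl)
      fix \<alpha> :: "'n \<Rightarrow> nat"
      have "boundary_value \<Omega> (mi_deriv (mi_of is) z) x = boundary_value \<Omega> (pd is z) x" if "length is \<le> ?k" for "is"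
        using that by (intro boundary_value_cong[OF open_\<Omega> x] mi_deriv_mi_of[OF open_\<Omega> Cext_imp_C_on[OF z closure_subset]]) auto
      then show "d ?k \<alpha> x * boundary_value \<Omega> (mi_deriv \<alpha> z) x
        = (\<Sum>is | is \<in> {is. length is \<le> ?k} \<and> mi_of is = \<alpha>. c j is x * boundary_value \<Omega> (pd is z) x)"
        unfolding d_def jk sum_distrib_right by (intro sum.cong) auto
    qed
    also have "\<dots> = (\<Sum>is | length is \<le> ?k. c j is x * boundary_value \<Omega> (pd is z) x)"
      by (intro sum.group finite_lists_le finite_mi_order_le) auto
    also have "\<dots> = (\<Sum>is | length is \<le> ?k. boundary_value \<Omega> (\<lambda>y. c j is y * pd is z y) x)"
    proof (intro sum.cong refl)
      fix "is" assume "is \<in> {is :: 'n list. length is \<le> ?k}"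
      then have p0: "CE 0 (pd is z)" using pz by blast
      have "boundary_value \<Omega> (c j is) x = c j is x"
        using cc[of "is"] by (intro boundary_value_continuous[OF open_\<Omega> x]) simp
      then show "c j is x * boundary_value \<Omega> (pd is z) x = boundary_value \<Omega> (\<lambda>y. c j is y * pd is z y) x"
        using boundary_value_mult[OF open_\<Omega> x Cext_ext_on[OF CE_of_C_on[OF cc]] Cext_ext_on[OF p0]] by simp
    qed
    also have "\<dots> = boundary_value \<Omega> (oper ?k (c j) z) x"
      unfolding oper_def
      by (rule boundary_value_sum[OF open_\<Omega> x, symmetric], rule Cext_ext_on[of _ 0]) (intro CE_mult CE_of_C_on cc pz, simp)
    finally show ?thesis .
  qed
  have "green_identity \<Omega> m d"
    unfolding green_identity_def
  proof (intro ballI)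
    fix v z assume "v \<in> C_closure (2 * m) \<Omega>" "z \<in> C_closure (2 * m) \<Omega>"
    then have v: "CE (2 * m) v" and z: "CE (2 * m) z" using C_closure_imp_Cext[OF open_\<Omega>] by blast+
    define w where "w x = cnj (v x)" for x
    have w: "CE (2 * m) w" unfolding w_def by (rule Cext_cnj[OF open_\<Omega> v])
    let ?b = "\<lambda>j x. cnj (normal_deriv \<Omega> j v x) * boundary_op \<Omega> (2 * m - 1 - j) (d (2 * m - 1 - j)) z x"
    have o0: "CE 0 (oper (2 * m - 1 - j) (c j) z)" if "j < m" for j
      using c(1) that by (intro CE_oper[of 0 "2 * m - 1 - j"] Cext_le[OF z]) auto
    have m0: "CE 0 (mixed j [] w)" if "j < m" for j using w by (rule CE_mixed) (use that in auto)
    have b: "?b j x = boundary_value \<Omega> (\<lambda>x. oper (2 * m - 1 - j) (c j) z x * mixed j [] w x) x"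
      if "j < m" "x \<in> frontier \<Omega>" for j x
      using boundary_value_mult[OF open_\<Omega> that(2) Cext_ext_on[OF o0[OF that(1)]] Cext_ext_on[OF m0[OF that(1)]]]
        bop[OF that(1) z that(2)] normal_deriv_eq[OF v _ that(2), of j] that(1) by (simp add: w_def[abs_def])
    have si: "surface_integrable \<Omega> (?b j)" if "j < m" for j
    proof (rule surface_integrableI)
      have "continuous_on (frontier \<Omega>) (boundary_value \<Omega> (\<lambda>x. oper (2 * m - 1 - j) (c j) z x * mixed j [] w x))"
        by (rule continuous_tr[of 0]) (intro CE_mult o0 m0 that)
      then show "continuous_on (frontier \<Omega>) (?b j)"
        using b[OF that] by (subst continuous_on_cong[OF refl]) auto
    qed
    have "surface_integral \<Omega> (?b j) = bd_int (\<lambda>x. oper (2 * m - 1 - j) (c j) z x * mixed j [] w x)" if "j < m" for j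
      unfolding bd_int_def using b[OF that] by (rule surface_integral_cong)
    then have "(\<Sum>j<m. surface_integral \<Omega> (?b j)) = (\<Sum>j<m. bd_int (\<lambda>x. oper (2 * m - 1 - j) (c j) z x * mixed j [] w x))"
      by simp
    also have "\<dots> = (\<Sum>\<alpha>\<in>?A. \<Sum>q<length (mi_list \<alpha>). (-1) ^ q *
        bd_int (\<lambda>x. pd (rev (take q (mi_list \<alpha>))) (pd (mi_list \<alpha>) z) x * pd (drop (Suc q) (mi_list \<alpha>)) w x * n (mi_list \<alpha> ! q) x))"
      using c(3) z w by simp
    finally show "(\<forall>j<m. surface_integrable \<Omega> (?b j)) \<and>
       (\<Sum>\<alpha> | mi_order \<alpha> \<le> m. L2_inner \<Omega> (mi_deriv \<alpha> z) (mi_deriv \<alpha> v)) = L2_inner \<Omega> (B_op m z) v + (\<Sum>j<m. surface_integral \<Omega> (?b j))"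
      using green_volume[OF z v] si by (simp add: w_def[abs_def])
  qed
  then show ?thesis using nonchar by blast
qed

end

section \<open>Hilbert spaces: Riesz representation\<close>

lemma quadratic_nonneg_zero:
  assumes "\<And>t::real. 0 \<le> 2 * t * R + t\<^sup>2 * N" shows "R = 0"
proof -
  have N: "N \<ge> 0" using assms[of 1] assms[of "-1"] by simp
  define k where "k = N + 1"
  have k: "k > 0" "N \<le> k" using N by (auto simp: k_def)
  have "0 \<le> 2 * (- R / k) * R + (- R / k)\<^sup>2 * N" by (rule assms)
  also have "(- R / k)\<^sup>2 * N \<le> (- R / k)\<^sup>2 * k" using k by (intro mult_left_mono) auto
  also have "2 * (- R / k) * R + (- R / k)\<^sup>2 * k = - (R\<^sup>2 / k)" using k by (simp add: power2_eq_square)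
  finally have "R\<^sup>2 / k \<le> 0" by simp
  then have "R\<^sup>2 \<le> 0" using k by (simp add: divide_le_0_iff)
  then show ?thesis by simp
qed

text \<open>The form is only semidefinite because elements of \<open>L\<^sub>2\<close> and \<open>H\<^sup>m\<close> are represented by functions,
  which matter up to null sets.\<close>
locale semi_inner =
  fixes H :: "'a set" and lin :: "complex \<Rightarrow> 'a \<Rightarrow> complex \<Rightarrow> 'a \<Rightarrow> 'a" and ip :: "'a \<Rightarrow> 'a \<Rightarrow> complex"
  assumes lin_in: "u \<in> H \<Longrightarrow> v \<in> H \<Longrightarrow> lin a u b v \<in> H"
    and ip_lin: "u \<in> H \<Longrightarrow> v \<in> H \<Longrightarrow> w \<in> H \<Longrightarrow> ip (lin a u b v) w = a * ip u w + b * ip v w"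
    and ip_cnj: "u \<in> H \<Longrightarrow> v \<in> H \<Longrightarrow> ip v u = cnj (ip u v)"
    and ip_pos: "u \<in> H \<Longrightarrow> 0 \<le> Re (ip u u)"
begin

definition sq :: "'a \<Rightarrow> real" where "sq u = Re (ip u u)"

lemma ip_lin_right: "u \<in> H \<Longrightarrow> v \<in> H \<Longrightarrow> w \<in> H \<Longrightarrow> ip w (lin a u b v) = cnj a * ip w u + cnj b * ip w v"
  using ip_cnj[OF lin_in[of u v a b], of w] ip_cnj[of u w] ip_cnj[of v w] by (simp add: ip_lin)

lemma sq_lin:
  assumes "u \<in> H" "v \<in> H"
  shows "sq (lin a u b v) = (cmod a)\<^sup>2 * sq u + (cmod b)\<^sup>2 * sq v + 2 * Re (a * cnj b * ip u v)"
proof -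
  have "Im (ip w w) = 0" if "w \<in> H" for w using ip_cnj[OF that that] by (metis cnj.simps(2) equal_neg_zero)
  then have r: "ip w w = of_real (sq w)" if "w \<in> H" for w using that by (simp add: sq_def complex_eq_iff)
  have "ip (lin a u b v) (lin a u b v) = a * cnj a * ip u u + b * cnj b * ip v v + (a * cnj b * ip u v + cnj (a * cnj b * ip u v))"
    using assms by (simp add: ip_lin ip_lin_right lin_in ip_cnj[of u v] algebra_simps)
  also have "\<dots> = of_real ((cmod a)\<^sup>2 * sq u + (cmod b)\<^sup>2 * sq v + 2 * Re (a * cnj b * ip u v))"
    unfolding complex_add_cnj complex_norm_square[symmetric] using assms by (simp add: r)
  finally show ?thesis by (simp add: sq_def)
qed

lemma sq_nonneg: "u \<in> H \<Longrightarrow> 0 \<le> sq u" by (simp add: sq_def ip_pos)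

lemma Cauchy_Schwarz:
  assumes u: "u \<in> H" and v: "v \<in> H"
  shows "(cmod (ip u v))\<^sup>2 \<le> sq u * sq v"
proof -
  define s where "s = cmod (ip u v)"
  obtain c where c: "cmod c = 1" "c * ip u v = of_real s"
  proof (cases "ip u v = 0")
    case False
    then show ?thesis
      by (intro that[of "cnj (ip u v) / of_real s"])
         (auto simp: s_def norm_divide complex_norm_square[symmetric] mult.commute power2_eq_square)
  qed (use that[of 1] in \<open>simp add: s_def\<close>)
  have q: "0 \<le> t\<^sup>2 * sq u + sq v + 2 * t * s" for t :: real
    using sq_nonneg[OF lin_in[OF u v, of "of_real t * c" 1]] c
    by (simp add: sq_lin[OF u v] norm_mult mult.assoc)
  show ?thesis
  proof (cases "sq u = 0")
    case True
    have "s = 0"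
    proof (rule ccontr)
      assume "s \<noteq> 0"
      then have "s > 0" by (simp add: s_def)
      then have "2 * (- (sq v + 1) / s) * s = - 2 * (sq v + 1)" by simp
      then show False using q[of "- (sq v + 1) / s"] sq_nonneg[OF v] True by simp
    qed
    then show ?thesis using True by (simp add: s_def)
  next
    case False
    then have p: "sq u > 0" using sq_nonneg[OF u] by simp
    have "0 \<le> (s / sq u)\<^sup>2 * sq u + sq v + 2 * (- s / sq u) * s" using q[of "- s / sq u"] by simp
    also have "\<dots> = sq v - s\<^sup>2 / sq u" using p by (simp add: power2_eq_square field_simps)
    finally show ?thesis using p by (simp add: s_def field_simps)
  qed
qed

lemma ip_tendsto:
  assumes f: "\<And>n. f n \<in> H" and z: "z \<in> H" and v: "v \<in> H"
    and lim: "(\<lambda>n. sq (lin 1 (f n) (-1) z)) \<longlonglongrightarrow> 0"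
  shows "(\<lambda>n. ip (f n) v) \<longlonglongrightarrow> ip z v"
proof -
  have "(\<lambda>n. sqrt (sq (lin 1 (f n) (-1) z) * sq v)) \<longlonglongrightarrow> sqrt (0 * sq v)"
    by (intro tendsto_intros lim)
  then have "(\<lambda>n. sqrt (sq (lin 1 (f n) (-1) z) * sq v)) \<longlonglongrightarrow> 0" by simp
  moreover have "cmod (ip (f n) v - ip z v) \<le> sqrt (sq (lin 1 (f n) (-1) z) * sq v)" for n
    using Cauchy_Schwarz[OF lin_in[OF f z] v, of 1 n "-1"] by (intro real_le_rsqrt) (simp add: ip_lin[OF f z v])
  ultimately have "(\<lambda>n. ip (f n) v - ip z v) \<longlonglongrightarrow> 0"
    by (intro Lim_null_comparison[of "\<lambda>n. ip (f n) v - ip z v" "\<lambda>n. sqrt (sq (lin 1 (f n) (-1) z) * sq v)"]) auto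
  then show ?thesis using Lim_null by blast
qed

text \<open>A minimising sequence of \<open>v \<mapsto> sq v - 2 Re (fl v)\<close> is a Cauchy sequence by the parallelogram law,
  and at its limit the first variation vanishes.\<close>
theorem Riesz:
  assumes ne: "H \<noteq> {}" and C: "0 \<le> C"
    and complete: "\<And>f. (\<And>n. f n \<in> H) \<Longrightarrow> (\<And>e. e > 0 \<Longrightarrow> \<exists>N. \<forall>m\<ge>N. \<forall>n\<ge>N. sq (lin 1 (f m) (-1) (f n)) < e)
        \<Longrightarrow> \<exists>z\<in>H. (\<lambda>n. sq (lin 1 (f n) (-1) z)) \<longlonglongrightarrow> 0"
    and fl_lin: "\<And>u v a b. u \<in> H \<Longrightarrow> v \<in> H \<Longrightarrow> fl (lin a u b v) = cnj a * fl u + cnj b * fl v"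
    and bound: "\<And>v. v \<in> H \<Longrightarrow> (cmod (fl v))\<^sup>2 \<le> C * sq v"
  obtains z where "z \<in> H" "\<And>v. v \<in> H \<Longrightarrow> ip z v = fl v"
proof -
  define J where "J v = sq v - 2 * Re (fl v)" for v
  have J_lin: "J (lin 1 u (of_real t) v) = J u + 2 * t * Re (ip u v - fl v) + t\<^sup>2 * sq v" if "u \<in> H" "v \<in> H" for u v t
    using that by (simp add: J_def sq_lin fl_lin algebra_simps)
  have "- C \<le> J v" if v: "v \<in> H" for v
  proof -
    have "\<bar>Re (fl v)\<bar>\<^sup>2 \<le> (cmod (fl v))\<^sup>2" by (intro power_mono abs_Re_le_cmod) simp
    then have "(Re (fl v))\<^sup>2 \<le> C * sq v" using bound[OF v] by simp
    moreover have "(sq v + C)\<^sup>2 = 4 * (C * sq v) + (sq v - C)\<^sup>2" by (simp add: power2_eq_square algebra_simps)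
    moreover have "(2 * Re (fl v))\<^sup>2 = 4 * (Re (fl v))\<^sup>2" by (simp add: power_mult_distrib)
    ultimately have "(2 * Re (fl v))\<^sup>2 \<le> (sq v + C)\<^sup>2" using zero_le_power2[of "sq v - C"] by linarith
    then have "2 * Re (fl v) \<le> sq v + C" by (rule power2_le_imp_le) (use sq_nonneg[OF v] C in simp)
    then show ?thesis by (simp add: J_def)
  qed
  then have bdd: "bdd_below (J ` H)" by (auto simp: bdd_below_def)
  define I where "I = Inf (J ` H)"
  have I_le: "I \<le> J v" if "v \<in> H" for v unfolding I_def using bdd that by (intro cInf_lower) auto
  have "\<exists>v\<in>H. J v < I + 1 / real (Suc n)" for n
    using cInf_lessD[of "J ` H" "I + 1 / real (Suc n)"] ne unfolding I_def by auto
  then obtain f where f: "\<And>n. f n \<in> H" "\<And>n. J (f n) < I + 1 / real (Suc n)" by metis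
  have par: "sq (lin 1 u (-1) v) = 2 * J u + 2 * J v - 4 * J (lin (1/2) u (1/2) v)" if "u \<in> H" "v \<in> H" for u v
    using that by (simp add: J_def sq_lin fl_lin norm_divide power2_eq_square algebra_simps)
  have cauchy: "\<exists>N. \<forall>m\<ge>N. \<forall>n\<ge>N. sq (lin 1 (f m) (-1) (f n)) < e" if e: "e > 0" for e
  proof -
    obtain N where N: "1 / real (Suc N) < e / 4" using e by (metis divide_pos_pos nat_approx_posE zero_less_numeral)
    have "sq (lin 1 (f m) (-1) (f n)) < e" if "m \<ge> N" "n \<ge> N" for m n
    proof -
      have "1 / real (Suc m) \<le> 1 / real (Suc N)" "1 / real (Suc n) \<le> 1 / real (Suc N)" using that by (auto simp: field_simps)
      then have "J (f m) < I + e / 4" "J (f n) < I + e / 4" using f(2)[of m] f(2)[of n] N by linarith+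
      moreover have "I \<le> J (lin (1/2) (f m) (1/2) (f n))" by (intro I_le lin_in f)
      ultimately show ?thesis unfolding par[OF f(1) f(1)] by linarith
    qed
    then show ?thesis by blast
  qed
  obtain z where z: "z \<in> H" "(\<lambda>n. sq (lin 1 (f n) (-1) z)) \<longlonglongrightarrow> 0"
    using complete[of f, OF f(1) cauchy] by auto
  have Re_eq: "Re (ip z v - fl v) = 0" if v: "v \<in> H" for v
  proof (rule quadratic_nonneg_zero[of _ "sq v"])
    fix t :: real
    have lim: "(\<lambda>n. 1 / real (Suc n) + (2 * t * Re (ip (f n) v - fl v) + t\<^sup>2 * sq v)) \<longlonglongrightarrow> 0 + (2 * t * Re (ip z v - fl v) + t\<^sup>2 * sq v)"
      using LIMSEQ_inverse_real_of_nat by (intro tendsto_intros ip_tendsto[OF f(1) z(1) v z(2)]) (simp add: inverse_eq_divide)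
    have "0 \<le> 1 / real (Suc n) + (2 * t * Re (ip (f n) v - fl v) + t\<^sup>2 * sq v)" for n
      using I_le[OF lin_in[OF f(1)[of n] v, of 1 "of_real t"]] f(2)[of n] unfolding J_lin[OF f(1) v] by linarith
    then show "0 \<le> 2 * t * Re (ip z v - fl v) + t\<^sup>2 * sq v" using LIMSEQ_le_const[OF lim] by auto
  qed
  have "ip z v = fl v" if v: "v \<in> H" for v
  proof -
    have "Re (ip z (lin \<i> v 0 v) - fl (lin \<i> v 0 v)) = 0" by (rule Re_eq[OF lin_in[OF v v]])
    then show ?thesis using Re_eq[OF v] by (simp add: ip_lin_right[OF v v z(1)] fl_lin[OF v v] complex_eq_iff)
  qed
  then show ?thesis using that z(1) by blast
qed

end

section \<open>The space \<open>L\<^sub>2\<close>\<close>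

abbreviation lincomb :: "complex \<Rightarrow> ('a \<Rightarrow> complex) \<Rightarrow> complex \<Rightarrow> ('a \<Rightarrow> complex) \<Rightarrow> 'a \<Rightarrow> complex" where
  "lincomb a u b v \<equiv> (\<lambda>x. a * u x + b * v x)"

lemma L2_measurable: "u \<in> L2 \<Omega> \<Longrightarrow> u \<in> borel_measurable (lebesgue_on \<Omega>)"
  by (simp add: L2_def)

lemma L2_lincomb:
  assumes "u \<in> L2 \<Omega>" "v \<in> L2 \<Omega>" shows "lincomb a u b v \<in> L2 \<Omega>"
proof -
  have m[measurable]: "u \<in> borel_measurable (lebesgue_on \<Omega>)" "v \<in> borel_measurable (lebesgue_on \<Omega>)" using assms L2_measurable by auto
  have "integrable (lebesgue_on \<Omega>) (\<lambda>x. (cmod (lincomb a u b v x))\<^sup>2)"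
  proof (rule Bochner_Integration.integrable_bound)
    show "integrable (lebesgue_on \<Omega>) (\<lambda>x. 2 * (cmod a)\<^sup>2 * (cmod (u x))\<^sup>2 + 2 * (cmod b)\<^sup>2 * (cmod (v x))\<^sup>2)"
      using assms by (simp add: L2_def)
    have "(cmod (a * p + b * q))\<^sup>2 \<le> 2 * (cmod a)\<^sup>2 * (cmod p)\<^sup>2 + 2 * (cmod b)\<^sup>2 * (cmod q)\<^sup>2" for p q
    proof -
      have "(cmod (a * p + b * q))\<^sup>2 \<le> (cmod (a * p) + cmod (b * q))\<^sup>2" by (intro power_mono norm_triangle_ineq) simp
      also have "\<dots> = 2 * (cmod (a * p))\<^sup>2 + 2 * (cmod (b * q))\<^sup>2 - (cmod (a * p) - cmod (b * q))\<^sup>2"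
        by (simp add: power2_eq_square algebra_simps)
      also have "\<dots> \<le> 2 * (cmod (a * p))\<^sup>2 + 2 * (cmod (b * q))\<^sup>2" by simp
      finally show ?thesis by (simp add: norm_mult power_mult_distrib)
    qed
    then show "AE x in lebesgue_on \<Omega>. norm ((cmod (lincomb a u b v x))\<^sup>2) \<le> norm (2 * (cmod a)\<^sup>2 * (cmod (u x))\<^sup>2 + 2 * (cmod b)\<^sup>2 * (cmod (v x))\<^sup>2)"
      by (intro AE_I2) (simp only: real_norm_def abs_of_nonneg[OF zero_le_power2], rule order_trans[OF _ abs_ge_self])
  qed simp
  then show ?thesis by (simp add: L2_def)
qed

lemma L2_cnj: "u \<in> L2 \<Omega> \<Longrightarrow> (\<lambda>x. cnj (u x)) \<in> L2 \<Omega>"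
  unfolding L2_def mem_Collect_eq complex_mod_cnj
  using measurable_compose[OF _ borel_measurable_continuous_onI[OF continuous_on_cnj[OF continuous_on_id]]] by blast

lemma L2_mult_integrable:
  assumes "u \<in> L2 \<Omega>" "v \<in> L2 \<Omega>" shows "integrable (lebesgue_on \<Omega>) (\<lambda>x. u x * v x)"
proof (rule Bochner_Integration.integrable_bound)
  show "integrable (lebesgue_on \<Omega>) (\<lambda>x. (cmod (u x))\<^sup>2 + (cmod (v x))\<^sup>2)" using assms by (simp add: L2_def)
  show "(\<lambda>x. u x * v x) \<in> borel_measurable (lebesgue_on \<Omega>)" using assms by (intro borel_measurable_times L2_measurable)
  have "cmod (p * q) \<le> (cmod p)\<^sup>2 + (cmod q)\<^sup>2" for p q
  proof -
    have "2 * (cmod p * cmod q) = (cmod p)\<^sup>2 + (cmod q)\<^sup>2 - (cmod p - cmod q)\<^sup>2"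
      by (simp add: power2_eq_square algebra_simps)
    moreover have "0 \<le> cmod p * cmod q" "0 \<le> (cmod p - cmod q)\<^sup>2" by simp_all
    ultimately show ?thesis unfolding norm_mult by linarith
  qed
  then show "AE x in lebesgue_on \<Omega>. norm (u x * v x) \<le> norm ((cmod (u x))\<^sup>2 + (cmod (v x))\<^sup>2)"
    by (intro AE_I2) (simp add: order_trans[OF _ abs_ge_self])
qed

interpretation L2: semi_inner "L2 \<Omega>" lincomb "L2_inner \<Omega>" for \<Omega> :: "(real ^ 'n::finite) set"
proof
  fix u v w :: "real ^ 'n \<Rightarrow> complex" and a b
  assume u: "u \<in> L2 \<Omega>"
  show "0 \<le> Re (L2_inner \<Omega> u u)" by (simp add: L2_inner_self)
  assume v: "v \<in> L2 \<Omega>"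
  show "lincomb a u b v \<in> L2 \<Omega>" by (rule L2_lincomb[OF u v])
  show "L2_inner \<Omega> v u = cnj (L2_inner \<Omega> u v)"
  proof -
    have "cnj (L2_inner \<Omega> u v) = (\<integral>x. cnj (u x * cnj (v x)) \<partial>lebesgue_on \<Omega>)"
      unfolding L2_inner_def by (rule Bochner_Integration.integral_cnj[symmetric])
    then show ?thesis unfolding L2_inner_def by (simp add: mult.commute)
  qed
  assume w: "w \<in> L2 \<Omega>"
  have "integrable (lebesgue_on \<Omega>) (\<lambda>x. u x * cnj (w x))" "integrable (lebesgue_on \<Omega>) (\<lambda>x. v x * cnj (w x))"
    by (intro L2_mult_integrable u v L2_cnj[OF w])+
  then have "(\<integral>x. a * (u x * cnj (w x)) + b * (v x * cnj (w x)) \<partial>lebesgue_on \<Omega>) = a * L2_inner \<Omega> u w + b * L2_inner \<Omega> v w"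
    unfolding L2_inner_def by simp
  then show "L2_inner \<Omega> (lincomb a u b v) w = a * L2_inner \<Omega> u w + b * L2_inner \<Omega> v w"
    unfolding L2_inner_def by (simp add: algebra_simps)
qed

lemma L2_sq: "L2.sq \<Omega> u = (\<integral>x. (cmod (u x))\<^sup>2 \<partial>lebesgue_on \<Omega>)"
proof -
  have "(L2_norm \<Omega> u)\<^sup>2 = (\<integral>x. (cmod (u x))\<^sup>2 \<partial>lebesgue_on \<Omega>)"
    unfolding L2_norm_def by (subst real_sqrt_pow2) (auto intro: integral_nonneg_AE)
  then show ?thesis by (simp add: L2.sq_def L2_inner_self)
qed

lemma L2_inner_ae:
  assumes "ae_eq \<Omega> u u'" "ae_eq \<Omega> v v'" "u \<in> L2 \<Omega>" "u' \<in> L2 \<Omega>" "v \<in> L2 \<Omega>" "v' \<in> L2 \<Omega>"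
  shows "L2_inner \<Omega> u v = L2_inner \<Omega> u' v'"
  unfolding L2_inner_def
proof (rule integral_cong_AE)
  show "AE x in lebesgue_on \<Omega>. u x * cnj (v x) = u' x * cnj (v' x)"
    using assms(1,2) unfolding ae_eq_def by eventually_elim simp
qed (use assms in \<open>auto intro!: borel_measurable_integrable L2_mult_integrable L2_cnj\<close>)

lemma L2_sq_zero:
  assumes "u \<in> L2 \<Omega>" "L2.sq \<Omega> u = 0" shows "AE x in lebesgue_on \<Omega>. u x = 0"
proof -
  have "AE x in lebesgue_on \<Omega>. (cmod (u x))\<^sup>2 = 0"
    using assms by (subst integral_nonneg_eq_0_iff_AE[symmetric]) (auto simp: L2_sq L2_def)
  then show ?thesis by simp
qed

lemma L2_nn_integral: "u \<in> L2 \<Omega> \<Longrightarrow> (\<integral>\<^sup>+ x. ennreal ((cmod (u x))\<^sup>2) \<partial>lebesgue_on \<Omega>) = ennreal (L2.sq \<Omega> u)"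
  unfolding L2_sq by (rule nn_integral_eq_integral) (auto simp: L2_def)

text \<open>A subsequence \<open>v\<close> is chosen whose successive squared distances are less than \<open>16\<^sup>-\<^sup>i\<close>. The sum of
  \<open>4\<^sup>i \<bar>v\<^sub>i\<^sub>+\<^sub>1 - v\<^sub>i\<bar>\<^sup>2\<close> is then integrable, hence finite almost everywhere, and where it is finite
  \<open>\<bar>v\<^sub>i\<^sub>+\<^sub>1 - v\<^sub>i\<bar>\<close> is at most a constant times \<open>2\<^sup>-\<^sup>i\<close>, so that \<open>v\<close> converges. Fatou's lemma bounds the
  distance to the limit.\<close>
theorem L2_complete:
  assumes f: "\<And>n. f n \<in> L2 \<Omega>"
    and cauchy: "\<And>e. e > 0 \<Longrightarrow> \<exists>N. \<forall>m\<ge>N. \<forall>n\<ge>N. L2.sq \<Omega> (lincomb 1 (f m) (-1) (f n)) < e"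
  shows "\<exists>z\<in>L2 \<Omega>. (\<lambda>n. L2.sq \<Omega> (lincomb 1 (f n) (-1) z)) \<longlonglongrightarrow> 0"
proof -
  let ?M = "lebesgue_on \<Omega>"
  have "\<forall>i. \<exists>N. \<forall>m\<ge>N. \<forall>n\<ge>N. L2.sq \<Omega> (lincomb 1 (f m) (-1) (f n)) < (1/16) ^ i"
    using cauchy by simp
  then obtain N where N: "\<And>i m n. m \<ge> N i \<Longrightarrow> n \<ge> N i \<Longrightarrow> L2.sq \<Omega> (lincomb 1 (f m) (-1) (f n)) < (1/16) ^ i" by metis
  define k where "k i = (\<Sum>j\<le>i. N j)" for i
  have k: "N j \<le> k i" if "j \<le> i" for i j unfolding k_def using that by (intro member_le_sum) auto
  define v where "v i = f (k i)" for i
  have v: "v i \<in> L2 \<Omega>" for i unfolding v_def by (rule f)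
  note [measurable] = L2_measurable[OF f] L2_measurable[OF v]
  have diff: "lincomb 1 p (-1) q = (\<lambda>x. p x - q x)" for p q :: "real ^ 'a \<Rightarrow> complex" by auto
  define D where "D i x = (cmod (v (Suc i) x - v i x))\<^sup>2" for i x
  have [measurable]: "D i \<in> borel_measurable ?M" for i unfolding D_def by measurable
  have D_int: "(\<integral>\<^sup>+ x. ennreal (D i x) \<partial>?M) \<le> ennreal ((1/16) ^ i)" for i
  proof -
    have "(\<integral>\<^sup>+ x. ennreal (D i x) \<partial>?M) = ennreal (L2.sq \<Omega> (lincomb 1 (v (Suc i)) (-1) (v i)))"
      unfolding L2_nn_integral[OF L2_lincomb[OF v v], symmetric] by (simp add: D_def)
    also have "\<dots> \<le> ennreal ((1/16) ^ i)"
      unfolding v_def using N[OF k k, of i "Suc i" i] by (intro ennreal_leI) simp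
    finally show ?thesis .
  qed
  define S where "S x = (\<Sum>i. ennreal (4 ^ i) * ennreal (D i x))" for x
  have "(\<integral>\<^sup>+ x. S x \<partial>?M) = (\<Sum>i. ennreal (4 ^ i) * (\<integral>\<^sup>+ x. ennreal (D i x) \<partial>?M))"
    unfolding S_def by (subst nn_integral_suminf) (auto simp: nn_integral_cmult)
  also have "\<dots> \<le> (\<Sum>i. ennreal ((1/4) ^ i))"
  proof (intro suminf_le summableI)
    fix i
    have "ennreal (4 ^ i) * (\<integral>\<^sup>+ x. ennreal (D i x) \<partial>?M) \<le> ennreal (4 ^ i) * ennreal ((1/16) ^ i)"
      by (intro mult_left_mono D_int) simp
    also have "\<dots> = ennreal ((1/4) ^ i)"
      by (subst ennreal_mult[symmetric]) (simp_all add: power_mult_distrib[symmetric])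
    finally show "ennreal (4 ^ i) * (\<integral>\<^sup>+ x. ennreal (D i x) \<partial>?M) \<le> ennreal ((1/4) ^ i)" .
  qed
  also have "\<dots> = ennreal (\<Sum>i. (1/4) ^ i)" by (intro suminf_ennreal2 summable_geometric) auto
  finally have "(\<integral>\<^sup>+ x. S x \<partial>?M) \<noteq> \<infinity>" by (metis ennreal_less_top infinity_ennreal_def leD)
  moreover have "S \<in> borel_measurable ?M" unfolding S_def by measurable
  ultimately have "AE x in ?M. S x \<noteq> \<infinity>" by (intro nn_integral_PInf_AE) auto
  then have conv: "AE x in ?M. convergent (\<lambda>i. v i x)"
  proof eventually_elim
    case (elim x)
    then obtain s where s: "s \<ge> 0" "S x = ennreal s" by (metis ennreal_cases infinity_ennreal_def)
    have le: "cmod (v (Suc i) x - v i x) \<le> sqrt s * (1/2) ^ i" for i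
    proof -
      have "ennreal (4 ^ i * D i x) \<le> S x"
        unfolding S_def using sum_le_suminf[of "\<lambda>i. ennreal (4 ^ i) * ennreal (D i x)" "{i}"]
        by (simp add: ennreal_mult' D_def)
      then have "4 ^ i * D i x \<le> s" using s by (simp add: ennreal_le_iff)
      moreover have "(2::real) ^ i * 2 ^ i = 4 ^ i" by (simp add: power_mult_distrib[symmetric])
      then have "(2 ^ i * cmod (v (Suc i) x - v i x))\<^sup>2 = 4 ^ i * D i x"
        by (simp add: D_def power_mult_distrib power2_eq_square)
      ultimately have "(2 ^ i * cmod (v (Suc i) x - v i x))\<^sup>2 \<le> s" by simp
      then have "2 ^ i * cmod (v (Suc i) x - v i x) \<le> sqrt s" by (rule real_le_rsqrt)
      then show ?thesis by (simp add: field_simps power_one_over)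
    qed
    have "summable (\<lambda>i. sqrt s * (1/2) ^ i :: real)" by (intro summable_mult summable_geometric) simp
    then have "summable (\<lambda>i. v (Suc i) x - v i x)"
      by (rule summable_comparison_test'[where N = 0]) (rule le)
    then have "(\<lambda>n. (\<Sum>i<n. v (Suc i) x - v i x)) \<longlonglongrightarrow> (\<Sum>i. v (Suc i) x - v i x)" by (rule summable_LIMSEQ)
    then have "(\<lambda>n. (v n x - v 0 x) + v 0 x) \<longlonglongrightarrow> (\<Sum>i. v (Suc i) x - v i x) + v 0 x"
      unfolding sum_lessThan_telescope[of "\<lambda>i. v i x"] by (intro tendsto_add tendsto_const)
    then show ?case by (auto simp: convergent_def)
  qed
  define z where "z x = lim (\<lambda>i. v i x)" for x
  have zm[measurable]: "z \<in> borel_measurable ?M" unfolding z_def by measurable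
  have bd: "(\<integral>\<^sup>+ x. ennreal ((cmod (f n x - z x))\<^sup>2) \<partial>?M) \<le> ennreal ((1/16) ^ j)" if n: "n \<ge> N j" for n j
  proof -
    have "AE x in ?M. ennreal ((cmod (f n x - z x))\<^sup>2) = liminf (\<lambda>i. ennreal ((cmod (f n x - v i x))\<^sup>2))"
      using conv
    proof eventually_elim
      case (elim x)
      then have "(\<lambda>i. v i x) \<longlonglongrightarrow> z x" unfolding z_def by (simp add: convergent_LIMSEQ_iff)
      then have "(\<lambda>i. ennreal ((cmod (f n x - v i x))\<^sup>2)) \<longlonglongrightarrow> ennreal ((cmod (f n x - z x))\<^sup>2)"
        by (intro tendsto_ennrealI tendsto_intros)
      from lim_imp_Liminf[OF trivial_limit_sequentially this] show ?case by (rule sym)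
    qed
    then have "(\<integral>\<^sup>+ x. ennreal ((cmod (f n x - z x))\<^sup>2) \<partial>?M) = (\<integral>\<^sup>+ x. liminf (\<lambda>i. ennreal ((cmod (f n x - v i x))\<^sup>2)) \<partial>?M)"
      by (rule nn_integral_cong_AE)
    also have "\<dots> \<le> liminf (\<lambda>i. \<integral>\<^sup>+ x. ennreal ((cmod (f n x - v i x))\<^sup>2) \<partial>?M)"
      by (rule nn_integral_liminf) measurable
    also have "\<dots> \<le> limsup (\<lambda>i. \<integral>\<^sup>+ x. ennreal ((cmod (f n x - v i x))\<^sup>2) \<partial>?M)"
      by (rule Liminf_le_Limsup) simp
    also have "\<dots> \<le> ennreal ((1/16) ^ j)"
    proof (rule Limsup_bounded)
      have "(\<integral>\<^sup>+ x. ennreal ((cmod (f n x - v i x))\<^sup>2) \<partial>?M) \<le> ennreal ((1/16) ^ j)" if i: "i \<ge> j" for i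
        using L2_nn_integral[OF L2_lincomb[OF f v], of 1 n "-1" i] N[OF n k[OF i]]
        by (simp add: diff v_def ennreal_leI less_imp_le)
      then show "\<forall>\<^sub>F i in sequentially. (\<integral>\<^sup>+ x. ennreal ((cmod (f n x - v i x))\<^sup>2) \<partial>?M) \<le> ennreal ((1/16) ^ j)"
        using eventually_ge_at_top[of j] by (rule eventually_mono[rotated])
    qed
    finally show ?thesis .
  qed
  have fz: "(\<lambda>x. f n x - z x) \<in> L2 \<Omega>" if "n \<ge> N 0" for n
  proof -
    have "(\<integral>\<^sup>+ x. ennreal (norm ((cmod (f n x - z x))\<^sup>2)) \<partial>?M) < \<infinity>"
      using bd[OF that] by (simp add: le_less_trans[OF _ ennreal_less_top[of 1]])
    then show ?thesis unfolding L2_def by (auto simp: integrable_iff_bounded)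
  qed
  have zL: "z \<in> L2 \<Omega>"
    using L2_lincomb[OF f[of "N 0"] fz[of "N 0"], of 1 "-1"] by simp
  have "(\<lambda>n. L2.sq \<Omega> (lincomb 1 (f n) (-1) z)) \<longlonglongrightarrow> 0"
  proof (rule LIMSEQ_I)
    fix e :: real assume "e > 0"
    then obtain j where j: "(1/16) ^ j < e" using real_arch_pow_inv[of e "1/16"] by auto
    have "norm (L2.sq \<Omega> (lincomb 1 (f n) (-1) z) - 0) < e" if n: "n \<ge> N j" for n
    proof -
      have "ennreal (L2.sq \<Omega> (lincomb 1 (f n) (-1) z)) \<le> ennreal ((1/16) ^ j)"
        using bd[OF n] L2_nn_integral[OF L2_lincomb[OF f zL], of 1 n "-1"] by (simp add: diff)
      then have "L2.sq \<Omega> (lincomb 1 (f n) (-1) z) \<le> (1/16) ^ j" by (simp add: ennreal_le_iff)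
      then show ?thesis using j L2.sq_nonneg[OF L2_lincomb[OF f zL], of 1 n "-1"] by simp
    qed
    then show "\<exists>no. \<forall>n\<ge>no. norm (L2.sq \<Omega> (lincomb 1 (f n) (-1) z) - 0) < e" by blast
  qed
  then show ?thesis using zL by blast
qed

section \<open>The fundamental lemma of the calculus of variations\<close>

lemma cutoff_tendsto_1: "(cutoff \<longlongrightarrow> 1) at_top"
proof -
  have "((\<lambda>t::real. exp (- (1 / t))) \<longlongrightarrow> exp (- 0)) at_top"
    by (intro tendsto_intros tendsto_divide_0[OF tendsto_const] filterlim_at_top_imp_at_infinity filterlim_ident)
  then have "((\<lambda>t::real. exp (- (1 / t))) \<longlongrightarrow> 1) at_top" by simp
  then show ?thesis
    by (rule Lim_transform_eventually) (use eventually_gt_at_top[of 0] in \<open>auto simp: flat_def elim: eventually_mono\<close>)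
qed

text \<open>The support stays inside the open box. The box is shrunk by \<open>1/(k+1)\<close>, which is slow against the
  steepness \<open>(k+1)\<^sup>2\<close>; so the limit for \<open>k \<rightarrow> \<infinity>\<close> is the indicator of the whole box.\<close>
definition inner_bump :: "nat \<Rightarrow> real ^ 'n \<Rightarrow> real ^ 'n \<Rightarrow> real ^ 'n::finite \<Rightarrow> real" where
  "inner_bump k a b = box_bump ((real (Suc k))\<^sup>2) (\<chi> i. a $ i + 1 / real (Suc k)) (\<chi> i. b $ i - 1 / real (Suc k))"

lemma inner_bump_test:
  assumes "box a b \<subseteq> \<Omega>" shows "(\<lambda>x. complex_of_real (inner_bump k a b x)) \<in> test_functions \<Omega>"
  unfolding inner_bump_def
proof (rule box_bump_test_function(2))
  have "cbox (\<chi> i. a $ i + 1 / real (Suc k)) (\<chi> i. b $ i - 1 / real (Suc k)) \<subseteq> box a b"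
    by (auto simp: mem_box_cart algebra_simps) (smt (verit) of_nat_0_le_iff zero_less_divide_1_iff)+
  then show "cbox (\<chi> i. a $ i + 1 / real (Suc k)) (\<chi> i. b $ i - 1 / real (Suc k)) \<subseteq> \<Omega>" using assms by blast
qed simp

lemma inner_bump_tendsto:
  fixes x :: "real ^ 'n::finite"
  shows "(\<lambda>k. inner_bump k a b x) \<longlonglongrightarrow> indicator (box a b) x"
proof (cases "x \<in> box a b")
  case True
  have fac: "(\<lambda>k. cutoff ((real (Suc k))\<^sup>2 * (s - 1 / real (Suc k)))) \<longlonglongrightarrow> 1" if "s > 0" for s
  proof (rule filterlim_compose[OF cutoff_tendsto_1])
    have S: "filterlim (\<lambda>k. real (Suc k)) at_top sequentially"
      by (rule filterlim_compose[OF filterlim_real_sequentially filterlim_Suc])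
    have "filterlim (\<lambda>k. s * real (Suc k)) at_top sequentially"
      by (rule filterlim_tendsto_pos_mult_at_top[OF tendsto_const that S])
    from filterlim_tendsto_add_at_top[OF tendsto_const[of "-1"] this]
    have "filterlim (\<lambda>k. - 1 + s * real (Suc k)) at_top sequentially" .
    from filterlim_at_top_mult_at_top[OF S this]
    have "filterlim (\<lambda>k. real (Suc k) * (- 1 + s * real (Suc k))) at_top sequentially" .
    moreover have "real (Suc k) * (- 1 + s * real (Suc k)) = (real (Suc k))\<^sup>2 * (s - 1 / real (Suc k))" for k
      by (simp add: power2_eq_square field_simps del: of_nat_Suc)
    ultimately show "filterlim (\<lambda>k. (real (Suc k))\<^sup>2 * (s - 1 / real (Suc k))) at_top sequentially" by simp
  qed
  have "(\<lambda>k. \<Prod>i\<in>UNIV. cutoff ((real (Suc k))\<^sup>2 * (x $ i - a $ i - 1 / real (Suc k))) * cutoff ((real (Suc k))\<^sup>2 * (b $ i - x $ i - 1 / real (Suc k))))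
      \<longlonglongrightarrow> (\<Prod>i\<in>(UNIV :: 'n set). 1 * 1)"
    using True by (intro tendsto_prod tendsto_mult fac) (auto simp: mem_box_cart)
  then show ?thesis using True by (simp add: inner_bump_def box_bump_def algebra_simps)
next
  case False
  have "inner_bump k a b x = 0" for k
  proof (rule ccontr)
    assume "inner_bump k a b x \<noteq> 0"
    then have "inner_bump k a b x > 0" using box_bump_nonneg unfolding inner_bump_def by (simp add: less_le)
    then have *: "x \<in> box (\<chi> i. a $ i + 1 / real (Suc k)) (\<chi> i. b $ i - 1 / real (Suc k))"
      unfolding inner_bump_def by (subst (asm) box_bump_pos_iff) auto
    define d where "d = 1 / real (Suc k)"
    have "d > 0" by (simp add: d_def)
    moreover have "a $ i + d < x $ i \<and> x $ i < b $ i - d" for i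
      using * by (simp only: mem_box_cart d_def[symmetric] vec_lambda_beta)
    ultimately have "a $ i < x $ i \<and> x $ i < b $ i" for i by (smt (verit))
    then have "x \<in> box a b" by (simp add: mem_box_cart)
    then show False using False by blast
  qed
  then show ?thesis using False by simp
qed

text \<open>The positive and the negative part of \<open>f\<close> are densities of measures that agree on boxes and
  therefore everywhere.\<close>
lemma AE_zero_of_boxes:
  fixes f :: "'a::euclidean_space \<Rightarrow> real"
  assumes f: "integrable lborel f" and box: "\<And>a b. (\<integral>x. indicator (box a b) x * f x \<partial>lborel) = 0"
  shows "AE x in lborel. f x = 0"
proof -
  have [measurable]: "f \<in> borel_measurable borel" using borel_measurable_integrable[OF f] by simp
  define p where "p x = max 0 (f x)" for x
  define q where "q x = max 0 (- f x)" for x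
  have [measurable]: "p \<in> borel_measurable borel" "q \<in> borel_measurable borel" unfolding p_def q_def by measurable
  have pq: "integrable lborel p" "integrable lborel q" unfolding p_def q_def using f by auto
  have dens: "emeasure (density lborel (\<lambda>x. ennreal (g x))) (box a b) = ennreal (\<integral>x. indicator (box a b) x * g x \<partial>lborel)"
    if g: "integrable lborel g" "\<And>x. g x \<ge> 0" "g \<in> borel_measurable borel" for g :: "'a \<Rightarrow> real" and a b
  proof -
    note [measurable] = g(3)
    have "emeasure (density lborel (\<lambda>x. ennreal (g x))) (box a b) = (\<integral>\<^sup>+ x. ennreal (g x) * indicator (box a b) x \<partial>lborel)"
      by (rule emeasure_density) auto
    also have "\<dots> = (\<integral>\<^sup>+ x. ennreal (indicator (box a b) x * g x) \<partial>lborel)"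
      by (intro nn_integral_cong) (auto simp: indicator_def)
    also have "\<dots> = ennreal (\<integral>x. indicator (box a b) x * g x \<partial>lborel)"
      using g by (intro nn_integral_eq_integral integrable_real_mult_indicator[of _ _ g, unfolded mult.commute[of _ "indicator _ _"]]) auto
    finally show ?thesis .
  qed
  have eq: "emeasure (density lborel (\<lambda>x. ennreal (p x))) (box a b) = emeasure (density lborel (\<lambda>x. ennreal (q x))) (box a b)" for a b
  proof -
    have i: "integrable lborel (\<lambda>x. indicator (box a b) x * p x)" "integrable lborel (\<lambda>x. indicator (box a b) x * q x)"
      using integrable_real_mult_indicator[of "box a b" lborel p] integrable_real_mult_indicator[of "box a b" lborel q] pq
      by (simp_all add: mult.commute)
    have "(\<integral>x. indicator (box a b) x * p x \<partial>lborel) - (\<integral>x. indicator (box a b) x * q x \<partial>lborel) = (\<integral>x. indicator (box a b) x * f x \<partial>lborel)"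
      unfolding Bochner_Integration.integral_diff[OF i, symmetric]
      by (intro Bochner_Integration.integral_cong) (auto simp: p_def q_def max_def algebra_simps)
    then show ?thesis using dens[OF pq(1), of a b] dens[OF pq(2), of a b] box[of a b] by (simp add: p_def q_def)
  qed
  have "density lborel (\<lambda>x. ennreal (p x)) = density lborel (\<lambda>x. ennreal (q x))"
  proof (rule measure_eqI_generator_eq)
    let ?E = "range (\<lambda>(a, b). box a b::'a set)"
    show "Int_stable ?E" by (auto simp: Int_stable_def box_Int_box)
    show "?E \<subseteq> Pow UNIV" "sets (density lborel (\<lambda>x. ennreal (p x))) = sigma_sets UNIV ?E"
      "sets (density lborel (\<lambda>x. ennreal (q x))) = sigma_sets UNIV ?E"
      by (simp_all add: borel_eq_box)
    let ?A = "\<lambda>n::nat. box (- (real n *\<^sub>R One)) (real n *\<^sub>R One) :: 'a set"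
    show "range ?A \<subseteq> ?E" "(\<Union>i. ?A i) = UNIV" unfolding UN_box_eq_UNIV by auto
    show "emeasure (density lborel (\<lambda>x. ennreal (p x))) (?A i) \<noteq> \<infinity>" for i
      using dens[OF pq(1)] by (simp add: p_def)
    show "emeasure (density lborel (\<lambda>x. ennreal (p x))) X = emeasure (density lborel (\<lambda>x. ennreal (q x))) X" if "X \<in> ?E" for X
      using that eq by auto
  qed
  then have "AE x in lborel. ennreal (p x) = ennreal (q x)"
    by (intro sigma_finite_measure.density_unique[OF sigma_finite_lborel]) auto
  then show ?thesis by eventually_elim (auto simp: p_def q_def max_def split: if_splits)
qed

locale bounded_open =
  fixes \<Omega> :: "(real ^ 'n::finite) set"
  assumes op: "open \<Omega>" and bd: "bounded \<Omega>"
begin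

abbreviation M :: "(real ^ 'n) measure" where "M \<equiv> lebesgue_on \<Omega>"

lemma sets_\<Omega>: "\<Omega> \<in> sets lebesgue" using op by auto

lemma L2_continuous:
  assumes "continuous_on UNIV g" shows "g \<in> L2 \<Omega>"
proof -
  obtain R where R: "\<And>x. x \<in> \<Omega> \<Longrightarrow> norm x \<le> R" using bd unfolding bounded_iff by blast
  obtain B where B: "B \<ge> 0" "\<And>x. norm x \<le> R \<Longrightarrow> norm (g x) \<le> B" using continuous_bounded_on_cball[OF assms] by blast
  have m: "g \<in> borel_measurable M"
    using continuous_imp_measurable_on_sets_lebesgue[OF continuous_on_subset[OF assms subset_UNIV] sets_\<Omega>] .
  have "integrable M (\<lambda>x. (cmod (g x))\<^sup>2)"
  proof (rule integrableI_bounded_set[where A = \<Omega> and B = "B\<^sup>2"])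
    have "emeasure M \<Omega> = emeasure lborel \<Omega>"
      using op by (simp add: emeasure_restrict_space)
    then show "emeasure M \<Omega> < \<infinity>" using emeasure_bounded_finite[OF bd] by simp
    have "norm ((cmod (g x))\<^sup>2) \<le> B\<^sup>2" if "x \<in> \<Omega>" for x
      using B(2)[OF R[OF that]] by (simp add: power_mono)
    then show "AE x in M. x \<in> \<Omega> \<longrightarrow> norm ((cmod (g x))\<^sup>2) \<le> B\<^sup>2" by simp
  qed (use m sets_\<Omega> in \<open>auto simp: sets_restrict_space intro!: AE_I2\<close>)
  then show ?thesis using m by (simp add: L2_def)
qed

lemma test_deriv_L2: "\<phi> \<in> test_functions \<Omega> \<Longrightarrow> mi_deriv \<alpha> \<phi> \<in> L2 \<Omega>"
proof (rule L2_continuous)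
  assume "\<phi> \<in> test_functions \<Omega>"
  then have "C_on 0 UNIV (pd (mi_list \<alpha>) \<phi>)"
    by (intro C_on_pd[of "length (mi_list \<alpha>)"]) (auto simp: test_functions_def)
  then show "continuous_on UNIV (mi_deriv \<alpha> \<phi>)" by (simp add: mi_deriv_eq_pd)
qed

lemma mi_deriv_0:
  fixes f :: "real ^ 'n \<Rightarrow> 'c::real_normed_vector"
  shows "mi_deriv (\<lambda>_. 0) f = f"
  using length_mi_list[of "\<lambda>_::'n. 0"] by (simp add: mi_deriv_eq_pd mi_order_def)

lemma test_L2: "\<phi> \<in> test_functions \<Omega> \<Longrightarrow> \<phi> \<in> L2 \<Omega>"
  using test_deriv_L2[of \<phi> "\<lambda>_. 0"] by (simp add: mi_deriv_0)

lemma L2_integrable: "u \<in> L2 \<Omega> \<Longrightarrow> integrable M u"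
  using L2_mult_integrable[OF _ L2_continuous[of "\<lambda>_. 1"], of u] by simp

lemma restrict_integral:
  fixes f :: "real ^ 'n \<Rightarrow> complex"
  shows "(\<integral>x. f x \<partial>M) = (\<integral>x. indicator \<Omega> x *\<^sub>R f x \<partial>lebesgue)"
  using sets_\<Omega> by (intro integral_restrict_space) auto

text \<open>Test functions approximate the indicator of any open box in \<open>\<Omega>\<close>, and \<open>\<Omega>\<close> is a countable union of
  such boxes.\<close>
lemma AE_zero_of_test:
  assumes w: "w \<in> L2 \<Omega>" and test: "\<And>\<phi>. \<phi> \<in> test_functions \<Omega> \<Longrightarrow> (\<integral>x. w x * \<phi> x \<partial>M) = 0"
  shows "AE x in M. w x = 0"
proof -
  define W where "W x = indicator \<Omega> x *\<^sub>R w x" for x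
  have W: "integrable lebesgue W"
    using L2_integrable[OF w] sets_\<Omega> unfolding W_def by (subst (asm) integrable_restrict_space) auto
  have box_zero: "(\<integral>x. indicator (box a b) x *\<^sub>R W x \<partial>lebesgue) = 0" if ab: "box a b \<subseteq> \<Omega>" for a b
  proof -
    have "(\<lambda>k. \<integral>x. inner_bump k a b x *\<^sub>R W x \<partial>lebesgue) \<longlonglongrightarrow> (\<integral>x. indicator (box a b) x *\<^sub>R W x \<partial>lebesgue)"
    proof (rule integral_dominated_convergence[where w = "\<lambda>x. norm (W x)"])
      have cb: "continuous_on UNIV (inner_bump k a b)" for k
        using C_on_box_bump[of 0] unfolding inner_bump_def by simp
      show "(\<lambda>x. inner_bump k a b x *\<^sub>R W x) \<in> borel_measurable lebesgue" for k
        using continuous_imp_measurable_on_sets_lebesgue[OF cb, of k] borel_measurable_integrable[OF W]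
        by (intro borel_measurable_scaleR) (auto simp: lebesgue_on_UNIV_eq)
      show "(\<lambda>x. indicator (box a b) x *\<^sub>R W x) \<in> borel_measurable lebesgue"
        using borel_measurable_integrable[OF W] by (intro borel_measurable_scaleR borel_measurable_indicator) auto
      show "AE x in lebesgue. (\<lambda>k. inner_bump k a b x *\<^sub>R W x) \<longlonglongrightarrow> indicator (box a b) x *\<^sub>R W x"
        by (intro AE_I2 tendsto_scaleR inner_bump_tendsto tendsto_const)
      have "\<bar>inner_bump k a b x\<bar> \<le> 1" for k x
      proof -
        have "0 \<le> inner_bump k a b x" "inner_bump k a b x \<le> 1"
          unfolding inner_bump_def by (rule box_bump_nonneg, rule box_bump_le_1)
        then show ?thesis by simp
      qed
      then show "AE x in lebesgue. norm (inner_bump k a b x *\<^sub>R W x) \<le> norm (W x)" for k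
        by (intro AE_I2) (simp add: mult_left_le_one_le)
    qed (use W in auto)
    moreover have "(\<integral>x. inner_bump k a b x *\<^sub>R W x \<partial>lebesgue) = 0" for k
    proof -
      have "(\<integral>x. inner_bump k a b x *\<^sub>R W x \<partial>lebesgue) = (\<integral>x. w x * complex_of_real (inner_bump k a b x) \<partial>M)"
        unfolding restrict_integral W_def by (intro Bochner_Integration.integral_cong) (auto simp: scaleR_conv_of_real)
      then show ?thesis using test[OF inner_bump_test[OF ab]] by simp
    qed
    ultimately show ?thesis by (simp add: LIMSEQ_const_iff)
  qed
  have part: "AE x in lebesgue. x \<in> box a b \<longrightarrow> P (W x) = 0"
    if ab: "box a b \<subseteq> \<Omega>" and P: "bounded_linear (P :: complex \<Rightarrow> real)" for a b P
  proof -
    interpret P: bounded_linear P by (rule P)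
    define g where "g x = P (indicator (box a b) x *\<^sub>R W x)" for x
    have gi: "integrable lebesgue g"
      unfolding g_def using W by (intro integrable_bounded_linear[OF P] integrable_mult_indicator) auto
    obtain g' where g': "g' \<in> borel_measurable lborel" "AE x in lborel. g x = g' x"
      using completion_ex_borel_measurable_real[OF borel_measurable_integrable[OF gi]] by blast
    have g'm: "g' \<in> borel_measurable lebesgue" using g'(1) by (rule measurable_completion)
    have ae: "AE x in lebesgue. g x = g' x" using g'(2) by (rule AE_completion)
    have "integrable lebesgue g'"
      using gi ae by (rule integrable_cong_AE_imp[OF _ g'm]) 
    then have gi': "integrable lborel g'" using g'(1) by (simp add: integrable_completion)
    have "AE x in lborel. g' x = 0"
    proof (rule AE_zero_of_boxes[OF gi'])
      fix c d :: "real ^ 'n"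
      obtain p q where pq: "box c d \<inter> box a b = box p q" using box_Int_box by blast
      have "(\<integral>x. indicator (box c d) x * g' x \<partial>lborel) = (\<integral>x. indicator (box c d) x * g' x \<partial>lebesgue)"
        using g'(1) by (intro integral_completion[symmetric] borel_measurable_times borel_measurable_indicator) auto
      also have "\<dots> = (\<integral>x. indicator (box c d) x * g x \<partial>lebesgue)"
        using ae g'm borel_measurable_integrable[OF gi]
        by (intro integral_cong_AE borel_measurable_times borel_measurable_indicator) auto
      also have "\<dots> = (\<integral>x. P (indicator (box p q) x *\<^sub>R W x) \<partial>lebesgue)"
        unfolding pq[symmetric] g_def by (intro Bochner_Integration.integral_cong) (auto simp: indicator_def P.zero)
      also have "\<dots> = P (\<integral>x. indicator (box p q) x *\<^sub>R W x \<partial>lebesgue)"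
        using W by (intro integral_bounded_linear[OF P] integrable_mult_indicator) auto
      also have "\<dots> = 0"
      proof -
        have "box p q \<subseteq> \<Omega>" using pq ab by blast
        from box_zero[OF this] show ?thesis by (simp add: P.zero)
      qed
      finally show "(\<integral>x. indicator (box c d) x * g' x \<partial>lborel) = 0" .
    qed
    then have "AE x in lebesgue. g' x = 0" by (rule AE_completion)
    with ae show ?thesis by eventually_elim (auto simp: g_def indicator_def)
  qed
  obtain \<D> where \<D>: "countable \<D>" "\<D> \<subseteq> Pow \<Omega>" "\<And>X. X \<in> \<D> \<Longrightarrow> \<exists>a b. X = box a b" "\<Union>\<D> = \<Omega>"
    using open_countable_Union_open_box[OF op] by blast
  have "AE x in lebesgue. \<forall>X\<in>\<D>. x \<in> X \<longrightarrow> W x = 0"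
  proof (rule AE_ball_countable')
    fix X assume X: "X \<in> \<D>"
    then obtain a b where ab: "X = box a b" using \<D>(3) by blast
    then have "box a b \<subseteq> \<Omega>" using X \<D>(2) by blast
    from part[OF this bounded_linear_Re] part[OF this bounded_linear_Im]
    show "AE x in lebesgue. x \<in> X \<longrightarrow> W x = 0"
      by eventually_elim (auto simp: ab complex_eq_iff)
  qed (rule \<D>(1))
  then have "AE x in lebesgue. x \<in> \<Omega> \<longrightarrow> w x = 0"
  proof eventually_elim
    case (elim x)
    show ?case
    proof
      assume x: "x \<in> \<Omega>"
      then obtain X where "X \<in> \<D>" "x \<in> X" using \<D>(4) by blast
      then have "W x = 0" using elim by blast
      then show "w x = 0" using x by (simp add: W_def)
    qed
  qed
  then show ?thesis using sets_\<Omega> by (subst AE_restrict_space_iff) auto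
qed

section \<open>The Sobolev space\<close>

lemma ae_eq_refl: "ae_eq \<Omega> u u" by (simp add: ae_eq_def)

lemma weak_deriv_unique:
  assumes "w \<in> L2 \<Omega>" "w' \<in> L2 \<Omega>" "is_weak_deriv \<Omega> \<alpha> u w" "is_weak_deriv \<Omega> \<alpha> u' w'" "ae_eq \<Omega> u u'"
    and "u \<in> L2 \<Omega>" "u' \<in> L2 \<Omega>"
  shows "ae_eq \<Omega> w w'"
proof -
  have "AE x in M. lincomb 1 w (-1) w' x = 0"
  proof (rule AE_zero_of_test[OF L2_lincomb[OF assms(1,2)]])
    fix \<phi> :: "real ^ 'n \<Rightarrow> complex" assume \<phi>: "\<phi> \<in> test_functions \<Omega>"
    have "(\<integral>x. u x * mi_deriv \<alpha> \<phi> x \<partial>M) = (\<integral>x. u' x * mi_deriv \<alpha> \<phi> x \<partial>M)"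
      using assms(5) unfolding ae_eq_def
      by (intro integral_cong_AE borel_measurable_integrable L2_mult_integrable assms test_deriv_L2 \<phi>) (auto elim: eventually_mono)
    then have "(-1) ^ mi_order \<alpha> * (\<integral>x. w x * \<phi> x \<partial>M) = (-1) ^ mi_order \<alpha> * (\<integral>x. w' x * \<phi> x \<partial>M)"
      using bspec[OF assms(3)[unfolded is_weak_deriv_def] \<phi>] bspec[OF assms(4)[unfolded is_weak_deriv_def] \<phi>] by simp
    then have "(\<integral>x. w x * \<phi> x \<partial>M) = (\<integral>x. w' x * \<phi> x \<partial>M)" by simp
    then show "(\<integral>x. lincomb 1 w (-1) w' x * \<phi> x \<partial>M) = 0"
      using L2_mult_integrable[OF assms(1) test_L2[OF \<phi>]] L2_mult_integrable[OF assms(2) test_L2[OF \<phi>]]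
      by (simp add: left_diff_distrib)
  qed
  then show ?thesis unfolding ae_eq_def by eventually_elim simp
qed

lemma is_weak_deriv_lincomb:
  assumes "is_weak_deriv \<Omega> \<alpha> u w" "is_weak_deriv \<Omega> \<alpha> u' w'" "u \<in> L2 \<Omega>" "u' \<in> L2 \<Omega>" "w \<in> L2 \<Omega>" "w' \<in> L2 \<Omega>"
  shows "is_weak_deriv \<Omega> \<alpha> (lincomb a u b u') (lincomb a w b w')"
  unfolding is_weak_deriv_def
proof
  fix \<phi> :: "real ^ 'n \<Rightarrow> complex" assume \<phi>: "\<phi> \<in> test_functions \<Omega>"
  have lin: "(\<integral>x. lincomb a p b q x * r x \<partial>M) = a * (\<integral>x. p x * r x \<partial>M) + b * (\<integral>x. q x * r x \<partial>M)"
    if "p \<in> L2 \<Omega>" "q \<in> L2 \<Omega>" "r \<in> L2 \<Omega>" for p q r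
    using L2_mult_integrable[OF that(1,3)] L2_mult_integrable[OF that(2,3)]
    by (simp add: distrib_right mult.assoc)
  show "(\<integral>x. lincomb a u b u' x * mi_deriv \<alpha> \<phi> x \<partial>M) = (-1) ^ mi_order \<alpha> * (\<integral>x. lincomb a w b w' x * \<phi> x \<partial>M)"
    using assms(1,2) \<phi> unfolding lin[OF assms(3,4) test_deriv_L2[OF \<phi>]] lin[OF assms(5,6) test_L2[OF \<phi>]] is_weak_deriv_def
    by (simp add: algebra_simps)
qed

lemma weak_deriv_spec:
  assumes "u \<in> Hm \<Omega> m" "mi_order \<alpha> \<le> m"
  shows "weak_deriv \<Omega> \<alpha> u \<in> L2 \<Omega>" "is_weak_deriv \<Omega> \<alpha> u (weak_deriv \<Omega> \<alpha> u)"
proof -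
  have "\<exists>w. w \<in> L2 \<Omega> \<and> is_weak_deriv \<Omega> \<alpha> u w" using assms unfolding Hm_def by blast
  from someI_ex[OF this] show "weak_deriv \<Omega> \<alpha> u \<in> L2 \<Omega>" "is_weak_deriv \<Omega> \<alpha> u (weak_deriv \<Omega> \<alpha> u)"
    unfolding weak_deriv_def by auto
qed

lemma Hm_L2: "u \<in> Hm \<Omega> m \<Longrightarrow> u \<in> L2 \<Omega>" by (simp add: Hm_def)

lemma Hm_lincomb:
  assumes u: "u \<in> Hm \<Omega> m" and v: "v \<in> Hm \<Omega> m"
  shows "lincomb a u b v \<in> Hm \<Omega> m"
proof -
  have "\<exists>w\<in>L2 \<Omega>. is_weak_deriv \<Omega> \<alpha> (lincomb a u b v) w" if \<alpha>: "mi_order \<alpha> \<le> m" for \<alpha>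
  proof
    show "lincomb a (weak_deriv \<Omega> \<alpha> u) b (weak_deriv \<Omega> \<alpha> v) \<in> L2 \<Omega>"
      by (intro L2_lincomb weak_deriv_spec[OF u \<alpha>] weak_deriv_spec[OF v \<alpha>])
    show "is_weak_deriv \<Omega> \<alpha> (lincomb a u b v) (lincomb a (weak_deriv \<Omega> \<alpha> u) b (weak_deriv \<Omega> \<alpha> v))"
      by (intro is_weak_deriv_lincomb weak_deriv_spec[OF u \<alpha>] weak_deriv_spec[OF v \<alpha>] Hm_L2[OF u] Hm_L2[OF v])
  qed
  then show ?thesis unfolding Hm_def using L2_lincomb[OF Hm_L2[OF u] Hm_L2[OF v]] by blast
qed

lemma weak_deriv_lincomb:
  assumes "u \<in> Hm \<Omega> m" "v \<in> Hm \<Omega> m" "mi_order \<alpha> \<le> m"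
  shows "ae_eq \<Omega> (weak_deriv \<Omega> \<alpha> (lincomb a u b v)) (lincomb a (weak_deriv \<Omega> \<alpha> u) b (weak_deriv \<Omega> \<alpha> v))"
  by (rule weak_deriv_unique[of _ _ \<alpha> "lincomb a u b v" "lincomb a u b v"])
     (intro weak_deriv_spec[of _ m] Hm_lincomb L2_lincomb is_weak_deriv_lincomb ae_eq_refl Hm_L2[of _ m] assms)+

lemma is_weak_deriv_0: "is_weak_deriv \<Omega> (\<lambda>_. 0) u u"
  by (simp add: is_weak_deriv_def mi_deriv_0 mi_order_def)

lemma weak_deriv_0: "u \<in> Hm \<Omega> m \<Longrightarrow> ae_eq \<Omega> (weak_deriv \<Omega> (\<lambda>_. 0) u) u"
  by (rule weak_deriv_unique[OF _ _ _ is_weak_deriv_0 ae_eq_refl])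
     (auto intro: weak_deriv_spec[of u m] Hm_L2 simp: mi_order_def)

sublocale Hm: semi_inner "Hm \<Omega> m" lincomb "Hm_inner \<Omega> m" for m
proof
  fix u v w a b assume u: "u \<in> Hm \<Omega> m"
  show "0 \<le> Re (Hm_inner \<Omega> m u u)" by (simp add: Hm_inner_self)
  assume v: "v \<in> Hm \<Omega> m"
  show "lincomb a u b v \<in> Hm \<Omega> m" by (rule Hm_lincomb[OF u v])
  show "Hm_inner \<Omega> m v u = cnj (Hm_inner \<Omega> m u v)"
    unfolding Hm_inner_def cnj_sum
    by (intro sum.cong refl L2.ip_cnj weak_deriv_spec[OF u] weak_deriv_spec[OF v]) auto
  assume w: "w \<in> Hm \<Omega> m"
  have "L2_inner \<Omega> (weak_deriv \<Omega> \<alpha> (lincomb a u b v)) (weak_deriv \<Omega> \<alpha> w)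
    = a * L2_inner \<Omega> (weak_deriv \<Omega> \<alpha> u) (weak_deriv \<Omega> \<alpha> w) + b * L2_inner \<Omega> (weak_deriv \<Omega> \<alpha> v) (weak_deriv \<Omega> \<alpha> w)"
    if \<alpha>: "mi_order \<alpha> \<le> m" for \<alpha>
  proof -
    note d = weak_deriv_spec(1)[OF u \<alpha>] weak_deriv_spec(1)[OF v \<alpha>] weak_deriv_spec(1)[OF w \<alpha>]
    have "L2_inner \<Omega> (weak_deriv \<Omega> \<alpha> (lincomb a u b v)) (weak_deriv \<Omega> \<alpha> w)
      = L2_inner \<Omega> (lincomb a (weak_deriv \<Omega> \<alpha> u) b (weak_deriv \<Omega> \<alpha> v)) (weak_deriv \<Omega> \<alpha> w)"
      by (intro L2_inner_ae weak_deriv_lincomb[OF u v \<alpha>] ae_eq_refl L2_lincomb d weak_deriv_spec(1)[OF Hm_lincomb[OF u v] \<alpha>])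
    also have "\<dots> = a * L2_inner \<Omega> (weak_deriv \<Omega> \<alpha> u) (weak_deriv \<Omega> \<alpha> w) + b * L2_inner \<Omega> (weak_deriv \<Omega> \<alpha> v) (weak_deriv \<Omega> \<alpha> w)"
      by (rule L2.ip_lin[OF d])
    finally show ?thesis .
  qed
  then show "Hm_inner \<Omega> m (lincomb a u b v) w = a * Hm_inner \<Omega> m u w + b * Hm_inner \<Omega> m v w"
    unfolding Hm_inner_def by (simp add: sum.distrib sum_distrib_left)
qed

lemma Hm_sq: "Hm.sq m u = (\<Sum>\<alpha> | mi_order \<alpha> \<le> m. L2.sq \<Omega> (weak_deriv \<Omega> \<alpha> u))"
  by (simp add: Hm.sq_def L2.sq_def Hm_inner_def)

lemma L2_sq_ae: "ae_eq \<Omega> u v \<Longrightarrow> u \<in> L2 \<Omega> \<Longrightarrow> v \<in> L2 \<Omega> \<Longrightarrow> L2.sq \<Omega> u = L2.sq \<Omega> v"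
  unfolding L2.sq_def using L2_inner_ae by metis

lemma weak_deriv_sq_le:
  assumes u: "u \<in> Hm \<Omega> m" and \<alpha>: "mi_order \<alpha> \<le> m"
  shows "L2.sq \<Omega> (weak_deriv \<Omega> \<alpha> u) \<le> Hm.sq m u"
  unfolding Hm_sq
proof (rule member_le_sum)
  show "0 \<le> L2.sq \<Omega> (weak_deriv \<Omega> \<beta> u)" for \<beta> by (simp add: L2_sq integral_nonneg_AE)
qed (use \<alpha> finite_mi_order_le in auto)

lemma L2_sq_le_Hm: "u \<in> Hm \<Omega> m \<Longrightarrow> L2.sq \<Omega> u \<le> Hm.sq m u"
  using weak_deriv_sq_le[of u m "\<lambda>_. 0"] L2_sq_ae[OF weak_deriv_0 weak_deriv_spec(1) Hm_L2, of u m m m]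
  by (simp add: mi_order_def)

text \<open>Every weak derivative converges in \<open>L\<^sub>2\<close>. The limits are the weak derivatives of the limit of the
  functions, because both sides of the defining identity are \<open>L\<^sub>2\<close> products with a fixed function.\<close>
theorem Hm_complete:
  assumes f: "\<And>k. f k \<in> Hm \<Omega> m"
    and cauchy: "\<And>e. e > 0 \<Longrightarrow> \<exists>N. \<forall>k\<ge>N. \<forall>l\<ge>N. Hm.sq m (lincomb 1 (f k) (-1) (f l)) < e"
  shows "\<exists>z\<in>Hm \<Omega> m. (\<lambda>k. Hm.sq m (lincomb 1 (f k) (-1) z)) \<longlonglongrightarrow> 0"
proof -
  let ?D = "\<lambda>\<alpha> k. weak_deriv \<Omega> \<alpha> (f k)"
  have D: "?D \<alpha> k \<in> L2 \<Omega>" if "mi_order \<alpha> \<le> m" for \<alpha> k by (rule weak_deriv_spec(1)[OF f that])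
  have "\<exists>w\<in>L2 \<Omega>. (\<lambda>k. L2.sq \<Omega> (lincomb 1 (?D \<alpha> k) (-1) w)) \<longlonglongrightarrow> 0" if \<alpha>: "mi_order \<alpha> \<le> m" for \<alpha>
  proof (rule L2_complete[of "?D \<alpha>", OF D[OF \<alpha>]])
    fix e :: real assume "e > 0"
    then obtain N where N: "\<And>k l. k \<ge> N \<Longrightarrow> l \<ge> N \<Longrightarrow> Hm.sq m (lincomb 1 (f k) (-1) (f l)) < e" using cauchy by blast
    have "L2.sq \<Omega> (lincomb 1 (?D \<alpha> k) (-1) (?D \<alpha> l)) < e" if "k \<ge> N" "l \<ge> N" for k l
    proof -
      have fkl: "lincomb 1 (f k) (-1) (f l) \<in> Hm \<Omega> m" by (intro Hm_lincomb f)
      have "L2.sq \<Omega> (lincomb 1 (?D \<alpha> k) (-1) (?D \<alpha> l)) = L2.sq \<Omega> (weak_deriv \<Omega> \<alpha> (lincomb 1 (f k) (-1) (f l)))"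
        by (intro L2_sq_ae[symmetric] weak_deriv_lincomb[OF f f \<alpha>] weak_deriv_spec(1)[OF fkl \<alpha>] L2_lincomb D[OF \<alpha>])
      also have "\<dots> \<le> Hm.sq m (lincomb 1 (f k) (-1) (f l))" by (rule weak_deriv_sq_le[OF fkl \<alpha>])
      finally show ?thesis using N[OF that] by simp
    qed
    then show "\<exists>N. \<forall>k\<ge>N. \<forall>l\<ge>N. L2.sq \<Omega> (lincomb 1 (?D \<alpha> k) (-1) (?D \<alpha> l)) < e" by blast
  qed
  then have "\<forall>\<alpha>. \<exists>w. mi_order \<alpha> \<le> m \<longrightarrow> w \<in> L2 \<Omega> \<and> (\<lambda>k. L2.sq \<Omega> (lincomb 1 (?D \<alpha> k) (-1) w)) \<longlonglongrightarrow> 0" by blast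
  from choice[OF this] obtain w where w: "\<And>\<alpha>. mi_order \<alpha> \<le> m \<Longrightarrow> w \<alpha> \<in> L2 \<Omega>"
    "\<And>\<alpha>. mi_order \<alpha> \<le> m \<Longrightarrow> (\<lambda>k. L2.sq \<Omega> (lincomb 1 (?D \<alpha> k) (-1) (w \<alpha>))) \<longlonglongrightarrow> 0" by auto
  define z where "z = w (\<lambda>_. 0)"
  have m0: "mi_order (\<lambda>_::'n. 0) \<le> m" by (simp add: mi_order_def)
  have zL: "z \<in> L2 \<Omega>" unfolding z_def by (rule w(1)[OF m0])
  have pair: "(\<lambda>k. \<integral>x. ?D \<alpha> k x * \<psi> x \<partial>M) \<longlonglongrightarrow> (\<integral>x. w \<alpha> x * \<psi> x \<partial>M)"
    if \<alpha>: "mi_order \<alpha> \<le> m" and \<psi>: "\<psi> \<in> L2 \<Omega>" for \<alpha> \<psi>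
    using L2.ip_tendsto[of "?D \<alpha>", OF D[OF \<alpha>] w(1)[OF \<alpha>] L2_cnj[OF \<psi>] w(2)[OF \<alpha>]] by (simp add: L2_inner_def)
  have wd: "is_weak_deriv \<Omega> \<alpha> z (w \<alpha>)" if \<alpha>: "mi_order \<alpha> \<le> m" for \<alpha>
    unfolding is_weak_deriv_def
  proof
    fix \<phi> :: "real ^ 'n \<Rightarrow> complex" assume \<phi>: "\<phi> \<in> test_functions \<Omega>"
    have "(\<integral>x. ?D (\<lambda>_. 0) k x * mi_deriv \<alpha> \<phi> x \<partial>M) = (-1) ^ mi_order \<alpha> * (\<integral>x. ?D \<alpha> k x * \<phi> x \<partial>M)" for k
    proof -
      have "(\<integral>x. ?D (\<lambda>_. 0) k x * mi_deriv \<alpha> \<phi> x \<partial>M) = (\<integral>x. f k x * mi_deriv \<alpha> \<phi> x \<partial>M)"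
        using weak_deriv_0[OF f[of k]] unfolding ae_eq_def
        by (intro integral_cong_AE borel_measurable_integrable L2_mult_integrable D m0 Hm_L2[OF f] test_deriv_L2 \<phi>) (auto elim: eventually_mono)
      then show ?thesis using bspec[OF weak_deriv_spec(2)[OF f[of k] \<alpha>, unfolded is_weak_deriv_def] \<phi>] by simp
    qed
    moreover have "(\<lambda>k. (-1) ^ mi_order \<alpha> * (\<integral>x. ?D \<alpha> k x * \<phi> x \<partial>M)) \<longlonglongrightarrow> (-1) ^ mi_order \<alpha> * (\<integral>x. w \<alpha> x * \<phi> x \<partial>M)"
      by (intro tendsto_mult tendsto_const pair[OF \<alpha>] test_L2 \<phi>)
    ultimately have "(\<lambda>k. \<integral>x. ?D (\<lambda>_. 0) k x * mi_deriv \<alpha> \<phi> x \<partial>M) \<longlonglongrightarrow> (-1) ^ mi_order \<alpha> * (\<integral>x. w \<alpha> x * \<phi> x \<partial>M)"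
      by simp
    from LIMSEQ_unique[OF pair[OF m0 test_deriv_L2[OF \<phi>]] this]
    show "(\<integral>x. z x * mi_deriv \<alpha> \<phi> x \<partial>M) = (-1) ^ mi_order \<alpha> * (\<integral>x. w \<alpha> x * \<phi> x \<partial>M)" unfolding z_def .
  qed
  have z: "z \<in> Hm \<Omega> m" unfolding Hm_def using zL wd w(1) by blast
  have "L2.sq \<Omega> (weak_deriv \<Omega> \<alpha> (lincomb 1 (f k) (-1) z)) = L2.sq \<Omega> (lincomb 1 (?D \<alpha> k) (-1) (w \<alpha>))"
    if \<alpha>: "mi_order \<alpha> \<le> m" for \<alpha> k
  proof (rule L2_sq_ae)
    have fz: "lincomb 1 (f k) (-1) z \<in> Hm \<Omega> m" by (intro Hm_lincomb f z)
    show "weak_deriv \<Omega> \<alpha> (lincomb 1 (f k) (-1) z) \<in> L2 \<Omega>" by (rule weak_deriv_spec(1)[OF fz \<alpha>])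
    show "lincomb 1 (?D \<alpha> k) (-1) (w \<alpha>) \<in> L2 \<Omega>" by (intro L2_lincomb D w(1) \<alpha>)
    show "ae_eq \<Omega> (weak_deriv \<Omega> \<alpha> (lincomb 1 (f k) (-1) z)) (lincomb 1 (?D \<alpha> k) (-1) (w \<alpha>))"
    proof (rule weak_deriv_unique[OF _ _ weak_deriv_spec(2)[OF fz \<alpha>] _ ae_eq_refl])
      show "is_weak_deriv \<Omega> \<alpha> (lincomb 1 (f k) (-1) z) (lincomb 1 (?D \<alpha> k) (-1) (w \<alpha>))"
        by (intro is_weak_deriv_lincomb weak_deriv_spec[OF f \<alpha>] wd \<alpha> w(1) Hm_L2[OF f] zL)
    qed (intro Hm_L2[OF fz] weak_deriv_spec(1)[OF fz \<alpha>] L2_lincomb D w(1) \<alpha>)+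
  qed
  then have "Hm.sq m (lincomb 1 (f k) (-1) z) = (\<Sum>\<alpha> | mi_order \<alpha> \<le> m. L2.sq \<Omega> (lincomb 1 (?D \<alpha> k) (-1) (w \<alpha>)))" for k
    unfolding Hm_sq by (intro sum.cong) auto
  moreover have "(\<lambda>k. \<Sum>\<alpha> | mi_order \<alpha> \<le> m. L2.sq \<Omega> (lincomb 1 (?D \<alpha> k) (-1) (w \<alpha>))) \<longlonglongrightarrow> (\<Sum>\<alpha>::'n \<Rightarrow> nat | mi_order \<alpha> \<le> m. 0)"
    by (intro tendsto_sum w(2)) simp
  ultimately have "(\<lambda>k. Hm.sq m (lincomb 1 (f k) (-1) z)) \<longlonglongrightarrow> 0" by simp
  then show ?thesis using z by blast
qed

text \<open>The \<open>L\<^sub>2\<close> norm is at most the \<open>H\<^sup>m\<close> norm, so \<open>v \<mapsto> \<langle>u, v\<rangle>\<close> is bounded on \<open>H\<^sup>m\<close>.\<close>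
theorem embed_adjoint:
  assumes u: "u \<in> L2 \<Omega>"
  shows "Hm_embed_adjoint \<Omega> m u \<in> Hm \<Omega> m"
    "\<And>v. v \<in> Hm \<Omega> m \<Longrightarrow> Hm_inner \<Omega> m (Hm_embed_adjoint \<Omega> m u) v = L2_inner \<Omega> u v"
proof -
  have "\<exists>z. z \<in> Hm \<Omega> m \<and> (\<forall>v\<in>Hm \<Omega> m. Hm_inner \<Omega> m z v = L2_inner \<Omega> u (Hm_embed v))"
  proof (rule Hm.Riesz[of m "L2.sq \<Omega> u" "L2_inner \<Omega> u"])
    have "(\<lambda>_. 0) \<in> Hm \<Omega> m"
      unfolding Hm_def by (auto simp: is_weak_deriv_def intro!: L2_continuous bexI[of _ "\<lambda>_. 0"])
    then show "Hm \<Omega> m \<noteq> {}" by blast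
    show "0 \<le> L2.sq \<Omega> u" by (rule L2.sq_nonneg[OF u])
    show "L2_inner \<Omega> u (lincomb a v b w) = cnj a * L2_inner \<Omega> u v + cnj b * L2_inner \<Omega> u w"
      if "v \<in> Hm \<Omega> m" "w \<in> Hm \<Omega> m" for v w a b
      by (rule L2.ip_lin_right[OF Hm_L2[OF that(1)] Hm_L2[OF that(2)] u])
    show "(cmod (L2_inner \<Omega> u v))\<^sup>2 \<le> L2.sq \<Omega> u * Hm.sq m v" if v: "v \<in> Hm \<Omega> m" for v
    proof -
      have "(cmod (L2_inner \<Omega> u v))\<^sup>2 \<le> L2.sq \<Omega> u * L2.sq \<Omega> v" by (rule L2.Cauchy_Schwarz[OF u Hm_L2[OF v]])
      also have "\<dots> \<le> L2.sq \<Omega> u * Hm.sq m v" by (intro mult_left_mono L2_sq_le_Hm v L2.sq_nonneg[OF u])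
      finally show ?thesis .
    qed
    fix z assume "z \<in> Hm \<Omega> m" "\<And>v. v \<in> Hm \<Omega> m \<Longrightarrow> Hm_inner \<Omega> m z v = L2_inner \<Omega> u v"
    then show ?thesis by (auto simp: Hm_embed_def)
  qed (rule Hm_complete)
  from someI_ex[OF this] show "Hm_embed_adjoint \<Omega> m u \<in> Hm \<Omega> m"
    "\<And>v. v \<in> Hm \<Omega> m \<Longrightarrow> Hm_inner \<Omega> m (Hm_embed_adjoint \<Omega> m u) v = L2_inner \<Omega> u v"
    unfolding Hm_embed_adjoint_def Hm_embed_def by auto
qed

lemma variational_solution_iff:
  "variational_solution \<Omega> m u z \<longleftrightarrow> z \<in> Hm \<Omega> m \<and> (\<forall>v\<in>Hm \<Omega> m. Hm_inner \<Omega> m z v = L2_inner \<Omega> u v)"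
  by (simp add: variational_solution_def Hm_inner_def)

theorem embed_adjoint_unique_solution:
  assumes u: "u \<in> L2 \<Omega>"
  shows "variational_solution \<Omega> m u (Hm_embed_adjoint \<Omega> m u)"
    "variational_solution \<Omega> m u z \<Longrightarrow> ae_eq \<Omega> z (Hm_embed_adjoint \<Omega> m u)"
proof -
  let ?E = "Hm_embed_adjoint \<Omega> m u"
  show "variational_solution \<Omega> m u ?E" using embed_adjoint[OF u] by (simp add: variational_solution_iff)
  assume "variational_solution \<Omega> m u z"
  then have z: "z \<in> Hm \<Omega> m" "\<And>v. v \<in> Hm \<Omega> m \<Longrightarrow> Hm_inner \<Omega> m z v = L2_inner \<Omega> u v"
    by (auto simp: variational_solution_iff)
  let ?d = "lincomb 1 z (-1) ?E"
  have d: "?d \<in> Hm \<Omega> m" by (intro Hm_lincomb z embed_adjoint u)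
  have "Hm_inner \<Omega> m ?d ?d = 0"
    using Hm.ip_lin[OF z(1) embed_adjoint(1)[OF u] d, of 1 "-1"] z(2)[OF d] embed_adjoint(2)[OF u d] by simp
  then have "L2.sq \<Omega> ?d \<le> 0" using L2_sq_le_Hm[OF d] by (simp add: Hm.sq_def)
  then have "L2.sq \<Omega> ?d = 0" using L2.sq_nonneg[OF Hm_L2[OF d]] by simp
  from L2_sq_zero[OF Hm_L2[OF d] this] show "ae_eq \<Omega> z ?E"
    unfolding ae_eq_def by eventually_elim simp
qed

end

theorem proposition3p3:
  fixes m :: nat
  shows "\<exists>K. \<forall>\<Omega> :: (real ^ 'n::finite) set.
    open \<Omega> \<and> connected \<Omega> \<and> \<Omega> \<noteq> {} \<and> bounded \<Omega> \<and> C_boundary K \<Omega> \<longrightarrow>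
    (\<exists>d :: nat \<Rightarrow> ('n \<Rightarrow> nat) \<Rightarrow> real ^ 'n \<Rightarrow> complex.
       (\<forall>k\<in>{m..<2 * m}. non_characteristic \<Omega> k (d k)) \<and>
       green_identity \<Omega> m d \<and>
       (\<forall>u\<in>L2 \<Omega>.
          variational_solution \<Omega> m u (Hm_embed_adjoint \<Omega> m u) \<and>
          (\<forall>z. variational_solution \<Omega> m u z \<longrightarrow> ae_eq \<Omega> z (Hm_embed_adjoint \<Omega> m u))))"
  \<comment> \<open>The normal loses one derivative against the boundary, and the reduction to normal derivatives
    uses \<open>m + 1\<close> derivatives of the normal.\<close>
proof (intro exI[of _ "Suc (m + 1)"] allI impI)
  fix \<Omega> :: "(real ^ 'n) set"
  assume "open \<Omega> \<and> connected \<Omega> \<and> \<Omega> \<noteq> {} \<and> bounded \<Omega> \<and> C_boundary (Suc (m + 1)) \<Omega>"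
  then have op: "open \<Omega>" and bd: "bounded \<Omega>" and C: "C_boundary (Suc (m + 1)) \<Omega>" by auto
  obtain \<nu> :: "real ^ 'n \<Rightarrow> real ^ 'n" where \<nu>: "\<And>j. C_on (m + 1) UNIV (\<lambda>x. \<nu> x $ j)"
    "\<And>x. x \<in> frontier \<Omega> \<Longrightarrow> \<nu> x = outer_normal \<Omega> x"
    using normal_field_exists[OF bd op C] by blast
  interpret normal_domain \<Omega> \<nu> "m + 1"
    using op bd C_boundary_le[OF C, of 1] \<nu> by unfold_locales auto
  interpret bounded_open \<Omega> using op bd by unfold_locales
  obtain d where "\<forall>k\<in>{m..<2 * m}. non_characteristic \<Omega> k (d k)" "green_identity \<Omega> m d"
    using green[of m] by auto
  then show "\<exists>d :: nat \<Rightarrow> ('n \<Rightarrow> nat) \<Rightarrow> real ^ 'n \<Rightarrow> complex.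
       (\<forall>k\<in>{m..<2 * m}. non_characteristic \<Omega> k (d k)) \<and>
       green_identity \<Omega> m d \<and>
       (\<forall>u\<in>L2 \<Omega>.
          variational_solution \<Omega> m u (Hm_embed_adjoint \<Omega> m u) \<and>
          (\<forall>z. variational_solution \<Omega> m u z \<longrightarrow> ae_eq \<Omega> z (Hm_embed_adjoint \<Omega> m u)))"
    using embed_adjoint_unique_solution by blast
qed

end
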